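(* Let $X$ be a non-monotone L\'evy process and let $\tau$ be an independent phase-type random time with representation $(\boldsymbol\alpha,\boldsymbol T)$ on the phases $\{1,\dots,n\}$, with underlying phase process $J$, such that $\boldsymbol T+\boldsymbol t\boldsymbol\alpha$ is irreducible, where $\boldsymbol t=-\boldsymbol T\boldsymbol 1$. Let $\mathbb P^*$ be the law associated with the time-reversed representation $(\boldsymbol\alpha^*,\boldsymbol T^* )$ (all notation as defined in the context). Then for all phases $i,j,k\in\{1,\dots,n\}$ with $\alpha_i\neq 0$, the following identity of measures in $(x,y)\in[0,\infty)\times(-\infty,0]$ holds: $$\mathbb P_i\bigl(\overline X_\tau\in \mathrm dx,\ X_\tau-\overline X_\tau\in \mathrm dy,\ J_{\overline\sigma_\tau}=k,\ J_{\tau-}=j\bigr)=\mathbb P_i\bigl(\overline X_\tau\in \mathrm dx,\ J_{\overline\sigma_\tau}=k\bigr)\,\mathbb P_j^*\bigl(\underline X_\tau\in \mathrm dy,\ J_{\underline\sigma_\tau}=k\bigr)\,\frac{\alpha_j^*}{c_k},$$ where $c_k=\mathbb P(J_{\overline\sigma_\tau}=k)=\mathbb P^*(J_{\underline\sigma_\tau}=k)>0$.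
   Context: Running extrema. For a L\'evy process $X_t$, $t\ge 0$ (with $X_0=0$ and the convention $X_{0-}=0$), put $\overline X_t=\sup_{s\le t}X_s$, $\overline\sigma_t=\inf\{s\in[0,t]: X_s\vee X_{s-}=\overline X_t\}$, $\underline X_t=\inf_{s\le t}X_s$, $\underline\sigma_t=\sup\{s\in[0,t]: X_s\wedge X_{s-}=\underline X_t\}$. Phase-type time. $\tau$ has a phase-type distribution with representation $(\boldsymbol\alpha,\boldsymbol T)$ if $\tau=\inf\{t\ge 0: J_t=\dagger\}$ is the lifetime of a terminating time-homogeneous Markov jump process $J$ on the finite set of phases $\{1,\dots,n\}$ with initial distribution $\boldsymbol\alpha$ (a probability row vector) and sub-generator $\boldsymbol T$ (transition rates among the phases), where $\dagger$ is an additional absorbing state. The column vector of exit rates is $\boldsymbol t=-\boldsymbol T\boldsymbol 1$, with $\boldsymbol 1$ the column vector of ones. It is assumed that $\boldsymbol T+\boldsymbol t\boldsymbol\alpha$ is irreducible; then all phases are transient and $\boldsymbol T$ is invertible. Time reversal. Let $\boldsymbol\nu=-\boldsymbol\alpha\boldsymbol T^{-1}$ (a vector with positive entries) and let $\boldsymbol\Delta_{\boldsymbol\nu}$ be the diagonal matrix with $\boldsymbol\nu$ on the diagonal. Define $\boldsymbol\alpha^*=\boldsymbol t^{\top}\boldsymbol\Delta_{\boldsymbol\nu}$, $\boldsymbol T^*=\boldsymbol\Delta_{\boldsymbol\nu}^{-1}\boldsymbol T^{\top}\boldsymbol\Delta_{\boldsymbol\nu}$, $\boldsymbol t^*=-\boldsymbol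 T^*\boldsymbol 1=\boldsymbol\Delta_{\boldsymbol\nu}^{-1}\boldsymbol\alpha^{\top}$. (This is the representation of the time-reversed process $J^*_t=J_{(\tau-t)-}$ for $t<\tau$, $J_t^*=\dagger$ for $t\geq\tau$.) Laws. Under $\mathbb P$, $X$ and $J$ are independent, $X$ is the given L\'evy process and $J$ has initial distribution $\boldsymbol\alpha$ and generator $\boldsymbol T$. Under $\mathbb P^*$, $X$ and $J$ are independent, $X$ has the same law as under $\mathbb P$, and $J$ has initial distribution $\boldsymbol\alpha^*$ and generator $\boldsymbol T^*$. In both cases $\tau$ is the lifetime of $J$. $\mathbb P_i$ and $\mathbb P^*_j$ denote the corresponding laws when $J$ is started at $J_0=i$, respectively $J_0=j$. Convention. On the event that the extremum is attained at the terminal time, i.e. $\overline\sigma_\tau=\tau$ (respectively $\underline\sigma_\tau=\tau$), the symbol $J_{\overline\sigma_\tau}$ (respectively $J_{\underline\sigma_\tau}$) is understood as the last phase $J_{\tau-}$. *)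

theory Defs
  imports "HOL-Probability.Probability"
begin

text \<open>
  Processes are indexed by \<^typ>\<open>real\<close>; only times \<open>t \<ge> 0\<close> matter.  Path regularity is required
  for every sample point, so that path functionals are measurable without completing the measure.
\<close>

definition path_space :: "'s measure \<Rightarrow> (real \<Rightarrow> 's) measure" where
  "path_space N = Pi\<^sub>M {0..} (\<lambda>_. N)"

definition path_of :: "(real \<Rightarrow> 'w \<Rightarrow> 's) \<Rightarrow> 'w \<Rightarrow> real \<Rightarrow> 's" where
  "path_of X \<omega> = (\<lambda>t\<in>{0..}. X t \<omega>)"

section \<open>Levy processes\<close>

definition cadlag :: "(real \<Rightarrow> real) \<Rightarrow> bool" where
  "cadlag f \<longleftrightarrow>
     (\<forall>t\<ge>0. continuous (at_right t) f) \<and> (\<forall>t>0. \<exists>l. (f \<longlongrightarrow> l) (at_left t))"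

definition levy_process :: "'w measure \<Rightarrow> (real \<Rightarrow> 'w \<Rightarrow> real) \<Rightarrow> bool" where
  "levy_process M X \<longleftrightarrow>
     prob_space M \<and>
     (\<forall>t\<ge>0. X t \<in> borel_measurable M) \<and>
     (\<forall>\<omega>\<in>space M. X 0 \<omega> = 0 \<and> cadlag (\<lambda>t. X t \<omega>)) \<and>
     (\<forall>s t. 0 \<le> s \<longrightarrow> s \<le> t \<longrightarrow>
        distr M borel (\<lambda>\<omega>. X t \<omega> - X s \<omega>) = distr M borel (X (t - s))) \<and>
     (\<forall>ts m. 0 \<le> ts 0 \<longrightarrow> incseq ts \<longrightarrow>
        prob_space.indep_vars M (\<lambda>_. borel)
          (\<lambda>l \<omega>. X (ts (Suc l)) \<omega> - X (ts l) \<omega>) {..<m::nat})"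

definition non_monotone :: "'w measure \<Rightarrow> (real \<Rightarrow> 'w \<Rightarrow> real) \<Rightarrow> bool" where
  "non_monotone M X \<longleftrightarrow>
     \<not> (AE \<omega> in M. mono_on {0..} (\<lambda>t. X t \<omega>)) \<and>
     \<not> (AE \<omega> in M. mono_on {0..} (\<lambda>t. - X t \<omega>))"

section \<open>Running extrema of a path\<close>

definition pre_value :: "(real \<Rightarrow> real) \<Rightarrow> real \<Rightarrow> real" where
  "pre_value f t = (if t \<le> 0 then 0 else Lim (at_left t) f)"

definition run_sup :: "(real \<Rightarrow> real) \<Rightarrow> real \<Rightarrow> real" where
  "run_sup f t = (SUP s\<in>{0..t}. f s)"

definition sup_time :: "(real \<Rightarrow> real) \<Rightarrow> real \<Rightarrow> real" where
  "sup_time f t = Inf {s\<in>{0..t}. max (f s) (pre_value f s) = run_sup f t}"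

definition run_inf :: "(real \<Rightarrow> real) \<Rightarrow> real \<Rightarrow> real" where
  "run_inf f t = (INF s\<in>{0..t}. f s)"

definition inf_time :: "(real \<Rightarrow> real) \<Rightarrow> real \<Rightarrow> real" where
  "inf_time f t = Sup {s\<in>{0..t}. min (f s) (pre_value f s) = run_inf f t}"

section \<open>Markov jump processes on a finite state space\<close>

definition transition_semigroup ::
    "(real \<Rightarrow> 's::finite \<Rightarrow> 's \<Rightarrow> real) \<Rightarrow> ('s \<Rightarrow> 's \<Rightarrow> real) \<Rightarrow> bool" where
  "transition_semigroup p Q \<longleftrightarrow>
     (\<forall>t\<ge>0. \<forall>x. (\<forall>y. 0 \<le> p t x y) \<and> (\<Sum>y\<in>UNIV. p t x y) = 1) \<and>
     (\<forall>x y. p 0 x y = (if x = y then 1 else 0)) \<and>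
     (\<forall>s\<ge>0. \<forall>t\<ge>0. \<forall>x z. p (s + t) x z = (\<Sum>y\<in>UNIV. p s x y * p t y z)) \<and>
     (\<forall>x y. ((\<lambda>h. (p h x y - p 0 x y) / h) \<longlongrightarrow> Q x y) (at_right 0))"

definition jump_path :: "(real \<Rightarrow> 's) \<Rightarrow> bool" where
  "jump_path f \<longleftrightarrow>
     (\<forall>t\<ge>0. \<forall>\<^sub>F s in at_right t. f s = f t) \<and> (\<forall>t>0. \<exists>x. \<forall>\<^sub>F s in at_left t. f s = x)"

definition markov_jump_process ::
    "'w measure \<Rightarrow> (real \<Rightarrow> 'w \<Rightarrow> 's::finite) \<Rightarrow> ('s \<Rightarrow> real) \<Rightarrow> ('s \<Rightarrow> 's \<Rightarrow> real) \<Rightarrow> bool" where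
  "markov_jump_process M J \<mu> Q \<longleftrightarrow>
     prob_space M \<and>
     (\<forall>t\<ge>0. J t \<in> M \<rightarrow>\<^sub>M count_space UNIV) \<and>
     (\<forall>\<omega>\<in>space M. jump_path (\<lambda>t. J t \<omega>)) \<and>
     (\<exists>p. transition_semigroup p Q \<and>
        (\<forall>ts xs m. ts 0 = 0 \<longrightarrow> incseq ts \<longrightarrow>
           measure M {\<omega>\<in>space M. \<forall>l\<le>m. J (ts l) \<omega> = xs l} =
           \<mu> (xs 0) * (\<Prod>l<m. p (ts (Suc l) - ts l) (xs l) (xs (Suc l)))))"

section \<open>Phase-type times\<close>

text \<open>The phases are the elements of \<open>'n\<close>; the state space of \<open>J\<close> is \<open>'n option\<close>, with
  \<^const>\<open>None\<close> as the absorbing state.\<close>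

definition exit_rates :: "real^'n^'n \<Rightarrow> real^'n" where
  "exit_rates T = - (T *v 1)"

definition prob_vector :: "real^'n \<Rightarrow> bool" where
  "prob_vector a \<longleftrightarrow> (\<forall>i. 0 \<le> a $ i) \<and> (\<Sum>i\<in>UNIV. a $ i) = 1"

definition sub_generator :: "real^'n^'n \<Rightarrow> bool" where
  "sub_generator T \<longleftrightarrow> (\<forall>i j. i \<noteq> j \<longrightarrow> 0 \<le> T $ i $ j) \<and> (\<forall>i. 0 \<le> exit_rates T $ i)"

definition irreducible_matrix :: "real^'n^'n \<Rightarrow> bool" where
  "irreducible_matrix A \<longleftrightarrow> (\<forall>i j. (i, j) \<in> {(a, b). A $ a $ b \<noteq> 0}\<^sup>*)"

fun full_initial :: "real^'n \<Rightarrow> 'n option \<Rightarrow> real" where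
  "full_initial a (Some i) = a $ i"
| "full_initial a None = 0"

fun full_generator :: "real^'n^'n \<Rightarrow> 'n option \<Rightarrow> 'n option \<Rightarrow> real" where
  "full_generator T (Some i) (Some j) = T $ i $ j"
| "full_generator T (Some i) None = exit_rates T $ i"
| "full_generator T None _ = 0"

text \<open>Almost sure termination is not implied by irreducibility of \<open>T + t \<alpha>\<close>: take \<open>T\<close>
  conservative, so that \<open>t = 0\<close>.\<close>

definition terminating_phase_process ::
    "'w measure \<Rightarrow> (real \<Rightarrow> 'w \<Rightarrow> 'n::finite option) \<Rightarrow> real^'n \<Rightarrow> real^'n^'n \<Rightarrow> bool" where
  "terminating_phase_process M J a T \<longleftrightarrow>
     markov_jump_process M J (full_initial a) (full_generator T) \<and>
     (AE \<omega> in M. \<exists>t\<ge>0. J t \<omega> = None)"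

text \<open>The values in the two null cases \<open>\<tau> = \<infinity>\<close> and \<open>\<tau> = 0\<close> below are conventions that keep
  \<open>lifetime\<close> and \<open>last_phase\<close> measurable.\<close>

definition lifetime :: "(real \<Rightarrow> 'w \<Rightarrow> 'n option) \<Rightarrow> 'w \<Rightarrow> real" where
  "lifetime J \<omega> =
     (if \<exists>t\<ge>0. J t \<omega> = None then Inf {t. 0 \<le> t \<and> J t \<omega> = None} else 0)"

definition last_phase :: "(real \<Rightarrow> 'w \<Rightarrow> 'n option) \<Rightarrow> 'w \<Rightarrow> 'n option" where
  "last_phase J \<omega> =
     (if lifetime J \<omega> = 0 then J 0 \<omega>
      else (THE x. \<forall>\<^sub>F s in at_left (lifetime J \<omega>). J s \<omega> = x))"

section \<open>Time reversal\<close>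

definition diag_matrix :: "real^'n \<Rightarrow> real^'n^'n" where
  "diag_matrix v = (\<chi> i j. if i = j then v $ i else 0)"

definition reversal_weights :: "real^'n \<Rightarrow> real^'n^'n \<Rightarrow> real^'n" where
  "reversal_weights a T = - (a v* matrix_inv T)"

definition rev_initial :: "real^'n \<Rightarrow> real^'n^'n \<Rightarrow> real^'n" where
  "rev_initial a T = exit_rates T v* diag_matrix (reversal_weights a T)"

definition rev_generator :: "real^'n \<Rightarrow> real^'n^'n \<Rightarrow> real^'n^'n" where
  "rev_generator a T =
     matrix_inv (diag_matrix (reversal_weights a T)) ** transpose T **
     diag_matrix (reversal_weights a T)"

section \<open>The killed process\<close>

definition sup_at_end :: "(real \<Rightarrow> 'w \<Rightarrow> real) \<Rightarrow> (real \<Rightarrow> 'w \<Rightarrow> 'n option) \<Rightarrow> 'w \<Rightarrow> real" where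
  "sup_at_end X J \<omega> = run_sup (\<lambda>t. X t \<omega>) (lifetime J \<omega>)"

definition inf_at_end :: "(real \<Rightarrow> 'w \<Rightarrow> real) \<Rightarrow> (real \<Rightarrow> 'w \<Rightarrow> 'n option) \<Rightarrow> 'w \<Rightarrow> real" where
  "inf_at_end X J \<omega> = run_inf (\<lambda>t. X t \<omega>) (lifetime J \<omega>)"

definition phase_at :: "(real \<Rightarrow> 'w \<Rightarrow> 'n option) \<Rightarrow> real \<Rightarrow> 'w \<Rightarrow> 'n option" where
  "phase_at J s \<omega> = (if s = lifetime J \<omega> then last_phase J \<omega> else J s \<omega>)"

definition phase_at_sup ::
    "(real \<Rightarrow> 'w \<Rightarrow> real) \<Rightarrow> (real \<Rightarrow> 'w \<Rightarrow> 'n option) \<Rightarrow> 'w \<Rightarrow> 'n option" where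
  "phase_at_sup X J \<omega> = phase_at J (sup_time (\<lambda>t. X t \<omega>) (lifetime J \<omega>)) \<omega>"

definition phase_at_inf ::
    "(real \<Rightarrow> 'w \<Rightarrow> real) \<Rightarrow> (real \<Rightarrow> 'w \<Rightarrow> 'n option) \<Rightarrow> 'w \<Rightarrow> 'n option" where
  "phase_at_inf X J \<omega> = phase_at J (inf_time (\<lambda>t. X t \<omega>) (lifetime J \<omega>)) \<omega>"

text \<open>\<open>killed_levy_law P X J a T M\<close>: \<open>M\<close> lives on the same measurable space as \<open>P\<close>, and under \<open>M\<close>
  the processes \<open>X\<close> and \<open>J\<close> are independent, \<open>X\<close> has the law it has under \<open>P\<close>, and \<open>J\<close> has initial
  distribution \<open>a\<close> and sub-generator \<open>T\<close>.\<close>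

definition killed_levy_law ::
    "'w measure \<Rightarrow> (real \<Rightarrow> 'w \<Rightarrow> real) \<Rightarrow> (real \<Rightarrow> 'w \<Rightarrow> 'n::finite option) \<Rightarrow>
     real^'n \<Rightarrow> real^'n^'n \<Rightarrow> 'w measure \<Rightarrow> bool" where
  "killed_levy_law P X J a T M \<longleftrightarrow>
     prob_space M \<and> sets M = sets P \<and>
     distr M (path_space borel) (path_of X) = distr P (path_space borel) (path_of X) \<and>
     terminating_phase_process M J a T \<and>
     prob_space.indep_set M
       {path_of X -` A \<inter> space M | A. A \<in> sets (path_space borel)}
       {path_of J -` B \<inter> space M | B. B \<in> sets (path_space (count_space UNIV))}"

text \<open>The measure \<open>M(Y \<in> dy, E)\<close>.\<close>

definition law_on :: "'w measure \<Rightarrow> 'w set \<Rightarrow> 'b measure \<Rightarrow> ('w \<Rightarrow> 'b) \<Rightarrow> 'b measure" where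
  "law_on M E N Y = distr (restrict_space M E) N Y"

end

theory Submission
  imports Defs
begin

text \<open>
  For fixed \<open>t\<close>, let \<open>\<sigma>\<close> be the time of the supremum \<open>S\<close> of the path on \<open>[0, t]\<close>.  Integrated over
  \<open>t\<close> with respect to Lebesgue measure, the pairs \<open>(\<sigma>, S)\<close> and \<open>(t - \<sigma>, X t - S)\<close> factorise: this
  is the fluctuation identity of a random walk stopped at an independent geometric time, passed to
  the limit along dyadic grids and then freed of the exponential weight, which splits as
  \<open>exp (- t) = exp (- \<sigma>) * exp (- (t - \<sigma>))\<close>.

  Given the path of \<open>X\<close>, the event of being in phase \<open>k\<close> at time \<open>\<sigma>\<close> and of exiting from \<open>j\<close> at time
  \<open>t\<close> has density \<open>\<pi>\<^sub>\<sigma>(k) * p\<^sub>t\<^sub>-\<^sub>\<sigma>(k, j) * t\<^sub>j\<close>, one factor for each pair.  Hence every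
  law in the identity is a product of a functional of the first pair and a functional of the second.
  For the infimum under the reversed law this uses that the time reversal at fixed \<open>t\<close> maps
  \<open>(t - \<sigma>, X t - S)\<close> to the time and the value of the infimum, and that the reversed semigroup is
  \<open>p\<^sub>t(j, i) * \<nu>\<^sub>j / \<nu>\<^sub>i\<close>.
\<close>

section \<open>Cadlag paths\<close>

text \<open>A path may approach its supremum at several times, and a grid maximum need not pick the
  first of them. The discrete maxima are therefore taken for walks with a small negative drift. This
  brings in two limits, the mesh for a fixed drift and the drift itself; only the iterated limit is
  controlled, so that both are finally chosen together along a diagonal.

  The two factors of the discrete identity have no normalisation of their own: for constant test
  functions their product grows like \<open>1 / (1 - r)\<close>, where \<open>r\<close> is the ratio
  of the geometric time. What passes to the limit is a cross relation between four such products. In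
  the same spirit the continuous identity reads \<open>split_integral F G = a F * b G\<close> with
  functionals \<open>a\<close> and \<open>b\<close> fixed only up to reciprocal constants. The
  theorem is again a cross relation, with the common factor \<open>a F2 * b G2\<close> equal to the
  constant for phase \<open>k\<close>, and with the reversed initial mass of \<open>j\<close>
  comparing its exit rate to its weight. Irreducibility makes the weights and the kernels in
  \<open>F2\<close> and \<open>G2\<close> positive, and non-monotonicity then makes that constant
  positive.\<close>

lemma cadlag_right: "cadlag f \<Longrightarrow> 0 \<le> t \<Longrightarrow> (f \<longlongrightarrow> f t) (at_right t)"
  by (simp add: cadlag_def continuous_within)

lemma cadlag_left: "cadlag f \<Longrightarrow> 0 < t \<Longrightarrow> (f \<longlongrightarrow> pre_value f t) (at_left t)"
  unfolding cadlag_def pre_value_def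
  by (auto dest!: spec[where x=t] intro!: tendsto_Lim[THEN ssubst, where P="\<lambda>l. (f \<longlongrightarrow> l) (at_left t)"])

lemma cadlag_uminus: "cadlag f \<Longrightarrow> cadlag (\<lambda>t. - f t)"
  unfolding cadlag_def by (metis continuous_minus tendsto_minus)

lemma pre_value_uminus: "cadlag f \<Longrightarrow> pre_value (\<lambda>t. - f t) t = - pre_value f t"
  using tendsto_minus[OF cadlag_left, of f t]
  by (cases "t \<le> 0") (auto simp: pre_value_def intro!: tendsto_Lim)

text \<open>Compactness: on \<open>[a, b]\<close> a strict pointwise bound on the values and on the left limits is
  automatically uniform.\<close>

lemma cadlag_uniform_bound:
  assumes f: "cadlag f" and ab: "0 \<le> a" "a \<le> b"
    and R: "\<And>u. u \<in> {a..b} \<Longrightarrow> \<exists>c. R c \<and> f u < c \<and> (a < u \<longrightarrow> pre_value f u < c)"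
    and Rmax: "\<And>c d. R c \<Longrightarrow> R d \<Longrightarrow> R (max c d)"
  shows "\<exists>c. R c \<and> (\<forall>u\<in>{a..b}. f u < (c::real))"
proof -
  let ?P = "\<lambda>a' b'. \<exists>c. R c \<and> (\<forall>u\<in>{a'..b'} \<inter> {a..b}. f u < c)"
  \<comment> \<open>Bisection: the bound passes to unions of adjacent intervals because
    \<open>R\<close> is closed under \<open>max\<close>, so it is enough to find it on short
    intervals around each point.\<close>
  have "?P a b"
  proof (rule Bolzano[OF ab(2), where P="?P"])
    fix x y z assume "?P x y" "?P y z" "x \<le> y" "y \<le> z"
    then obtain c d where "R c" "\<forall>u\<in>{x..y} \<inter> {a..b}. f u < c"
      "R d" "\<forall>u\<in>{y..z} \<inter> {a..b}. f u < d" by blast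
    then show "?P x z"
      by (intro exI[of _ "max c d"]) (force simp: Rmax less_max_iff_disj)
  next
    fix x assume x: "a \<le> x" "x \<le> b"
    then obtain c where c: "R c" "f x < c" "a < x \<longrightarrow> pre_value f x < c" using R[of x] by auto
    have "\<forall>\<^sub>F u in at_right x. f u < c"
      using order_tendstoD(2)[OF cadlag_right[OF f, of x] c(2)] x ab by auto
    then obtain d1 where d1: "d1 > x" "\<And>u. x < u \<Longrightarrow> u < d1 \<Longrightarrow> f u < c"
      by (auto simp: eventually_at_right_field)
    obtain d2 where d2: "d2 < x" "\<And>u. a \<le> u \<Longrightarrow> d2 < u \<Longrightarrow> u < x \<Longrightarrow> f u < c"
    proof (cases "a < x")
      case True
      then have "\<forall>\<^sub>F u in at_left x. f u < c"
        using order_tendstoD(2)[OF cadlag_left[OF f, of x]] c ab by auto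
      then show ?thesis using that by (auto simp: eventually_at_left_field)
    next
      case False
      \<comment> \<open>At \<open>x = a\<close> nothing of the interval lies to the left, so any
        point below \<open>x\<close> serves and the left limit at \<open>a\<close> is never
        consulted.\<close>
      then show ?thesis using that[of "x - 1"] by auto
    qed
    show "\<exists>d>0. \<forall>a' b'. a' \<le> x \<and> x \<le> b' \<and> b' - a' < d \<longrightarrow> ?P a' b'"
    proof (rule exI[of _ "min (d1 - x) (x - d2)"], intro conjI allI impI)
      fix a' b' assume ab': "a' \<le> x \<and> x \<le> b' \<and> b' - a' < min (d1 - x) (x - d2)"
      show "?P a' b'"
      proof (intro exI[of _ c] conjI ballI)
        fix u assume u: "u \<in> {a'..b'} \<inter> {a..b}"
        then consider "u < x" | "u = x" | "x < u" by linarith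
        then show "f u < c" using u ab' d1(2)[of u] d2(2)[of u] c by cases auto
      qed (rule c)
    qed (use d1 d2 in auto)
  qed
  then show ?thesis by auto
qed

lemma cadlag_bdd_above:
  assumes "cadlag f" "0 \<le> a" shows "bdd_above (f ` {a..b})"
proof (cases "a \<le> b")
  case True
  have "\<exists>c. True \<and> (\<forall>u\<in>{a..b}. f u < c)"
  proof (rule cadlag_uniform_bound[OF assms True])
    fix u show "\<exists>c. True \<and> f u < c \<and> (a < u \<longrightarrow> pre_value f u < c)"
      by (intro exI[of _ "max (f u) (pre_value f u) + 1"]) auto
  qed auto
  then obtain c where "\<forall>u\<in>{a..b}. f u < c" by auto
  then show ?thesis by (intro bdd_aboveI2[of _ _ c] less_imp_le) blast
qed auto

lemma SUP_cadlag_upper: "cadlag f \<Longrightarrow> 0 \<le> a \<Longrightarrow> u \<in> {a..b} \<Longrightarrow> f u \<le> (SUP s\<in>{a..b}. f s)"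
  for f :: "real \<Rightarrow> real"
  by (auto intro!: cSUP_upper cadlag_bdd_above)

lemma less_SUP_cadlag: "cadlag f \<Longrightarrow> 0 \<le> a \<Longrightarrow> a \<le> b \<Longrightarrow>
    c < (SUP s\<in>{a..b}. f s) \<longleftrightarrow> (\<exists>u\<in>{a..b}. c < f u)"
  for f :: "real \<Rightarrow> real"
  by (rule less_cSUP_iff) (auto intro!: cadlag_bdd_above)

text \<open>If neither a value nor a left limit reached the supremum, every point would admit a
  strict local bound below it, and compactness would produce one bound strictly below the supremum.
  The left limit at \<open>a\<close> looks outside the interval and is excluded.\<close>

lemma SUP_cadlag_attained:
  assumes f: "cadlag f" and ab: "0 \<le> a" "a \<le> b"
  shows "\<exists>u\<in>{a..b}. (SUP s\<in>{a..b}. f s) \<le> f u \<or> (a < u \<and> (SUP s\<in>{a..b}. f s) \<le> pre_value f u)"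
proof (rule ccontr)
  let ?S = "SUP s\<in>{a..b}. f s"
  assume *: "\<not> ?thesis"
  have "\<exists>c. c < ?S \<and> (\<forall>u\<in>{a..b}. f u < c)"
  proof (rule cadlag_uniform_bound[OF f ab])
    fix u assume u: "u \<in> {a..b}"
    then have "f u < ?S \<and> (a < u \<longrightarrow> pre_value f u < ?S)" using * by force
    then have "max (f u) (if a < u then pre_value f u else f u) < ?S" by auto
    from dense[OF this] show "\<exists>c<?S. f u < c \<and> (a < u \<longrightarrow> pre_value f u < c)" by auto
  qed auto
  then obtain c where c: "c < ?S" "\<forall>u\<in>{a..b}. f u < c" by auto
  then show False using less_SUP_cadlag[OF f ab, of c] by force
qed

lemma pre_value_le:
  assumes f: "cadlag f" and "0 \<le> a" "a < u" "u \<le> b" and "\<And>v. a \<le> v \<Longrightarrow> v < u \<Longrightarrow> f v \<le> c"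
  shows "pre_value f u \<le> c"
proof (rule tendsto_upperbound[OF cadlag_left[OF f]])
  show "\<forall>\<^sub>F v in at_left u. f v \<le> c"
    using eventually_at_left_field assms by (metis less_eq_real_def)
qed (use assms in auto)

lemma pre_value_le_SUP:
  "cadlag f \<Longrightarrow> 0 \<le> a \<Longrightarrow> a < u \<Longrightarrow> u \<le> b \<Longrightarrow> pre_value f u \<le> (SUP s\<in>{a..b}. f s)"
  by (rule pre_value_le[of f a u b]) (auto intro!: SUP_cadlag_upper)

section \<open>The first time of the supremum and the last time of the infimum of one path\<close>

text \<open>Starting at 0 reconciles the convention for the left limit at time 0 with the path: that
  value is also \<open>f 0\<close>, so it never exceeds a running supremum.\<close>

locale cadlag0 =
  fixes f :: "real \<Rightarrow> real"
  assumes cadlag: "cadlag f" and zero: "f 0 = 0"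
begin

lemma run_sup_upper: "0 \<le> s \<Longrightarrow> s \<le> t \<Longrightarrow> f s \<le> run_sup f t"
  unfolding run_sup_def by (intro SUP_cadlag_upper cadlag) auto

lemma run_sup_nonneg: "0 \<le> t \<Longrightarrow> 0 \<le> run_sup f t"
  using run_sup_upper[of 0 t] zero by simp

lemma pre_value_le_run_sup: "0 \<le> s \<Longrightarrow> s \<le> t \<Longrightarrow> pre_value f s \<le> run_sup f t"
  using pre_value_le_SUP[OF cadlag, of 0 s t] run_sup_nonneg[of t]
  by (cases "s = 0") (auto simp: run_sup_def pre_value_def)

lemma run_sup_mono: "0 \<le> s \<Longrightarrow> s \<le> t \<Longrightarrow> run_sup f s \<le> run_sup f t"
  by (auto simp: run_sup_def[of _ s] intro!: cSUP_least run_sup_upper)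

definition sup_times :: "real \<Rightarrow> real set" where
  "sup_times t = {s\<in>{0..t}. max (f s) (pre_value f s) = run_sup f t}"

text \<open>Translates the position of the supremum into values of the running supremum. The latter
  can be measured through rational times and compared through grids, the former cannot
  directly.\<close>

lemma run_sup_eq_iff:
  assumes "0 \<le> s" "s \<le> t"
  shows "run_sup f s = run_sup f t \<longleftrightarrow> (\<exists>u\<in>sup_times t. u \<le> s)"
proof
  assume eq: "run_sup f s = run_sup f t"
  obtain u where u: "u \<in> {0..s}" "run_sup f s \<le> f u \<or> (0 < u \<and> run_sup f s \<le> pre_value f u)"
    using SUP_cadlag_attained[OF cadlag, of 0 s] assms unfolding run_sup_def by blast
  then have "max (f u) (pre_value f u) = run_sup f t"
    using assms eq run_sup_upper[of u t] pre_value_le_run_sup[of u t] by (auto simp: max_def)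
  then show "\<exists>u\<in>sup_times t. u \<le> s" using u assms by (auto simp: sup_times_def)
next
  assume "\<exists>u\<in>sup_times t. u \<le> s"
  then obtain u where u: "0 \<le> u" "u \<le> s" "max (f u) (pre_value f u) = run_sup f t"
    by (auto simp: sup_times_def)
  then have "run_sup f t \<le> run_sup f s"
    using run_sup_upper[of u s] pre_value_le_run_sup[of u s] by auto
  then show "run_sup f s = run_sup f t" using run_sup_mono[OF assms] by auto
qed

lemma sup_times_nonempty: "0 \<le> t \<Longrightarrow> sup_times t \<noteq> {}"
  using run_sup_eq_iff[of t t] by auto

lemma sup_time_eq: "sup_time f t = Inf (sup_times t)"
  by (simp add: sup_time_def sup_times_def)

lemma sup_time_le: "u \<in> sup_times t \<Longrightarrow> sup_time f t \<le> u"
  unfolding sup_time_eq by (rule cInf_lower) (auto simp: sup_times_def)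

lemma sup_time_nonneg: "0 \<le> t \<Longrightarrow> 0 \<le> sup_time f t"
  unfolding sup_time_eq using sup_times_nonempty by (intro cInf_greatest) (auto simp: sup_times_def)

lemma sup_time_le_t: "0 \<le> t \<Longrightarrow> sup_time f t \<le> t"
  using run_sup_eq_iff[of t t] sup_time_le by force

text \<open>The infimum in \<open>sup_time\<close> is a minimum. If the value at \<open>?g\<close>
  were below the supremum, right continuity would keep the path, and with it the left limits, at or
  below a level \<open>c\<close> under the supremum on a stretch to the right of \<open>?g\<close>;
  no other supremum time could then be close to \<open>?g\<close>.\<close>

lemma sup_time_attained:
  assumes "0 \<le> t" shows "sup_time f t \<in> sup_times t"
proof (rule ccontr)
  let ?g = "sup_time f t"
  assume n: "?g \<notin> sup_times t"
  have g: "0 \<le> ?g" "?g \<le> t" using sup_time_nonneg sup_time_le_t assms by auto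
  then have "f ?g < run_sup f t"
    using n run_sup_upper[of ?g t] pre_value_le_run_sup[of ?g t]
    by (auto simp: sup_times_def max_def split: if_splits)
  then obtain c where c: "f ?g < c" "c < run_sup f t" using dense by blast
  have "\<forall>\<^sub>F u in at_right ?g. f u < c"
    by (rule order_tendstoD(2)[OF cadlag_right[OF cadlag g(1)] c(1)])
  then obtain d where d: "d > ?g" "\<And>u. ?g < u \<Longrightarrow> u < d \<Longrightarrow> f u < c"
    by (auto simp: eventually_at_right_field)
  obtain u where u: "u \<in> sup_times t" "u < d"
    using d(1) sup_times_nonempty[OF assms] unfolding sup_time_eq by (meson cInf_lessD)
  have "?g < u" using sup_time_le[OF u(1)] u(1) n by (cases "u = ?g") auto
  have "f v \<le> c" if "?g \<le> v" "v < u" for v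
    using that c d(2)[of v] u(2) by (cases "v = ?g") auto
  then have "pre_value f u \<le> c" using g \<open>?g < u\<close>
    by (intro pre_value_le[OF cadlag, of ?g u u]) auto
  moreover have "f u < c" using d u \<open>?g < u\<close> by auto
  ultimately show False using u c by (auto simp: sup_times_def)
qed

lemma sup_time_le_iff:
  assumes "0 \<le> s" "s \<le> t" shows "sup_time f t \<le> s \<longleftrightarrow> run_sup f s = run_sup f t"
  using run_sup_eq_iff[OF assms] sup_time_le sup_time_attained[of t] assms by force

lemma less_sup_time_iff:
  assumes "0 \<le> s" "s \<le> t" shows "s < sup_time f t \<longleftrightarrow> run_sup f s < run_sup f t"
  using sup_time_le_iff[OF assms] run_sup_mono[OF assms] by force

lemma run_inf_eq: "run_inf f t = - run_sup (\<lambda>s. - f s) t"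
  by (simp add: run_inf_def run_sup_def Inf_real_def image_image)

end

lemma INF_eq_uminus_SUP: "(INF s\<in>A. f s) = - (SUP s\<in>A. - f s)" for f :: "'a \<Rightarrow> real"
  by (simp add: Inf_real_def image_image)

context cadlag0 begin

interpretation neg: cadlag0 "\<lambda>t. - f t"
  by unfold_locales (auto simp: zero cadlag_uminus cadlag)

lemma run_inf_lower: "0 \<le> s \<Longrightarrow> s \<le> t \<Longrightarrow> run_inf f t \<le> f s"
  using neg.run_sup_upper[of s t] by (simp add: run_inf_eq)

lemma inf_time_eq: "inf_time f t = Sup (neg.sup_times t)"
  unfolding inf_time_def neg.sup_times_def run_inf_eq pre_value_uminus[OF cadlag]
  by (intro arg_cong[where f=Sup] Collect_cong) (auto simp: min_def max_def)

lemma bdd_above_neg_sup_times: "bdd_above (neg.sup_times t)"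
  by (rule bdd_aboveI[of _ t]) (auto simp: neg.sup_times_def)

lemma inf_time_le_t: "0 \<le> t \<Longrightarrow> inf_time f t \<le> t"
  unfolding inf_time_eq using neg.sup_times_nonempty[of t]
  by (intro cSup_least) (auto simp: neg.sup_times_def)

lemma inf_time_nonneg: "0 \<le> t \<Longrightarrow> 0 \<le> inf_time f t"
  using cSup_upper[OF neg.sup_time_attained bdd_above_neg_sup_times, of t] neg.sup_time_nonneg[of t]
  unfolding inf_time_eq by auto

text \<open>The infimum time is the last one. When it is 0, no time but 0 is left for the infimum,
  and there the path and the conventional left limit both vanish.\<close>

lemma run_inf_eq_0_of_inf_time:
  assumes t: "0 \<le> t" and i: "inf_time f t \<le> 0"
  shows "run_inf f t = 0"
proof -
  obtain u where u: "u \<in> neg.sup_times t" using neg.sup_times_nonempty[OF t] by blast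
  then have "u \<le> 0" using cSup_upper[OF u bdd_above_neg_sup_times] i by (simp add: inf_time_eq)
  then have "u = 0" using u by (auto simp: neg.sup_times_def)
  then show ?thesis using u zero by (simp add: neg.sup_times_def run_inf_eq pre_value_def)
qed

text \<open>Together with \<open>run_inf_less_INF\<close> this brackets the last time of the infimum
  by comparing the infima over \<open>{0..t}\<close> and \<open>{r..t}\<close>. The case
  \<open>inf_time f t = r\<close> stays undecided: a left limit at \<open>r\<close> belongs to the
  past of \<open>r\<close>, a value at \<open>r\<close> to \<open>{r..t}\<close>.\<close>

lemma inf_time_le:
  assumes "0 \<le> r" "r \<le> t" "run_inf f t < (INF s\<in>{r..t}. f s)"
  shows "inf_time f t \<le> r"
  unfolding inf_time_eq
proof (rule cSup_least)
  show "neg.sup_times t \<noteq> {}" using neg.sup_times_nonempty assms by auto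
  fix u assume u: "u \<in> neg.sup_times t"
  show "u \<le> r"
  proof (rule ccontr)
    assume "\<not> u \<le> r"
    then have "- f u \<le> (SUP s\<in>{r..t}. - f s)" "pre_value (\<lambda>s. - f s) u \<le> (SUP s\<in>{r..t}. - f s)"
      using u assms by (auto simp: neg.sup_times_def intro!: SUP_cadlag_upper pre_value_le_SUP neg.cadlag)
    then show False using u assms(3)
      by (auto simp: run_inf_eq INF_eq_uminus_SUP neg.sup_times_def)
  qed
qed

text \<open>The infimum over \<open>{r..t}\<close> is reached as a value or a left limit at some
  \<open>u \<ge> r\<close>; if it were equal to the overall infimum, \<open>u\<close> would be an
  infimum time after the last one.\<close>

lemma run_inf_less_INF:
  assumes "0 \<le> r" "r \<le> t" "inf_time f t < r"
  shows "run_inf f t < (INF s\<in>{r..t}. f s)"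
proof (rule ccontr)
  assume *: "\<not> ?thesis"
  then have *: "run_sup (\<lambda>s. - f s) t \<le> (SUP s\<in>{r..t}. - f s)"
    by (auto simp: run_inf_eq INF_eq_uminus_SUP)
  obtain u where "u \<in> {r..t}" "(SUP s\<in>{r..t}. - f s) \<le> - f u \<or> (r < u \<and> (SUP s\<in>{r..t}. - f s) \<le> pre_value (\<lambda>s. - f s) u)"
    using SUP_cadlag_attained[OF neg.cadlag assms(1,2)] by blast
  then have u: "r \<le> u" "u \<in> neg.sup_times t"
    using * assms neg.run_sup_upper[of u t] neg.pre_value_le_run_sup[of u t]
    by (auto simp: neg.sup_times_def max_def)
  then show False using cSup_upper[OF u(2) bdd_above_neg_sup_times] assms by (auto simp: inf_time_eq)
qed

end

section \<open>Approximation of times from the right by dyadic points\<close>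

text \<open>The \<open>Suc\<close> puts the point strictly to the right of a nonnegative
  \<open>x\<close>, grid points included, so that right continuity alone controls the
  approximation.\<close>

definition dyadic_above :: "nat \<Rightarrow> real \<Rightarrow> real" where
  "dyadic_above n x = real (Suc (nat \<lfloor>x * 2 ^ n\<rfloor>)) / 2 ^ n"

lemma dyadic_above_bounds:
  assumes "0 \<le> x" shows "x < dyadic_above n x" "dyadic_above n x \<le> x + 1 / 2 ^ n"
proof -
  have "real (nat \<lfloor>x * 2 ^ n\<rfloor>) = of_int \<lfloor>x * 2 ^ n\<rfloor>" using assms by simp
  then have "x * 2 ^ n < real (Suc (nat \<lfloor>x * 2 ^ n\<rfloor>))" "real (Suc (nat \<lfloor>x * 2 ^ n\<rfloor>)) \<le> x * 2 ^ n + 1"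
    by linarith+
  then show "x < dyadic_above n x" "dyadic_above n x \<le> x + 1 / 2 ^ n"
    by (simp_all add: dyadic_above_def field_simps)
qed

lemma LIMSEQ_inverse_power2: "(\<lambda>n. 1 / 2 ^ n :: real) \<longlonglongrightarrow> 0"
  using LIMSEQ_divide_realpow_zero[of 2 1] by simp

lemma filterlim_dyadic_above:
  assumes "0 \<le> x" shows "filterlim (\<lambda>n. dyadic_above n x) (at_right x) sequentially"
  unfolding filterlim_at
proof
  have "dyadic_above n x \<in> {x<..} \<and> dyadic_above n x \<noteq> x" for n
    using dyadic_above_bounds(1)[OF assms, of n] by auto
  then show "\<forall>\<^sub>F n in sequentially. dyadic_above n x \<in> {x<..} \<and> dyadic_above n x \<noteq> x"
    by simp
  have "(\<lambda>n. x + 1 / 2 ^ n) \<longlonglongrightarrow> x + 0"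
    by (intro tendsto_add tendsto_const LIMSEQ_inverse_power2)
  then have lim: "(\<lambda>n. x + 1 / 2 ^ n) \<longlonglongrightarrow> x" by simp
  show "(\<lambda>n. dyadic_above n x) \<longlonglongrightarrow> x"
    using dyadic_above_bounds(2)[OF assms] less_imp_le[OF dyadic_above_bounds(1)[OF assms]]
    by (intro tendsto_sandwich[OF _ _ tendsto_const lim] always_eventually allI)
qed

text \<open>At a fixed dyadic level the random time takes countably many values, which reduces
  evaluation at it to evaluation at fixed times. The map \<open>h\<close> allows the sample point to
  be one coordinate of a product space.\<close>

lemma measurable_at_dyadic_above:
  assumes X: "\<And>t. 0 \<le> t \<Longrightarrow> X t \<in> N \<rightarrow>\<^sub>M L"
    and h: "h \<in> K \<rightarrow>\<^sub>M N" and g: "g \<in> borel_measurable K"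
  shows "(\<lambda>x. X (dyadic_above n (g x)) (h x)) \<in> K \<rightarrow>\<^sub>M L"
  unfolding dyadic_above_def
proof (rule measurable_compose_countable[where f="\<lambda>m x. X (real (Suc m) / 2 ^ n) (h x)"])
  show "(\<lambda>x. nat \<lfloor>g x * 2 ^ n\<rfloor>) \<in> K \<rightarrow>\<^sub>M count_space UNIV" using g by measurable
  fix m show "(\<lambda>x. X (real (Suc m) / 2 ^ n) (h x)) \<in> K \<rightarrow>\<^sub>M L"
    by (rule measurable_compose[OF h X]) auto
qed

lemma measurable_cadlag_at:
  fixes X :: "real \<Rightarrow> 'w \<Rightarrow> real"
  assumes X: "\<And>t. 0 \<le> t \<Longrightarrow> X t \<in> borel_measurable N"
    and path: "\<And>\<omega>. \<omega> \<in> space N \<Longrightarrow> cadlag (\<lambda>t. X t \<omega>)"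
    and h: "h \<in> K \<rightarrow>\<^sub>M N" and g: "g \<in> borel_measurable K" "\<And>x. x \<in> space K \<Longrightarrow> 0 \<le> g x"
  shows "(\<lambda>x. X (g x) (h x)) \<in> borel_measurable K"
proof (rule borel_measurable_LIMSEQ_real)
  show "(\<lambda>x. X (dyadic_above n (g x)) (h x)) \<in> borel_measurable K" for n
    by (rule measurable_at_dyadic_above[OF X h g(1)])
  fix x assume "x \<in> space K"
  then show "(\<lambda>n. X (dyadic_above n (g x)) (h x)) \<longlonglongrightarrow> X (g x) (h x)"
    using measurable_space[OF h] g(2)
    by (blast intro: filterlim_compose[OF cadlag_right[OF path] filterlim_dyadic_above])
qed

section \<open>Transition semigroups\<close>

lemma filterlim_divide_Suc: "0 < t \<Longrightarrow> filterlim (\<lambda>n. t / real (Suc n)) (at_right 0) sequentially"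
  unfolding filterlim_at using LIMSEQ_Suc[OF lim_const_over_n[of t]] by (auto intro!: always_eventually)

text \<open>Telescoping: the factors of \<open>p (t / N) ^ N\<close> are replaced by those of \<open>q (t / N) ^ N\<close> one by one.\<close>

lemma semigroup_unique:
  fixes p q :: "real \<Rightarrow> 'a::finite \<Rightarrow> 'a \<Rightarrow> real"
  assumes p0: "\<And>x y. p 0 x y = (if x = y then 1 else 0)"
    and q0: "\<And>x y. q 0 x y = (if x = y then 1 else 0)"
    and pa: "\<And>s t x z. 0 \<le> s \<Longrightarrow> 0 \<le> t \<Longrightarrow> p (s + t) x z = (\<Sum>y\<in>UNIV. p s x y * p t y z)"
    and qa: "\<And>s t x z. 0 \<le> s \<Longrightarrow> 0 \<le> t \<Longrightarrow> q (s + t) x z = (\<Sum>y\<in>UNIV. q s x y * q t y z)"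
    and pb: "\<And>t x y. 0 \<le> t \<Longrightarrow> \<bar>p t x y\<bar> \<le> C" and qb: "\<And>t x y. 0 \<le> t \<Longrightarrow> \<bar>q t x y\<bar> \<le> C'"
    and d: "\<And>x y. ((\<lambda>h. (p h x y - q h x y) / h) \<longlongrightarrow> 0) (at_right 0)"
    and t: "0 \<le> t"
  shows "p t x y = q t x y"
proof (cases "t = 0")
  case False
  with t have t: "0 < t" by simp
  \<comment> \<open>Total difference quotient of the two families over a step \<open>h\<close>; it
    tends to 0 since both have the same derivative at 0.\<close>
  define D where "D h = (\<Sum>u\<in>UNIV. \<Sum>v\<in>UNIV. \<bar>(p h u v - q h u v) / h\<bar>)" for h
  have "(D \<longlongrightarrow> (\<Sum>u\<in>(UNIV :: 'a set). \<Sum>v\<in>(UNIV :: 'a set). \<bar>0\<bar>)) (at_right 0)"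
    unfolding D_def by (intro tendsto_sum tendsto_rabs d)
  then have D0: "(\<lambda>n. t * (C * C') * D (t / real (Suc n))) \<longlonglongrightarrow> t * (C * C') * 0"
    by (intro tendsto_mult tendsto_const filterlim_compose[OF _ filterlim_divide_Suc[OF t]]) simp
  have CC: "0 \<le> C" "0 \<le> C'" using pb[of 0 x y] qb[of 0 x y] by auto
  have "\<bar>p t x y - q t x y\<bar> \<le> t * (C * C') * D (t / real (Suc n))" for n
  proof -
    define N h where "N = Suc n" and "h = t / real N"
    have h: "h > 0" and Nh: "real N * h = t" using t by (auto simp: h_def N_def)
    \<comment> \<open>Hybrid kernel: the first \<open>k\<close> of the \<open>N\<close> steps follow
      \<open>p\<close>, the others \<open>q\<close>. One replacement costs at most
      \<open>h * (C * C') * D h\<close>, and \<open>N * h = t\<close>.\<close>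
    define e where "e k = (\<Sum>z\<in>UNIV. p (real k * h) x z * q (real (N - k) * h) z y)" for k
    have step: "\<bar>e (Suc k) - e k\<bar> \<le> h * (C * C') * D h" if k: "k < N" for k
    proof -
      have 1: "p (real (Suc k) * h) x v = (\<Sum>u\<in>UNIV. p (real k * h) x u * p h u v)" for v
        using pa[of "real k * h" h x v] h by (simp add: algebra_simps)
      have 2: "q (real (N - k) * h) u y = (\<Sum>v\<in>UNIV. q h u v * q (real (N - Suc k) * h) v y)" for u
      proof -
        have "real (N - k) = real (N - Suc k) + 1" using k by linarith
        then have "real (N - k) * h = h + real (N - Suc k) * h" by (simp add: algebra_simps)
        from arg_cong[OF this, of "\<lambda>s. q s u y"] qa[of h "real (N - Suc k) * h" u y] h
        show ?thesis by simp
      qed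
      have "e (Suc k) = (\<Sum>u\<in>UNIV. \<Sum>v\<in>UNIV. p (real k * h) x u * p h u v * q (real (N - Suc k) * h) v y)"
        unfolding e_def 1 sum_distrib_right by (rule sum.swap)
      moreover have "e k = (\<Sum>u\<in>UNIV. \<Sum>v\<in>UNIV. p (real k * h) x u * q h u v * q (real (N - Suc k) * h) v y)"
        unfolding e_def 2 sum_distrib_left by (simp add: mult.assoc)
      ultimately have "e (Suc k) - e k =
          (\<Sum>u\<in>UNIV. \<Sum>v\<in>UNIV. p (real k * h) x u * (p h u v - q h u v) * q (real (N - Suc k) * h) v y)"
        by (simp add: sum_subtractf algebra_simps)
      also have "\<bar>\<dots>\<bar> \<le> (\<Sum>u\<in>UNIV. \<Sum>v\<in>UNIV. C * \<bar>p h u v - q h u v\<bar> * C')"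
        using h k CC pb[of "real k * h"] qb[of "real (N - Suc k) * h"]
        by (intro order_trans[OF sum_abs] sum_mono) (auto simp: abs_mult intro!: mult_mono)
      also have "\<dots> = h * (C * C') * D h"
        using h by (simp add: D_def sum_distrib_left mult_ac)
      finally show ?thesis .
    qed
    have "\<bar>e N - e 0\<bar> = \<bar>\<Sum>k<N. e (Suc k) - e k\<bar>" by (simp add: sum_lessThan_telescope)
    also have "\<dots> \<le> (\<Sum>k<N. h * (C * C') * D h)"
      by (intro order_trans[OF sum_abs] sum_mono step) auto
    also have "\<dots> = t * (C * C') * D h" using Nh by (simp add: mult.assoc[symmetric])
    finally have "\<bar>e N - e 0\<bar> \<le> t * (C * C') * D h" .
    moreover have "e N = p t x y" "e 0 = q t x y"
      by (simp_all add: e_def Nh p0 q0 if_distrib if_distribR sum.delta cong: if_cong)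
    ultimately show ?thesis by (simp add: h_def N_def)
  qed
  then have "\<bar>p t x y - q t x y\<bar> \<le> t * (C * C') * 0"
    by (intro LIMSEQ_le_const[OF D0]) auto
  then show ?thesis by simp
qed (simp add: p0 q0)

text \<open>A maximum principle: a vector whose image under the generator is nonpositive decreases
  along the semigroup. It is applied to the indicator of the phases, to kernel vectors of
  \<open>T\<close>, and, under the transposed semigroup, to the reversal weights.\<close>

lemma semigroup_supermedian:
  fixes p :: "real \<Rightarrow> 'a::finite \<Rightarrow> 'a \<Rightarrow> real"
  assumes p0: "\<And>x y. p 0 x y = (if x = y then 1 else 0)"
    and pa: "\<And>s t x z. 0 \<le> s \<Longrightarrow> 0 \<le> t \<Longrightarrow> p (s + t) x z = (\<Sum>y\<in>UNIV. p s x y * p t y z)"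
    and pb: "\<And>t x y. 0 \<le> t \<Longrightarrow> 0 \<le> p t x y \<and> p t x y \<le> 1"
    and d: "\<And>x. ((\<lambda>h. ((\<Sum>y\<in>UNIV. p h x y * v y) - v x) / h) \<longlongrightarrow> w x) (at_right 0)"
    and w: "\<And>x. w x \<le> 0"
    and t: "0 \<le> t"
  shows "(\<Sum>y\<in>UNIV. p t x y * v y) \<le> v x"
proof (cases "t = 0")
  case True
  then show ?thesis by (simp add: p0 if_distrib if_distribR sum.delta cong: if_cong)
next
  case False
  with t have t: "0 < t" by simp
  define r where "r h x = (\<Sum>y\<in>UNIV. p h x y * v y) - v x" for h x
  \<comment> \<open>Only the positive parts of the one-step increments can push the sum up, and
    these vanish in the limit because \<open>w x \<le> 0\<close>.\<close>
  define D where "D h = (\<Sum>z\<in>UNIV. max 0 (r h z / h))" for h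
  have "(D \<longlongrightarrow> (\<Sum>z\<in>(UNIV :: 'a set). max 0 (w z))) (at_right 0)"
    unfolding D_def r_def by (intro tendsto_sum tendsto_max tendsto_const d)
  then have D0: "(\<lambda>n. t * D (t / real (Suc n))) \<longlonglongrightarrow> t * 0"
    using w by (intro tendsto_mult tendsto_const filterlim_compose[OF _ filterlim_divide_Suc[OF t]])
      (simp add: max.absorb1)
  have "(\<Sum>y\<in>UNIV. p t x y * v y) - v x \<le> t * D (t / real (Suc n))" for n
  proof -
    define N h where "N = Suc n" and "h = t / real N"
    have h: "h > 0" and Nh: "real N * h = t" using t by (auto simp: h_def N_def)
    define e where "e k = (\<Sum>z\<in>UNIV. p (real k * h) x z * v z)" for k
    have step: "e (Suc k) - e k \<le> h * D h" for k
    proof -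
      have 1: "p (real (Suc k) * h) x v = (\<Sum>u\<in>UNIV. p (real k * h) x u * p h u v)" for v
        using pa[of "real k * h" h x v] h by (simp add: algebra_simps)
      have "e (Suc k) = (\<Sum>z\<in>UNIV. p (real k * h) x z * (\<Sum>y\<in>UNIV. p h z y * v y))"
        unfolding e_def 1 sum_distrib_right sum_distrib_left by (subst sum.swap) (simp add: mult.assoc)
      then have "e (Suc k) - e k = (\<Sum>z\<in>UNIV. p (real k * h) x z * r h z)"
        by (simp add: e_def r_def sum_subtractf algebra_simps)
      also have "\<dots> \<le> (\<Sum>z\<in>UNIV. 1 * (h * max 0 (r h z / h)))"
      proof (rule sum_mono)
        fix z
        have "p (real k * h) x z * r h z \<le> p (real k * h) x z * (h * max 0 (r h z / h))"
          using h pb[of "real k * h" x z] by (intro mult_left_mono) (auto simp: max_def field_simps)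
        also have "\<dots> \<le> 1 * (h * max 0 (r h z / h))"
          using h pb[of "real k * h" x z] by (intro mult_right_mono) auto
        finally show "p (real k * h) x z * r h z \<le> 1 * (h * max 0 (r h z / h))" .
      qed
      also have "\<dots> = h * D h" by (simp add: D_def sum_distrib_left)
      finally show ?thesis .
    qed
    have "e N - e 0 = (\<Sum>k<N. e (Suc k) - e k)" by (simp add: sum_lessThan_telescope)
    also have "\<dots> \<le> (\<Sum>k<N. h * D h)" by (intro sum_mono step)
    also have "\<dots> = t * D h" using Nh by (simp add: mult.assoc[symmetric])
    finally have "e N - e 0 \<le> t * D h" .
    moreover have "e N = (\<Sum>y\<in>UNIV. p t x y * v y)" "e 0 = v x"
      by (simp_all add: e_def Nh p0 if_distrib if_distribR sum.delta cong: if_cong)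
    ultimately show ?thesis by (simp add: h_def N_def)
  qed
  then have "(\<Sum>y\<in>UNIV. p t x y * v y) - v x \<le> t * 0"
    by (intro LIMSEQ_le_const[OF D0]) auto
  then show ?thesis by simp
qed

lemma UNIV_option_sum:
  fixes g :: "'n::finite option \<Rightarrow> real"
  shows "(\<Sum>x\<in>UNIV. g x) = g None + (\<Sum>i\<in>UNIV. g (Some i))"
  by (simp add: UNIV_option_conv sum.reindex)

text \<open>Entries of stochastic kernels are bounded by 1, so \<open>semigroup_unique\<close>
  applies with both constants equal to 1.\<close>

lemma transition_semigroup_unique:
  assumes "transition_semigroup p Q" "transition_semigroup q Q" "0 \<le> t"
  shows "p t x y = q t x y"
proof -
  have le1: "\<bar>p t x y\<bar> \<le> 1" if "transition_semigroup p Q" "0 \<le> t" for p t x y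
    using that member_le_sum[of y UNIV "p t x"] by (auto simp: transition_semigroup_def)
  show ?thesis
    using assms le1 tendsto_diff[of "\<lambda>h. (p h x y - p 0 x y) / h" "Q x y" "at_right 0" "\<lambda>h. (q h x y - q 0 x y) / h" "Q x y" for x y]
    by (intro semigroup_unique[where p=p and q=q and C=1 and C'=1])
       (auto simp: transition_semigroup_def diff_divide_distrib)
qed

locale phase_semigroup =
  fixes p :: "real \<Rightarrow> 'n::finite option \<Rightarrow> 'n option \<Rightarrow> real" and T :: "real^'n^'n"
  assumes sg: "transition_semigroup p (full_generator T)"
begin

abbreviation pp :: "real \<Rightarrow> 'n \<Rightarrow> 'n \<Rightarrow> real" where "pp t i j \<equiv> p t (Some i) (Some j)"

lemma p_nonneg: "0 \<le> t \<Longrightarrow> 0 \<le> p t x y"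
  and p_sum: "0 \<le> t \<Longrightarrow> (\<Sum>y\<in>UNIV. p t x y) = 1"
  and p_0: "p 0 x y = (if x = y then 1 else 0)"
  and p_add: "0 \<le> s \<Longrightarrow> 0 \<le> t \<Longrightarrow> p (s + t) x z = (\<Sum>y\<in>UNIV. p s x y * p t y z)"
  and p_deriv: "((\<lambda>h. (p h x y - p 0 x y) / h) \<longlongrightarrow> full_generator T x y) (at_right 0)"
  using sg unfolding transition_semigroup_def by blast+

lemma p_le_1: "0 \<le> t \<Longrightarrow> p t x y \<le> 1"
  using p_sum[of t x] member_le_sum[of y UNIV "p t x"] p_nonneg by auto

lemma p_tendsto_0: "((\<lambda>h. p h x y) \<longlongrightarrow> p 0 x y) (at_right 0)"
proof -
  have "((\<lambda>h. h * ((p h x y - p 0 x y) / h) + p 0 x y) \<longlongrightarrow> 0 * full_generator T x y + p 0 x y) (at_right 0)"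
    by (intro tendsto_intros p_deriv)
  moreover have "\<forall>\<^sub>F h in at_right 0. h * ((p h x y - p 0 x y) / h) + p 0 x y = p h x y"
    by (auto simp: eventually_at_right_field intro!: exI[of _ 1])
  ultimately show ?thesis
    using Lim_transform_eventually by fastforce
qed

lemma exit_limit: "((\<lambda>h. p h (Some i) None / h) \<longlongrightarrow> exit_rates T $ i) (at_right 0)"
  using p_deriv[of "Some i" None] by (simp add: p_0)

lemma exit_nonneg: "0 \<le> exit_rates T $ i"
  by (rule tendsto_lowerbound[OF exit_limit])
     (auto simp: eventually_at_right_field p_nonneg intro!: exI[of _ 1])

text \<open>The generator only says that the rates out of \<open>None\<close> vanish. That no mass
  ever leaves follows from the maximum principle for the indicator \<open>v\<close> of the phases:
  its image under the generator is minus the exit rate at a phase and 0 at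
  \<open>None\<close>.\<close>

lemma p_None:
  assumes "0 \<le> t" shows "p t None (Some i) = 0" "p t None None = 1"
proof -
  define v where "v = (\<lambda>x. case x of None \<Rightarrow> 0 | Some (_::'n) \<Rightarrow> (1::real))"
  define w where "w = (\<lambda>x. case x of None \<Rightarrow> 0 | Some i \<Rightarrow> - exit_rates T $ i)"
  have v: "(\<Sum>y\<in>UNIV. p h x y * v y) = (\<Sum>y\<in>UNIV. p h x y) - p h x None" for h x
    by (simp add: UNIV_option_sum v_def)
  have vx: "v x = (if x = None then 0 else 1)" for x by (cases x) (auto simp: v_def)
  have "(\<Sum>y\<in>UNIV. p t None y * v y) \<le> v None"
  proof (rule semigroup_supermedian[where w=w])
    fix x
    have ev: "\<forall>\<^sub>F h in at_right 0. - ((p h x None - p 0 x None) / h) = ((\<Sum>y\<in>UNIV. p h x y * v y) - v x) / h"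
      unfolding v by (auto simp: eventually_at_right_field p_sum p_0 vx diff_divide_distrib
          intro!: exI[of _ 1])
    have "((\<lambda>h. - ((p h x None - p 0 x None) / h)) \<longlongrightarrow> - full_generator T x None) (at_right 0)"
      by (intro tendsto_intros p_deriv)
    moreover have "- full_generator T x None = w x" by (cases x) (auto simp: w_def)
    ultimately show "((\<lambda>h. ((\<Sum>y\<in>UNIV. p h x y * v y) - v x) / h) \<longlongrightarrow> w x) (at_right 0)"
      using Lim_transform_eventually[OF _ ev] by auto
    show "w x \<le> 0" using exit_nonneg by (auto simp: w_def split: option.splits)
  qed (use assms p_add p_nonneg p_le_1 p_0 in auto)
  then have "(\<Sum>i\<in>UNIV. p t None (Some i)) \<le> 0" by (simp add: UNIV_option_sum v_def)
  moreover have "p t None (Some i) \<le> (\<Sum>i\<in>UNIV. p t None (Some i))" for i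
    using p_nonneg assms by (intro member_le_sum) auto
  ultimately show *: "p t None (Some i) = 0" for i using p_nonneg[OF assms, of None "Some i"]
    by (meson dual_order.trans order_antisym)
  show "p t None None = 1" using p_sum[OF assms, of None] by (simp add: UNIV_option_sum *)
qed

lemma pp_add: "0 \<le> s \<Longrightarrow> 0 \<le> t \<Longrightarrow> pp (s + t) i j = (\<Sum>k\<in>UNIV. pp s i k * pp t k j)"
  by (simp add: p_add UNIV_option_sum p_None)

text \<open>Distance of the kernel at time \<open>h\<close> from the identity. As it bounds
  increments from every base time, it is a uniform modulus of continuity, used for continuity in
  \<open>t\<close> and for the convergence of Riemann sums.\<close>

definition modulus :: "real \<Rightarrow> real" where
  "modulus h = (\<Sum>x\<in>UNIV. \<Sum>y\<in>UNIV. \<bar>p h x y - p 0 x y\<bar>)"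

lemma modulus_tendsto: "(modulus \<longlongrightarrow> 0) (at_right 0)"
proof -
  have "(modulus \<longlongrightarrow> (\<Sum>x\<in>(UNIV :: 'n option set). \<Sum>y\<in>(UNIV :: 'n option set). \<bar>p 0 x y - p 0 x y\<bar>)) (at_right 0)"
    unfolding modulus_def by (intro tendsto_sum tendsto_rabs tendsto_diff p_tendsto_0 tendsto_const)
  then show ?thesis by simp
qed

text \<open>The extra time is placed at the beginning, which writes the increment as the matrix
  product of \<open>p h - p 0\<close> with \<open>p t\<close>, whose entries are at most 1.\<close>

lemma p_modulus:
  assumes "0 \<le> t" "0 \<le> h" shows "\<bar>p (t + h) x y - p t x y\<bar> \<le> modulus h"
proof -
  have "p t x y = (\<Sum>z\<in>UNIV. p 0 x z * p t z y)"
    using p_add[of 0 t x y] assms by simp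
  then have "p (t + h) x y - p t x y = (\<Sum>z\<in>UNIV. (p h x z - p 0 x z) * p t z y)"
    using p_add[of h t x y] assms by (simp add: add.commute algebra_simps sum_subtractf)
  also have "\<bar>\<dots>\<bar> \<le> (\<Sum>z\<in>UNIV. \<bar>p h x z - p 0 x z\<bar> * 1)"
    using assms p_nonneg p_le_1
    by (intro order_trans[OF sum_abs] sum_mono) (auto simp: abs_mult intro!: mult_left_le)
  also have "\<dots> \<le> modulus h"
    unfolding modulus_def by (simp, intro member_le_sum) (auto intro!: sum_nonneg)
  finally show ?thesis .
qed

lemma continuous_on_p: "continuous_on {0..} (\<lambda>t. p t x y)"
  unfolding continuous_on_iff
proof (intro ballI allI impI)
  fix t e :: real assume t: "t \<in> {0..}" and e: "e > 0"
  from order_tendstoD(2)[OF modulus_tendsto e] obtain d where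
    d: "d > 0" "\<And>h. 0 < h \<Longrightarrow> h < d \<Longrightarrow> modulus h < e"
    by (auto simp: eventually_at_right_field)
  show "\<exists>d>0. \<forall>t'\<in>{0..}. dist t' t < d \<longrightarrow> dist (p t' x y) (p t x y) < e"
  proof (intro exI[of _ d] conjI ballI impI d)
    fix t' assume t': "t' \<in> {0..}" "dist t' t < d"
    consider "t' = t" | "t' < t" | "t < t'" by linarith
    then show "dist (p t' x y) (p t x y) < e"
      using t t' e p_modulus[of t "t' - t" x y] p_modulus[of t' "t - t'" x y]
        d(2)[of "t - t'"] d(2)[of "t' - t"]
      by cases (auto simp: dist_real_def)
  qed
qed

end

section \<open>Phase processes\<close>

lemma exists_rat_right:
  assumes "\<forall>\<^sub>F s in at_right t. P s" "t < (u::real)"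
  shows "\<exists>q\<in>\<rat>. t < q \<and> q < u \<and> P q"
proof -
  obtain d where d: "d > t" "\<And>s. t < s \<Longrightarrow> s < d \<Longrightarrow> P s"
    using assms(1) by (auto simp: eventually_at_right_field)
  obtain q where "q \<in> \<rat>" "t < q" "q < min d u" using Rats_dense_in_real[of t "min d u"] d(1) assms(2) by auto
  then show ?thesis using d by auto
qed

text \<open>Measurability and path regularity without a law: the locale is instantiated for the full
  measure and for the \<sigma>-algebra generated by \<open>J\<close>, on which independence is
  formulated.\<close>

locale jump_process =
  fixes N :: "'w measure" and J :: "real \<Rightarrow> 'w \<Rightarrow> 'n::finite option"
  assumes J_meas: "\<And>t. 0 \<le> t \<Longrightarrow> J t \<in> N \<rightarrow>\<^sub>M count_space UNIV"
    and J_path: "\<And>\<omega>. \<omega> \<in> space N \<Longrightarrow> jump_path (\<lambda>t. J t \<omega>)"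
begin

lemma J_right: "\<omega> \<in> space N \<Longrightarrow> 0 \<le> t \<Longrightarrow> \<forall>\<^sub>F s in at_right t. J s \<omega> = J t \<omega>"
  and J_left: "\<omega> \<in> space N \<Longrightarrow> 0 < t \<Longrightarrow> \<exists>x. \<forall>\<^sub>F s in at_left t. J s \<omega> = x"
  using J_path by (auto simp: jump_path_def)

lemma J_dyadic:
  assumes "\<omega> \<in> space N" "0 \<le> t" shows "\<forall>\<^sub>F n in sequentially. J (dyadic_above n t) \<omega> = J t \<omega>"
  using filterlim_dyadic_above[OF assms(2)] J_right[OF assms] by (auto simp: filterlim_iff)

text \<open>Paths are constant just to the right of each time, so the state at a random time is the
  eventual value along its dyadic approximations, a countable combination of measurable
  events.\<close>

lemma measurable_J_at:
  assumes h: "h \<in> K \<rightarrow>\<^sub>M N" and g: "g \<in> borel_measurable K" "\<And>x. x \<in> space K \<Longrightarrow> 0 \<le> g x"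
  shows "(\<lambda>x. J (g x) (h x)) \<in> K \<rightarrow>\<^sub>M count_space UNIV"
  unfolding measurable_count_space_eq2[OF finite]
proof (intro conjI ballI)
  fix y
  have [measurable]: "(\<lambda>x. J (dyadic_above n (g x)) (h x)) \<in> K \<rightarrow>\<^sub>M count_space UNIV" for n
    by (rule measurable_at_dyadic_above[OF J_meas h g(1)])
  have "(J (g x) (h x) = y) \<longleftrightarrow> (\<exists>m. \<forall>n\<ge>m. J (dyadic_above n (g x)) (h x) = y)" if "x \<in> space K" for x
    using J_dyadic[OF measurable_space[OF h that] g(2)[OF that]]
    unfolding eventually_sequentially by (metis nat_le_linear)
  then have "(\<lambda>x. J (g x) (h x)) -` {y} \<inter> space K =
      {x\<in>space K. \<exists>m. \<forall>n\<ge>m. J (dyadic_above n (g x)) (h x) = y}" by auto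
  also have "\<dots> \<in> sets K" by measurable
  finally show "(\<lambda>x. J (g x) (h x)) -` {y} \<inter> space K \<in> sets K" .
qed simp

lemma terminates_before_rat_iff:
  assumes "\<omega> \<in> space N"
  shows "(\<exists>t\<ge>0. J t \<omega> = None \<and> t < c) \<longleftrightarrow> (\<exists>q\<in>\<rat>. 0 \<le> q \<and> q < c \<and> J q \<omega> = None)"
proof
  assume "\<exists>t\<ge>0. J t \<omega> = None \<and> t < c"
  then obtain t where t: "0 \<le> t" "J t \<omega> = None" "t < c" by auto
  from exists_rat_right[OF J_right[OF assms t(1)] t(3)]
  obtain q where "q \<in> \<rat>" "t < q" "q < c" "J q \<omega> = J t \<omega>" by auto
  then show "\<exists>q\<in>\<rat>. 0 \<le> q \<and> q < c \<and> J q \<omega> = None"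
    using t by (intro bexI[of _ q]) auto
qed auto

lemma terminates_rat_iff:
  assumes "\<omega> \<in> space N"
  shows "(\<exists>t\<ge>0. J t \<omega> = None) \<longleftrightarrow> (\<exists>q\<in>\<rat>. 0 \<le> q \<and> J q \<omega> = None)"
  using terminates_before_rat_iff[OF assms] by (metis gt_ex)

text \<open>The second disjunct covers paths that never terminate, whose lifetime has the default
  value 0. For the others, right constancy replaces an arbitrary time in the absorbing state by a
  rational one.\<close>

lemma lifetime_less_iff:
  assumes "\<omega> \<in> space N"
  shows "lifetime J \<omega> < c \<longleftrightarrow> (\<exists>q\<in>\<rat>. 0 \<le> q \<and> q < c \<and> J q \<omega> = None)
    \<or> (\<not> (\<exists>q\<in>\<rat>. 0 \<le> q \<and> J q \<omega> = None) \<and> 0 < c)"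
proof (cases "\<exists>t\<ge>0. J t \<omega> = None")
  case True
  have "lifetime J \<omega> < c \<longleftrightarrow> (\<exists>t\<in>{t. 0 \<le> t \<and> J t \<omega> = None}. t < c)"
    using True unfolding lifetime_def by (simp, subst cInf_less_iff) (auto intro!: bdd_belowI[of _ 0])
  then show ?thesis using True terminates_before_rat_iff[OF assms, of c] terminates_rat_iff[OF assms] by auto
qed (use terminates_rat_iff[OF assms] in \<open>auto simp: lifetime_def\<close>)

lemma lifetime_measurable [measurable]: "lifetime J \<in> borel_measurable N"
proof (rule borel_measurableI_less)
  fix c
  have [measurable]: "{\<omega>\<in>space N. J q \<omega> = None} \<in> sets N" if "0 \<le> q" for q
    using J_meas[OF that] by measurable
  have [simp]: "countable (\<rat> \<inter> {q. 0 \<le> q \<and> P q})" "countable (\<rat> \<inter> {q. 0 \<le> q})" for P :: "real \<Rightarrow> bool"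
    by (auto intro: countable_subset[OF _ countable_rat])
  have "{\<omega>\<in>space N. lifetime J \<omega> < c} =
    (\<Union>q\<in>\<rat> \<inter> {q. 0 \<le> q \<and> q < c}. {\<omega>\<in>space N. J q \<omega> = None}) \<union>
    (space N - (\<Union>q\<in>\<rat> \<inter> {q. 0 \<le> q}. {\<omega>\<in>space N. J q \<omega> = None})) \<inter> {\<omega>\<in>space N. 0 < c}"
  proof (intro set_eqI)
    fix \<omega>
    show "\<omega> \<in> {\<omega>\<in>space N. lifetime J \<omega> < c} \<longleftrightarrow> \<omega> \<in> (\<Union>q\<in>\<rat> \<inter> {q. 0 \<le> q \<and> q < c}. {\<omega>\<in>space N. J q \<omega> = None}) \<union>
    (space N - (\<Union>q\<in>\<rat> \<inter> {q. 0 \<le> q}. {\<omega>\<in>space N. J q \<omega> = None})) \<inter> {\<omega>\<in>space N. 0 < c}"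
      by (cases "\<omega> \<in> space N") (simp_all only: mem_Collect_eq lifetime_less_iff Un_iff Int_iff Diff_iff UN_iff, blast+)
  qed
  also have "\<dots> \<in> sets N"
    by (intro sets.Un sets.Int sets.Diff sets.top sets.countable_UN'' sets.sets_Collect_const) auto
  finally show "{\<omega>\<in>space N. lifetime J \<omega> < c} \<in> sets N" .
qed

lemma lifetime_nonneg: "0 \<le> lifetime J \<omega>"
  by (auto simp: lifetime_def intro!: cInf_greatest)

text \<open>Two eventual values along the same nontrivial filter agree, which justifies the definite
  description in \<open>last_phase\<close>.\<close>

lemma last_phase_left:
  assumes "\<omega> \<in> space N" "0 < lifetime J \<omega>"
  shows "\<forall>\<^sub>F s in at_left (lifetime J \<omega>). J s \<omega> = last_phase J \<omega>"
proof -
  obtain x where x: "\<forall>\<^sub>F s in at_left (lifetime J \<omega>). J s \<omega> = x" using J_left[OF assms] by auto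
  have "y = x" if "\<forall>\<^sub>F s in at_left (lifetime J \<omega>). J s \<omega> = y" for y
    using eventually_happens'[OF _ eventually_conj[OF x that]] by auto
  then have "(THE x. \<forall>\<^sub>F s in at_left (lifetime J \<omega>). J s \<omega> = x) = x" using x by (intro the_equality)
  then have "last_phase J \<omega> = x" using assms(2) by (simp add: last_phase_def)
  then show ?thesis using x by simp
qed

lemma last_phase_measurable [measurable]: "last_phase J \<in> N \<rightarrow>\<^sub>M count_space UNIV"
  unfolding measurable_count_space_eq2[OF finite]
proof (intro conjI ballI)
  fix y
  \<comment> \<open>These points lie strictly below a positive lifetime and increase to it, so they
    sample the left limit; at lifetime 0 the default \<open>J 0\<close> takes over.\<close>
  let ?g = "\<lambda>n \<omega>. lifetime J \<omega> - lifetime J \<omega> / real (Suc n)"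
  have g: "0 \<le> ?g n \<omega>" for n \<omega> using lifetime_nonneg[of \<omega>] by (simp add: field_simps)
  have [measurable]: "(\<lambda>\<omega>. J (?g n \<omega>) \<omega>) \<in> N \<rightarrow>\<^sub>M count_space UNIV" for n
    by (rule measurable_J_at) (use g in auto)
  have [measurable]: "J 0 \<in> N \<rightarrow>\<^sub>M count_space UNIV" by (rule J_meas) simp
  have pos_iff: "last_phase J \<omega> = y \<longleftrightarrow> (\<exists>m. \<forall>n\<ge>m. J (?g n \<omega>) \<omega> = y)"
    if \<omega>: "\<omega> \<in> space N" and pos: "0 < lifetime J \<omega>" for \<omega>
  proof -
    have "filterlim (\<lambda>n. ?g n \<omega>) (at_left (lifetime J \<omega>)) sequentially"
      unfolding filterlim_at
    proof
      have "(\<lambda>n. ?g n \<omega>) \<longlonglongrightarrow> lifetime J \<omega> - 0"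
        by (intro tendsto_diff tendsto_const LIMSEQ_Suc lim_const_over_n)
      then show "(\<lambda>n. ?g n \<omega>) \<longlonglongrightarrow> lifetime J \<omega>" by simp
    qed (use pos in auto)
    then have "\<forall>\<^sub>F n in sequentially. J (?g n \<omega>) \<omega> = last_phase J \<omega>"
      by (rule eventually_compose_filterlim[OF last_phase_left[OF \<omega> pos]])
    then show ?thesis unfolding eventually_sequentially by (metis nat_le_linear)
  qed
  have "last_phase J \<omega> = y \<longleftrightarrow>
      (if lifetime J \<omega> = 0 then J 0 \<omega> = y else (\<exists>m. \<forall>n\<ge>m. J (?g n \<omega>) \<omega> = y))"
    if "\<omega> \<in> space N" for \<omega>
    using pos_iff[OF that] lifetime_nonneg[of \<omega>] by (cases "lifetime J \<omega> = 0") (simp_all add: last_phase_def)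
  then have "last_phase J -` {y} \<inter> space N =
      {\<omega>\<in>space N. if lifetime J \<omega> = 0 then J 0 \<omega> = y else (\<exists>m. \<forall>n\<ge>m. J (?g n \<omega>) \<omega> = y)}"
    by blast
  also have "\<dots> \<in> sets N" by measurable
  finally show "last_phase J -` {y} \<inter> space N \<in> sets N" .
qed simp

lemma phase_at_measurable:
  assumes h: "h \<in> K \<rightarrow>\<^sub>M N" and g: "g \<in> borel_measurable K" "\<And>x. x \<in> space K \<Longrightarrow> 0 \<le> g x"
  shows "(\<lambda>x. phase_at J (g x) (h x)) \<in> K \<rightarrow>\<^sub>M count_space UNIV"
proof -
  have "(\<lambda>x. J (g x) (h x)) \<in> K \<rightarrow>\<^sub>M count_space UNIV"
    by (rule measurable_J_at) (use assms in auto)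
  moreover have "{x\<in>space K. g x = lifetime J (h x)} \<in> sets K"
    by (intro borel_measurable_eq g(1) measurable_compose[OF h lifetime_measurable])
  ultimately show ?thesis unfolding phase_at_def
    by (intro measurable_If measurable_compose[OF h last_phase_measurable])
qed

end

locale phase_process = phase_semigroup p T + prob_space M + jump_process M J
  for p :: "real \<Rightarrow> 'n::finite option \<Rightarrow> 'n option \<Rightarrow> real" and T :: "real^'n^'n"
    and M :: "'w measure" and J :: "real \<Rightarrow> 'w \<Rightarrow> 'n option" +
  fixes a :: "real^'n"
  assumes fdd: "\<And>ts xs m. ts 0 = 0 \<Longrightarrow> incseq ts \<Longrightarrow>
           measure M {\<omega>\<in>space M. \<forall>l\<le>m. J (ts l) \<omega> = xs l} =
           full_initial a (xs 0) * (\<Prod>l<m. p (ts (Suc l) - ts l) (xs l) (xs (Suc l)))"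
    and terminating: "AE \<omega> in M. \<exists>t\<ge>0. J t \<omega> = None"
begin

lemma J_meas_set [measurable]: "0 \<le> t \<Longrightarrow> {\<omega>\<in>space M. J t \<omega> = x} \<in> sets M"
  using J_meas[of t] by measurable

lemma sum_J0:
  assumes [measurable]: "E \<in> sets M"
  shows "prob E = (\<Sum>x\<in>UNIV. prob {\<omega>\<in>E. J 0 \<omega> = x})"
proof -
  have "{\<omega>\<in>E. J 0 \<omega> = x} = E \<inter> {\<omega>\<in>space M. J 0 \<omega> = x}" for x
    using sets.sets_into_space[OF assms] by auto
  then have [measurable]: "{\<omega>\<in>E. J 0 \<omega> = x} \<in> sets M" for x using assms by auto
  have "prob E = prob (\<Union>x. {\<omega>\<in>E. J 0 \<omega> = x})" by (rule arg_cong[where f=prob]) auto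
  also have "\<dots> = (\<Sum>x\<in>UNIV. prob {\<omega>\<in>E. J 0 \<omega> = x})"
    by (intro finite_measure_finite_Union) (auto simp: disjoint_family_on_def)
  finally show ?thesis .
qed

text \<open>The prescribed finite dimensional distributions fix the state at time 0, which is summed
  out here; \<open>None\<close> has initial mass 0. Three times are what is needed later: the time
  of observation and the two ends of a short interval in which \<open>J\<close> exits.\<close>

lemma fdd3:
  assumes "0 \<le> s" "0 \<le> u" "0 \<le> v"
  shows "prob {\<omega>\<in>space M. J s \<omega> = x \<and> J (s + u) \<omega> = y \<and> J (s + u + v) \<omega> = z} =
    (\<Sum>i\<in>UNIV. a $ i * p s (Some i) x) * p u x y * p v y z"
proof -
  \<comment> \<open>Constant from index 3 on, which keeps the sequence monotone.\<close>
  define ts where "ts = (\<lambda>l::nat. if l = 0 then 0 else if l = 1 then s else if l = 2 then s + u else s + u + v)"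
  have inc: "incseq ts" "ts 0 = 0" using assms by (auto simp: incseq_def ts_def)
  have le3: "(\<forall>l\<le>3. P l) \<longleftrightarrow> P 0 \<and> P 1 \<and> P 2 \<and> P (3::nat)" for P
    by (auto simp: numeral_3_eq_3 numeral_2_eq_2 le_Suc_eq)
  have "{\<omega>\<in>space M. J s \<omega> = x \<and> J (s + u) \<omega> = y \<and> J (s + u + v) \<omega> = z} =
     {\<omega>\<in>space M. J s \<omega> = x} \<inter> {\<omega>\<in>space M. J (s + u) \<omega> = y} \<inter> {\<omega>\<in>space M. J (s + u + v) \<omega> = z}" by auto
  then have E: "{\<omega>\<in>space M. J s \<omega> = x \<and> J (s + u) \<omega> = y \<and> J (s + u + v) \<omega> = z} \<in> sets M"
    using assms by (simp add: J_meas_set sets.Int)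
  have "prob {\<omega>\<in>{\<omega>\<in>space M. J s \<omega> = x \<and> J (s + u) \<omega> = y \<and> J (s + u + v) \<omega> = z}. J 0 \<omega> = w} =
      full_initial a w * (p s w x * p u x y * p v y z)" for w
  proof -
    define xs where "xs = (\<lambda>l::nat. if l = 0 then w else if l = 1 then x else if l = 2 then y else z)"
    have "prob {\<omega>\<in>space M. \<forall>l\<le>3. J (ts l) \<omega> = xs l} = full_initial a w * (p s w x * p u x y * p v y z)"
      unfolding fdd[OF inc(2,1)] by (simp add: numeral_3_eq_3 xs_def ts_def mult.assoc)
    moreover have "{\<omega>\<in>space M. \<forall>l\<le>3. J (ts l) \<omega> = xs l} =
      {\<omega>\<in>{\<omega>\<in>space M. J s \<omega> = x \<and> J (s + u) \<omega> = y \<and> J (s + u + v) \<omega> = z}. J 0 \<omega> = w}"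
      unfolding le3 by (auto simp: ts_def xs_def)
    ultimately show ?thesis by simp
  qed
  then show ?thesis
    unfolding sum_J0[OF E] by (simp add: UNIV_option_sum sum_distrib_right sum_distrib_left mult_ac)
qed

definition pi :: "real \<Rightarrow> 'n \<Rightarrow> real" where "pi s k = (\<Sum>i\<in>UNIV. a $ i * pp s i k)"

text \<open>Path properties that the law provides almost surely and \<open>jump_path\<close> does
  not: termination, a start in a phase, and absorption at \<open>None\<close>.\<close>

definition good :: "'w \<Rightarrow> bool" where
  "good \<omega> \<longleftrightarrow> (\<exists>t\<ge>0. J t \<omega> = None) \<and> J 0 \<omega> \<noteq> None \<and>
     (\<forall>s t. 0 \<le> s \<longrightarrow> s \<le> t \<longrightarrow> J s \<omega> = None \<longrightarrow> J t \<omega> = None)"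

lemma AE_J0: "AE \<omega> in M. J 0 \<omega> \<noteq> None"
proof -
  have "prob {\<omega>\<in>space M. J 0 \<omega> = None} = 0"
    using fdd[of "\<lambda>_. 0" 0 "\<lambda>_. None"] by simp
  then show ?thesis by (intro AE_I[of _ _ "{\<omega>\<in>space M. J 0 \<omega> = None}"]) (auto simp: emeasure_eq_measure)
qed

text \<open>For two fixed times absorption is \<open>p_None\<close>. Countably many rational pairs
  are treated at once, and right constancy moves a violating pair \<open>s < t\<close> to rational
  times \<open>q\<close> and \<open>r\<close> just after \<open>s\<close> and
  \<open>t\<close>.\<close>

lemma AE_good: "AE \<omega> in M. good \<omega>"
proof -
  have "AE \<omega> in M. \<not> (J q \<omega> = None \<and> J r \<omega> = Some y)" if "0 \<le> q" "q \<le> r" for q r y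
  proof -
    have "prob {\<omega>\<in>space M. J q \<omega> = None \<and> J (q + (r - q)) \<omega> = Some y \<and> J (q + (r - q) + 0) \<omega> = Some y} = 0"
      using that by (subst fdd3) (auto simp: p_None)
    then have "prob {\<omega>\<in>space M. J q \<omega> = None \<and> J r \<omega> = Some y} = 0" by simp
    moreover have "{\<omega>\<in>space M. J q \<omega> = None \<and> J r \<omega> = Some y} \<in> sets M"
      using sets.Int[OF J_meas_set[of q None] J_meas_set[of r "Some y"]] that
      by (simp add: Collect_conj_eq Int_ac)
    ultimately show ?thesis
      by (intro AE_I[of _ _ "{\<omega>\<in>space M. J q \<omega> = None \<and> J r \<omega> = Some y}"])
         (auto simp: emeasure_eq_measure)
  qed
  then have "AE \<omega> in M. \<forall>y\<in>UNIV. \<not> (J q \<omega> = None \<and> J r \<omega> = Some y)" if "0 \<le> q" "q \<le> r" for q r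
    using that by (subst AE_ball_countable) (auto simp: countable_finite)
  then have "AE \<omega> in M. 0 \<le> q \<and> q \<le> r \<longrightarrow> (\<forall>y\<in>UNIV. \<not> (J q \<omega> = None \<and> J r \<omega> = Some y))" for q r
    by (cases "0 \<le> q \<and> q \<le> r") simp_all
  then have "AE \<omega> in M. \<forall>q\<in>\<rat>. \<forall>r\<in>\<rat>. 0 \<le> q \<and> q \<le> r \<longrightarrow> (\<forall>y\<in>UNIV. \<not> (J q \<omega> = None \<and> J r \<omega> = Some y))"
    by (simp only: AE_ball_countable[OF countable_rat]) blast
  with terminating AE_J0 AE_space show ?thesis
  proof eventually_elim
    case (elim \<omega>)
    have "J t \<omega> = None" if st: "0 \<le> s" "s \<le> t" "J s \<omega> = None" for s t
    proof (rule ccontr)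
      assume "J t \<omega> \<noteq> None"
      then obtain y where y: "J t \<omega> = Some y" by auto
      then have "s < t" using st by (cases "s = t") auto
      from exists_rat_right[OF J_right[OF elim(3) st(1)] this]
      obtain q where q: "q \<in> \<rat>" "s < q" "q < t" "J q \<omega> = None" using st by auto
      have "t < t + 1" by simp
      from exists_rat_right[OF J_right[OF elim(3), of t] this] st
      obtain r where "r \<in> \<rat>" "t < r" "J r \<omega> = Some y" using y by auto
      then show False using elim(4) q st by force
    qed
    then show ?case using elim by (auto simp: good_def)
  qed
qed

lemma good_facts:
  assumes \<omega>: "\<omega> \<in> space M" and g: "good \<omega>"
  shows "0 < lifetime J \<omega>" "0 \<le> s \<Longrightarrow> J s \<omega> = None \<longleftrightarrow> lifetime J \<omega> \<le> s" "\<exists>j. last_phase J \<omega> = Some j"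
proof -
  let ?A = "{t. 0 \<le> t \<and> J t \<omega> = None}"
  have A: "lifetime J \<omega> = Inf ?A" "?A \<noteq> {}" "bdd_below ?A"
    using g by (auto simp: lifetime_def good_def intro!: bdd_belowI[of _ 0])
  have None_iff: "J s \<omega> = None \<longleftrightarrow> lifetime J \<omega> \<le> s" if s0: "0 \<le> s" for s
  proof
    assume "J s \<omega> = None" then show "lifetime J \<omega> \<le> s" unfolding A using s0 A by (auto intro!: cInf_lower)
  next
    assume le: "lifetime J \<omega> \<le> s"
    show "J s \<omega> = None"
    proof (rule ccontr)
      assume nn: "J s \<omega> \<noteq> None"
      \<comment> \<open>A phase at \<open>s\<close> would persist up to \<open>d\<close>, whereas
        the infimum leaves a time in the absorbing state before \<open>d\<close>; absorption forbids
        that this time is at most \<open>s\<close>. So the absorbing state is already occupied at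
        the lifetime itself.\<close>
      obtain d where d: "d > s" "\<And>u. s < u \<Longrightarrow> u < d \<Longrightarrow> J u \<omega> = J s \<omega>"
        using J_right[OF \<omega> s0] by (auto simp: eventually_at_right_field)
      have "Inf ?A < d" using le d(1) A(1) by simp
      from cInf_lessD[OF A(2) this] obtain u where u: "u \<in> ?A" "u < d" by blast
      have "u > s"
      proof (rule ccontr)
        assume "\<not> u > s"
        then have us: "0 \<le> u" "u \<le> s" "J u \<omega> = None" using u(1) by simp_all
        have "\<forall>s t. 0 \<le> s \<longrightarrow> s \<le> t \<longrightarrow> J s \<omega> = None \<longrightarrow> J t \<omega> = None"
          using g unfolding good_def by (elim conjE)
        from this[rule_format, OF us] nn show False by contradiction
      qed
      from d(2)[OF this u(2)] show False using u(1) nn by simp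
    qed
  qed
  then show "0 \<le> s \<Longrightarrow> J s \<omega> = None \<longleftrightarrow> lifetime J \<omega> \<le> s" by blast
  show pos: "0 < lifetime J \<omega>" using None_iff[of 0] g by (auto simp: good_def)
  have "\<forall>\<^sub>F s in at_left (lifetime J \<omega>). 0 \<le> s \<and> s < lifetime J \<omega>"
    using pos by (auto simp: eventually_at_left_field intro!: exI[of _ 0])
  from eventually_happens'[OF _ eventually_conj[OF this last_phase_left[OF \<omega> pos]]]
  obtain s where "0 \<le> s" "s < lifetime J \<omega>" "J s \<omega> = last_phase J \<omega>" by auto
  then show "\<exists>j. last_phase J \<omega> = Some j" using None_iff[of s] by auto
qed

end

section \<open>The phases at a given time and at the end\<close>

lemma riemann_sum_error:
  fixes g :: "real \<Rightarrow> real"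
  assumes g: "continuous_on {s..} g" and h: "0 \<le> h"
    and B: "\<And>u v. s \<le> u \<Longrightarrow> 0 \<le> v \<Longrightarrow> v \<le> h \<Longrightarrow> \<bar>g (u + v) - g u\<bar> \<le> B"
  shows "\<bar>integral {s..s + real n * h} g - (\<Sum>m<n. h * g (s + real m * h))\<bar> \<le> real n * h * B"
proof (induction n)
  case (Suc n)
  let ?u = "s + real n * h"
  have u: "s \<le> ?u" "?u \<le> s + real (Suc n) * h" and eq: "s + real (Suc n) * h = ?u + h"
    using h by (auto simp: algebra_simps)
  have int: "g integrable_on {a..b}" if "s \<le> a" for a b
    by (intro integrable_continuous_real continuous_on_subset[OF g]) (use that in auto)
  have "integral {s..s + real (Suc n) * h} g = integral {s..?u} g + integral {?u..?u + h} g"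
    using Henstock_Kurzweil_Integration.integral_combine[OF u int] unfolding eq by simp
  moreover have "\<bar>integral {?u..?u + h} g - h * g ?u\<bar> \<le> h * B"
  proof -
    have "norm (integral {?u..?u + h} (\<lambda>x. g x - g ?u)) \<le> integral {?u..?u + h} (\<lambda>x. B)"
    proof (rule integral_norm_bound_integral)
      fix x assume "x \<in> {?u..?u + h}"
      then show "norm (g x - g ?u) \<le> B" using B[of ?u "x - ?u"] u by auto
    qed (use u int in \<open>auto intro!: integrable_diff\<close>)
    moreover have "integral {?u..?u + h} (\<lambda>x. g x - g ?u) = integral {?u..?u + h} g - h * g ?u"
      using h u int by (subst Henstock_Kurzweil_Integration.integral_diff) auto
    ultimately show ?thesis using h by simp
  qed
  ultimately show ?case using Suc.IH by (simp add: algebra_simps)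
qed simp

text \<open>The bound \<open>w\<close> is uniform in the base point: once a cell is so short that
  \<open>w\<close> stays below \<open>e\<close>, the left-endpoint sum is off by at most
  \<open>(b - s) * e\<close>.\<close>

lemma riemann_sum_tendsto:
  fixes g :: "real \<Rightarrow> real"
  assumes g: "continuous_on {s..} g" and st: "s < b"
    and w: "(w \<longlongrightarrow> 0) (at_right 0)"
    and B: "\<And>u v. s \<le> u \<Longrightarrow> 0 \<le> v \<Longrightarrow> \<bar>g (u + v) - g u\<bar> \<le> w v"
  shows "(\<lambda>n. \<Sum>m<Suc n. (b - s) / real (Suc n) * g (s + real m * ((b - s) / real (Suc n))))
    \<longlonglongrightarrow> integral {s..b} g"
proof (rule LIMSEQ_I)
  fix r :: real assume r: "0 < r"
  define e where "e = r / (2 * (b - s))"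
  have e: "e > 0" using r st by (simp add: e_def)
  from order_tendstoD(2)[OF w e] obtain d where
    d: "d > 0" "\<And>h. 0 < h \<Longrightarrow> h < d \<Longrightarrow> w h < e"
    by (auto simp: eventually_at_right_field)
  have "(\<lambda>n. (b - s) / real (Suc n)) \<longlonglongrightarrow> 0" by (intro LIMSEQ_Suc lim_const_over_n)
  from order_tendstoD(2)[OF this d(1)] obtain N where N: "\<And>n. n \<ge> N \<Longrightarrow> (b - s) / real (Suc n) < d"
    by (auto simp: eventually_sequentially)
  show "\<exists>no. \<forall>n\<ge>no. norm ((\<Sum>m<Suc n. (b - s) / real (Suc n) * g (s + real m * ((b - s) / real (Suc n)))) - integral {s..b} g) < r"
  proof (intro exI[of _ N] allI impI)
    fix n assume n: "N \<le> n"
    let ?h = "(b - s) / real (Suc n)"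
    have h: "0 < ?h" "?h < d" using st N[OF n] by auto
    have b: "s + real (Suc n) * ?h = b" by simp
    have "\<bar>g (u + v) - g u\<bar> \<le> e" if "s \<le> u" "0 \<le> v" "v \<le> ?h" for u v
      using that B[of u v] d(2)[of v] h e by (cases "v = 0") auto
    from riemann_sum_error[OF g less_imp_le[OF h(1)] this, of "Suc n"]
    have "\<bar>integral {s..b} g - (\<Sum>m<Suc n. ?h * g (s + real m * ?h))\<bar> \<le> real (Suc n) * ?h * e"
      unfolding b by simp
    also have "real (Suc n) * ?h * e = (b - s) * e" by simp
    also have "c * (r / (2 * c)) = r / 2" if "c \<noteq> 0" for c using that by simp
    from this[of "b - s"] have "(b - s) * e = r / 2" using st unfolding e_def by simp
    finally show "norm ((\<Sum>m<Suc n. ?h * g (s + real m * ?h)) - integral {s..b} g) < r"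
      using r by (simp add: abs_minus_commute)
  qed
qed

lemma (in phase_semigroup) borel_measurable_p_at:
  assumes "g \<in> borel_measurable L" "\<And>x. x \<in> space L \<Longrightarrow> 0 \<le> g x"
  shows "(\<lambda>x. p (g x) u v) \<in> borel_measurable L"
proof -
  have "(\<lambda>t. indicator {0..} t *\<^sub>R p t u v) \<in> borel_measurable borel"
    by (intro borel_measurable_continuous_on_indicator continuous_on_p) auto
  from measurable_compose[OF assms(1) this]
  have "(\<lambda>x. indicator {0..} (g x) *\<^sub>R p (g x) u v) \<in> borel_measurable L" .
  then show ?thesis by (rule measurable_cong[THEN iffD1, rotated]) (use assms(2) in auto)
qed

context phase_process begin

lemma a_nonneg: "0 \<le> a $ i"
proof -
  have "prob {\<omega>\<in>space M. J 0 \<omega> = Some i} = a $ i"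
    using fdd[of "\<lambda>_. 0" 0 "\<lambda>_. Some i"] by simp
  then show ?thesis using measure_nonneg by metis
qed

lemma pi_prob: "0 \<le> s \<Longrightarrow> pi s k = prob {\<omega>\<in>space M. J s \<omega> = Some k}"
  using fdd3[of s 0 0 "Some k" "Some k" "Some k"] by (simp add: p_0 pi_def)

lemma pi_bounds: "0 \<le> s \<Longrightarrow> 0 \<le> pi s k" "0 \<le> s \<Longrightarrow> pi s k \<le> 1"
  by (simp_all add: pi_prob)

lemma pi_0: "pi 0 k = a $ k"
  by (simp add: pi_def p_0 if_distrib cong: if_cong)

definition dens :: "'n \<Rightarrow> 'n \<Rightarrow> real \<Rightarrow> real \<Rightarrow> real" where
  "dens k j s t = pi s k * pp (t - s) k j * exit_rates T $ j"

lemma dens_bounds: "0 \<le> s \<Longrightarrow> s \<le> t \<Longrightarrow> 0 \<le> dens k j s t"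
  "0 \<le> s \<Longrightarrow> s \<le> t \<Longrightarrow> dens k j s t \<le> exit_rates T $ j"
  unfolding dens_def using pi_bounds[of s k] p_nonneg[of "t - s" "Some k" "Some j"]
    p_le_1[of "t - s" "Some k" "Some j"] exit_nonneg[of j]
  by (auto intro!: mult_nonneg_nonneg mult_left_le_one_le mult_le_one)

text \<open>Exits are detected on a partition of \<open>{s..b}\<close>: \<open>E n m\<close> asks
  for phase \<open>j\<close> at the left end of cell \<open>m\<close> and absorption at its right
  end. Almost surely at most one cell qualifies, so the counts \<open>S n\<close> are bounded by 1
  and converge to the indicator of the event. Their expectations are Riemann sums times
  \<open>p (h n) (Some j) None / h n\<close>, which tends to the exit rate.\<close>

lemma lifetime_cdf:
  assumes s: "0 \<le> s" "s < b"
  shows "prob {\<omega>\<in>space M. J s \<omega> = Some k \<and> last_phase J \<omega> = Some j \<and> s < lifetime J \<omega> \<and> lifetime J \<omega> \<le> b} =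
    integral {s..b} (\<lambda>t. dens k j s t)"
proof -
  define h where "h n = (b - s) / real (Suc n)" for n
  have h: "h n > 0" "real (Suc n) * h n = b - s" for n using s by (auto simp: h_def)
  define E where "E n m = {\<omega>\<in>space M. J s \<omega> = Some k \<and> J (s + real m * h n) \<omega> = Some j \<and>
    J (s + real m * h n + h n) \<omega> = None}" for n m
  have E_eq: "E n m = {\<omega>\<in>space M. J s \<omega> = Some k} \<inter> {\<omega>\<in>space M. J (s + real m * h n) \<omega> = Some j} \<inter>
      {\<omega>\<in>space M. J (s + real m * h n + h n) \<omega> = None}" for n m
    unfolding E_def by auto
  have [measurable]: "E n m \<in> sets M" for n m
    using s h(1)[of n] unfolding E_eq by (intro sets.Int J_meas_set) (auto intro!: add_nonneg_nonneg)
  define A where "A = {\<omega>\<in>space M. J s \<omega> = Some k \<and> last_phase J \<omega> = Some j \<and> s < lifetime J \<omega> \<and> lifetime J \<omega> \<le> b}"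
  have A_eq: "A = {\<omega>\<in>space M. J s \<omega> = Some k} \<inter> {\<omega>\<in>space M. last_phase J \<omega> = Some j} \<inter>
      {\<omega>\<in>space M. s < lifetime J \<omega> \<and> lifetime J \<omega> \<le> b}" by (auto simp: A_def)
  have [measurable]: "A \<in> sets M" unfolding A_eq using s(1) by measurable
  define S where "S n \<omega> = (\<Sum>m<Suc n. indicator (E n m) \<omega> :: real)" for n \<omega>
  have S_single: "\<exists>m0 < Suc n. s + real m0 * h n < lifetime J \<omega> \<and> lifetime J \<omega> \<le> s + real m0 * h n + h n \<and> S n \<omega> = indicator (E n m0) \<omega>"
    if \<omega>: "\<omega> \<in> space M" "good \<omega>" and l: "s < lifetime J \<omega>" "lifetime J \<omega> \<le> b" for \<omega> n
  proof -
    \<comment> \<open>Index of the cell containing the lifetime. Cells are open on the left and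
      closed on the right, since \<open>J\<close> is already absorbed at its lifetime; hence the
      ceiling minus one.\<close>
    define m0 where "m0 = nat (\<lceil>(lifetime J \<omega> - s) / h n\<rceil> - 1)"
    have "0 < (lifetime J \<omega> - s) / h n" using l h(1)[of n] by simp
    then have "\<lceil>(lifetime J \<omega> - s) / h n\<rceil> \<ge> 1" by linarith
    then have m0': "real m0 = of_int \<lceil>(lifetime J \<omega> - s) / h n\<rceil> - 1" by (simp add: m0_def of_nat_nat)
    then have "real m0 < (lifetime J \<omega> - s) / h n" "(lifetime J \<omega> - s) / h n \<le> real m0 + 1" by linarith+
    then have m0: "s + real m0 * h n < lifetime J \<omega>" "lifetime J \<omega> \<le> s + real m0 * h n + h n"
      using h(1)[of n] by (simp_all add: field_simps)
    have "real m0 * h n < real (Suc n) * h n" using m0(1) l h(2)[of n] by simp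
    then have lt: "m0 < Suc n" using h(1)[of n] by (simp add: mult_less_cancel_right)
    have "\<omega> \<notin> E n m" if "m \<noteq> m0" for m
    proof
      assume "\<omega> \<in> E n m"
      then have "\<not> lifetime J \<omega> \<le> s + real m * h n" "lifetime J \<omega> \<le> s + real m * h n + h n"
        using good_facts(2)[OF \<omega>, of "s + real m * h n"] good_facts(2)[OF \<omega>, of "s + real m * h n + h n"]
          s h(1)[of n] by (auto simp: E_def)
      then have "real m0 * h n < (real m + 1) * h n" "real m * h n < (real m0 + 1) * h n"
        using m0 by (auto simp: algebra_simps)
      then have "real m0 < real m + 1" "real m < real m0 + 1"
        using h(1)[of n] by (auto simp: mult_less_cancel_right)
      then show False using that by linarith
    qed
    then have "S n \<omega> = (\<Sum>m<Suc n. if m = m0 then indicator (E n m0) \<omega> else 0)"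
      unfolding S_def by (intro sum.cong) auto
    then show ?thesis using lt m0 by (auto intro!: exI[of _ m0])
  qed
  have S_zero: "S n \<omega> = 0" if \<omega>: "\<omega> \<in> space M" "good \<omega>" and l: "\<not> (s < lifetime J \<omega> \<and> lifetime J \<omega> \<le> b)" for \<omega> n
  proof -
    have "\<omega> \<notin> E n m" if "m < Suc n" for m
    proof
      assume "\<omega> \<in> E n m"
      then have "\<not> lifetime J \<omega> \<le> s + real m * h n" "lifetime J \<omega> \<le> s + real m * h n + h n" "\<not> lifetime J \<omega> \<le> s"
        using good_facts(2)[OF \<omega>, of "s + real m * h n"] good_facts(2)[OF \<omega>, of "s + real m * h n + h n"]
          good_facts(2)[OF \<omega>, of s] s h(1)[of n] by (auto simp: E_def)
      moreover have "real (Suc m) * h n \<le> real (Suc n) * h n" using that h(1)[of n] by (intro mult_right_mono) auto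
      moreover have "real (Suc m) * h n = real m * h n + h n" by (simp add: algebra_simps)
      ultimately show False using l h(2)[of n] by linarith
    qed
    then show ?thesis by (auto simp: S_def)
  qed
  have lim: "(\<lambda>n. S n \<omega>) \<longlonglongrightarrow> indicator A \<omega>" if \<omega>: "\<omega> \<in> space M" "good \<omega>" for \<omega>
  proof (cases "s < lifetime J \<omega> \<and> lifetime J \<omega> \<le> b")
    case True
    from last_phase_left[OF \<omega>(1) good_facts(1)[OF \<omega>]] obtain d where d: "d < lifetime J \<omega>"
      "\<And>u. d < u \<Longrightarrow> u < lifetime J \<omega> \<Longrightarrow> J u \<omega> = last_phase J \<omega>"
      by (auto simp: eventually_at_left_field)
    \<comment> \<open>Once the mesh is below the length of the final stretch on which
      \<open>J\<close> is constant, the left end of the exit cell lies in that stretch and shows the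
      last phase.\<close>
    have "h \<longlonglongrightarrow> 0" unfolding h_def by (intro LIMSEQ_Suc lim_const_over_n)
    then have "\<forall>\<^sub>F n in sequentially. h n < lifetime J \<omega> - d" using d(1) by (intro order_tendstoD) auto
    then have "\<forall>\<^sub>F n in sequentially. S n \<omega> = indicator A \<omega>"
    proof eventually_elim
      case (elim n)
      from S_single[OF \<omega>, of n] True obtain m0 where m0: "s + real m0 * h n < lifetime J \<omega>"
        "lifetime J \<omega> \<le> s + real m0 * h n + h n" "S n \<omega> = indicator (E n m0) \<omega>" by auto
      have "J (s + real m0 * h n) \<omega> = last_phase J \<omega>" using d(2) m0 elim by simp
      moreover have "J (s + real m0 * h n + h n) \<omega> = None"
        using good_facts(2)[OF \<omega>, of "s + real m0 * h n + h n"] m0 s h(1)[of n] by auto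
      ultimately show ?case using m0(3) True \<omega> by (auto simp: E_def A_def indicator_def)
    qed
    then show ?thesis by (rule tendsto_eventually)
  next
    case False
    then show ?thesis using S_zero[OF \<omega> False] by (auto simp: A_def)
  qed
  have "(\<lambda>n. \<integral>\<omega>. S n \<omega> \<partial>M) \<longlonglongrightarrow> (\<integral>\<omega>. indicator A \<omega> \<partial>M)"
  proof (rule integral_dominated_convergence[where w="\<lambda>_. 1"])
    show "AE \<omega> in M. (\<lambda>n. S n \<omega>) \<longlonglongrightarrow> indicator A \<omega>" using AE_good AE_space by eventually_elim (rule lim)
    show "AE \<omega> in M. norm (S n \<omega>) \<le> 1" for n
      using AE_good AE_space
    proof eventually_elim
      case (elim \<omega>)
      then show ?case using S_single[of \<omega> n] S_zero[of \<omega> n] by (cases "s < lifetime J \<omega> \<and> lifetime J \<omega> \<le> b") (auto simp: indicator_def)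
    qed
  qed (auto simp: S_def)
  moreover have "(\<integral>\<omega>. indicator A \<omega> \<partial>M) = prob A" by simp
  moreover have "(\<integral>\<omega>. S n \<omega> \<partial>M) = pi s k * (p (h n) (Some j) None / h n) * (\<Sum>m<Suc n. h n * pp (real m * h n) k j)" for n
  proof -
    have "(\<integral>\<omega>. S n \<omega> \<partial>M) = (\<Sum>m<Suc n. prob (E n m))"
      unfolding S_def by (subst Bochner_Integration.integral_sum)
        (auto simp del: sum.lessThan_Suc simp: less_top[symmetric] intro!: integrable_real_indicator)
    also have "\<dots> = (\<Sum>m<Suc n. pi s k * pp (real m * h n) k j * p (h n) (Some j) None)"
      unfolding E_def pi_def using s h(1)[of n] by (intro sum.cong refl fdd3) auto
    also have "\<dots> = pi s k * (p (h n) (Some j) None / h n) * (\<Sum>m<Suc n. h n * pp (real m * h n) k j)"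
      using h(1)[of n] by (simp add: sum_distrib_left field_simps)
    finally show ?thesis .
  qed
  ultimately have "(\<lambda>n. pi s k * (p (h n) (Some j) None / h n) * (\<Sum>m<Suc n. h n * pp (real m * h n) k j)) \<longlonglongrightarrow> prob A"
    by simp
  moreover have "(\<lambda>n. pi s k * (p (h n) (Some j) None / h n) * (\<Sum>m<Suc n. h n * pp (real m * h n) k j)) \<longlonglongrightarrow>
    pi s k * exit_rates T $ j * integral {s..b} (\<lambda>t. pp (t - s) k j)"
  proof (intro tendsto_mult tendsto_const)
    show "(\<lambda>n. p (h n) (Some j) None / h n) \<longlonglongrightarrow> exit_rates T $ j"
      unfolding h_def using s by (intro filterlim_compose[OF exit_limit filterlim_divide_Suc]) auto
    have "(\<lambda>n. \<Sum>m<Suc n. h n * pp (s + real m * h n - s) k j) \<longlonglongrightarrow> integral {s..b} (\<lambda>t. pp (t - s) k j)"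
      unfolding h_def
    proof (rule riemann_sum_tendsto[OF _ s(2) modulus_tendsto])
      show "continuous_on {s..} (\<lambda>t. pp (t - s) k j)"
        by (intro continuous_on_compose2[OF continuous_on_p]) (auto intro!: continuous_intros)
      fix u v :: real assume "s \<le> u" "0 \<le> v"
      then show "\<bar>pp (u + v - s) k j - pp (u - s) k j\<bar> \<le> modulus v"
        using p_modulus[of "u - s" v "Some k" "Some j"] by (simp add: algebra_simps)
    qed
    then show "(\<lambda>n. \<Sum>m<Suc n. h n * pp (real m * h n) k j) \<longlonglongrightarrow> integral {s..b} (\<lambda>t. pp (t - s) k j)" by simp
  qed
  ultimately have "prob A = pi s k * exit_rates T $ j * integral {s..b} (\<lambda>t. pp (t - s) k j)"
    by (rule LIMSEQ_unique)
  then show ?thesis unfolding A_def[symmetric] dens_def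
    by (simp add: mult.commute mult.left_commute)
qed

lemma borel_measurable_dens_fixed:
  assumes "0 \<le> s" shows "(\<lambda>t. indicator {s<..} t * ennreal (dens k j s t)) \<in> borel_measurable borel"
proof -
  have "continuous_on {s<..} (\<lambda>t. dens k j s t)"
    unfolding dens_def
    by (intro continuous_intros continuous_on_compose2[OF continuous_on_p]) auto
  then have "(\<lambda>t. indicator {s<..} t *\<^sub>R dens k j s t) \<in> borel_measurable borel"
    by (intro borel_measurable_continuous_on_indicator) auto
  then have "(\<lambda>t. ennreal (indicator {s<..} t *\<^sub>R dens k j s t)) \<in> borel_measurable borel" by measurable
  also have "(\<lambda>t. ennreal (indicator {s<..} t *\<^sub>R dens k j s t)) = (\<lambda>t. indicator {s<..} t * ennreal (dens k j s t))"
    by (auto simp: indicator_def)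
  finally show ?thesis .
qed

text \<open>Both sides integrate \<open>H\<close> against a finite measure in the time variable, and
  \<open>lifetime_cdf\<close> says that these two measures agree on all half-lines.\<close>

lemma phase_integral_fixed:
  assumes s: "0 \<le> s" and H: "H \<in> borel_measurable borel"
  shows "(\<integral>\<^sup>+\<omega>. H (lifetime J \<omega>) * indicator {\<omega>. J s \<omega> = Some k \<and> last_phase J \<omega> = Some j \<and> s < lifetime J \<omega>} \<omega> \<partial>M) =
    (\<integral>\<^sup>+t. H t * (indicator {s<..} t * ennreal (dens k j s t)) \<partial>lborel)"
proof -
  define E where "E = {\<omega>\<in>space M. J s \<omega> = Some k \<and> last_phase J \<omega> = Some j \<and> s < lifetime J \<omega>}"
  have E_eq: "E = {\<omega>\<in>space M. J s \<omega> = Some k} \<inter> {\<omega>\<in>space M. last_phase J \<omega> = Some j} \<inter>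
      {\<omega>\<in>space M. s < lifetime J \<omega>}" by (auto simp: E_def)
  have [measurable]: "E \<in> sets M" unfolding E_eq using s by measurable
  note [measurable] = H borel_measurable_dens_fixed[OF s]
  define \<mu> where "\<mu> = distr (density M (indicator E)) borel (lifetime J)"
  define \<nu> where "\<nu> = density lborel (\<lambda>t. indicator {s<..} t * ennreal (dens k j s t))"
  have eq: "emeasure \<mu> {..b} = emeasure \<nu> {..b}" for b
  proof -
    have 1: "emeasure \<mu> {..b} = emeasure M {\<omega>\<in>space M. J s \<omega> = Some k \<and> last_phase J \<omega> = Some j \<and> s < lifetime J \<omega> \<and> lifetime J \<omega> \<le> b}"
    proof -
      have "emeasure \<mu> {..b} = emeasure (density M (indicator E)) {\<omega>\<in>space M. lifetime J \<omega> \<le> b}"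
        unfolding \<mu>_def by (subst emeasure_distr) (auto intro!: arg_cong[where f="emeasure _"])
      also have "\<dots> = emeasure M (E \<inter> {\<omega>\<in>space M. lifetime J \<omega> \<le> b})"
        by (subst emeasure_density) (auto simp: indicator_inter_arith[symmetric])
      also have "E \<inter> {\<omega>\<in>space M. lifetime J \<omega> \<le> b} = {\<omega>\<in>space M. J s \<omega> = Some k \<and> last_phase J \<omega> = Some j \<and> s < lifetime J \<omega> \<and> lifetime J \<omega> \<le> b}"
        by (auto simp: E_def)
      finally show ?thesis .
    qed
    have 2: "emeasure \<nu> {..b} = (\<integral>\<^sup>+t. indicator {s<..} t * ennreal (dens k j s t) * indicator {..b} t \<partial>lborel)"
      unfolding \<nu>_def by (subst emeasure_density) auto
    show ?thesis
    proof (cases "s < b")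
      case True
      define f where "f t = (if t \<in> {s..b} then dens k j s t else 0)" for t
      have cont: "continuous_on {s..b} (\<lambda>t. dens k j s t)"
        unfolding dens_def using s
        by (intro continuous_intros continuous_on_compose2[OF continuous_on_p]) auto
      have f0: "0 \<le> f t" for t using dens_bounds(1)[OF s, of t] by (auto simp: f_def)
      have "f = (\<lambda>t. indicator {s..b} t *\<^sub>R dens k j s t)" by (auto simp: f_def)
      moreover have "(\<lambda>t. indicator {s..b} t *\<^sub>R dens k j s t) \<in> borel_measurable borel"
        by (intro borel_measurable_continuous_on_indicator cont) auto
      ultimately have fm: "f \<in> borel_measurable borel" by simp
      have "((\<lambda>t. dens k j s t) has_integral integral {s..b} (dens k j s)) {s..b}"
        using integrable_continuous_real[OF cont] by (simp add: has_integral_integral)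
      then have "(f has_integral integral {s..b} (dens k j s)) UNIV"
        unfolding f_def by (simp only: has_integral_restrict_UNIV)
      from nn_integral_has_integral_lborel[OF fm f0 this]
      have "(\<integral>\<^sup>+t. f t \<partial>lborel) = ennreal (integral {s..b} (dens k j s))" .
      moreover have "(\<integral>\<^sup>+t. indicator {s<..} t * ennreal (dens k j s t) * indicator {..b} t \<partial>lborel) = (\<integral>\<^sup>+t. f t \<partial>lborel)"
        using AE_lborel_singleton[of s] by (intro nn_integral_cong_AE) (auto simp: f_def indicator_def)
      ultimately show ?thesis unfolding 1 2 using lifetime_cdf[OF s True, of k j] by (simp add: emeasure_eq_measure)
    next
      case False
      then have e: "{\<omega>\<in>space M. J s \<omega> = Some k \<and> last_phase J \<omega> = Some j \<and> s < lifetime J \<omega> \<and> lifetime J \<omega> \<le> b} = {}" by auto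
      have z: "(\<lambda>t. indicator {s<..} t * ennreal (dens k j s t) * indicator {..b} t) = (\<lambda>_. 0)"
        using False by (auto simp: indicator_def)
      show ?thesis unfolding 1 2 e z by simp
    qed
  qed
  have "\<mu> = \<nu>"
  proof (rule measure_eqI_generator_eq[where \<Omega>=UNIV and E="range atMost" and A="\<lambda>i. {..real i}"])
    show "Int_stable (range (atMost :: real \<Rightarrow> _))" by (auto simp: Int_stable_def)
    show "sets \<mu> = sigma_sets UNIV (range atMost)" "sets \<nu> = sigma_sets UNIV (range atMost)"
      by (simp_all add: \<mu>_def \<nu>_def) (subst borel_eq_atMost, simp)+
    show "(\<Union>i. {..real i}) = UNIV" by (auto intro: real_arch_simple)
    show "emeasure \<mu> {..real i} \<noteq> \<infinity>" for i
    proof -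
      have "emeasure \<mu> {..real i} \<le> emeasure \<mu> (space \<mu>)" by (rule emeasure_space)
      also have "\<dots> = emeasure M E"
        unfolding \<mu>_def using emeasure_density[of "indicator E" M "space M"]
        by (subst emeasure_distr) (auto simp: indicator_inter_arith[symmetric])
      finally show ?thesis using emeasure_finite[of E] by (auto simp: top_unique)
    qed
  qed (auto simp: eq)
  then have "(\<integral>\<^sup>+t. H t \<partial>\<mu>) = (\<integral>\<^sup>+t. H t \<partial>\<nu>)" by simp
  also have "(\<integral>\<^sup>+t. H t \<partial>\<mu>) = (\<integral>\<^sup>+\<omega>. indicator E \<omega> * H (lifetime J \<omega>) \<partial>M)"
    unfolding \<mu>_def by (subst nn_integral_distr) (simp_all add: nn_integral_density)
  also have "\<dots> = (\<integral>\<^sup>+\<omega>. H (lifetime J \<omega>) * indicator {\<omega>. J s \<omega> = Some k \<and> last_phase J \<omega> = Some j \<and> s < lifetime J \<omega>} \<omega> \<partial>M)"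
    by (intro nn_integral_cong) (auto simp: E_def indicator_def)
  also have "(\<integral>\<^sup>+t. H t \<partial>\<nu>) = (\<integral>\<^sup>+t. H t * (indicator {s<..} t * ennreal (dens k j s t)) \<partial>lborel)"
    unfolding \<nu>_def by (subst nn_integral_density) (auto simp: mult.commute)
  finally show ?thesis .
qed

lemma borel_measurable_dens:
  assumes "g \<in> borel_measurable L" "f \<in> borel_measurable L" "\<And>x. x \<in> space L \<Longrightarrow> 0 \<le> g x \<and> g x \<le> f x"
  shows "(\<lambda>x. dens k j (g x) (f x)) \<in> borel_measurable L"
  unfolding dens_def pi_def
  by (intro borel_measurable_times borel_measurable_sum borel_measurable_const borel_measurable_p_at
      borel_measurable_diff assms) (use assms(3) in auto)

text \<open>A dyadic function of the lifetime has countably many values \<open>s m\<close>. On each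
  of them the observation time is deterministic, and the restriction to lifetimes with that value is
  absorbed into \<open>H\<close>.\<close>

lemma phase_integral_dyadic:
  assumes g: "g \<in> borel_measurable borel" "\<And>t. 0 \<le> t \<Longrightarrow> 0 \<le> g t" and H: "H \<in> borel_measurable borel"
  shows "(\<integral>\<^sup>+\<omega>. H (lifetime J \<omega>) * indicator {\<omega>. J (dyadic_above n (g (lifetime J \<omega>))) \<omega> = Some k \<and>
      last_phase J \<omega> = Some j \<and> dyadic_above n (g (lifetime J \<omega>)) < lifetime J \<omega>} \<omega> \<partial>M) =
    (\<integral>\<^sup>+t. H t * (indicator {t. dyadic_above n (g t) < t} t * ennreal (dens k j (dyadic_above n (g t)) t)) \<partial>lborel)"
proof -
  define m0 where "m0 t = nat \<lfloor>g t * 2 ^ n\<rfloor>" for t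
  define s where "s m = real (Suc m) / 2 ^ n" for m
  have s0: "0 \<le> s m" for m by (simp add: s_def)
  have dy: "dyadic_above n (g t) = s (m0 t)" for t by (simp add: dyadic_above_def s_def m0_def)
  have [measurable]: "m0 \<in> borel \<rightarrow>\<^sub>M count_space UNIV" unfolding m0_def using g(1) by measurable
  note [measurable] = H
  have [measurable]: "{\<omega>\<in>space M. J (s m) \<omega> = Some k} \<in> sets M" for m by (rule J_meas_set[OF s0])
  have sum1: "(\<Sum>m. (if m = i then f m else 0)) = f i" for f :: "nat \<Rightarrow> ennreal" and i
    using sums_unique[OF sums_single[where f=f and i=i]] by simp
  have "(\<integral>\<^sup>+\<omega>. H (lifetime J \<omega>) * indicator {\<omega>. J (dyadic_above n (g (lifetime J \<omega>))) \<omega> = Some k \<and>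
      last_phase J \<omega> = Some j \<and> dyadic_above n (g (lifetime J \<omega>)) < lifetime J \<omega>} \<omega> \<partial>M) =
    (\<integral>\<^sup>+\<omega>. (\<Sum>m. (if m = m0 (lifetime J \<omega>) then H (lifetime J \<omega>) * indicator {\<omega>. J (s m) \<omega> = Some k \<and>
      last_phase J \<omega> = Some j \<and> s m < lifetime J \<omega>} \<omega> else 0)) \<partial>M)"
    unfolding sum1 dy by (simp add: indicator_def)
  also have "\<dots> = (\<integral>\<^sup>+\<omega>. (\<Sum>m. (if m = m0 (lifetime J \<omega>) then H (lifetime J \<omega>) else 0) * indicator {\<omega>. J (s m) \<omega> = Some k \<and>
      last_phase J \<omega> = Some j \<and> s m < lifetime J \<omega>} \<omega>) \<partial>M)"
    by (intro nn_integral_cong suminf_cong) auto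
  also have "\<dots> = (\<Sum>m. \<integral>\<^sup>+\<omega>. (if m = m0 (lifetime J \<omega>) then H (lifetime J \<omega>) else 0) * indicator {\<omega>. J (s m) \<omega> = Some k \<and>
      last_phase J \<omega> = Some j \<and> s m < lifetime J \<omega>} \<omega> \<partial>M)"
  proof (rule nn_integral_suminf)
    fix m
    have "{\<omega>\<in>space M. J (s m) \<omega> = Some k} \<inter> {\<omega>\<in>space M. last_phase J \<omega> = Some j} \<inter> {\<omega>\<in>space M. s m < lifetime J \<omega>} \<in> sets M"
      by measurable
    also have "{\<omega>\<in>space M. J (s m) \<omega> = Some k} \<inter> {\<omega>\<in>space M. last_phase J \<omega> = Some j} \<inter> {\<omega>\<in>space M. s m < lifetime J \<omega>} =
      {\<omega>\<in>space M. J (s m) \<omega> = Some k \<and> last_phase J \<omega> = Some j \<and> s m < lifetime J \<omega>}" by auto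
    finally have "(\<lambda>\<omega>. indicator {\<omega>. J (s m) \<omega> = Some k \<and> last_phase J \<omega> = Some j \<and> s m < lifetime J \<omega>} \<omega> :: ennreal) \<in> borel_measurable M"
      by (intro borel_measurable_indicator') auto
    then show "(\<lambda>\<omega>. (if m = m0 (lifetime J \<omega>) then H (lifetime J \<omega>) else 0) * indicator {\<omega>. J (s m) \<omega> = Some k \<and>
      last_phase J \<omega> = Some j \<and> s m < lifetime J \<omega>} \<omega>) \<in> borel_measurable M" by measurable
  qed
  also have "\<dots> = (\<Sum>m. \<integral>\<^sup>+t. (if m = m0 t then H t else 0) * (indicator {s m<..} t * ennreal (dens k j (s m) t)) \<partial>lborel)"
  proof (rule suminf_cong)
    fix m
    have "(\<lambda>t. if m = m0 t then H t else 0) \<in> borel_measurable borel" by measurable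
    from phase_integral_fixed[OF s0 this, of m k j]
    show "(\<integral>\<^sup>+\<omega>. (if m = m0 (lifetime J \<omega>) then H (lifetime J \<omega>) else 0) * indicator {\<omega>. J (s m) \<omega> = Some k \<and>
      last_phase J \<omega> = Some j \<and> s m < lifetime J \<omega>} \<omega> \<partial>M) = (\<integral>\<^sup>+t. (if m = m0 t then H t else 0) * (indicator {s m<..} t * ennreal (dens k j (s m) t)) \<partial>lborel)" .
  qed
  also have "\<dots> = (\<integral>\<^sup>+t. (\<Sum>m. (if m = m0 t then H t else 0) * (indicator {s m<..} t * ennreal (dens k j (s m) t))) \<partial>lborel)"
  proof (rule nn_integral_suminf[symmetric])
    fix m
    note [measurable] = borel_measurable_dens_fixed[OF s0, of m k j]
    show "(\<lambda>t. (if m = m0 t then H t else 0) * (indicator {s m<..} t * ennreal (dens k j (s m) t))) \<in> borel_measurable lborel"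
      by measurable
  qed
  also have "\<dots> = (\<integral>\<^sup>+t. (\<Sum>m. (if m = m0 t then H t * (indicator {s m<..} t * ennreal (dens k j (s m) t)) else 0)) \<partial>lborel)"
    by (intro nn_integral_cong suminf_cong) auto
  also have "\<dots> = (\<integral>\<^sup>+t. H t * (indicator {t. dyadic_above n (g t) < t} t * ennreal (dens k j (dyadic_above n (g t)) t)) \<partial>lborel)"
    unfolding sum1 dy by (simp add: indicator_def)
  finally show ?thesis .
qed

text \<open>Approximating \<open>g\<close> strictly from above makes both sides converge, as
  \<open>J\<close> is right constant and the density is continuous in the observation time.
  Strictness loses the event that \<open>g\<close> equals the lifetime, which is treated separately.
  The support in \<open>{0..b}\<close> supplies an integrable majorant on the Lebesgue side.\<close>

lemma phase_integral_before_end: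
  assumes g: "g \<in> borel_measurable borel" "\<And>t. 0 \<le> t \<Longrightarrow> 0 \<le> g t \<and> g t \<le> t"
    and H: "H \<in> borel_measurable borel" "\<And>t. H t \<le> indicator {0..b} t"
  shows "(\<integral>\<^sup>+\<omega>. H (lifetime J \<omega>) * indicator {\<omega>. J (g (lifetime J \<omega>)) \<omega> = Some k \<and>
      last_phase J \<omega> = Some j \<and> g (lifetime J \<omega>) < lifetime J \<omega>} \<omega> \<partial>M) =
    (\<integral>\<^sup>+t. H t * (indicator {t. g t < t} t * ennreal (dens k j (g t) t)) \<partial>lborel)"
proof -
  note [measurable] = H(1) g(1)
  define U where "U g \<omega> = H (lifetime J \<omega>) * indicator {\<omega>. J (g (lifetime J \<omega>)) \<omega> = Some k \<and>
      last_phase J \<omega> = Some j \<and> g (lifetime J \<omega>) < lifetime J \<omega>} \<omega>" for g \<omega>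
  define V where "V g t = H t * (indicator {t. g t < t} t * ennreal (dens k j (g t) t))" for g t
  have H1: "H t \<le> 1" for t by (rule order_trans[OF H(2)]) (simp split: split_indicator)
  have H0: "t < 0 \<Longrightarrow> H t = 0" "b < t \<Longrightarrow> H t = 0" for t
    using H(2)[of t] by (auto simp: indicator_def split: if_splits)
  have Hfin: "H t < top" for t using H1[of t] by (metis ennreal_one_less_top order_le_less_trans)
  have [measurable]: "dyadic_above n \<in> borel_measurable borel" for n
    unfolding dyadic_above_def by measurable
  have U_meas: "U f \<in> borel_measurable M" if [measurable]: "f \<in> borel_measurable borel" and f0: "\<And>t. 0 \<le> t \<Longrightarrow> 0 \<le> f t" for f
  proof -
    have [measurable]: "(\<lambda>\<omega>. J (f (lifetime J \<omega>)) \<omega>) \<in> M \<rightarrow>\<^sub>M count_space UNIV"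
      by (intro measurable_J_at) (auto intro: f0 lifetime_nonneg)
    have "{\<omega>\<in>space M. J (f (lifetime J \<omega>)) \<omega> = Some k \<and> last_phase J \<omega> = Some j \<and> f (lifetime J \<omega>) < lifetime J \<omega>} \<in> sets M"
      by measurable
    then have "(\<lambda>\<omega>. indicator {\<omega>. J (f (lifetime J \<omega>)) \<omega> = Some k \<and> last_phase J \<omega> = Some j \<and> f (lifetime J \<omega>) < lifetime J \<omega>} \<omega> :: ennreal) \<in> borel_measurable M"
      by (intro borel_measurable_indicator') auto
    then show ?thesis unfolding U_def by measurable
  qed
  have dyn: "0 \<le> dyadic_above n (g t)" for n t by (simp add: dyadic_above_def)
  have V_meas: "V f \<in> borel_measurable borel" if [measurable]: "f \<in> borel_measurable borel" and f0: "\<And>t. 0 \<le> t \<Longrightarrow> 0 \<le> f t" for f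
  proof -
    \<comment> \<open>Clipping enforces the bounds under which \<open>dens\<close> is measurable;
      nothing changes where \<open>H\<close> and the indicator are nonzero.\<close>
    have [measurable]: "(\<lambda>t. dens k j (min (max 0 (f t)) (max 0 t)) (max 0 t)) \<in> borel_measurable borel"
      by (rule borel_measurable_dens) auto
    have eq: "V f t = H t * (indicator {t. f t < t} t * ennreal (dens k j (min (max 0 (f t)) (max 0 t)) (max 0 t)))" for t
      using H0(1)[of t] f0[of t] by (cases "t < 0") (auto simp: V_def indicator_def max_def min_def)
    show ?thesis unfolding eq by measurable
  qed
  have g0: "0 \<le> g t" if "0 \<le> t" for t using g(2)[OF that] by simp
  have LU: "(\<lambda>n. U (\<lambda>t. dyadic_above n (g t)) \<omega>) \<longlonglongrightarrow> U g \<omega>" if "\<omega> \<in> space M" for \<omega>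
  proof (rule tendsto_eventually)
    let ?g = "g (lifetime J \<omega>)"
    have g0': "0 \<le> ?g" by (intro g0 lifetime_nonneg)
    \<comment> \<open>The strict inequality is stable in both directions: if it holds it persists a
      little to the right of \<open>?g\<close>, and if it fails it fails for every larger
      point.\<close>
    have "\<forall>\<^sub>F n in sequentially. (dyadic_above n ?g < lifetime J \<omega>) = (?g < lifetime J \<omega>)"
    proof (cases "?g < lifetime J \<omega>")
      case True
      then have "\<forall>\<^sub>F s in at_right ?g. s < lifetime J \<omega>"
        by (auto simp: eventually_at_right_field)
      from eventually_compose_filterlim[OF this filterlim_dyadic_above[OF g0']] show ?thesis using True by simp
    next
      case False
      then have "\<not> dyadic_above n ?g < lifetime J \<omega>" for n using dyadic_above_bounds(1)[OF g0', of n] by linarith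
      then show ?thesis using False by simp
    qed
    with J_dyadic[OF that g0'] show "\<forall>\<^sub>F n in sequentially. U (\<lambda>t. dyadic_above n (g t)) \<omega> = U g \<omega>"
      by eventually_elim (simp add: U_def indicator_def)
  qed
  have LV: "(\<lambda>n. V (\<lambda>t. dyadic_above n (g t)) t) \<longlonglongrightarrow> V g t" for t
  proof (cases "0 \<le> t \<and> g t < t")
    case True
    then have gt: "0 \<le> g t" "g t < t" using g0 by auto
    have c: "continuous_on {0..t} (\<lambda>s. dens k j s t)"
      unfolding dens_def pi_def
      by (intro continuous_intros continuous_on_compose2[OF continuous_on_p]) auto
    have lim: "(\<lambda>n. dyadic_above n (g t)) \<longlonglongrightarrow> g t"
      using filterlim_dyadic_above[OF gt(1)] by (simp add: filterlim_at)
    have ev: "\<forall>\<^sub>F n in sequentially. dyadic_above n (g t) < t"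
      using lim gt(2) by (rule order_tendstoD)
    have "(\<lambda>n. dens k j (dyadic_above n (g t)) t) \<longlonglongrightarrow> dens k j (g t) t"
      using ev gt by (intro continuous_on_tendsto_compose[OF c lim]) (auto elim!: eventually_mono simp: dyn)
    then have "(\<lambda>n. H t * ennreal (dens k j (dyadic_above n (g t)) t)) \<longlonglongrightarrow> H t * ennreal (dens k j (g t) t)"
      by (intro ennreal_tendsto_cmult Hfin tendsto_ennrealI)
    moreover have "V g t = H t * ennreal (dens k j (g t) t)" using gt by (simp add: V_def)
    moreover have "\<forall>\<^sub>F n in sequentially. H t * ennreal (dens k j (dyadic_above n (g t)) t) = V (\<lambda>t. dyadic_above n (g t)) t"
      using ev by eventually_elim (simp add: V_def)
    ultimately show ?thesis using Lim_transform_eventually by fastforce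
  next
    case False
    have "V g t = 0 \<and> (\<forall>n. V (\<lambda>t. dyadic_above n (g t)) t = 0)"
    proof (cases "0 \<le> t")
      case True
      then have "\<not> dyadic_above n (g t) < t" for n using False dyadic_above_bounds(1)[OF g0[OF True], of n] by linarith
      then show ?thesis using False True by (simp add: V_def)
    qed (simp add: V_def H0)
    then show ?thesis by simp
  qed
  have L1: "(\<lambda>n. \<integral>\<^sup>+\<omega>. U (\<lambda>t. dyadic_above n (g t)) \<omega> \<partial>M) \<longlonglongrightarrow> (\<integral>\<^sup>+\<omega>. U g \<omega> \<partial>M)"
  proof (rule nn_integral_dominated_convergence[where w="\<lambda>_. 1"])
    show "AE \<omega> in M. U (\<lambda>t. dyadic_above n (g t)) \<omega> \<le> 1" for n
      using H1 by (auto simp: U_def indicator_def)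
    show "AE \<omega> in M. (\<lambda>n. U (\<lambda>t. dyadic_above n (g t)) \<omega>) \<longlonglongrightarrow> U g \<omega>" using LU by (intro AE_I2) auto
  qed (auto simp: emeasure_space_1 intro!: U_meas g0 simp: dyn)
  have L2: "(\<lambda>n. \<integral>\<^sup>+t. V (\<lambda>t. dyadic_above n (g t)) t \<partial>lborel) \<longlonglongrightarrow> (\<integral>\<^sup>+t. V g t \<partial>lborel)"
  proof (rule nn_integral_dominated_convergence[where w="\<lambda>t. ennreal (exit_rates T $ j) * indicator {0..b} t"])
    show "AE t in lborel. V (\<lambda>t. dyadic_above n (g t)) t \<le> ennreal (exit_rates T $ j) * indicator {0..b} t" for n
    proof (rule AE_I2)
      fix t
      show "V (\<lambda>t. dyadic_above n (g t)) t \<le> ennreal (exit_rates T $ j) * indicator {0..b} t"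
      proof (cases "dyadic_above n (g t) < t")
        case True
        then have "ennreal (dens k j (dyadic_above n (g t)) t) \<le> ennreal (exit_rates T $ j)"
          by (intro ennreal_leI dens_bounds dyn) auto
        then have "H t * ennreal (dens k j (dyadic_above n (g t)) t) \<le> indicator {0..b} t * ennreal (exit_rates T $ j)"
          using H(2) by (intro mult_mono) auto
        then show ?thesis using True by (simp add: V_def mult.commute)
      qed (simp add: V_def)
    qed
    show "(\<integral>\<^sup>+t. ennreal (exit_rates T $ j) * indicator {0..b} t \<partial>lborel) < \<infinity>"
      by (subst nn_integral_cmult_indicator) (auto simp: ennreal_mult_less_top emeasure_lborel_Icc_eq)
  qed (use LV in \<open>auto intro!: V_meas g0 simp: dyn\<close>)
  have eq: "(\<integral>\<^sup>+\<omega>. U (\<lambda>t. dyadic_above n (g t)) \<omega> \<partial>M) = (\<integral>\<^sup>+t. V (\<lambda>t. dyadic_above n (g t)) t \<partial>lborel)" for n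
    unfolding U_def V_def by (rule phase_integral_dyadic[OF g(1) g0 H(1)])
  have "(\<integral>\<^sup>+\<omega>. U g \<omega> \<partial>M) = (\<integral>\<^sup>+t. V g t \<partial>lborel)"
    by (rule LIMSEQ_unique[OF L1[unfolded eq] L2])
  then show ?thesis unfolding U_def V_def .
qed

lemma sum_dens_0: "0 \<le> t \<Longrightarrow> (\<Sum>k\<in>UNIV. dens k j 0 t) = pi t j * exit_rates T $ j"
  unfolding dens_def pi_0 by (simp add: pi_def sum_distrib_right)

text \<open>Observation at time 0 records only the start. Summing
  \<open>phase_integral_fixed\<close> over the starting phases removes that condition and leaves the
  exit from \<open>j\<close>.\<close>

lemma phase_integral_at_end:
  assumes H: "H \<in> borel_measurable borel"
  shows "(\<integral>\<^sup>+\<omega>. H (lifetime J \<omega>) * indicator {\<omega>. last_phase J \<omega> = Some j} \<omega> \<partial>M) =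
    (\<integral>\<^sup>+t. H t * (indicator {0<..} t * ennreal (pi t j * exit_rates T $ j)) \<partial>lborel)"
proof -
  have [measurable]: "{\<omega>\<in>space M. J 0 \<omega> = Some k} \<in> sets M" for k by (rule J_meas_set) simp
  note [measurable] = H borel_measurable_dens_fixed[OF order.refl]
  have ind: "(\<lambda>\<omega>. indicator {\<omega>. J 0 \<omega> = Some k \<and> last_phase J \<omega> = Some j \<and> 0 < lifetime J \<omega>} \<omega> :: ennreal) \<in> borel_measurable M" for k
  proof -
    have "{\<omega>\<in>space M. J 0 \<omega> = Some k} \<inter> {\<omega>\<in>space M. last_phase J \<omega> = Some j} \<inter> {\<omega>\<in>space M. 0 < lifetime J \<omega>} \<in> sets M"
      by measurable
    also have "{\<omega>\<in>space M. J 0 \<omega> = Some k} \<inter> {\<omega>\<in>space M. last_phase J \<omega> = Some j} \<inter> {\<omega>\<in>space M. 0 < lifetime J \<omega>} =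
      {\<omega>\<in>space M. J 0 \<omega> = Some k \<and> last_phase J \<omega> = Some j \<and> 0 < lifetime J \<omega>}" by auto
    finally show ?thesis by (intro borel_measurable_indicator') auto
  qed
  have "(\<integral>\<^sup>+\<omega>. H (lifetime J \<omega>) * indicator {\<omega>. last_phase J \<omega> = Some j} \<omega> \<partial>M) =
    (\<integral>\<^sup>+\<omega>. (\<Sum>k\<in>UNIV. H (lifetime J \<omega>) * indicator {\<omega>. J 0 \<omega> = Some k \<and> last_phase J \<omega> = Some j \<and> 0 < lifetime J \<omega>} \<omega>) \<partial>M)"
  proof (rule nn_integral_cong_AE)
    show "AE \<omega> in M. H (lifetime J \<omega>) * indicator {\<omega>. last_phase J \<omega> = Some j} \<omega> =
       (\<Sum>k\<in>UNIV. H (lifetime J \<omega>) * indicator {\<omega>. J 0 \<omega> = Some k \<and> last_phase J \<omega> = Some j \<and> 0 < lifetime J \<omega>} \<omega>)"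
      using AE_good AE_space
    proof eventually_elim
      case (elim \<omega>)
      obtain i where i: "J 0 \<omega> = Some i" using elim(1) by (auto simp: good_def)
      have "(\<Sum>k\<in>UNIV. H (lifetime J \<omega>) * indicator {\<omega>. J 0 \<omega> = Some k \<and> last_phase J \<omega> = Some j \<and> 0 < lifetime J \<omega>} \<omega>) =
        (\<Sum>k\<in>UNIV. if k = i then H (lifetime J \<omega>) * indicator {\<omega>. last_phase J \<omega> = Some j} \<omega> else 0)"
        using i good_facts(1)[OF elim(2,1)] by (intro sum.cong) (auto simp: indicator_def)
      then show ?case by simp
    qed
  qed
  also have "\<dots> = (\<Sum>k\<in>UNIV. \<integral>\<^sup>+\<omega>. H (lifetime J \<omega>) * indicator {\<omega>. J 0 \<omega> = Some k \<and> last_phase J \<omega> = Some j \<and> 0 < lifetime J \<omega>} \<omega> \<partial>M)"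
    using ind by (intro nn_integral_sum) measurable
  also have "\<dots> = (\<Sum>k\<in>UNIV. \<integral>\<^sup>+t. H t * (indicator {0<..} t * ennreal (dens k j 0 t)) \<partial>lborel)"
    by (intro sum.cong refl phase_integral_fixed H) simp
  also have "\<dots> = (\<integral>\<^sup>+t. (\<Sum>k\<in>UNIV. H t * (indicator {0<..} t * ennreal (dens k j 0 t))) \<partial>lborel)"
    by (intro nn_integral_sum[symmetric]) measurable
  also have "\<dots> = (\<integral>\<^sup>+t. H t * (indicator {0<..} t * ennreal (pi t j * exit_rates T $ j)) \<partial>lborel)"
  proof (rule nn_integral_cong)
    fix t :: real
    show "(\<Sum>k\<in>UNIV. H t * (indicator {0<..} t * ennreal (dens k j 0 t))) = H t * (indicator {0<..} t * ennreal (pi t j * exit_rates T $ j))"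
    proof (cases "0 < t")
      case True
      then have "(\<Sum>k\<in>UNIV. ennreal (dens k j 0 t)) = ennreal (\<Sum>k\<in>UNIV. dens k j 0 t)"
        by (intro sum_ennreal dens_bounds) auto
      then show ?thesis using True sum_dens_0[of t j] by (simp add: sum_distrib_left[symmetric])
    qed simp
  qed
  finally show ?thesis .
qed

text \<open>The convention that the phase at the terminal time is the last phase is exactly what
  lets one density cover all cases: where \<open>g t = t\<close>, the factor \<open>p 0\<close> in
  \<open>dens k j t t\<close> is 1 for \<open>k = j\<close> and 0 otherwise.\<close>

theorem phase_integral:
  assumes g: "g \<in> borel_measurable borel" "\<And>t. 0 \<le> t \<Longrightarrow> 0 \<le> g t \<and> g t \<le> t"
    and H: "H \<in> borel_measurable borel" "\<And>t. H t \<le> 1"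
  shows "(\<integral>\<^sup>+\<omega>. H (lifetime J \<omega>) * indicator {\<omega>. phase_at J (g (lifetime J \<omega>)) \<omega> = Some k \<and> last_phase J \<omega> = Some j} \<omega> \<partial>M) =
    (\<integral>\<^sup>+t. H t * (indicator {0<..} t * ennreal (dens k j (g t) t)) \<partial>lborel)"
proof -
  note [measurable] = H(1) g(1)
  define U where "U H \<omega> = H (lifetime J \<omega>) * indicator {\<omega>. phase_at J (g (lifetime J \<omega>)) \<omega> = Some k \<and> last_phase J \<omega> = Some j} \<omega>"
    for H :: "real \<Rightarrow> ennreal" and \<omega>
  define V where "V H t = H t * (indicator {0<..} t * ennreal (dens k j (g t) t))" for H :: "real \<Rightarrow> ennreal" and t
  have ind: "(\<lambda>\<omega>. indicator {\<omega>. phase_at J (g (lifetime J \<omega>)) \<omega> = Some k \<and> last_phase J \<omega> = Some j} \<omega> :: ennreal) \<in> borel_measurable M"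
  proof -
    have [measurable]: "(\<lambda>\<omega>. phase_at J (g (lifetime J \<omega>)) \<omega>) \<in> M \<rightarrow>\<^sub>M count_space UNIV"
      using g(2) lifetime_nonneg by (intro phase_at_measurable) auto
    have "{\<omega>\<in>space M. phase_at J (g (lifetime J \<omega>)) \<omega> = Some k \<and> last_phase J \<omega> = Some j} \<in> sets M"
      by measurable
    then show ?thesis by (intro borel_measurable_indicator') auto
  qed
  have U_meas: "U H' \<in> borel_measurable M" if [measurable]: "H' \<in> borel_measurable borel" for H'
    using ind unfolding U_def by measurable
  have Vd: "(\<lambda>t. indicator {0<..} t * ennreal (dens k j (g t) t)) \<in> borel_measurable borel"
  proof -
    have [measurable]: "(\<lambda>t. dens k j (min (max 0 (g t)) (max 0 t)) (max 0 t)) \<in> borel_measurable borel"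
      by (rule borel_measurable_dens) auto
    have "(\<lambda>t. indicator {0<..} t * ennreal (dens k j (g t) t)) =
        (\<lambda>t. indicator {0<..} t * ennreal (dens k j (min (max 0 (g t)) (max 0 t)) (max 0 t)))"
      using g(2) by (intro ext) (auto simp: indicator_def max_def min_def)
    then show ?thesis by simp
  qed
  have V_meas: "V H' \<in> borel_measurable lborel" if [measurable]: "H' \<in> borel_measurable borel" for H'
    unfolding V_def using Vd by measurable
  have trunc: "(\<integral>\<^sup>+\<omega>. U H' \<omega> \<partial>M) = (\<integral>\<^sup>+t. V H' t \<partial>lborel)"
    if [measurable]: "H' \<in> borel_measurable borel" and H': "\<And>t. H' t \<le> indicator {0..b} t" for H' b
  proof -
    define A where "A = {t. g t < t}"
    define B where "B = {t. g t = t}"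
    have [measurable]: "B \<in> sets borel" unfolding B_def by measurable
    have le: "H' t * indicator B t \<le> indicator {0..b} t" for t
      using H'[of t] by (auto simp: indicator_def split: if_splits)
    have gl: "g (lifetime J \<omega>) < lifetime J \<omega> \<or> g (lifetime J \<omega>) = lifetime J \<omega>" for \<omega>
      using g(2)[OF lifetime_nonneg] by (auto simp: less_le)
    have "U H' \<omega> = H' (lifetime J \<omega>) * indicator {\<omega>. J (g (lifetime J \<omega>)) \<omega> = Some k \<and>
        last_phase J \<omega> = Some j \<and> g (lifetime J \<omega>) < lifetime J \<omega>} \<omega> +
      (if k = j then (H' (lifetime J \<omega>) * indicator B (lifetime J \<omega>)) * indicator {\<omega>. last_phase J \<omega> = Some j} \<omega> else 0)" for \<omega>
      using gl[of \<omega>] by (auto simp: U_def phase_at_def B_def indicator_def)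
    then have "(\<integral>\<^sup>+\<omega>. U H' \<omega> \<partial>M) = (\<integral>\<^sup>+\<omega>. H' (lifetime J \<omega>) * indicator {\<omega>. J (g (lifetime J \<omega>)) \<omega> = Some k \<and>
        last_phase J \<omega> = Some j \<and> g (lifetime J \<omega>) < lifetime J \<omega>} \<omega> +
      (if k = j then (H' (lifetime J \<omega>) * indicator B (lifetime J \<omega>)) * indicator {\<omega>. last_phase J \<omega> = Some j} \<omega> else 0) \<partial>M)"
      by simp
    also have "\<dots> = (\<integral>\<^sup>+\<omega>. H' (lifetime J \<omega>) * indicator {\<omega>. J (g (lifetime J \<omega>)) \<omega> = Some k \<and>
        last_phase J \<omega> = Some j \<and> g (lifetime J \<omega>) < lifetime J \<omega>} \<omega> \<partial>M) +
      (\<integral>\<^sup>+\<omega>. (if k = j then (H' (lifetime J \<omega>) * indicator B (lifetime J \<omega>)) * indicator {\<omega>. last_phase J \<omega> = Some j} \<omega> else 0) \<partial>M)"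
    proof (rule nn_integral_add)
      have [measurable]: "(\<lambda>\<omega>. J (g (lifetime J \<omega>)) \<omega>) \<in> M \<rightarrow>\<^sub>M count_space UNIV"
        using g(2) lifetime_nonneg by (intro measurable_J_at) auto
      have "{\<omega>\<in>space M. J (g (lifetime J \<omega>)) \<omega> = Some k \<and> last_phase J \<omega> = Some j \<and> g (lifetime J \<omega>) < lifetime J \<omega>} \<in> sets M"
        by measurable
      then have "(\<lambda>\<omega>. indicator {\<omega>. J (g (lifetime J \<omega>)) \<omega> = Some k \<and> last_phase J \<omega> = Some j \<and> g (lifetime J \<omega>) < lifetime J \<omega>} \<omega> :: ennreal) \<in> borel_measurable M"
        by (intro borel_measurable_indicator') auto
      then show "(\<lambda>\<omega>. H' (lifetime J \<omega>) * indicator {\<omega>. J (g (lifetime J \<omega>)) \<omega> = Some k \<and>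
        last_phase J \<omega> = Some j \<and> g (lifetime J \<omega>) < lifetime J \<omega>} \<omega>) \<in> borel_measurable M" by measurable
      have "{\<omega>\<in>space M. last_phase J \<omega> = Some j} \<in> sets M" by measurable
      then have "(\<lambda>\<omega>. indicator {\<omega>. last_phase J \<omega> = Some j} \<omega> :: ennreal) \<in> borel_measurable M"
        by (intro borel_measurable_indicator') auto
      then show "(\<lambda>\<omega>. if k = j then (H' (lifetime J \<omega>) * indicator B (lifetime J \<omega>)) * indicator {\<omega>. last_phase J \<omega> = Some j} \<omega> else 0) \<in> borel_measurable M"
        by measurable
    qed
    also have "(\<integral>\<^sup>+\<omega>. (if k = j then (H' (lifetime J \<omega>) * indicator B (lifetime J \<omega>)) * indicator {\<omega>. last_phase J \<omega> = Some j} \<omega> else 0) \<partial>M) =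
      (\<integral>\<^sup>+t. H' t * indicator B t * (indicator {0<..} t * (if k = j then ennreal (pi t j * exit_rates T $ j) else 0)) \<partial>lborel)"
      using phase_integral_at_end[of "\<lambda>t. H' t * indicator B t" j] by (cases "k = j") simp_all
    also have "(\<integral>\<^sup>+\<omega>. H' (lifetime J \<omega>) * indicator {\<omega>. J (g (lifetime J \<omega>)) \<omega> = Some k \<and>
        last_phase J \<omega> = Some j \<and> g (lifetime J \<omega>) < lifetime J \<omega>} \<omega> \<partial>M) = (\<integral>\<^sup>+t. H' t * (indicator {t. g t < t} t * ennreal (dens k j (g t) t)) \<partial>lborel)"
      by (rule phase_integral_before_end[OF g that])
    also have "(\<integral>\<^sup>+t. H' t * (indicator {t. g t < t} t * ennreal (dens k j (g t) t)) \<partial>lborel) +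
      (\<integral>\<^sup>+t. H' t * indicator B t * (indicator {0<..} t * (if k = j then ennreal (pi t j * exit_rates T $ j) else 0)) \<partial>lborel) =
      (\<integral>\<^sup>+t. V (\<lambda>t. H' t * indicator {t. g t < t} t) t \<partial>lborel) + (\<integral>\<^sup>+t. V (\<lambda>t. H' t * indicator B t) t \<partial>lborel)"
    proof (intro arg_cong2[where f="(+)"] nn_integral_cong)
      fix t :: real
      \<comment> \<open>Where \<open>H'\<close> is nonzero, \<open>g t < t\<close> entails
        \<open>0 < t\<close>: negative \<open>t\<close> lie outside the support, and the bounds
        force \<open>g 0 = 0\<close>.\<close>
      have "H' t = 0" if "t < 0" using H'[of t] that by simp
      then show "H' t * (indicator {t. g t < t} t * ennreal (dens k j (g t) t)) = V (\<lambda>t. H' t * indicator {t. g t < t} t) t"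
        using g(2)[of 0] by (cases t "0::real" rule: linorder_cases) (auto simp: V_def indicator_def)
      show "H' t * indicator B t * (indicator {0<..} t * (if k = j then ennreal (pi t j * exit_rates T $ j) else 0)) = V (\<lambda>t. H' t * indicator B t) t"
        by (auto simp: V_def indicator_def B_def dens_def p_0)
    qed
    also have "\<dots> = (\<integral>\<^sup>+t. V (\<lambda>t. H' t * indicator {t. g t < t} t) t + V (\<lambda>t. H' t * indicator B t) t \<partial>lborel)"
      by (intro nn_integral_add[symmetric] V_meas) measurable
    also have "\<dots> = (\<integral>\<^sup>+t. V H' t \<partial>lborel)"
    proof (rule nn_integral_cong)
      fix t :: real
      show "V (\<lambda>t. H' t * indicator {t. g t < t} t) t + V (\<lambda>t. H' t * indicator B t) t = V H' t"
        using g(2)[of t] by (auto simp: V_def indicator_def B_def)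
    qed
    finally show ?thesis .
  qed
  \<comment> \<open>Truncations of \<open>H\<close> to bounded time intervals, removed by monotone
    convergence.\<close>
  define Hn where "Hn n t = H t * indicator {0..real n} t" for n t
  have [measurable]: "Hn n \<in> borel_measurable borel" for n unfolding Hn_def by measurable
  have le: "Hn n t \<le> indicator {0..real n} t" for n t using H(2)[of t] by (auto simp: Hn_def indicator_def)
  have inc: "incseq Hn" by (auto simp: incseq_def le_fun_def Hn_def indicator_def)
  have ev: "\<forall>\<^sub>F n in sequentially. Hn n t = H t" if "0 \<le> t" for t
  proof -
    obtain N where "t \<le> real N" using real_arch_simple by auto
    then have "\<forall>n\<ge>N. t \<le> real n" by (meson of_nat_mono order_trans)
    then show ?thesis using that by (auto simp: eventually_sequentially Hn_def indicator_def intro!: exI[of _ N])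
  qed
  have "(\<integral>\<^sup>+\<omega>. U H \<omega> \<partial>M) = (\<integral>\<^sup>+\<omega>. (SUP n. U (Hn n) \<omega>) \<partial>M)"
  proof (rule nn_integral_cong)
    fix \<omega>
    have "\<forall>\<^sub>F n in sequentially. U (Hn n) \<omega> = U H \<omega>"
      using ev[OF lifetime_nonneg, of \<omega>] by eventually_elim (simp add: U_def)
    then have "(\<lambda>n. U (Hn n) \<omega>) \<longlonglongrightarrow> U H \<omega>" by (rule tendsto_eventually)
    moreover have "incseq (\<lambda>n. U (Hn n) \<omega>)"
      using inc by (auto simp: incseq_def le_fun_def U_def intro!: mult_right_mono)
    ultimately show "U H \<omega> = (SUP n. U (Hn n) \<omega>)" using LIMSEQ_unique LIMSEQ_SUP by blast
  qed
  also have "\<dots> = (SUP n. \<integral>\<^sup>+\<omega>. U (Hn n) \<omega> \<partial>M)"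
    using inc by (intro nn_integral_monotone_convergence_SUP U_meas)
       (auto simp: incseq_def le_fun_def U_def intro!: mult_right_mono)
  also have "\<dots> = (SUP n. \<integral>\<^sup>+t. V (Hn n) t \<partial>lborel)"
    by (intro SUP_cong refl trunc[OF _ le]) measurable
  also have "\<dots> = (\<integral>\<^sup>+t. (SUP n. V (Hn n) t) \<partial>lborel)"
    using inc by (intro nn_integral_monotone_convergence_SUP[symmetric] V_meas)
       (auto simp: incseq_def le_fun_def V_def intro!: mult_right_mono)
  also have "\<dots> = (\<integral>\<^sup>+t. V H t \<partial>lborel)"
  proof (rule nn_integral_cong)
    fix t :: real
    have "(\<lambda>n. V (Hn n) t) \<longlonglongrightarrow> V H t"
    proof (cases "0 \<le> t")
      case True
      have "\<forall>\<^sub>F n in sequentially. V (Hn n) t = V H t"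
        using ev[OF True] by eventually_elim (simp add: V_def)
      then show ?thesis by (rule tendsto_eventually)
    qed (simp add: V_def)
    moreover have "incseq (\<lambda>n. V (Hn n) t)"
      using inc by (auto simp: incseq_def le_fun_def V_def intro!: mult_right_mono)
    ultimately show "(SUP n. V (Hn n) t) = V H t" using LIMSEQ_unique LIMSEQ_SUP by blast
  qed
  finally show ?thesis unfolding U_def V_def .
qed

end

section \<open>Random walks\<close>

locale iid_sequence = prob_space P for P :: "'w measure" +
  fixes \<eta> :: "nat \<Rightarrow> 'w \<Rightarrow> real"
  assumes indep: "indep_vars (\<lambda>_. borel) \<eta> UNIV"
    and ident: "\<And>l. distr P borel (\<eta> l) = distr P borel (\<eta> 0)"
begin

lemma eta_meas [measurable]: "\<eta> l \<in> borel_measurable P"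
  using indep by (auto simp: indep_vars_def)

definition walk :: "nat \<Rightarrow> 'w \<Rightarrow> real" where "walk k \<omega> = (\<Sum>l<k. \<eta> l \<omega>)"

lemma walk_meas [measurable]: "walk k \<in> borel_measurable P"
  unfolding walk_def by measurable

lemma walk_0 [simp]: "walk 0 \<omega> = 0" by (simp add: walk_def)

lemma walk_add: "walk (m + l) \<omega> = walk m \<omega> + (\<Sum>i<l. \<eta> (m + i) \<omega>)"
  unfolding walk_def using sum.nat_group[of "\<lambda>_. 0"]
  by (induction l) (auto simp: add.assoc)

text \<open>Any injective choice of increments has the same joint law. It serves for the shift
  \<open>l \<mapsto> m + l\<close>, which restarts the walk after its maximum, and for reversing the
  order of the increments.\<close>

lemma exchangeable:
  fixes N :: nat
  assumes "inj_on \<pi> {..N}"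
  shows "distr P (PiM {..N} (\<lambda>_. borel)) (\<lambda>\<omega>. \<lambda>l\<in>{..N}. \<eta> (\<pi> l) \<omega>) =
    PiM {..N} (\<lambda>_. distr P borel (\<eta> 0))"
proof -
  let ?I = "\<pi> ` {..N}" and ?\<nu> = "distr P borel (\<eta> 0)"
  have "\<pi> 0 \<in> ?I" by simp
  then have ne: "?I \<noteq> {}" by (metis empty_iff)
  have "indep_vars (\<lambda>_. borel) \<eta> ?I" by (rule indep_vars_subset[OF indep]) auto
  then have I: "distr P (PiM ?I (\<lambda>_. borel)) (\<lambda>\<omega>. \<lambda>i\<in>?I. \<eta> i \<omega>) = PiM ?I (\<lambda>i. distr P borel (\<eta> i))"
    using indep_vars_iff_distr_eq_PiM[OF ne, where M'="\<lambda>_. borel" and X=\<eta>, OF eta_meas] by simp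
  have "distr P (PiM {..N} (\<lambda>_. borel)) (\<lambda>\<omega>. \<lambda>l\<in>{..N}. \<eta> (\<pi> l) \<omega>) =
      distr P (PiM {..N} (\<lambda>_. borel)) ((\<lambda>x. \<lambda>l\<in>{..N}. x (\<pi> l)) \<circ> (\<lambda>\<omega>. \<lambda>i\<in>?I. \<eta> i \<omega>))"
    by (intro distr_cong) auto
  also have "\<dots> = distr (distr P (PiM ?I (\<lambda>_. borel)) (\<lambda>\<omega>. \<lambda>i\<in>?I. \<eta> i \<omega>)) (PiM {..N} (\<lambda>_. borel)) (\<lambda>x. \<lambda>l\<in>{..N}. x (\<pi> l))"
    by (intro distr_distr[symmetric] measurable_restrict measurable_component_singleton) auto
  also have "\<dots> = distr (PiM ?I (\<lambda>_. ?\<nu>)) (PiM {..N} (\<lambda>_. ?\<nu>)) (\<lambda>x. \<lambda>l\<in>{..N}. x (\<pi> l))"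
    unfolding I by (intro distr_cong sets_PiM_cong PiM_cong ident) auto
  also have "\<dots> = PiM {..N} (\<lambda>_. ?\<nu>)"
    by (rule distr_PiM_reindex) (auto intro!: prob_space_distr assms)
  finally show ?thesis .
qed

lemma exchangeable_integral:
  fixes F :: "(nat \<Rightarrow> real) \<Rightarrow> real" and N :: nat
  assumes "inj_on \<pi> {..N}" and F: "F \<in> borel_measurable (PiM {..N} (\<lambda>_. borel))"
  shows "(\<integral>\<omega>. F (\<lambda>l\<in>{..N}. \<eta> (\<pi> l) \<omega>) \<partial>P) = (\<integral>\<omega>. F (\<lambda>l\<in>{..N}. \<eta> l \<omega>) \<partial>P)"
proof -
  have *: "(\<integral>\<omega>. F (\<lambda>l\<in>{..N}. \<eta> (\<pi> l) \<omega>) \<partial>P) = integral\<^sup>L (PiM {..N} (\<lambda>_. distr P borel (\<eta> 0))) F"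
    if "inj_on \<pi> {..N}" for \<pi>
  proof -
    have "(\<integral>\<omega>. F (\<lambda>l\<in>{..N}. \<eta> (\<pi> l) \<omega>) \<partial>P) =
        integral\<^sup>L (distr P (PiM {..N} (\<lambda>_. borel)) (\<lambda>\<omega>. \<lambda>l\<in>{..N}. \<eta> (\<pi> l) \<omega>)) F"
      by (rule integral_distr[symmetric, OF _ F]) measurable
    then show ?thesis unfolding exchangeable[OF that] .
  qed
  show ?thesis using *[OF assms(1)] *[of "\<lambda>l. l"] by simp
qed

definition argmax :: "nat \<Rightarrow> 'w \<Rightarrow> nat" where
  "argmax N \<omega> = (LEAST m. m \<le> N \<and> (\<forall>l\<le>N. walk l \<omega> \<le> walk m \<omega>))"

lemma argmax_props: "argmax N \<omega> \<le> N" "l \<le> N \<Longrightarrow> walk l \<omega> \<le> walk (argmax N \<omega>) \<omega>"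
proof -
  have "Max ((\<lambda>l. walk l \<omega>) ` {..N}) \<in> (\<lambda>l. walk l \<omega>) ` {..N}" by (intro Max_in) auto
  then obtain m where "Max ((\<lambda>l. walk l \<omega>) ` {..N}) = walk m \<omega>" "m \<le> N" by (elim imageE) auto
  then have "m \<le> N \<and> (\<forall>l\<le>N. walk l \<omega> \<le> walk m \<omega>)"
    using Max_ge[of "(\<lambda>l. walk l \<omega>) ` {..N}"] by (metis finite_imageI finite_atMost image_eqI atMost_iff)
  from LeastI[of "\<lambda>m. m \<le> N \<and> (\<forall>l\<le>N. walk l \<omega> \<le> walk m \<omega>)", OF this]
  show "argmax N \<omega> \<le> N" "l \<le> N \<Longrightarrow> walk l \<omega> \<le> walk (argmax N \<omega>) \<omega>"
    by (auto simp: argmax_def)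
qed

text \<open>Choosing the first maximiser turns the event into a strict condition on the increments
  before \<open>m\<close> and a weak one on the increments after \<open>m\<close>. These concern
  disjoint blocks, so independence can be used.\<close>

lemma argmax_eq_iff:
  "m \<le> N \<Longrightarrow> argmax N \<omega> = m \<longleftrightarrow> (\<forall>l<m. walk l \<omega> < walk m \<omega>) \<and> (\<forall>l\<le>N - m. walk (m + l) \<omega> - walk m \<omega> \<le> 0)"
proof
  assume m: "m \<le> N" and eq: "argmax N \<omega> = m"
  have "walk l \<omega> < walk m \<omega>" if "l < m" for l
  proof (rule ccontr)
    assume "\<not> walk l \<omega> < walk m \<omega>"
    then have "walk m \<omega> \<le> walk l \<omega>" by simp
    then have "l \<le> N \<and> (\<forall>i\<le>N. walk i \<omega> \<le> walk l \<omega>)"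
      using argmax_props(2)[of _ N \<omega>] eq that m by (meson less_imp_le order_trans)
    then have "argmax N \<omega> \<le> l" unfolding argmax_def by (rule Least_le)
    then show False using eq that by simp
  qed
  moreover have "walk (m + l) \<omega> - walk m \<omega> \<le> 0" if "l \<le> N - m" for l
    using argmax_props(2)[of "m + l" N \<omega>] eq that m by simp
  ultimately show "(\<forall>l<m. walk l \<omega> < walk m \<omega>) \<and> (\<forall>l\<le>N - m. walk (m + l) \<omega> - walk m \<omega> \<le> 0)" by blast
next
  assume m: "m \<le> N" and *: "(\<forall>l<m. walk l \<omega> < walk m \<omega>) \<and> (\<forall>l\<le>N - m. walk (m + l) \<omega> - walk m \<omega> \<le> 0)"
  have le: "walk l \<omega> \<le> walk m \<omega>" if "l \<le> N" for l
  proof (cases "l < m")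
    case False
    then show ?thesis using * that spec[of "\<lambda>l. l \<le> N - m \<longrightarrow> walk (m + l) \<omega> - walk m \<omega> \<le> 0" "l - m"] by simp
  qed (use * in \<open>auto intro: less_imp_le\<close>)
  show "argmax N \<omega> = m"
    unfolding argmax_def
  proof (rule Least_equality)
    show "m \<le> N \<and> (\<forall>l\<le>N. walk l \<omega> \<le> walk m \<omega>)" using m le by blast
    fix y assume y: "y \<le> N \<and> (\<forall>l\<le>N. walk l \<omega> \<le> walk y \<omega>)"
    show "m \<le> y"
    proof (rule ccontr)
      assume "\<not> m \<le> y"
      then have "walk y \<omega> < walk m \<omega>" using * by simp
      moreover have "walk m \<omega> \<le> walk y \<omega>" using y m by simp
      ultimately show False by simp
    qed
  qed
qed

lemma argmax_meas [measurable]: "argmax N \<in> P \<rightarrow>\<^sub>M count_space UNIV"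
proof (rule measurable_compose_countable'[where I="{..N}" and f="\<lambda>m _. m" and g="argmax N"])
  show "argmax N \<in> P \<rightarrow>\<^sub>M count_space {..N}"
    unfolding measurable_count_space_eq2[OF finite_atMost]
  proof (intro conjI ballI)
    show "argmax N \<in> space P \<rightarrow> {..N}" using argmax_props by auto
    fix m assume "m \<in> {..N}"
    then have "argmax N -` {m} \<inter> space P = {\<omega>\<in>space P. (\<forall>l\<in>{..<m}. walk l \<omega> < walk m \<omega>) \<and>
        (\<forall>l\<in>{..N - m}. walk (m + l) \<omega> - walk m \<omega> \<le> 0)}"
      using argmax_eq_iff[of m N] by (simp only: atMost_iff vimage_def Int_def mem_Collect_eq singleton_iff Ball_def lessThan_iff) blast
    also have "\<dots> \<in> sets P" by measurable
    finally show "argmax N -` {m} \<inter> space P \<in> sets P" .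
  qed
qed auto

text \<open>A walk with a strict record at time \<open>m\<close>: the part of the event
  \<open>argmax N \<omega> = m\<close> that concerns the past. The part that concerns the future,
  for the restarted walk, is in \<open>post_sum\<close>.\<close>

definition pre_sum :: "(nat \<Rightarrow> real \<Rightarrow> real) \<Rightarrow> nat \<Rightarrow> real" where
  "pre_sum \<phi> m = (\<integral>\<omega>. \<phi> m (walk m \<omega>) * indicator {\<omega>. \<forall>l<m. walk l \<omega> < walk m \<omega>} \<omega> \<partial>P)"

definition post_sum :: "(nat \<Rightarrow> real \<Rightarrow> real) \<Rightarrow> nat \<Rightarrow> real" where
  "post_sum \<psi> k = (\<integral>\<omega>. \<psi> k (walk k \<omega>) * indicator {\<omega>. \<forall>l\<le>k. walk l \<omega> \<le> 0} \<omega> \<partial>P)"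

definition mark :: "(nat \<Rightarrow> real \<Rightarrow> real) \<Rightarrow> (nat \<Rightarrow> real \<Rightarrow> real) \<Rightarrow> nat \<Rightarrow> 'w \<Rightarrow> real" where
  "mark \<phi> \<psi> N \<omega> = \<phi> (argmax N \<omega>) (walk (argmax N \<omega>) \<omega>) *
     \<psi> (N - argmax N \<omega>) (walk N \<omega> - walk (argmax N \<omega>) \<omega>)"

text \<open>The conditions before and after \<open>m\<close> depend on disjoint blocks of increments
  and are independent; exchangeability moves the second block back to index 0.\<close>

lemma split_at:
  assumes [measurable]: "\<And>m. \<phi> m \<in> borel_measurable borel" "\<And>m. \<psi> m \<in> borel_measurable borel"
    and bd: "\<And>m x. \<bar>\<phi> m x\<bar> \<le> 1" "\<And>m x. \<bar>\<psi> m x\<bar> \<le> 1" and m: "m \<le> N"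
  shows "(\<integral>\<omega>. \<phi> m (walk m \<omega>) * \<psi> (N - m) (walk N \<omega> - walk m \<omega>) * indicator {\<omega>. argmax N \<omega> = m} \<omega> \<partial>P) =
    pre_sum \<phi> m * post_sum \<psi> (N - m)"
proof -
  define k where "k = N - m"
  have N: "N = m + k" using m by (simp add: k_def)
  define F1 where "F1 x = \<phi> m (\<Sum>i<m. x i) * indicator {x. \<forall>l<m. (\<Sum>i<l. x i) < (\<Sum>i<m. x i)} x" for x :: "nat \<Rightarrow> real"
  \<comment> \<open>The offset \<open>j\<close> lets one functional act both on the block starting
    at \<open>m\<close> and, after the shift, on the block starting at 0.\<close>
  define F2 where "F2 j x = \<psi> k (\<Sum>i<k. x (j + i)) * indicator {x. \<forall>l\<le>k. (\<Sum>i<l. x (j + i)) \<le> 0} x" for j :: nat and x :: "nat \<Rightarrow> real"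
  have F1_eq: "F1 x = \<phi> m (\<Sum>i<m. x i) * of_bool (\<forall>l\<in>{..<m}. (\<Sum>i<l. x i) < (\<Sum>i<m. x i))" for x
    by (auto simp: F1_def indicator_def)
  have F2_eq: "F2 j x = \<psi> k (\<Sum>i<k. x (j + i)) * of_bool (\<forall>l\<in>{..k}. (\<Sum>i<l. x (j + i)) \<le> 0)" for j x
    by (auto simp: F2_def indicator_def)
  have F1_meas: "F1 \<in> borel_measurable (PiM {..<m} (\<lambda>_. borel))"
  proof -
    have s: "(\<lambda>x. \<Sum>i<l. x i) \<in> borel_measurable (PiM {..<m} (\<lambda>_. borel :: real measure))" if l: "l \<le> m" for l
    proof (intro borel_measurable_sum measurable_component_singleton)
      fix i assume "i \<in> {..<l}" then show "i \<in> {..<m}" using l by auto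
    qed
    have "Measurable.pred (PiM {..<m} (\<lambda>_. borel :: real measure)) (\<lambda>x. (\<Sum>i<l. x i) < (\<Sum>i<m. x i))" if "l \<in> {..<m}" for l
      unfolding pred_def by (intro borel_measurable_less s) (use that in auto)
    then have [measurable]: "Measurable.pred (PiM {..<m} (\<lambda>_. borel :: real measure)) (\<lambda>x. \<forall>l\<in>{..<m}. (\<Sum>i<l. x i) < (\<Sum>i<m. x i))"
      by (intro pred_intros_finite) auto
    have [measurable]: "(\<lambda>x. \<Sum>i<m. x i) \<in> borel_measurable (PiM {..<m} (\<lambda>_. borel :: real measure))" by (rule s) simp
    show ?thesis unfolding F1_eq by measurable
  qed
  have F2_meas: "F2 j \<in> borel_measurable (PiM A (\<lambda>_. borel))" if A: "{j..<j + k} \<subseteq> A" for j A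
  proof -
    have s: "(\<lambda>x. \<Sum>i<l. x (j + i)) \<in> borel_measurable (PiM A (\<lambda>_. borel :: real measure))" if "l \<le> k" for l
      using that A by (intro borel_measurable_sum measurable_component_singleton) auto
    have "Measurable.pred (PiM A (\<lambda>_. borel :: real measure)) (\<lambda>x. (\<Sum>i<l. x (j + i)) \<le> 0)" if "l \<in> {..k}" for l
      unfolding pred_def by (intro borel_measurable_le borel_measurable_const s) (use that in auto)
    then have [measurable]: "Measurable.pred (PiM A (\<lambda>_. borel :: real measure)) (\<lambda>x. \<forall>l\<in>{..k}. (\<Sum>i<l. x (j + i)) \<le> 0)"
      by (intro pred_intros_finite) auto
    have [measurable]: "(\<lambda>x. \<Sum>i<k. x (j + i)) \<in> borel_measurable (PiM A (\<lambda>_. borel :: real measure))" by (rule s) simp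
    show ?thesis unfolding F2_eq by measurable
  qed
  define Y1 where "Y1 \<omega> = F1 (restrict (\<lambda>i. \<eta> i \<omega>) {..<m})" for \<omega>
  define Y2 where "Y2 \<omega> = F2 m (restrict (\<lambda>i. \<eta> i \<omega>) {m..N})" for \<omega>
  have "indep_var (PiM {..<m} (\<lambda>_. borel)) (\<lambda>\<omega>. restrict (\<lambda>i. \<eta> i \<omega>) {..<m}) (PiM {m..N} (\<lambda>_. borel)) (\<lambda>\<omega>. restrict (\<lambda>i. \<eta> i \<omega>) {m..N})"
    by (rule indep_var_restrict[OF indep]) auto
  note ri = this
  have "{m..<m + k} \<subseteq> {m..N}" using N by auto
  from indep_var_compose[OF ri F1_meas F2_meas[OF this]]
  have ind: "indep_var borel Y1 borel Y2" by (simp add: Y1_def[abs_def] Y2_def[abs_def] o_def)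
  have Y_meas [measurable]: "Y1 \<in> borel_measurable P" "Y2 \<in> borel_measurable P"
    using indep_var_rv1[OF ind] indep_var_rv2[OF ind] by auto
  have Fbd: "\<bar>F1 x\<bar> \<le> 1" "\<bar>F2 j x\<bar> \<le> 1" for x j
    using bd by (auto simp: F1_def F2_def indicator_def)
  have Ybd: "\<bar>Y1 \<omega>\<bar> \<le> 1" "\<bar>Y2 \<omega>\<bar> \<le> 1" for \<omega> by (simp_all add: Y1_def Y2_def Fbd)
  have int: "integrable P Y1" "integrable P Y2"
    by (rule integrable_const_bound[where B=1]; use Ybd Y_meas in simp)+
  have walk1: "(\<Sum>i<l. restrict (\<lambda>i. \<eta> i \<omega>) {..<m} i) = walk l \<omega>" if "l \<le> m" for l \<omega>
    unfolding walk_def using that by (intro sum.cong) auto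
  have Y1: "Y1 \<omega> = \<phi> m (walk m \<omega>) * indicator {\<omega>. \<forall>l<m. walk l \<omega> < walk m \<omega>} \<omega>" for \<omega>
    using walk1[of _ \<omega>] unfolding Y1_def F1_def indicator_def by (simp only: mem_Collect_eq order.refl less_imp_le cong: conj_cong imp_cong)
  have Y2: "Y2 \<omega> = \<psi> k (walk N \<omega> - walk m \<omega>) * indicator {\<omega>. \<forall>l\<le>k. walk (m + l) \<omega> - walk m \<omega> \<le> 0} \<omega>" for \<omega>
    by (simp add: Y2_def F2_def indicator_def N walk_add)
  have "(\<integral>\<omega>. \<phi> m (walk m \<omega>) * \<psi> (N - m) (walk N \<omega> - walk m \<omega>) * indicator {\<omega>. argmax N \<omega> = m} \<omega> \<partial>P) =
      (\<integral>\<omega>. Y1 \<omega> * Y2 \<omega> \<partial>P)"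
    unfolding Y1 Y2 using argmax_eq_iff[OF m] by (intro Bochner_Integration.integral_cong) (auto simp: indicator_def k_def)
  also have "\<dots> = (\<integral>\<omega>. Y1 \<omega> \<partial>P) * (\<integral>\<omega>. Y2 \<omega> \<partial>P)"
    by (rule indep_var_lebesgue_integral[OF ind int])
  also have "(\<integral>\<omega>. Y1 \<omega> \<partial>P) = pre_sum \<phi> m" unfolding Y1 pre_sum_def ..
  also have "(\<integral>\<omega>. Y2 \<omega> \<partial>P) = (\<integral>\<omega>. F2 0 (\<lambda>l\<in>{..k}. \<eta> (m + l) \<omega>) \<partial>P)"
  proof (rule Bochner_Integration.integral_cong)
    fix \<omega>
    have "(\<Sum>i<l. restrict (\<lambda>i. \<eta> i \<omega>) {m..N} (m + i)) = (\<Sum>i<l. (\<lambda>l\<in>{..k}. \<eta> (m + l) \<omega>) (0 + i))" if "l \<le> k" for l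
      using that N by (intro sum.cong) auto
    then show "Y2 \<omega> = F2 0 (\<lambda>l\<in>{..k}. \<eta> (m + l) \<omega>)"
      unfolding Y2_def F2_def indicator_def by (simp only: mem_Collect_eq order.refl cong: conj_cong imp_cong)
  qed simp
  also have "\<dots> = (\<integral>\<omega>. F2 0 (\<lambda>l\<in>{..k}. \<eta> l \<omega>) \<partial>P)"
    by (rule exchangeable_integral) (auto intro!: F2_meas inj_onI)
  also have "\<dots> = post_sum \<psi> k"
    unfolding post_sum_def
  proof (rule Bochner_Integration.integral_cong)
    fix \<omega>
    have "(\<Sum>i<l. (\<lambda>l\<in>{..k}. \<eta> l \<omega>) (0 + i)) = walk l \<omega>" if "l \<le> k" for l
      unfolding walk_def using that by (intro sum.cong) auto
    then show "F2 0 (\<lambda>l\<in>{..k}. \<eta> l \<omega>) = \<psi> k (walk k \<omega>) * indicator {\<omega>. \<forall>l\<le>k. walk l \<omega> \<le> 0} \<omega>"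
      unfolding F2_def indicator_def by (simp only: mem_Collect_eq order.refl cong: conj_cong imp_cong)
  qed simp
  finally show ?thesis unfolding k_def .
qed

lemma mark_meas:
  assumes [measurable]: "\<And>m. \<phi> m \<in> borel_measurable borel" "\<And>m. \<psi> m \<in> borel_measurable borel"
  shows "mark \<phi> \<psi> N \<in> borel_measurable P"
  unfolding mark_def
proof (rule measurable_compose_countable[where g="argmax N" and f="\<lambda>m \<omega>. \<phi> m (walk m \<omega>) * \<psi> (N - m) (walk N \<omega> - walk m \<omega>)"])
qed measurable

lemma mark_bound:
  assumes "\<And>m x. \<bar>\<phi> m x\<bar> \<le> 1" "\<And>m x. \<bar>\<psi> m x\<bar> \<le> 1" shows "\<bar>mark \<phi> \<psi> N \<omega>\<bar> \<le> 1"
  unfolding mark_def abs_mult using assms by (intro mult_le_one) auto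

lemma integral_mark:
  assumes meas[measurable]: "\<And>m. \<phi> m \<in> borel_measurable borel" "\<And>m. \<psi> m \<in> borel_measurable borel"
    and bd: "\<And>m x. \<bar>\<phi> m x\<bar> \<le> 1" "\<And>m x. \<bar>\<psi> m x\<bar> \<le> 1"
  shows "(\<integral>\<omega>. mark \<phi> \<psi> N \<omega> \<partial>P) = (\<Sum>m\<le>N. pre_sum \<phi> m * post_sum \<psi> (N - m))"
proof -
  let ?f = "\<lambda>m \<omega>. \<phi> m (walk m \<omega>) * \<psi> (N - m) (walk N \<omega> - walk m \<omega>) * indicator {\<omega>. argmax N \<omega> = m} \<omega>"
  have "mark \<phi> \<psi> N \<omega> = (\<Sum>m\<le>N. ?f m \<omega>)" for \<omega>
  proof -
    have "(\<Sum>m\<le>N. ?f m \<omega>) = (\<Sum>m\<le>N. if m = argmax N \<omega> then mark \<phi> \<psi> N \<omega> else 0)"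
      by (intro sum.cong) (auto simp: mark_def indicator_def)
    then show ?thesis using argmax_props(1)[of N \<omega>] by simp
  qed
  then have "(\<integral>\<omega>. mark \<phi> \<psi> N \<omega> \<partial>P) = (\<integral>\<omega>. (\<Sum>m\<le>N. ?f m \<omega>) \<partial>P)" by simp
  also have "\<dots> = (\<Sum>m\<le>N. \<integral>\<omega>. ?f m \<omega> \<partial>P)"
  proof (rule Bochner_Integration.integral_sum)
    fix m
    have "{\<omega>\<in>space P. argmax N \<omega> = m} \<in> sets P" by measurable
    then have "(\<lambda>\<omega>. indicator {\<omega>. argmax N \<omega> = m} \<omega> :: real) \<in> borel_measurable P"
      by (intro borel_measurable_indicator') auto
    then have "?f m \<in> borel_measurable P" by measurable
    moreover have "\<bar>?f m \<omega>\<bar> \<le> 1" for \<omega>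
      using bd by (auto simp: abs_mult indicator_def intro!: mult_le_one)
    ultimately show "integrable P (?f m)" by (intro integrable_const_bound[of _ 1]) auto
  qed
  also have "\<dots> = (\<Sum>m\<le>N. pre_sum \<phi> m * post_sum \<psi> (N - m))"
    by (intro sum.cong refl split_at meas bd) auto
  finally show ?thesis .
qed

text \<open>Summing over a geometric time turns the convolution over the position of the maximum into a Cauchy product.\<close>

lemma geometric_factorisation:
  assumes meas: "\<And>m. \<phi> m \<in> borel_measurable borel" "\<And>m. \<psi> m \<in> borel_measurable borel"
    and bd: "\<And>m x. \<bar>\<phi> m x\<bar> \<le> 1" "\<And>m x. \<bar>\<psi> m x\<bar> \<le> 1" and r: "0 \<le> r" "r < 1"
  shows "(\<lambda>N. r ^ N * (\<integral>\<omega>. mark \<phi> \<psi> N \<omega> \<partial>P)) sums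
      ((\<Sum>m. r ^ m * pre_sum \<phi> m) * (\<Sum>m. r ^ m * post_sum \<psi> m))"
proof -
  have bound: "\<bar>pre_sum \<phi> m\<bar> \<le> 1" "\<bar>post_sum \<psi> m\<bar> \<le> 1" for m
  proof -
    have *: "\<bar>\<integral>\<omega>. f \<omega> \<partial>P\<bar> \<le> 1" if f: "\<And>\<omega>. \<bar>f \<omega>\<bar> \<le> (1 :: real)" for f
    proof -
      have "\<bar>\<integral>\<omega>. f \<omega> \<partial>P\<bar> \<le> (\<integral>\<omega>. \<bar>f \<omega>\<bar> \<partial>P)" by (rule integral_abs_bound)
      also have "\<dots> \<le> (\<integral>\<omega>. 1 \<partial>P)"
        using f by (intro integral_mono') auto
      finally show ?thesis by (simp add: prob_space)
    qed
    show "\<bar>pre_sum \<phi> m\<bar> \<le> 1" "\<bar>post_sum \<psi> m\<bar> \<le> 1"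
      unfolding pre_sum_def post_sum_def using bd by (intro *; auto simp: indicator_def)+
  qed
  \<comment> \<open>The Cauchy product needs absolute summability, which the geometric weights give
    for bounded coefficients.\<close>
  have sm: "summable (\<lambda>m. norm (r ^ m * c m))" if "\<And>m. \<bar>c m\<bar> \<le> 1" for c
    using r that by (intro summable_comparison_test'[OF summable_geometric[of r], of 0])
      (auto simp: abs_mult intro!: mult_left_le)
  have "(\<lambda>N. \<Sum>m\<le>N. (r ^ m * pre_sum \<phi> m) * (r ^ (N - m) * post_sum \<psi> (N - m))) sums
      ((\<Sum>m. r ^ m * pre_sum \<phi> m) * (\<Sum>m. r ^ m * post_sum \<psi> m))"
    by (rule Cauchy_product_sums) (intro sm bound)+
  moreover have "(\<Sum>m\<le>N. (r ^ m * pre_sum \<phi> m) * (r ^ (N - m) * post_sum \<psi> (N - m))) = r ^ N * (\<integral>\<omega>. mark \<phi> \<psi> N \<omega> \<partial>P)" for N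
    unfolding integral_mark[OF meas bd] sum_distrib_left
  proof (rule sum.cong)
    fix m assume "m \<in> {..N}"
    then have "r ^ N = r ^ m * r ^ (N - m)" by (simp flip: power_add)
    then show "(r ^ m * pre_sum \<phi> m) * (r ^ (N - m) * post_sum \<psi> (N - m)) = r ^ N * (pre_sum \<phi> m * post_sum \<psi> (N - m))" by simp
  qed simp
  ultimately show ?thesis by simp
qed

end

section \<open>Families of functions and sets that determine a finite measure\<close>

text \<open>Indicators of closed sets are decreasing limits of continuous functions of the distance,
  and closed sets form an intersection-stable generator. This turns limits of expectations of
  continuous functions along grids into identities of laws.\<close>

lemma measure_eqI_continuous:
  fixes M N :: "'a::metric_space measure"
  assumes fin: "finite_measure M" "finite_measure N" and sets: "sets M = sets borel" "sets N = sets borel"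
    and eq: "\<And>f :: 'a \<Rightarrow> real. continuous_on UNIV f \<Longrightarrow> (\<And>x. 0 \<le> f x \<and> f x \<le> 1) \<Longrightarrow> integral\<^sup>L M f = integral\<^sup>L N f"
  shows "M = N"
proof -
  interpret M: finite_measure M by fact
  interpret N: finite_measure N by fact
  \<comment> \<open>\<open>infdist\<close> to the empty set is 0 by convention, so the approximation
    fails there; the empty set is settled separately.\<close>
  have closed_eq: "measure M A = measure N A" if A: "closed A" "A \<noteq> {}" for A
  proof -
    define f where "f n x = max 0 (1 - real n * infdist x A)" for n x
    have f01: "0 \<le> f n x \<and> f n x \<le> 1" for n x using infdist_nonneg[of x A] by (auto simp: f_def)
    have fc: "continuous_on UNIV (f n)" for n unfolding f_def by (intro continuous_intros)
    have f_meas: "f n \<in> borel_measurable L" if "sets L = sets borel" for n L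
      unfolding measurable_cong_sets[OF that refl] by (rule borel_measurable_continuous_onI[OF fc])
    have lim: "(\<lambda>n. f n x) \<longlonglongrightarrow> indicator A x" for x
    proof (cases "x \<in> A")
      case False
      then have pos: "infdist x A > 0" using A infdist_pos_not_in_closed by blast
      obtain m where m: "1 / infdist x A < real m" using reals_Archimedean2 by blast
      have "f n x = 0" if "n \<ge> m" for n
      proof -
        have "1 / infdist x A < real n" using m that by (meson less_le_trans of_nat_le_iff)
        then show ?thesis using pos by (simp add: f_def field_simps max_def)
      qed
      then have "\<forall>\<^sub>F n in sequentially. f n x = indicator A x" using False by (auto simp: eventually_sequentially)
      then show ?thesis by (rule tendsto_eventually)
    qed (auto simp: f_def)
    have L: "(\<lambda>n. integral\<^sup>L L (f n)) \<longlonglongrightarrow> measure L A" if L: "finite_measure L" "sets L = sets borel" for L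
    proof -
      interpret finite_measure L by (rule L)
      have "A \<in> sets L" using A L by auto
      have "(\<lambda>n. integral\<^sup>L L (f n)) \<longlonglongrightarrow> integral\<^sup>L L (indicator A)"
      proof (rule integral_dominated_convergence[where w="\<lambda>_. 1"])
        show "(indicator A :: 'a \<Rightarrow> real) \<in> borel_measurable L" using \<open>A \<in> sets L\<close> by measurable
        show "AE x in L. (\<lambda>i. f i x) \<longlonglongrightarrow> indicator A x" using lim by simp
        show "AE x in L. norm (f i x) \<le> 1" for i using f01[of i] by (auto simp: abs_le_iff intro: order_trans[of _ 0])
      qed (use f_meas L in auto)
      then show ?thesis using \<open>A \<in> sets L\<close> sets.sets_into_space[of A L] by (simp add: Int_absorb2)
    qed
    show ?thesis
      using LIMSEQ_unique[OF L[OF fin(1) sets(1)]] L[OF fin(2) sets(2)] eq[OF fc f01] by simp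
  qed
  show ?thesis
  proof (rule measure_eqI_generator_eq[where \<Omega>=UNIV and E="{A. closed A}" and A="\<lambda>_. UNIV"])
    show "Int_stable {A :: 'a set. closed A}" by (auto simp: Int_stable_def)
    show "sets M = sigma_sets UNIV {A. closed A}" "sets N = sigma_sets UNIV {A. closed A}"
      unfolding sets by (subst borel_eq_closed, simp)+
    show "emeasure M X = emeasure N X" if "X \<in> {A. closed A}" for X
      using closed_eq[of X] that by (cases "X = {}") (auto simp: M.emeasure_eq_measure N.emeasure_eq_measure)
  qed auto
qed

lemma measure_eqI_rectangles:
  assumes fin: "finite_measure M" and sets: "sets M = sets (A \<Otimes>\<^sub>M B)" "sets N = sets (A \<Otimes>\<^sub>M B)"
    and eq: "\<And>a b. a \<in> sets A \<Longrightarrow> b \<in> sets B \<Longrightarrow> emeasure M (a \<times> b) = emeasure N (a \<times> b)"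
  shows "M = N"
proof (rule measure_eqI_generator_eq[where \<Omega>="space A \<times> space B" and E="{a \<times> b |a b. a \<in> sets A \<and> b \<in> sets B}"
      and A="\<lambda>_. space A \<times> space B"])
  interpret finite_measure M by fact
  show "Int_stable {a \<times> b |a b. a \<in> sets A \<and> b \<in> sets B}" by (rule Int_stable_pair_measure_generator)
  show "{a \<times> b |a b. a \<in> sets A \<and> b \<in> sets B} \<subseteq> Pow (space A \<times> space B)"
    by (rule pair_measure_closed)
  show "sets M = sigma_sets (space A \<times> space B) {a \<times> b |a b. a \<in> sets A \<and> b \<in> sets B}"
    "sets N = sigma_sets (space A \<times> space B) {a \<times> b |a b. a \<in> sets A \<and> b \<in> sets B}"
    unfolding sets by (simp_all add: sets_pair_measure)
  show "emeasure M (space A \<times> space B) \<noteq> \<infinity>" by simp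
  show "emeasure M X = emeasure N X" if "X \<in> {a \<times> b |a b. a \<in> sets A \<and> b \<in> sets B}" for X
    using that eq by auto
qed auto

section \<open>Suprema as limits of maxima over refining grids\<close>

text \<open>Grid points lie in the interval, so grid maxima never exceed the supremum. Conversely, a
  value above \<open>c\<close> persists to the right and is seen by a fine grid. The right end has
  no right neighbourhood inside the interval, but as a multiple of \<open>h\<close> it is itself a
  grid point.\<close>

lemma grid_max_tendsto:
  assumes f: "cadlag f" and h: "0 < h" and ij: "i \<le> (j::nat)"
  shows "(\<lambda>n. Max ((\<lambda>k. f (real k * (h / 2 ^ n))) ` {i * 2 ^ n..j * 2 ^ n})) \<longlonglongrightarrow> (SUP s\<in>{real i * h..real j * h}. f s)"
proof (rule order_tendstoI)
  let ?a = "real i * h" and ?b = "real j * h"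
  have ab: "0 \<le> ?a" "?a \<le> ?b" using h ij by auto
  have mem: "real k * (h / 2 ^ n) \<in> {?a..?b}" if "k \<in> {i * 2 ^ n..j * 2 ^ n}" for k n
  proof -
    have "real (i * 2 ^ n) \<le> real k" "real k \<le> real (j * 2 ^ n)" using that by (simp_all only: of_nat_le_iff atLeastAtMost_iff)
    then have "real (i * 2 ^ n) * (h / 2 ^ n) \<le> real k * (h / 2 ^ n)" "real k * (h / 2 ^ n) \<le> real (j * 2 ^ n) * (h / 2 ^ n)"
      using h by (intro mult_right_mono; simp)+
    then show ?thesis by simp
  qed
  have ne: "{i * 2 ^ n..j * 2 ^ n} \<noteq> {}" for n using ij by simp
  fix c
  { assume c: "(SUP s\<in>{?a..?b}. f s) < c"
    have "Max ((\<lambda>k. f (real k * (h / 2 ^ n))) ` {i * 2 ^ n..j * 2 ^ n}) < c" for n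
    proof -
      have "f (real k * (h / 2 ^ n)) < c" if "k \<in> {i * 2 ^ n..j * 2 ^ n}" for k
        using SUP_cadlag_upper[OF f ab(1) mem[OF that]] c by linarith
      then show ?thesis using ne[of n] by (subst Max_less_iff) auto
    qed
    then show "\<forall>\<^sub>F n in sequentially. Max ((\<lambda>k. f (real k * (h / 2 ^ n))) ` {i * 2 ^ n..j * 2 ^ n}) < c" by simp }
  { assume "c < (SUP s\<in>{?a..?b}. f s)"
    then obtain u where u: "u \<in> {?a..?b}" "c < f u" using less_SUP_cadlag[OF f ab] by auto
    have "\<forall>\<^sub>F n in sequentially. \<exists>k\<in>{i * 2 ^ n..j * 2 ^ n}. c < f (real k * (h / 2 ^ n))"
    proof (cases "u = ?b")
      case True
      then have "c < f (real (j * 2 ^ n) * (h / 2 ^ n))" for n using u by simp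
      moreover have "j * 2 ^ n \<in> {i * 2 ^ n..j * 2 ^ n}" for n using ij by simp
      ultimately show ?thesis by (intro always_eventually allI) blast
    next
      case False
      then have ub: "u < ?b" "0 \<le> u" using u ab by auto
      have "\<forall>\<^sub>F s in at_right u. c < f s" using order_tendstoD(1)[OF cadlag_right[OF f ub(2)] u(2)] .
      then obtain d where d: "d > u" "\<And>s. u < s \<Longrightarrow> s < d \<Longrightarrow> c < f s"
        by (auto simp: eventually_at_right_field)
      have "(\<lambda>n. h * (1 / 2 ^ n)) \<longlonglongrightarrow> h * 0" by (intro tendsto_mult tendsto_const LIMSEQ_inverse_power2)
      then have "\<forall>\<^sub>F n in sequentially. h * (1 / 2 ^ n) < min (d - u) (?b - u)"
        using d ub by (intro order_tendstoD(2)) auto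
      then show ?thesis
      proof eventually_elim
        case (elim n)
        \<comment> \<open>First grid index strictly to the right of \<open>u\<close>.\<close>
        define k where "k = Suc (nat \<lfloor>u * 2 ^ n / h\<rfloor>)"
        have "0 \<le> u * 2 ^ n / h" using ub h by simp
        then have k': "u * 2 ^ n / h < real k" "real k \<le> u * 2 ^ n / h + 1" unfolding k_def by linarith+
        then have k: "u < real k * (h / 2 ^ n)" "real k * (h / 2 ^ n) \<le> u + h / 2 ^ n"
          using h by (simp_all add: field_simps)
        have kb: "real k * (h / 2 ^ n) < ?b" "real k * (h / 2 ^ n) < d" using k elim by auto
        have "real i * h < real k * (h / 2 ^ n)" using k u by auto
        then have "real (i * 2 ^ n) < real k" using h by (simp add: field_simps)
        moreover have "real k < real (j * 2 ^ n)" using kb(1) h by (simp add: field_simps)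
        ultimately have "k \<in> {i * 2 ^ n..j * 2 ^ n}" unfolding of_nat_less_iff by simp
        moreover have "c < f (real k * (h / 2 ^ n))" using d k kb by auto
        ultimately show ?case by blast
      qed
    qed
    then show "\<forall>\<^sub>F n in sequentially. c < Max ((\<lambda>k. f (real k * (h / 2 ^ n))) ` {i * 2 ^ n..j * 2 ^ n})"
      by eventually_elim (use ne in \<open>simp add: Max_gr_iff\<close>) }
qed

section \<open>Measurability of path functionals\<close>

text \<open>As for \<open>jump_process\<close>, no law is fixed: the locale is used with
  \<open>P\<close>, with a killed law \<open>M\<close>, and with the \<sigma>-algebra generated by
  the path of \<open>X\<close>.\<close>

locale cadlag_process =
  fixes N :: "'w measure" and X :: "real \<Rightarrow> 'w \<Rightarrow> real"
  assumes X_meas: "\<And>t. 0 \<le> t \<Longrightarrow> X t \<in> borel_measurable N"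
    and X_path: "\<And>\<omega>. \<omega> \<in> space N \<Longrightarrow> cadlag0 (\<lambda>t. X t \<omega>)"
begin

lemma X_cadlag: "\<omega> \<in> space N \<Longrightarrow> cadlag (\<lambda>t. X t \<omega>)"
  using X_path by (simp add: cadlag0_def)

lemma measurable_X_at:
  assumes "h \<in> K \<rightarrow>\<^sub>M N" "g \<in> borel_measurable K" "\<And>x. x \<in> space K \<Longrightarrow> 0 \<le> g x"
  shows "(\<lambda>x. X (g x) (h x)) \<in> borel_measurable K"
  using measurable_cadlag_at[OF X_meas X_cadlag assms] .

text \<open>Right continuity replaces times in the range by rational ones. The random right end
  remains as a separate sampling point because nothing beyond it belongs to the range.\<close>

lemma measurable_range_sup:
  assumes h: "h \<in> K \<rightarrow>\<^sub>M N" and g: "g \<in> borel_measurable K" "\<And>x. x \<in> space K \<Longrightarrow> r \<le> g x"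
    and r: "r \<in> \<rat>" "0 \<le> r"
  shows "(\<lambda>x. SUP s\<in>{r..g x}. X s (h x)) \<in> borel_measurable K"
proof (rule borel_measurableI_greater)
  fix c
  have [measurable]: "(\<lambda>x. X (g x) (h x)) \<in> borel_measurable K"
    using g r by (intro measurable_X_at[OF h]) force+
  have Xq: "(\<lambda>x. X q (h x)) \<in> borel_measurable K" if "0 \<le> q" for q
    using that by (intro measurable_compose[OF h X_meas])
  note [measurable] = g(1)
  have iff: "c < (SUP s\<in>{r..g x}. X s (h x)) \<longleftrightarrow> c < X (g x) (h x) \<or> (\<exists>q\<in>\<rat> \<inter> {r..}. q < g x \<and> c < X q (h x))"
    if x: "x \<in> space K" for x
  proof -
    have cad: "cadlag (\<lambda>t. X t (h x))" using X_cadlag measurable_space[OF h x] by blast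
    have "c < (SUP s\<in>{r..g x}. X s (h x)) \<longleftrightarrow> (\<exists>u\<in>{r..g x}. c < X u (h x))"
      by (rule less_SUP_cadlag[OF cad r(2) g(2)[OF x]])
    also have "\<dots> \<longleftrightarrow> c < X (g x) (h x) \<or> (\<exists>q\<in>\<rat> \<inter> {r..}. q < g x \<and> c < X q (h x))"
    proof
      assume "\<exists>u\<in>{r..g x}. c < X u (h x)"
      then obtain u where u: "r \<le> u" "u \<le> g x" "c < X u (h x)" by auto
      show "c < X (g x) (h x) \<or> (\<exists>q\<in>\<rat> \<inter> {r..}. q < g x \<and> c < X q (h x))"
      proof (cases "u = g x")
        case False
        then have "u < g x" using u by simp
        moreover have "\<forall>\<^sub>F s in at_right u. c < X s (h x)"
          using order_tendstoD(1)[OF cadlag_right[OF cad, of u]] u r by auto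
        ultimately obtain q where "q \<in> \<rat>" "u < q" "q < g x" "c < X q (h x)" using exists_rat_right by blast
        then show ?thesis using u by (intro disjI2 bexI[of _ q]) auto
      qed (use u in auto)
    qed (use g(2)[OF x] in \<open>auto intro: less_imp_le\<close>)
    finally show ?thesis .
  qed
  have "{x\<in>space K. c < (SUP s\<in>{r..g x}. X s (h x))} =
      {x\<in>space K. c < X (g x) (h x)} \<union> (\<Union>q\<in>\<rat> \<inter> {r..}. {x\<in>space K. q < g x \<and> c < X q (h x)})"
    using iff by blast
  also have "\<dots> \<in> sets K"
  proof (intro sets.Un sets.countable_UN'')
    show "countable (\<rat> \<inter> {r..})" using countable_rat by (rule countable_subset[rotated]) auto
    fix q assume "q \<in> \<rat> \<inter> {r..}"
    then have [measurable]: "(\<lambda>x. X q (h x)) \<in> borel_measurable K" using Xq r by auto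
    show "{x\<in>space K. q < g x \<and> c < X q (h x)} \<in> sets K" by measurable
  qed measurable
  finally show "{x\<in>space K. c < (SUP s\<in>{r..g x}. X s (h x))} \<in> sets K" .
qed

lemma measurable_run_sup:
  assumes "h \<in> K \<rightarrow>\<^sub>M N" "g \<in> borel_measurable K" "\<And>x. x \<in> space K \<Longrightarrow> 0 \<le> g x"
  shows "(\<lambda>x. run_sup (\<lambda>t. X t (h x)) (g x)) \<in> borel_measurable K"
  unfolding run_sup_def by (rule measurable_range_sup[OF assms]) auto

lemma measurable_sup_time:
  assumes h: "h \<in> K \<rightarrow>\<^sub>M N" and g: "g \<in> borel_measurable K" "\<And>x. x \<in> space K \<Longrightarrow> 0 \<le> g x"
  shows "(\<lambda>x. sup_time (\<lambda>t. X t (h x)) (g x)) \<in> borel_measurable K"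
proof (rule borel_measurableI_le)
  fix s
  show "{x\<in>space K. sup_time (\<lambda>t. X t (h x)) (g x) \<le> s} \<in> sets K"
  proof (cases "0 \<le> s")
    case True
    \<comment> \<open>For \<open>s\<close> beyond \<open>g x\<close> both sides are true; the
      \<open>min\<close> makes the comparison uniform in \<open>x\<close>.\<close>
    have "sup_time (\<lambda>t. X t (h x)) (g x) \<le> s \<longleftrightarrow>
        run_sup (\<lambda>t. X t (h x)) (min s (g x)) = run_sup (\<lambda>t. X t (h x)) (g x)" if x: "x \<in> space K" for x
    proof -
      interpret cadlag0 "\<lambda>t. X t (h x)" using X_path measurable_space[OF h x] by blast
      show ?thesis using sup_time_le_iff[OF True, of "g x"] sup_time_le_t[OF g(2)[OF x]]
        by (cases "s \<le> g x") (auto simp: min_def)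
    qed
    then have "{x\<in>space K. sup_time (\<lambda>t. X t (h x)) (g x) \<le> s} = {x\<in>space K.
        run_sup (\<lambda>t. X t (h x)) (min s (g x)) = run_sup (\<lambda>t. X t (h x)) (g x)}" by blast
    also have "\<dots> \<in> sets K"
      using True g by (intro borel_measurable_eq measurable_run_sup[OF h]) auto
    finally show ?thesis .
  next
    case False
    have "\<not> sup_time (\<lambda>t. X t (h x)) (g x) \<le> s" if x: "x \<in> space K" for x
    proof -
      interpret cadlag0 "\<lambda>t. X t (h x)" using X_path measurable_space[OF h x] by blast
      show ?thesis using sup_time_nonneg[OF g(2)[OF x]] False by linarith
    qed
    then have "{x\<in>space K. sup_time (\<lambda>t. X t (h x)) (g x) \<le> s} = {}" by blast
    then show ?thesis by (simp only: sets.empty_sets)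
  qed
qed

end

lemma cadlag0_uminus: "cadlag0 f \<Longrightarrow> cadlag0 (\<lambda>t. - f t)"
  by (simp add: cadlag0_def cadlag_uminus)

lemma (in cadlag_process) cadlag_process_uminus: "cadlag_process N (\<lambda>t \<omega>. - X t \<omega>)"
  by (intro cadlag_process.intro borel_measurable_uminus X_meas cadlag0_uminus X_path)

context cadlag_process begin

lemma measurable_range_inf:
  assumes "h \<in> K \<rightarrow>\<^sub>M N" "g \<in> borel_measurable K" "\<And>x. x \<in> space K \<Longrightarrow> r \<le> g x" "r \<in> \<rat>" "0 \<le> r"
  shows "(\<lambda>x. INF s\<in>{r..g x}. X s (h x)) \<in> borel_measurable K"
  unfolding INF_eq_uminus_SUP
  by (intro borel_measurable_uminus cadlag_process.measurable_range_sup[OF cadlag_process_uminus] assms)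

lemma measurable_run_inf:
  assumes "h \<in> K \<rightarrow>\<^sub>M N" "g \<in> borel_measurable K" "\<And>x. x \<in> space K \<Longrightarrow> 0 \<le> g x"
  shows "(\<lambda>x. run_inf (\<lambda>t. X t (h x)) (g x)) \<in> borel_measurable K"
  unfolding run_inf_def by (rule measurable_range_inf[OF assms]) auto

lemma measurable_inf_time:
  assumes h: "h \<in> K \<rightarrow>\<^sub>M N" and g: "g \<in> borel_measurable K" "\<And>x. x \<in> space K \<Longrightarrow> 0 \<le> g x"
  shows "(\<lambda>x. inf_time (\<lambda>t. X t (h x)) (g x)) \<in> borel_measurable K"
proof (rule borel_measurableI_less)
  fix s
  let ?i = "\<lambda>x. inf_time (\<lambda>t. X t (h x)) (g x)"
  \<comment> \<open>The \<open>max\<close> keeps the interval nonempty also where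
    \<open>g x < r\<close>, so that the infimum is a measurable function of every \<open>x\<close>;
    the condition \<open>r \<le> g x\<close> discards those points afterwards.\<close>
  let ?C = "\<lambda>r x. run_inf (\<lambda>t. X t (h x)) (g x) < (INF u\<in>{r..max r (g x)}. X u (h x))"
  have iff: "?i x < s \<longleftrightarrow> g x < s \<or> (\<exists>r\<in>\<rat> \<inter> {0..<s}. r \<le> g x \<and> ?C r x)" if x: "x \<in> space K" for x
  proof -
    interpret cadlag0 "\<lambda>t. X t (h x)" using X_path measurable_space[OF h x] by blast
    have i: "0 \<le> ?i x" "?i x \<le> g x" using inf_time_nonneg inf_time_le_t g(2)[OF x] by auto
    show ?thesis
    proof
      assume "?i x < s"
      show "g x < s \<or> (\<exists>r\<in>\<rat> \<inter> {0..<s}. r \<le> g x \<and> ?C r x)"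
      proof (cases "g x < s")
        case False
        obtain r where r: "r \<in> \<rat>" "?i x < r" "r < s" using Rats_dense_in_real[OF \<open>?i x < s\<close>] by auto
        then show ?thesis using run_inf_less_INF[of r "g x"] False i
          by (intro disjI2 bexI[of _ r]) (auto simp: max_def)
      qed simp
    next
      assume "g x < s \<or> (\<exists>r\<in>\<rat> \<inter> {0..<s}. r \<le> g x \<and> ?C r x)"
      then show "?i x < s" using i inf_time_le[of _ "g x"] by (auto simp: max_def) (meson le_less_trans)
    qed
  qed
  note [measurable] = g(1) measurable_run_inf[OF h g]
  have "{x\<in>space K. ?i x < s} = {x\<in>space K. g x < s} \<union> (\<Union>r\<in>\<rat> \<inter> {0..<s}. {x\<in>space K. r \<le> g x \<and> ?C r x})"
    using iff by blast
  also have "\<dots> \<in> sets K"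
  proof (intro sets.Un sets.countable_UN'')
    show "countable (\<rat> \<inter> {0..<s})" using countable_rat by (rule countable_subset[rotated]) auto
    fix r assume "r \<in> \<rat> \<inter> {0..<s}"
    then have [measurable]: "(\<lambda>x. INF u\<in>{r..max r (g x)}. X u (h x)) \<in> borel_measurable K"
      using g(1) by (intro measurable_range_inf[OF h]) auto
    show "{x\<in>space K. r \<le> g x \<and> ?C r x} \<in> sets K" by measurable
  qed measurable
  finally show "{x\<in>space K. ?i x < s} \<in> sets K" .
qed

end

lemma cadlag_const_diff: "cadlag f \<Longrightarrow> cadlag (\<lambda>s. c - f s)"
  unfolding cadlag_def
proof (elim conjE, intro conjI allI impI)
  fix t :: real
  assume r: "\<forall>t\<ge>0. continuous (at_right t) f" and l: "\<forall>t>0. \<exists>l. (f \<longlongrightarrow> l) (at_left t)"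
  show "continuous (at_right t) (\<lambda>s. c - f s)" if "0 \<le> t"
    by (rule continuous_diff[OF continuous_const r[rule_format, OF that]])
  show "\<exists>l. ((\<lambda>s. c - f s) \<longlongrightarrow> l) (at_left t)" if "0 < t"
    using l[rule_format, OF that] tendsto_diff[OF tendsto_const[of c]] by blast
qed

section \<open>Increments of a Levy process on a grid\<close>

locale levy = prob_space P for P :: "'w measure" +
  fixes X :: "real \<Rightarrow> 'w \<Rightarrow> real"
  assumes levy: "levy_process P X"
begin

sublocale cadlag_process P X
  using levy by unfold_locales (auto simp: levy_process_def cadlag0_def)

lemma X_0: "\<omega> \<in> space P \<Longrightarrow> X 0 \<omega> = 0"
  using levy by (auto simp: levy_process_def)

text \<open>The constant \<open>c\<close> is a drift removed at each step: 0 for the reversal at a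
  fixed time, and a small positive multiple of the mesh for the tilted maximum.\<close>

definition incr :: "real \<Rightarrow> real \<Rightarrow> nat \<Rightarrow> 'w \<Rightarrow> real" where
  "incr h c l \<omega> = X (real (Suc l) * h) \<omega> - X (real l * h) \<omega> - c"

text \<open>\<open>levy_process\<close> grants independence of finite initial blocks. Independence
  of the whole sequence is tested on finite index sets, each of which lies in such a block.\<close>

lemma iid_incr:
  assumes h: "0 \<le> h" shows "iid_sequence P (incr h c)"
proof
  define D where "D l \<omega> = X (real (Suc l) * h) \<omega> - X (real l * h) \<omega>" for l \<omega>
  have inc: "incseq (\<lambda>l. real l * h)" using h by (auto simp: incseq_def intro!: mult_right_mono)
  have "indep_vars (\<lambda>_. borel) D {..<m}" for m
  proof -
    have "\<forall>ts m. 0 \<le> ts 0 \<longrightarrow> incseq ts \<longrightarrow>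
        indep_vars (\<lambda>_. borel) (\<lambda>l \<omega>. X (ts (Suc l)) \<omega> - X (ts l) \<omega>) {..<m::nat}"
      using levy unfolding levy_process_def by blast
    from this[rule_format, of "\<lambda>l. real l * h", OF _ inc] show ?thesis by (simp add: D_def[abs_def])
  qed
  note D = this
  have "indep_vars (\<lambda>_. borel) D UNIV"
    unfolding indep_vars_def
  proof (intro conjI ballI)
    show "random_variable borel (D i)" for i
      using D[of "Suc i"] by (auto simp: indep_vars_def)
    show "indep_sets (\<lambda>i. sigma_sets (space P) {D i -` A \<inter> space P |A. A \<in> sets borel}) UNIV"
    proof (subst indep_sets_finite_index_sets, intro allI impI)
      fix J :: "nat set" assume "J \<subseteq> UNIV" "J \<noteq> {}" "finite J"
      then obtain m where "J \<subseteq> {..<m}" using finite_nat_set_iff_bounded by (metis lessThan_iff subsetI)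
      moreover have "indep_sets (\<lambda>i. sigma_sets (space P) {D i -` A \<inter> space P |A. A \<in> sets borel}) {..<m}"
        using D[of m] unfolding indep_vars_def by blast
      ultimately show "indep_sets (\<lambda>i. sigma_sets (space P) {D i -` A \<inter> space P |A. A \<in> sets borel}) J"
        by (rule indep_sets_mono_index)
    qed
  qed
  from indep_vars_compose2[OF this, of "\<lambda>_ x. x - c" "\<lambda>_. borel"]
  show "indep_vars (\<lambda>_. borel) (incr h c) UNIV" by (simp add: incr_def[abs_def] D_def)
  have D_meas: "D l \<in> borel_measurable P" for l using D[of "Suc l"] by (auto simp: indep_vars_def)
  have "distr P borel (D l) = distr P borel (X h)" for l
  proof -
    have "\<forall>s t. 0 \<le> s \<longrightarrow> s \<le> t \<longrightarrow> distr P borel (\<lambda>\<omega>. X t \<omega> - X s \<omega>) = distr P borel (X (t - s))"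
      using levy unfolding levy_process_def by blast
    from this[rule_format, of "real l * h" "real (Suc l) * h"] h
    show ?thesis by (simp add: D_def[abs_def] algebra_simps)
  qed
  then have "distr (distr P borel (D l)) borel (\<lambda>x. x - c) = distr (distr P borel (D 0)) borel (\<lambda>x. x - c)" for l by simp
  moreover have "distr P borel (incr h c l) = distr (distr P borel (D l)) borel (\<lambda>x. x - c)" for l
    using D_meas[of l] by (subst distr_distr) (auto simp: o_def incr_def[abs_def] D_def)
  ultimately show "distr P borel (incr h c l) = distr P borel (incr h c 0)" for l by simp
qed

lemma walk_incr:
  assumes "0 \<le> h" "\<omega> \<in> space P"
  shows "iid_sequence.walk (incr h c) k \<omega> = X (real k * h) \<omega> - real k * c"
proof -
  interpret iid_sequence P "incr h c" by (rule iid_incr[OF assms(1)])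
  show ?thesis unfolding walk_def
    by (induction k) (auto simp: incr_def X_0[OF assms(2)] algebra_simps)
qed

section \<open>Time reversal at a fixed time\<close>

text \<open>Reversing the order of the increments sends the path to \<open>X t\<close> minus its
  left limits at \<open>t - s\<close>, so suprema over an initial piece become \<open>X t\<close>
  minus infima over a final piece. On each grid this is exchangeability, and refining the grid
  yields suprema and infima of the path. The split point is a fraction of \<open>t\<close> so that
  it belongs to every grid.\<close>

lemma path_reversal:
  fixes p q :: nat
  assumes t: "0 < t" and pq: "p \<le> q" "0 < q"
  defines "h \<equiv> t / real q"
  shows "distr P borel (\<lambda>\<omega>. (SUP s\<in>{0..real (q - p) * h}. X s \<omega>, run_sup (\<lambda>s. X s \<omega>) t, X t \<omega>)) =
    distr P borel (\<lambda>\<omega>. (X t \<omega> - (INF s\<in>{real p * h..t}. X s \<omega>), X t \<omega> - run_inf (\<lambda>s. X s \<omega>) t, X t \<omega>))"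
    (is "distr P borel ?U = distr P borel ?V")
    and "(\<lambda>\<omega>. (SUP s\<in>{0..real (q - p) * h}. X s \<omega>, run_sup (\<lambda>s. X s \<omega>) t, X t \<omega>)) \<in> borel_measurable P"
    and "(\<lambda>\<omega>. (X t \<omega> - (INF s\<in>{real p * h..t}. X s \<omega>), X t \<omega> - run_inf (\<lambda>s. X s \<omega>) t, X t \<omega>)) \<in> borel_measurable P"
proof -
  have h: "h > 0" "real q * h = t" using t pq by (auto simp: h_def)
  define \<eta> where "\<eta> n = incr (h / 2 ^ n) 0" for n
  define K N where "K n = (q - p) * 2 ^ n" and "N n = q * 2 ^ n" for n :: nat
  have KN: "K n \<le> N n" "N n > 0" "real (N n) * (h / 2 ^ n) = t" for n
    using pq h by (auto simp: K_def N_def)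
  define G where "G n x = (Max ((\<lambda>k. \<Sum>i<k. x i) ` {0..K n}), Max ((\<lambda>k. \<Sum>i<k. x i) ` {0..N n}), \<Sum>i<N n. x i)"
    for n and x :: "nat \<Rightarrow> real"
  \<comment> \<open>Reverses the \<open>N n\<close> increments of the grid; the index
    \<open>N n\<close> only completes the index set \<open>{..N n}\<close> and stays fixed.\<close>
  define \<pi> where "\<pi> n i = (if i < N n then N n - 1 - i else N n)" for n i
  have inj: "inj_on (\<pi> n) {..N n}" for n by (auto simp: inj_on_def \<pi>_def split: if_splits)
  define A where "A n \<omega> = (Max ((\<lambda>k. X (real k * (h / 2 ^ n)) \<omega>) ` {0 * 2 ^ n..(q - p) * 2 ^ n}),
      Max ((\<lambda>k. X (real k * (h / 2 ^ n)) \<omega>) ` {0 * 2 ^ n..q * 2 ^ n}), X t \<omega>)" for n \<omega>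
  define B where "B n \<omega> = (Max ((\<lambda>k. X t \<omega> - X (real k * (h / 2 ^ n)) \<omega>) ` {p * 2 ^ n..q * 2 ^ n}),
      Max ((\<lambda>k. X t \<omega> - X (real k * (h / 2 ^ n)) \<omega>) ` {0 * 2 ^ n..q * 2 ^ n}), X t \<omega>)" for n \<omega>
  have A_eq: "G n (\<lambda>l\<in>{..N n}. \<eta> n l \<omega>) = A n \<omega>" if \<omega>: "\<omega> \<in> space P" for n \<omega>
  proof -
    interpret iid_sequence P "\<eta> n" unfolding \<eta>_def using h by (intro iid_incr) auto
    have "(\<Sum>i<k. (\<lambda>l\<in>{..N n}. \<eta> n l \<omega>) i) = X (real k * (h / 2 ^ n)) \<omega>" if "k \<le> N n" for k
    proof -
      have "(\<Sum>i<k. (\<lambda>l\<in>{..N n}. \<eta> n l \<omega>) i) = walk k \<omega>"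
        unfolding walk_def using that by (intro sum.cong) auto
      also have "\<dots> = X (real k * (h / 2 ^ n)) \<omega>"
        unfolding \<eta>_def using walk_incr[of "h / 2 ^ n" \<omega> 0 k] h \<omega> by simp
      finally show ?thesis .
    qed
    note s = this
    show ?thesis unfolding G_def A_def using s[of "N n"] KN(1)[of n] KN(3)[of n]
      by (intro arg_cong2[where f=Pair] arg_cong[where f=Max] image_cong s)
        (use order_trans[OF _ KN(1)[of n]] in \<open>auto simp: K_def N_def\<close>)
  qed
  have B_eq: "G n (\<lambda>l\<in>{..N n}. \<eta> n (\<pi> n l) \<omega>) = B n \<omega>" if \<omega>: "\<omega> \<in> space P" for n \<omega>
  proof -
    let ?x = "\<lambda>k. X (real k * (h / 2 ^ n)) \<omega>"
    have s: "(\<Sum>i<k. (\<lambda>l\<in>{..N n}. \<eta> n (\<pi> n l) \<omega>) i) = X t \<omega> - ?x (N n - k)" if k: "k \<le> N n" for k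
    proof -
      have "(\<Sum>i<k. (\<lambda>l\<in>{..N n}. \<eta> n (\<pi> n l) \<omega>) i) = (\<Sum>i<k. ?x (N n - i) - ?x (N n - Suc i))"
      proof (rule sum.cong)
        fix i assume i: "i \<in> {..<k}"
        then have "Suc (N n - Suc i) = N n - i" using k by auto
        then show "(\<lambda>l\<in>{..N n}. \<eta> n (\<pi> n l) \<omega>) i = ?x (N n - i) - ?x (N n - Suc i)"
          using i k by (simp add: \<pi>_def \<eta>_def incr_def del: of_nat_Suc)
      qed simp
      also have "\<dots> = ?x (N n - 0) - ?x (N n - k)" by (rule sum_lessThan_telescope')
      finally show ?thesis using KN(3)[of n] by simp
    qed
    have im: "(\<lambda>k. \<Sum>i<k. (\<lambda>l\<in>{..N n}. \<eta> n (\<pi> n l) \<omega>) i) ` {0..L} = (\<lambda>k. X t \<omega> - ?x k) ` {N n - L..N n}" if "L \<le> N n" for L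
    proof -
      have "(\<lambda>k. \<Sum>i<k. (\<lambda>l\<in>{..N n}. \<eta> n (\<pi> n l) \<omega>) i) ` {0..L} = (\<lambda>k. X t \<omega> - ?x (N n - k)) ` {0..L}"
        using that by (intro image_cong s) auto
      also have "\<dots> = (\<lambda>k. X t \<omega> - ?x k) ` ((\<lambda>k. N n - k) ` {0..L})" by (simp add: image_image)
      also have "(\<lambda>k. N n - k) ` {0..L} = {N n - L..N n}"
      proof (intro set_eqI iffI)
        fix k assume "k \<in> {N n - L..N n}"
        then have "k = N n - (N n - k)" "N n - k \<in> {0..L}" using that by auto
        then show "k \<in> (\<lambda>k. N n - k) ` {0..L}" by blast
      qed auto
      finally show ?thesis .
    qed
    \<comment> \<open>The initial indices up to \<open>K n\<close> are sent to those from
      \<open>N n - K n\<close> on, that is, to the times from \<open>p * h\<close> on.\<close>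
    have "N n - K n = p * 2 ^ n" using pq by (simp add: K_def N_def flip: diff_mult_distrib)
    then show ?thesis unfolding G_def B_def using im[OF KN(1)[of n]] im[of "N n"] s[of "N n"] X_0[OF \<omega>]
      by (simp add: N_def)
  qed
  have A_lim: "(\<lambda>n. A n \<omega>) \<longlonglongrightarrow> ?U \<omega>" if "\<omega> \<in> space P" for \<omega>
    using grid_max_tendsto[OF X_cadlag[OF that] h(1), of 0 "q - p"] grid_max_tendsto[OF X_cadlag[OF that] h(1), of 0 q] h(2)
    unfolding A_def run_sup_def by (intro tendsto_Pair tendsto_const) auto
  have B_lim: "(\<lambda>n. B n \<omega>) \<longlonglongrightarrow> ?V \<omega>" if \<omega>: "\<omega> \<in> space P" for \<omega>
  proof -
    have cad: "cadlag (\<lambda>s. X t \<omega> - X s \<omega>)"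
      using X_cadlag[OF \<omega>] by (rule cadlag_const_diff)
    have sup: "(SUP s\<in>{a..b}. X t \<omega> - X s \<omega>) = X t \<omega> - (INF s\<in>{a..b}. X s \<omega>)" if ab: "0 \<le> a" "a \<le> b" for a b
    proof (rule antisym)
      interpret cadlag0 "\<lambda>s. X s \<omega>" by (rule X_path[OF \<omega>])
      have bdd: "bdd_below ((\<lambda>s. X s \<omega>) ` {a..b})"
        using cadlag_bdd_above[OF cadlag_uminus[OF cadlag] ab(1), of b] bdd_above_uminus[of "(\<lambda>s. X s \<omega>) ` {a..b}"]
        by (simp add: image_image)
      show "(SUP s\<in>{a..b}. X t \<omega> - X s \<omega>) \<le> X t \<omega> - (INF s\<in>{a..b}. X s \<omega>)"
        using ab bdd by (intro cSUP_least) (auto intro!: cINF_lower)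
      have "X t \<omega> - (SUP s\<in>{a..b}. X t \<omega> - X s \<omega>) \<le> (INF s\<in>{a..b}. X s \<omega>)"
        using ab SUP_cadlag_upper[OF cad ab(1), of _ b] by (intro cINF_greatest) (auto simp: algebra_simps)
      then show "X t \<omega> - (INF s\<in>{a..b}. X s \<omega>) \<le> (SUP s\<in>{a..b}. X t \<omega> - X s \<omega>)" by simp
    qed
    have "real p * h \<le> t" using h pq by (metis less_eq_real_def mult_right_mono of_nat_le_iff)
    then show ?thesis
      using grid_max_tendsto[OF cad h(1), of p q] grid_max_tendsto[OF cad h(1), of 0 q] pq h t
        sup[of "real p * h" t] sup[of 0 t]
      unfolding B_def run_inf_def by (intro tendsto_Pair tendsto_const) auto
  qed
  have A_meas: "A n \<in> borel_measurable P" and B_meas: "B n \<in> borel_measurable P" for n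
    unfolding A_def B_def using h(1) t
    by (intro borel_measurable_Pair borel_measurable_Max borel_measurable_diff X_meas; simp)+
  show U_meas: "?U \<in> borel_measurable P" by (rule borel_measurable_LIMSEQ_metric[OF A_meas A_lim])
  show V_meas: "?V \<in> borel_measurable P" by (rule borel_measurable_LIMSEQ_metric[OF B_meas B_lim])
  show "distr P borel ?U = distr P borel ?V"
  proof (rule measure_eqI_continuous)
    show "finite_measure (distr P borel ?U)" "finite_measure (distr P borel ?V)"
      using U_meas V_meas by (auto intro!: finite_measure_distr)
    fix f :: "real \<times> real \<times> real \<Rightarrow> real"
    assume f: "continuous_on UNIV f" and f01: "\<And>x. 0 \<le> f x \<and> f x \<le> 1"
    have f_meas [measurable]: "f \<in> borel_measurable borel" by (rule borel_measurable_continuous_onI[OF f])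
    have G_meas: "G n \<in> borel_measurable (PiM {..N n} (\<lambda>_. borel))" for n
    proof -
      have s: "(\<lambda>x. \<Sum>i<k. x i) \<in> borel_measurable (PiM {..N n} (\<lambda>_. borel :: real measure))" if k: "k \<le> N n" for k
        using k by (intro borel_measurable_sum measurable_component_singleton) auto
      show ?thesis unfolding G_def using KN(1)[of n]
        by (intro borel_measurable_Pair borel_measurable_Max s) auto
    qed
    have eq: "(\<integral>\<omega>. f (A n \<omega>) \<partial>P) = (\<integral>\<omega>. f (B n \<omega>) \<partial>P)" for n
    proof -
      interpret iid_sequence P "\<eta> n" unfolding \<eta>_def using h by (intro iid_incr) auto
      have "(\<integral>\<omega>. f (A n \<omega>) \<partial>P) = (\<integral>\<omega>. f (G n (\<lambda>l\<in>{..N n}. \<eta> n l \<omega>)) \<partial>P)"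
        by (intro Bochner_Integration.integral_cong) (simp_all only: A_eq)
      also have "\<dots> = (\<integral>\<omega>. f (G n (\<lambda>l\<in>{..N n}. \<eta> n (\<pi> n l) \<omega>)) \<partial>P)"
        by (rule exchangeable_integral[OF inj, symmetric]) (rule measurable_compose[OF G_meas f_meas])
      also have "\<dots> = (\<integral>\<omega>. f (B n \<omega>) \<partial>P)"
        by (intro Bochner_Integration.integral_cong) (simp_all only: B_eq)
      finally show ?thesis .
    qed
    have lim: "(\<lambda>n. \<integral>\<omega>. f (C n \<omega>) \<partial>P) \<longlonglongrightarrow> (\<integral>\<omega>. f (D \<omega>) \<partial>P)"
      if C: "\<And>n. C n \<in> borel_measurable P" "D \<in> borel_measurable P" "\<And>\<omega>. \<omega> \<in> space P \<Longrightarrow> (\<lambda>n. C n \<omega>) \<longlonglongrightarrow> D \<omega>" for C D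
    proof (rule integral_dominated_convergence[where w="\<lambda>_. 1"])
      show "AE \<omega> in P. (\<lambda>n. f (C n \<omega>)) \<longlonglongrightarrow> f (D \<omega>)"
        by (intro AE_I2 continuous_on_tendsto_compose[OF f] C(3)) auto
      show "AE \<omega> in P. norm (f (C n \<omega>)) \<le> 1" for n using f01 by auto
    qed (use C in measurable)
    have "(\<integral>\<omega>. f (?U \<omega>) \<partial>P) = (\<integral>\<omega>. f (?V \<omega>) \<partial>P)"
      using LIMSEQ_unique[OF lim[OF A_meas U_meas A_lim, unfolded eq] lim[OF B_meas V_meas B_lim]] .
    then show "integral\<^sup>L (distr P borel ?U) f = integral\<^sup>L (distr P borel ?V) f"
      using U_meas V_meas by (simp add: integral_distr)
  qed simp_all
qed

text \<open>Reversal turns the event that the infimum over \<open>{r..t}\<close> exceeds the overall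
  infimum into the event that the supremum over \<open>{0..t - r}\<close> stays below the overall
  supremum, which is \<open>t - sup_time < r\<close>. The former event only brackets
  \<open>inf_time < r\<close>, so a bound \<open>s\<close> is reached through fractions
  \<open>r\<close> of \<open>t\<close> increasing to \<open>s\<close>.\<close>

theorem inf_sup_duality:
  assumes t: "0 < t"
  shows "distr P (borel \<Otimes>\<^sub>M borel) (\<lambda>\<omega>. (inf_time (\<lambda>s. X s \<omega>) t, run_inf (\<lambda>s. X s \<omega>) t)) =
    distr P (borel \<Otimes>\<^sub>M borel) (\<lambda>\<omega>. (t - sup_time (\<lambda>s. X s \<omega>) t, X t \<omega> - run_sup (\<lambda>s. X s \<omega>) t))"
proof -
  let ?i = "\<lambda>\<omega>. inf_time (\<lambda>s. X s \<omega>) t" and ?I = "\<lambda>\<omega>. run_inf (\<lambda>s. X s \<omega>) t"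
    and ?s = "\<lambda>\<omega>. sup_time (\<lambda>s. X s \<omega>) t" and ?S = "\<lambda>\<omega>. run_sup (\<lambda>s. X s \<omega>) t"
  have [measurable]: "?i \<in> borel_measurable P" "?I \<in> borel_measurable P" "?s \<in> borel_measurable P" "?S \<in> borel_measurable P"
    "X t \<in> borel_measurable P"
    using t measurable_inf_time[of "\<lambda>\<omega>. \<omega>" P "\<lambda>_. t"] measurable_run_inf[of "\<lambda>\<omega>. \<omega>" P "\<lambda>_. t"]
      measurable_sup_time[of "\<lambda>\<omega>. \<omega>" P "\<lambda>_. t"] measurable_run_sup[of "\<lambda>\<omega>. \<omega>" P "\<lambda>_. t"] by (auto intro: X_meas)
  have grid: "prob {\<omega>\<in>space P. ?I \<omega> < (INF u\<in>{real p * (t / real q)..t}. X u \<omega>) \<and> ?I \<omega> \<in> B} =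
      prob {\<omega>\<in>space P. t - ?s \<omega> < real p * (t / real q) \<and> X t \<omega> - ?S \<omega> \<in> B}"
    if B[measurable]: "B \<in> sets borel" and pq: "p \<le> q" "0 < q" for B p q
  proof -
    define h where "h = t / real q"
    have h: "real q * h = t" "h > 0" using t pq by (auto simp: h_def)
    then have tr: "real (q - p) * h = t - real p * h" "0 \<le> t - real p * h" "t - real p * h \<le> t"
      using pq by (auto simp: of_nat_diff algebra_simps)
    let ?U = "\<lambda>\<omega>. (SUP s\<in>{0..real (q - p) * h}. X s \<omega>, ?S \<omega>, X t \<omega>)"
    let ?V = "\<lambda>\<omega>. (X t \<omega> - (INF s\<in>{real p * h..t}. X s \<omega>), X t \<omega> - ?I \<omega>, X t \<omega>)"
    have m: "?U \<in> borel_measurable P" "?V \<in> borel_measurable P"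
      using path_reversal(2,3)[OF t pq] unfolding h_def by simp_all
    define E where "E = {x :: real \<times> real \<times> real. fst x < fst (snd x) \<and> snd (snd x) - fst (snd x) \<in> B}"
    have "{x\<in>space (borel \<Otimes>\<^sub>M borel \<Otimes>\<^sub>M borel :: (real \<times> real \<times> real) measure). fst x < fst (snd x) \<and> snd (snd x) - fst (snd x :: real \<times> real) \<in> B}
        \<in> sets (borel \<Otimes>\<^sub>M borel \<Otimes>\<^sub>M borel)" by measurable
    then have E: "E \<in> sets borel" unfolding E_def borel_prod by simp
    have "measure (distr P borel ?U) E = measure (distr P borel ?V) E"
      using path_reversal(1)[OF t pq] unfolding h_def by simp
    then have "prob (?U -` E \<inter> space P) = prob (?V -` E \<inter> space P)"
      by (simp add: measure_distr m E)
    moreover have "?U -` E \<inter> space P = {\<omega>\<in>space P. t - ?s \<omega> < real p * h \<and> X t \<omega> - ?S \<omega> \<in> B}"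
    proof -
      have "(SUP s\<in>{0..real (q - p) * h}. X s \<omega>) < ?S \<omega> \<longleftrightarrow> t - ?s \<omega> < real p * h" if "\<omega> \<in> space P" for \<omega>
        using cadlag0.less_sup_time_iff[OF X_path[OF that] tr(2,3)] unfolding tr(1) run_sup_def by auto
      then show ?thesis by (auto simp: E_def)
    qed
    moreover have "?V -` E \<inter> space P = {\<omega>\<in>space P. ?I \<omega> < (INF u\<in>{real p * h..t}. X u \<omega>) \<and> ?I \<omega> \<in> B}"
      by (auto simp: E_def)
    ultimately show ?thesis by (simp add: h_def)
  qed
  have fraction: "\<exists>P Q :: nat \<Rightarrow> nat. (\<forall>m. P m \<le> Q m \<and> 0 < Q m \<and> real (P m) * (t / real (Q m)) < s) \<and>
      (\<lambda>m. real (P m) * (t / real (Q m))) \<longlonglongrightarrow> s" if s: "0 < s" "s \<le> t" for s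
  proof -
    \<comment> \<open>The largest integer strictly below \<open>s / t * 2 ^ m\<close>; the ceiling
      minus one keeps the fraction strictly below \<open>s\<close> even when \<open>s\<close> is
      itself a dyadic fraction of \<open>t\<close>.\<close>
    define p where "p m = nat (\<lceil>s / t * 2 ^ m\<rceil> - 1)" for m
    have p: "real (p m) < s / t * 2 ^ m" "s / t * 2 ^ m \<le> real (p m) + 1" for m
    proof -
      have "0 < s / t * 2 ^ m" using s t by simp
      then have "\<lceil>s / t * 2 ^ m\<rceil> \<ge> 1" by linarith
      then have "real (p m) = of_int \<lceil>s / t * 2 ^ m\<rceil> - 1" by (simp add: p_def of_nat_nat)
      then show "real (p m) < s / t * 2 ^ m" "s / t * 2 ^ m \<le> real (p m) + 1" by linarith+
    qed
    have lt: "real (p m) * (t / real (2 ^ m)) < s" "s - t * (1 / 2 ^ m) \<le> real (p m) * (t / real (2 ^ m))" for m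
    proof -
      have *: "t * real (p m) < s * 2 ^ m" "s * 2 ^ m - t \<le> real (p m) * t"
        using p[of m] t by (simp_all add: field_simps)
      then show "real (p m) * (t / real (2 ^ m)) < s" by (simp add: field_simps)
      have "(s * 2 ^ m - t) / 2 ^ m \<le> real (p m) * t / 2 ^ m"
        using *(2) by (intro divide_right_mono) auto
      then show "s - t * (1 / 2 ^ m) \<le> real (p m) * (t / real (2 ^ m))" by (simp add: diff_divide_distrib)
    qed
    have "p m \<le> 2 ^ m" for m
    proof -
      have "s / t * 2 ^ m \<le> 1 * 2 ^ m" using s t by (intro mult_right_mono) auto
      then have "real (p m) < 2 ^ m" using p(1)[of m] by linarith
      then show ?thesis by simp
    qed
    moreover have "(\<lambda>m. real (p m) * (t / real (2 ^ m))) \<longlonglongrightarrow> s"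
    proof (rule tendsto_sandwich)
      have "(\<lambda>m. s - t * (1 / 2 ^ m)) \<longlonglongrightarrow> s - t * 0"
        by (intro tendsto_diff tendsto_mult tendsto_const LIMSEQ_inverse_power2)
      then show "(\<lambda>m. s - t * (1 / 2 ^ m)) \<longlonglongrightarrow> s" by simp
      show "(\<lambda>_. s) \<longlonglongrightarrow> s" by simp
      show "\<forall>\<^sub>F m in sequentially. s - t * (1 / 2 ^ m) \<le> real (p m) * (t / real (2 ^ m))" using lt(2) by simp
      show "\<forall>\<^sub>F m in sequentially. real (p m) * (t / real (2 ^ m)) \<le> s" using less_imp_le[OF lt(1)] by simp
    qed
    ultimately show ?thesis using lt(1) by (intro exI[of _ p] exI[of _ "\<lambda>m. 2 ^ m"]) auto
  qed
  have key: "prob {\<omega>\<in>space P. ?i \<omega> < s \<and> ?I \<omega> \<in> B} = prob {\<omega>\<in>space P. t - ?s \<omega> < s \<and> X t \<omega> - ?S \<omega> \<in> B}"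
    if B[measurable]: "B \<in> sets borel" for s B
  proof -
    consider "s \<le> 0" | "t < s" | "0 < s" "s \<le> t" by linarith
    then show ?thesis
    proof cases
      case 1
      have "\<not> ?i \<omega> < s" "\<not> t - ?s \<omega> < s" if "\<omega> \<in> space P" for \<omega>
        using cadlag0.inf_time_nonneg[OF X_path[OF that], of t] cadlag0.sup_time_le_t[OF X_path[OF that], of t] t 1 by auto
      then have "{\<omega>\<in>space P. ?i \<omega> < s \<and> ?I \<omega> \<in> B} = {}" "{\<omega>\<in>space P. t - ?s \<omega> < s \<and> X t \<omega> - ?S \<omega> \<in> B} = {}" by blast+
      then show ?thesis by (simp only:)
    next
      case 2
      \<comment> \<open>Beyond \<open>t\<close> both conditions on the time hold always and only the
        laws of the values remain to be compared, by the reversal with the trivial split point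
        \<open>p = 0\<close>, \<open>q = 1\<close>.\<close>
      have i: "?i \<omega> < s" "t - ?s \<omega> < s" if "\<omega> \<in> space P" for \<omega>
        using cadlag0.inf_time_le_t[OF X_path[OF that], of t] cadlag0.sup_time_nonneg[OF X_path[OF that], of t] t 2 by auto
      let ?U = "\<lambda>\<omega>. (SUP s\<in>{0..real (1 - 0) * (t / real 1)}. X s \<omega>, ?S \<omega>, X t \<omega>)"
      let ?V = "\<lambda>\<omega>. (X t \<omega> - (INF s\<in>{real 0 * (t / real 1)..t}. X s \<omega>), X t \<omega> - ?I \<omega>, X t \<omega>)"
      note pr = path_reversal[OF t, of 0 1, OF le0 zero_less_one]
      define E where "E = {x :: real \<times> real \<times> real. snd (snd x) - fst (snd x) \<in> B}"
      have "{x\<in>space (borel \<Otimes>\<^sub>M borel \<Otimes>\<^sub>M borel :: (real \<times> real \<times> real) measure). snd (snd x) - fst (snd x :: real \<times> real) \<in> B}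
          \<in> sets (borel \<Otimes>\<^sub>M borel \<Otimes>\<^sub>M borel)" by measurable
      then have E: "E \<in> sets borel" unfolding E_def borel_prod by simp
      have "measure (distr P borel ?U) E = measure (distr P borel ?V) E" using pr(1) by (simp only:)
      then have "prob (?U -` E \<inter> space P) = prob (?V -` E \<inter> space P)"
        by (simp only: measure_distr[OF pr(2) E] measure_distr[OF pr(3) E])
      moreover have "?U -` E \<inter> space P = {\<omega>\<in>space P. t - ?s \<omega> < s \<and> X t \<omega> - ?S \<omega> \<in> B}" using i by (auto simp: E_def)
      moreover have "?V -` E \<inter> space P = {\<omega>\<in>space P. ?i \<omega> < s \<and> ?I \<omega> \<in> B}" using i by (auto simp: E_def)
      ultimately show ?thesis by simp
    next
      case 3
      from fraction[OF 3] obtain p q :: "nat \<Rightarrow> nat" where pq: "\<And>m. p m \<le> q m" "\<And>m. 0 < q m"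
        and lt: "\<And>m. real (p m) * (t / real (q m)) < s" and lim: "(\<lambda>m. real (p m) * (t / real (q m))) \<longlonglongrightarrow> s" by blast
      define r where "r m = real (p m) * (t / real (q m))" for m
      have r: "0 \<le> r m" "r m \<le> t" "r m < s" for m
        using lt[of m] t 3 pq[of m] by (auto simp: r_def)
      let ?A = "\<lambda>m. {\<omega>\<in>space P. ?I \<omega> < (INF u\<in>{r m..t}. X u \<omega>) \<and> ?I \<omega> \<in> B}"
      let ?B = "\<lambda>m. {\<omega>\<in>space P. t - ?s \<omega> < r m \<and> X t \<omega> - ?S \<omega> \<in> B}"
      have ev_r: "\<forall>\<^sub>F m in sequentially. x < r m" if "x < s" for x
        using order_tendstoD(1)[OF lim that] by (simp add: r_def)
      have A_lim: "(\<lambda>m. prob (?A m)) \<longlonglongrightarrow> prob {\<omega>\<in>space P. ?i \<omega> < s \<and> ?I \<omega> \<in> B}"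
      proof -
        have A_meas [measurable]: "?A m \<in> sets P" for m
        proof -
          have m: "(\<lambda>\<omega>. (X t \<omega> - (INF u\<in>{r m..t}. X u \<omega>), X t \<omega> - ?I \<omega>, X t \<omega>)) \<in> borel_measurable P"
            using path_reversal(3)[OF t pq(1,2), of m] by (simp add: r_def)
          have "(\<lambda>\<omega>. X t \<omega> - fst (X t \<omega> - (INF u\<in>{r m..t}. X u \<omega>), X t \<omega> - ?I \<omega>, X t \<omega>)) \<in> borel_measurable P"
            using measurable_compose[OF m[folded borel_prod] measurable_fst] by (intro borel_measurable_diff) auto
          then have [measurable]: "(\<lambda>\<omega>. INF u\<in>{r m..t}. X u \<omega>) \<in> borel_measurable P" by simp
          show ?thesis by measurable
        qed
        have "(\<lambda>m. \<integral>\<omega>. indicator (?A m) \<omega> \<partial>P) \<longlonglongrightarrow> (\<integral>\<omega>. indicator {\<omega>\<in>space P. ?i \<omega> < s \<and> ?I \<omega> \<in> B} \<omega> \<partial>P :: real)"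
        proof (rule integral_dominated_convergence[where w="\<lambda>_. 1"])
          show "AE \<omega> in P. (\<lambda>m. indicator (?A m) \<omega> :: real) \<longlonglongrightarrow> indicator {\<omega>\<in>space P. ?i \<omega> < s \<and> ?I \<omega> \<in> B} \<omega>"
          proof (rule AE_I2, rule tendsto_eventually)
            fix \<omega> assume \<omega>: "\<omega> \<in> space P"
            interpret cadlag0 "\<lambda>s. X s \<omega>" by (rule X_path[OF \<omega>])
            \<comment> \<open>If \<open>?i \<omega> < s\<close>, the comparison becomes true as soon
              as \<open>r m\<close> has passed \<open>?i \<omega>\<close>; otherwise it is never
              true because \<open>r m < s\<close>.\<close>
            have "\<forall>\<^sub>F m in sequentially. (?I \<omega> < (INF u\<in>{r m..t}. X u \<omega>)) = (?i \<omega> < s)"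
            proof (cases "?i \<omega> < s")
              case True
              from ev_r[OF True] show ?thesis
                by eventually_elim (use True run_inf_less_INF[OF r(1,2)] in blast)
            next
              case False
              have "\<not> ?I \<omega> < (INF u\<in>{r m..t}. X u \<omega>)" for m
                using inf_time_le[OF r(1)[of m] r(2)[of m]] r(3)[of m] False by linarith
              then show ?thesis using False by simp
            qed
            then show "\<forall>\<^sub>F m in sequentially. indicator (?A m) \<omega> = (indicator {\<omega>\<in>space P. ?i \<omega> < s \<and> ?I \<omega> \<in> B} \<omega> :: real)"
              by eventually_elim (simp add: indicator_def)
          qed
        qed (auto simp: indicator_def)
        then show ?thesis by simp
      qed
      have B_lim: "(\<lambda>m. prob (?B m)) \<longlonglongrightarrow> prob {\<omega>\<in>space P. t - ?s \<omega> < s \<and> X t \<omega> - ?S \<omega> \<in> B}"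
      proof -
        have "(\<lambda>m. \<integral>\<omega>. indicator (?B m) \<omega> \<partial>P) \<longlonglongrightarrow> (\<integral>\<omega>. indicator {\<omega>\<in>space P. t - ?s \<omega> < s \<and> X t \<omega> - ?S \<omega> \<in> B} \<omega> \<partial>P :: real)"
        proof (rule integral_dominated_convergence[where w="\<lambda>_. 1"])
          show "AE \<omega> in P. (\<lambda>m. indicator (?B m) \<omega> :: real) \<longlonglongrightarrow> indicator {\<omega>\<in>space P. t - ?s \<omega> < s \<and> X t \<omega> - ?S \<omega> \<in> B} \<omega>"
          proof (rule AE_I2, rule tendsto_eventually)
            fix \<omega> assume \<omega>: "\<omega> \<in> space P"
            have "\<forall>\<^sub>F m in sequentially. (t - ?s \<omega> < r m) = (t - ?s \<omega> < s)"
            proof (cases "t - ?s \<omega> < s")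
              case True
              from ev_r[OF True] show ?thesis by eventually_elim (use True in simp)
            next
              case False
              then have "\<not> t - ?s \<omega> < r m" for m using r(3)[of m] by linarith
              then show ?thesis using False by simp
            qed
            then show "\<forall>\<^sub>F m in sequentially. indicator (?B m) \<omega> = (indicator {\<omega>\<in>space P. t - ?s \<omega> < s \<and> X t \<omega> - ?S \<omega> \<in> B} \<omega> :: real)"
              by eventually_elim (simp add: indicator_def)
          qed
        qed (auto simp: indicator_def)
        then show ?thesis by simp
      qed
      have "prob (?A m) = prob (?B m)" for m
        using grid[OF B pq(1,2), of m] by (simp add: r_def)
      then show ?thesis using LIMSEQ_unique[OF A_lim] B_lim by simp
    qed
  qed
  let ?M = "distr P (borel \<Otimes>\<^sub>M borel) (\<lambda>\<omega>. (?i \<omega>, ?I \<omega>))"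
  let ?N = "distr P (borel \<Otimes>\<^sub>M borel) (\<lambda>\<omega>. (t - ?s \<omega>, X t \<omega> - ?S \<omega>))"
  show ?thesis
  proof (rule measure_eqI_rectangles)
    show "finite_measure ?M" by (rule finite_measure_distr) measurable
    fix A B :: "real set" assume A: "A \<in> sets borel" and B[measurable]: "B \<in> sets borel"
    \<comment> \<open>With the value restricted to \<open>B\<close>, both time components have
      finite laws, which \<open>key\<close> identifies on all half-lines
      \<open>{..<s}\<close>.\<close>
    define \<mu> where "\<mu> = distr (density P (indicator {\<omega>\<in>space P. ?I \<omega> \<in> B})) borel ?i"
    define \<nu> where "\<nu> = distr (density P (indicator {\<omega>\<in>space P. X t \<omega> - ?S \<omega> \<in> B})) borel (\<lambda>\<omega>. t - ?s \<omega>)"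
    have \<mu>: "emeasure \<mu> C = emeasure P {\<omega>\<in>space P. ?i \<omega> \<in> C \<and> ?I \<omega> \<in> B}" if [measurable]: "C \<in> sets borel" for C
    proof -
      have "emeasure \<mu> C = emeasure P ({\<omega>\<in>space P. ?I \<omega> \<in> B} \<inter> (?i -` C \<inter> space P))"
        unfolding \<mu>_def by (subst emeasure_distr) (auto simp: emeasure_density indicator_inter_arith[symmetric])
      also have "{\<omega>\<in>space P. ?I \<omega> \<in> B} \<inter> (?i -` C \<inter> space P) = {\<omega>\<in>space P. ?i \<omega> \<in> C \<and> ?I \<omega> \<in> B}" by auto
      finally show ?thesis .
    qed
    have \<nu>: "emeasure \<nu> C = emeasure P {\<omega>\<in>space P. t - ?s \<omega> \<in> C \<and> X t \<omega> - ?S \<omega> \<in> B}" if [measurable]: "C \<in> sets borel" for C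
    proof -
      have "emeasure \<nu> C = emeasure P ({\<omega>\<in>space P. X t \<omega> - ?S \<omega> \<in> B} \<inter> ((\<lambda>\<omega>. t - ?s \<omega>) -` C \<inter> space P))"
        unfolding \<nu>_def by (subst emeasure_distr) (auto simp: emeasure_density indicator_inter_arith[symmetric])
      also have "{\<omega>\<in>space P. X t \<omega> - ?S \<omega> \<in> B} \<inter> ((\<lambda>\<omega>. t - ?s \<omega>) -` C \<inter> space P) = {\<omega>\<in>space P. t - ?s \<omega> \<in> C \<and> X t \<omega> - ?S \<omega> \<in> B}" by auto
      finally show ?thesis .
    qed
    have "\<mu> = \<nu>"
    proof (rule measure_eqI_generator_eq[where \<Omega>=UNIV and E="range lessThan" and A="\<lambda>i. {..<real i}"])
      have "{..<a} \<inter> {..<b} = {..<min a b}" for a b :: real by auto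
      then show "Int_stable (range (lessThan :: real \<Rightarrow> _))" by (auto simp: Int_stable_def)
      show "sets \<mu> = sigma_sets UNIV (range lessThan)" "sets \<nu> = sigma_sets UNIV (range lessThan)"
        by (simp_all add: \<mu>_def \<nu>_def) (subst borel_Iio, simp)+
      show "(\<Union>i. {..<real i}) = UNIV" by (auto intro: reals_Archimedean2)
      show "emeasure \<mu> {..<real i} \<noteq> \<infinity>" for i by (simp add: \<mu>)
      show "emeasure \<mu> C = emeasure \<nu> C" if C: "C \<in> range lessThan" for C
      proof -
        from C obtain s where "C = {..<s}" by auto
        then show ?thesis using key[OF B, of s] by (simp add: \<mu> \<nu> emeasure_eq_measure)
      qed
    qed auto
    then have "emeasure P {\<omega>\<in>space P. ?i \<omega> \<in> A \<and> ?I \<omega> \<in> B} = emeasure P {\<omega>\<in>space P. t - ?s \<omega> \<in> A \<and> X t \<omega> - ?S \<omega> \<in> B}"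
      using \<mu>[OF A] \<nu>[OF A] by simp
    moreover have "emeasure ?M (A \<times> B) = emeasure P {\<omega>\<in>space P. ?i \<omega> \<in> A \<and> ?I \<omega> \<in> B}"
      using A by (subst emeasure_distr) (auto intro!: arg_cong[where f="emeasure P"])
    moreover have "emeasure ?N (A \<times> B) = emeasure P {\<omega>\<in>space P. t - ?s \<omega> \<in> A \<and> X t \<omega> - ?S \<omega> \<in> B}"
      using A by (subst emeasure_distr) (auto intro!: arg_cong[where f="emeasure P"])
    ultimately show "emeasure ?M (A \<times> B) = emeasure ?N (A \<times> B)" by simp
  qed simp_all
qed

end

section \<open>Approximation of the time of the supremum\<close>

text \<open>Index of \<open>dyadic_above n t\<close> on the mesh \<open>1 / 2 ^ n\<close>: for
  nonnegative \<open>t\<close> the grid reaches just beyond \<open>t\<close>, so that right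
  continuity at \<open>t\<close> is available at its end.\<close>

definition grid_size :: "nat \<Rightarrow> real \<Rightarrow> nat" where
  "grid_size n t = Suc (nat \<lfloor>t * 2 ^ n\<rfloor>)"

lemma dyadic_above_grid_size: "dyadic_above n t = real (grid_size n t) / 2 ^ n"
  by (simp add: dyadic_above_def grid_size_def)

lemma grid_size_mono: "s \<le> t \<Longrightarrow> grid_size n s \<le> grid_size n t"
  unfolding grid_size_def by (intro Suc_le_mono[THEN iffD2] nat_mono floor_mono mult_right_mono) auto

context cadlag0 begin

text \<open>A supremum reached as a value is approached by grid points from the right, possibly
  beyond \<open>t\<close>, which the grid allows. One reached only as a left limit is approached by
  grid points strictly to its left.\<close>

lemma grid_near_supremum:
  assumes t: "0 \<le> t" and \<delta>: "0 < \<delta>"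
  shows "\<forall>\<^sub>F n in sequentially. \<exists>m\<le>grid_size n t. run_sup f t - \<delta> < f (real m / 2 ^ n) \<and>
    \<bar>real m / 2 ^ n - sup_time f t\<bar> < \<delta>"
proof -
  let ?g = "sup_time f t"
  have g: "0 \<le> ?g" "?g \<le> t" "max (f ?g) (pre_value f ?g) = run_sup f t"
    using sup_time_nonneg[OF t] sup_time_le_t[OF t] sup_time_attained[OF t] by (auto simp: sup_times_def)
  have small: "\<forall>\<^sub>F n in sequentially. 1 / 2 ^ n < \<delta>" by (rule order_tendstoD(2)[OF LIMSEQ_inverse_power2 \<delta>])
  show ?thesis
  proof (cases "f ?g = run_sup f t")
    case True
    then have "\<forall>\<^sub>F s in at_right ?g. run_sup f t - \<delta> < f s"
      using \<delta> by (intro order_tendstoD(1)[OF cadlag_right[OF cadlag g(1)]]) auto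
    from eventually_compose_filterlim[OF this filterlim_dyadic_above[OF g(1)]] small
    show ?thesis
    proof eventually_elim
      case (elim n)
      show ?case
        using elim dyadic_above_bounds[OF g(1), of n] grid_size_mono[OF g(2), of n]
        by (intro exI[of _ "grid_size n ?g"]) (auto simp: dyadic_above_grid_size)
    qed
  next
    case False
    then have pre: "pre_value f ?g = run_sup f t" using g(3) by (auto simp: max_def split: if_splits)
    have pos: "0 < ?g"
      using pre False zero g(1) by (cases "?g = 0") (auto simp: pre_value_def)
    \<comment> \<open>Last grid index strictly before the supremum time.\<close>
    define m where "m n = nat (\<lceil>?g * 2 ^ n\<rceil> - 1)" for n
    have m: "real (m n) / 2 ^ n < ?g" "?g \<le> real (m n) / 2 ^ n + 1 / 2 ^ n" for n
    proof -
      have "0 < ?g * 2 ^ n" using pos by simp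
      then have "\<lceil>?g * 2 ^ n\<rceil> \<ge> 1" by linarith
      then have "real (m n) = of_int \<lceil>?g * 2 ^ n\<rceil> - 1" by (simp add: m_def of_nat_nat)
      then have "real (m n) < ?g * 2 ^ n" "?g * 2 ^ n \<le> real (m n) + 1" by linarith+
      then show "real (m n) / 2 ^ n < ?g" "?g \<le> real (m n) / 2 ^ n + 1 / 2 ^ n"
        by (simp_all add: field_simps)
    qed
    have "\<forall>\<^sub>F s in at_left ?g. run_sup f t - \<delta> < f s"
      using \<delta> pre by (intro order_tendstoD(1)[OF cadlag_left[OF cadlag pos]]) auto
    then obtain d where d: "d < ?g" "\<And>s. d < s \<Longrightarrow> s < ?g \<Longrightarrow> run_sup f t - \<delta> < f s"
      by (auto simp: eventually_at_left_field)
    have "\<forall>\<^sub>F n in sequentially. 1 / 2 ^ n < ?g - d" using d(1) by (intro order_tendstoD(2)[OF LIMSEQ_inverse_power2]) auto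
    with small show ?thesis
    proof eventually_elim
      case (elim n)
      have "m n \<le> nat \<lfloor>t * 2 ^ n\<rfloor>"
      proof -
        have "?g * 2 ^ n \<le> t * 2 ^ n" using g(2) by (intro mult_right_mono) auto
        moreover have "real (m n) < ?g * 2 ^ n" using m(1)[of n] by (simp add: field_simps)
        ultimately have "real (m n) \<le> t * 2 ^ n" by linarith
        then show ?thesis by linarith
      qed
      then have "m n \<le> grid_size n t" by (simp add: grid_size_def)
      then show ?case
        using elim m[of n] d(2)[of "real (m n) / 2 ^ n"] by (intro exI[of _ "m n"]) auto
    qed
  qed
qed

text \<open>The maximum over a grid may be attained near a later point where the supremum is approached
  again.  The drift \<open>- e\<close> breaks such ties in favour of the first one.\<close>

lemma tilted_argmax_limit:
  assumes t: "0 \<le> t" and \<eta>: "0 < \<eta>"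
  shows "\<exists>e0>0. \<forall>e. 0 < e \<longrightarrow> e < e0 \<longrightarrow> (\<forall>\<^sub>F n in sequentially.
    \<forall>m\<le>grid_size n t. (\<forall>l\<le>grid_size n t. f (real l / 2 ^ n) - e * (real l / 2 ^ n) \<le> f (real m / 2 ^ n) - e * (real m / 2 ^ n)) \<longrightarrow>
      \<bar>real m / 2 ^ n - sup_time f t\<bar> \<le> \<eta> \<and> \<bar>f (real m / 2 ^ n) - e * (real m / 2 ^ n) - run_sup f t\<bar> \<le> \<eta> \<and>
      \<bar>real (grid_size n t) / 2 ^ n - t\<bar> \<le> \<eta> \<and>
      \<bar>f (real (grid_size n t) / 2 ^ n) - e * (real (grid_size n t) / 2 ^ n) - f t\<bar> \<le> \<eta>)"
proof -
  let ?g = "sup_time f t" and ?S = "run_sup f t"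
  have g: "0 \<le> ?g" "?g \<le> t" using sup_time_nonneg[OF t] sup_time_le_t[OF t] by auto
  \<comment> \<open>The loss in height incurred by staying before \<open>?g - \<eta>\<close>; it is
    positive because \<open>?g\<close> is the first time of the supremum. For
    \<open>?g < \<eta>\<close> there is nothing to exclude on the left and 1 is a dummy.\<close>
  define \<gamma> where "\<gamma> = (if \<eta> \<le> ?g then ?S - run_sup f (?g - \<eta>) else 1)"
  have \<gamma>: "0 < \<gamma>" using less_sup_time_iff[of "?g - \<eta>" t] g \<eta> by (auto simp: \<gamma>_def)
  \<comment> \<open>Keeps the effect of the drift up to time \<open>t + 1\<close> below half of
    \<open>\<gamma>\<close> and half of \<open>\<eta>\<close>.\<close>
  define e0 where "e0 = min (\<gamma> / 2) (\<eta> / 2) / (t + 1)"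
  have e0: "0 < e0" using \<gamma> \<eta> t by (simp add: e0_def)
  show ?thesis
  proof (intro exI[of _ e0] conjI allI impI e0)
    fix e :: real assume e: "0 < e" "e < e0"
    have "e * (t + 1) < min (\<gamma> / 2) (\<eta> / 2)" using e(2) t by (simp add: e0_def field_simps)
    then have et: "e * t + e < \<gamma> / 2" "e * t + e < \<eta> / 2" by (simp_all add: algebra_simps)
    \<comment> \<open>Chosen after the drift: the grid error must be small against
      \<open>e * \<eta>\<close>, the price the drift puts on a competitor later than
      \<open>?g + \<eta>\<close>. The last entry is half of what is needed, which leaves the strict
      inequality \<open>2 * \<delta> + e * \<delta> < e * \<eta>\<close>.\<close>
    define \<delta> where "\<delta> = min (min 1 (\<gamma> / 2)) (min (\<eta> / 2) (e * \<eta> / (2 * (2 + e))))"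
    have \<delta>0: "0 < \<delta>" using \<gamma> \<eta> e by (simp add: \<delta>_def)
    have \<delta>1: "\<delta> \<le> 1" "\<delta> \<le> \<gamma> / 2" "\<delta> \<le> \<eta> / 2" "\<delta> \<le> e * \<eta> / (2 * (2 + e))"
      unfolding \<delta>_def by linarith+
    have "\<delta> * (2 * (2 + e)) \<le> e * \<eta>" using \<delta>1(4) e by (simp add: pos_le_divide_eq)
    then have "4 * \<delta> + 2 * (e * \<delta>) \<le> e * \<eta>" by (simp add: algebra_simps)
    then have \<delta>2: "2 * \<delta> + e * \<delta> < e * \<eta>" using \<delta>0 mult_pos_pos[OF e(1) \<delta>0] by linarith
    have e\<delta>: "e * \<delta> \<le> e" using \<delta>1(1) e by simp
    have eg: "e * ?g \<le> e * t" using g e by simp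
    have lim: "((\<lambda>n. f (dyadic_above n t)) \<longlongrightarrow> f t) sequentially"
      by (rule filterlim_compose[OF cadlag_right[OF cadlag t] filterlim_dyadic_above[OF t]])
    have limd: "((\<lambda>n. dyadic_above n t) \<longlongrightarrow> t) sequentially"
      using filterlim_dyadic_above[OF t] by (simp add: filterlim_at)
    have "\<forall>\<^sub>F n in sequentially. dist (f (dyadic_above n t)) (f t) < \<delta>" by (rule tendstoD[OF lim \<delta>0])
    moreover have "\<forall>\<^sub>F n in sequentially. dist (dyadic_above n t) t < \<delta>" by (rule tendstoD[OF limd \<delta>0])
    ultimately show "\<forall>\<^sub>F n in sequentially.
      \<forall>m\<le>grid_size n t. (\<forall>l\<le>grid_size n t. f (real l / 2 ^ n) - e * (real l / 2 ^ n) \<le> f (real m / 2 ^ n) - e * (real m / 2 ^ n)) \<longrightarrow>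
      \<bar>real m / 2 ^ n - ?g\<bar> \<le> \<eta> \<and> \<bar>f (real m / 2 ^ n) - e * (real m / 2 ^ n) - ?S\<bar> \<le> \<eta> \<and>
      \<bar>real (grid_size n t) / 2 ^ n - t\<bar> \<le> \<eta> \<and>
      \<bar>f (real (grid_size n t) / 2 ^ n) - e * (real (grid_size n t) / 2 ^ n) - f t\<bar> \<le> \<eta>"
      using grid_near_supremum[OF t \<delta>0]
    proof eventually_elim
      case (elim n)
      let ?N = "grid_size n t"
      have N1: "\<bar>f (real ?N / 2 ^ n) - f t\<bar> < \<delta>" "\<bar>real ?N / 2 ^ n - t\<bar> < \<delta>"
        using elim(1,2) by (simp_all add: dyadic_above_grid_size dist_real_def)
      from elim(3) obtain m0 where m0: "m0 \<le> ?N" "?S - \<delta> < f (real m0 / 2 ^ n)" "\<bar>real m0 / 2 ^ n - ?g\<bar> < \<delta>" by auto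
      \<comment> \<open>The last grid point lies beyond \<open>t\<close> and is not bounded by
        \<open>?S\<close>; closeness to \<open>f t\<close> bounds it up to
        \<open>\<delta>\<close>.\<close>
      have f_le: "f (real l / 2 ^ n) \<le> ?S + \<delta>" if "l \<le> ?N" for l
      proof (cases "l = ?N")
        case True
        then show ?thesis using N1(1) run_sup_upper[of t t] t by simp
      next
        case False
        then have "l \<le> nat \<lfloor>t * 2 ^ n\<rfloor>" using that by (simp add: grid_size_def)
        then have "real l \<le> t * 2 ^ n" using t by (simp add: le_nat_iff le_floor_iff)
        then have "real l / 2 ^ n \<le> t" by (simp add: field_simps)
        then show ?thesis using run_sup_upper[of "real l / 2 ^ n" t] \<delta>0 by simp
      qed
      show ?case
      proof (intro allI impI)
        fix m assume m: "m \<le> ?N" and mx: "\<forall>l\<le>?N. f (real l / 2 ^ n) - e * (real l / 2 ^ n) \<le> f (real m / 2 ^ n) - e * (real m / 2 ^ n)"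
        let ?u = "real m / 2 ^ n"
        have "e * (real m0 / 2 ^ n) \<le> e * (?g + \<delta>)" using m0(3) e by (intro mult_left_mono) auto
        then have low: "?S - \<delta> - e * ?g - e * \<delta> < f ?u - e * ?u"
          using mx[rule_format, OF m0(1)] m0(2) by (simp add: algebra_simps)
        have eu: "0 \<le> e * ?u" using e by simp
        \<comment> \<open>A later maximiser would lose at least \<open>e * \<eta>\<close> through
          the drift, more than the errors in height can make up for.\<close>
        have 1: "?u \<le> ?g + \<eta>"
        proof (rule ccontr)
          assume "\<not> ?u \<le> ?g + \<eta>"
          then have "e * (?g + \<eta>) \<le> e * ?u" using e by (intro mult_left_mono) auto
          then show False using f_le[OF m] low \<delta>2 by (simp add: algebra_simps)
        qed
        \<comment> \<open>An earlier maximiser would stay at least \<open>\<gamma>\<close> below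
          \<open>?S\<close>, more than drift and grid errors together.\<close>
        have 2: "?g - \<eta> \<le> ?u"
        proof (rule ccontr)
          assume n: "\<not> ?g - \<eta> \<le> ?u"
          have "0 \<le> ?u" by simp
          then have s: "\<eta> \<le> ?g" "0 \<le> ?g - \<eta>" using n by linarith+
          then have "f ?u \<le> run_sup f (?g - \<eta>)" using n by (intro run_sup_upper) auto
          then have "f ?u \<le> ?S - \<gamma>" using s by (simp add: \<gamma>_def)
          then show False using low eu et(1) e\<delta> eg \<delta>1(2) by linarith
        qed
        have 3: "\<bar>f ?u - e * ?u - ?S\<bar> \<le> \<eta>"
          using low f_le[OF m] eu et(2) e\<delta> eg \<delta>1(3) by linarith
        have "e * (real ?N / 2 ^ n) \<le> e * (t + \<delta>)" using N1(2) e by (intro mult_left_mono) auto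
        then have "e * (real ?N / 2 ^ n) \<le> e * t + e" using e\<delta> by (simp add: algebra_simps)
        moreover have "0 \<le> e * (real ?N / 2 ^ n)" using e by simp
        ultimately have 4: "\<bar>f (real ?N / 2 ^ n) - e * (real ?N / 2 ^ n) - f t\<bar> \<le> \<eta>"
          using N1(1) et(2) \<delta>1(3) by linarith
        show "\<bar>?u - ?g\<bar> \<le> \<eta> \<and> \<bar>f ?u - e * ?u - ?S\<bar> \<le> \<eta> \<and> \<bar>real ?N / 2 ^ n - t\<bar> \<le> \<eta> \<and>
          \<bar>f (real ?N / 2 ^ n) - e * (real ?N / 2 ^ n) - f t\<bar> \<le> \<eta>"
          using 1 2 3 4 N1(2) \<delta>1(3) \<eta> by auto
      qed
    qed
  qed
qed

end

section \<open>Limits of integrals\<close>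

text \<open>The inner limit need not exist, so the limsup \<open>D j\<close> takes its place:
  dominated convergence sends the integrals of \<open>D j\<close> to 0, and the reverse Fatou
  inequality leads back from the integral of a limsup to the integrals for large
  \<open>n\<close>.\<close>

lemma iterated_dominated_convergence:
  fixes d :: "nat \<Rightarrow> nat \<Rightarrow> 'a \<Rightarrow> real"
  assumes "finite_measure Q" and d[measurable]: "\<And>j n. d j n \<in> borel_measurable Q"
    and bd: "\<And>j n x. 0 \<le> d j n x \<and> d j n x \<le> B"
    and lim: "\<And>x \<eta>. x \<in> space Q \<Longrightarrow> 0 < \<eta> \<Longrightarrow> \<forall>\<^sub>F j in sequentially. \<forall>\<^sub>F n in sequentially. d j n x \<le> \<eta>"
    and \<kappa>: "0 < \<kappa>"
  shows "\<forall>\<^sub>F j in sequentially. \<forall>\<^sub>F n in sequentially. (\<integral>x. d j n x \<partial>Q) < \<kappa>"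
proof -
  interpret finite_measure Q by fact
  define D where "D j x = limsup (\<lambda>n. ennreal (d j n x))" for j x
  have [measurable]: "D j \<in> borel_measurable Q" for j unfolding D_def by measurable
  have DB: "D j x \<le> ennreal B" for j x
    unfolding D_def by (rule Limsup_bounded) (auto intro!: always_eventually ennreal_leI simp: bd)
  have "emeasure Q (space Q) < \<top>" by (simp add: less_top[symmetric])
  then have fin: "(\<integral>\<^sup>+x. ennreal B \<partial>Q) < \<infinity>" by (simp add: ennreal_mult_less_top)
  have "(\<lambda>j. \<integral>\<^sup>+x. D j x \<partial>Q) \<longlonglongrightarrow> (\<integral>\<^sup>+x. 0 \<partial>Q)"
  proof (rule nn_integral_dominated_convergence[where w="\<lambda>_. ennreal B"])
    show "AE x in Q. (\<lambda>j. D j x) \<longlonglongrightarrow> 0"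
    proof (rule AE_I2, rule order_tendstoI)
      fix x and c :: ennreal assume x: "x \<in> space Q" and c: "0 < c"
      obtain \<eta> where \<eta>: "0 < \<eta>" "ennreal \<eta> < c"
      proof (cases "c = \<top>")
        case True then show ?thesis using that[of 1] by simp
      next
        case False
        then have "0 < enn2real c" using c by (simp add: enn2real_positive_iff less_top)
        then show ?thesis using that[of "enn2real c / 2"] False c
          by (metis ennreal_enn2real ennreal_less_iff field_sum_of_halves half_gt_zero less_add_same_cancel1 less_eq_real_def less_top)
      qed
      from lim[OF x \<eta>(1)] show "\<forall>\<^sub>F j in sequentially. D j x < c"
      proof eventually_elim
        case (elim j)
        then have "D j x \<le> ennreal \<eta>"
          unfolding D_def by (intro Limsup_bounded) (auto elim!: eventually_mono intro!: ennreal_leI)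
        then show ?case using \<eta>(2) by (rule le_less_trans)
      qed
    qed simp
  qed (use DB fin in auto)
  then have "\<forall>\<^sub>F j in sequentially. (\<integral>\<^sup>+x. D j x \<partial>Q) < ennreal \<kappa>"
    using \<kappa> by (intro order_tendstoD(2)) auto
  then show ?thesis
  proof eventually_elim
    case (elim j)
    have "limsup (\<lambda>n. \<integral>\<^sup>+x. ennreal (d j n x) \<partial>Q) \<le> (\<integral>\<^sup>+x. D j x \<partial>Q)"
      unfolding D_def by (rule nn_integral_limsup[where w="\<lambda>_. ennreal B"]) (use fin bd in \<open>auto intro!: ennreal_leI\<close>)
    then have "limsup (\<lambda>n. \<integral>\<^sup>+x. ennreal (d j n x) \<partial>Q) < ennreal \<kappa>" using elim by (rule le_less_trans)
    from Limsup_lessD[OF this] show ?case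
    proof eventually_elim
      case (elim n)
      have "integrable Q (d j n)" using bd by (intro integrable_const_bound[of _ B]) (auto simp: abs_le_iff intro: order_trans[of _ 0])
      then have "(\<integral>\<^sup>+x. ennreal (d j n x) \<partial>Q) = ennreal (\<integral>x. d j n x \<partial>Q)"
        using bd by (intro nn_integral_eq_integral) auto
      then show ?case using elim bd by (simp add: ennreal_less_iff integral_nonneg)
    qed
  qed
qed

text \<open>Two finite measures are compared, the law of \<open>Y\<close> weighted by
  \<open>W\<close> and the law of \<open>Y\<close> scaled by the mean of \<open>W\<close>. They
  agree on continuous functions, hence on Borel sets.\<close>

lemma weighted_distr_eq:
  fixes Y :: "'a \<Rightarrow> 'b::metric_space"
  assumes "prob_space Q" and [measurable]: "W \<in> borel_measurable Q" "Y \<in> borel_measurable Q"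
    and W: "\<And>x. 0 \<le> W x \<and> W x \<le> (1 :: real)"
    and eq: "\<And>f :: 'b \<Rightarrow> real. continuous_on UNIV f \<Longrightarrow> (\<And>y. 0 \<le> f y \<and> f y \<le> 1) \<Longrightarrow>
      (\<integral>x. f (Y x) * W x \<partial>Q) = (\<integral>x. f (Y x) \<partial>Q) * (\<integral>x. W x \<partial>Q)"
    and [measurable]: "C \<in> sets borel"
  shows "(\<integral>x. indicator C (Y x) * W x \<partial>Q) = (\<integral>x. indicator C (Y x) \<partial>Q) * (\<integral>x. W x \<partial>Q)"
proof -
  interpret prob_space Q by fact
  define w where "w = (\<integral>x. W x \<partial>Q)"
  have w0: "0 \<le> w" unfolding w_def using W by (simp add: integral_nonneg)
  define \<mu> where "\<mu> = distr (density Q (\<lambda>x. ennreal (W x))) borel Y"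
  define \<nu> where "\<nu> = density (distr Q borel Y) (\<lambda>_. ennreal w)"
  have \<mu>: "integral\<^sup>L \<mu> f = (\<integral>x. f (Y x) * W x \<partial>Q)" if [measurable]: "f \<in> borel_measurable borel" for f :: "'b \<Rightarrow> real"
    unfolding \<mu>_def using W by (subst integral_distr) (simp_all add: integral_density mult.commute)
  have \<nu>: "integral\<^sup>L \<nu> f = (\<integral>x. f (Y x) \<partial>Q) * w" if [measurable]: "f \<in> borel_measurable borel" for f :: "'b \<Rightarrow> real"
    unfolding \<nu>_def using w0 by (subst integral_density) (simp_all add: integral_distr mult.commute)
  have "finite_measure \<mu>"
  proof
    have "integrable Q W" using W by (intro integrable_const_bound[of _ 1]) (auto simp: abs_le_iff intro: order_trans[of _ 0])
    then have "(\<integral>\<^sup>+x. ennreal (W x) \<partial>Q) = ennreal w" unfolding w_def using W by (intro nn_integral_eq_integral) auto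
    then show "emeasure \<mu> (space \<mu>) \<noteq> \<infinity>" unfolding \<mu>_def by (simp add: emeasure_distr emeasure_density)
  qed
  moreover have "finite_measure \<nu>"
    by rule (simp add: \<nu>_def emeasure_density emeasure_distr ennreal_mult_eq_top_iff)
  ultimately have "\<mu> = \<nu>"
  proof (rule measure_eqI_continuous)
    fix f :: "'b \<Rightarrow> real" assume f: "continuous_on UNIV f" "\<And>x. 0 \<le> f x \<and> f x \<le> 1"
    have "f \<in> borel_measurable borel" by (rule borel_measurable_continuous_onI[OF f(1)])
    then show "integral\<^sup>L \<mu> f = integral\<^sup>L \<nu> f" using eq[OF f] \<mu> \<nu> by (simp add: w_def)
  qed (simp_all add: \<mu>_def \<nu>_def)
  then have "integral\<^sup>L \<mu> (indicator C :: 'b \<Rightarrow> real) = integral\<^sup>L \<nu> (indicator C)" by simp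
  then show ?thesis using \<mu>[of "indicator C"] \<nu>[of "indicator C"] by (simp add: w_def)
qed

text \<open>\<open>weighted_distr_eq\<close> is used twice: a continuous function of
  \<open>V\<close> acts as weight while the function of \<open>U\<close> is replaced by an
  indicator, and this indicator is the weight in the second round.\<close>

lemma distr_pair_eq_product:
  fixes U :: "'a \<Rightarrow> 'b::metric_space" and V :: "'a \<Rightarrow> 'c::metric_space"
  assumes Q: "prob_space Q" and [measurable]: "U \<in> borel_measurable Q" "V \<in> borel_measurable Q"
    and eq: "\<And>(f :: 'b \<Rightarrow> real) (g :: 'c \<Rightarrow> real). continuous_on UNIV f \<Longrightarrow> continuous_on UNIV g \<Longrightarrow>
      (\<And>y. 0 \<le> f y \<and> f y \<le> 1) \<Longrightarrow> (\<And>y. 0 \<le> g y \<and> g y \<le> 1) \<Longrightarrow>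
      (\<integral>x. f (U x) * g (V x) \<partial>Q) = (\<integral>x. f (U x) \<partial>Q) * (\<integral>x. g (V x) \<partial>Q)"
  shows "distr Q (borel \<Otimes>\<^sub>M borel) (\<lambda>x. (U x, V x)) = distr Q borel U \<Otimes>\<^sub>M distr Q borel V"
proof (rule measure_eqI_rectangles)
  interpret prob_space Q by fact
  show "finite_measure (distr Q (borel \<Otimes>\<^sub>M borel) (\<lambda>x. (U x, V x)))" by (rule finite_measure_distr) measurable
  show "sets (distr Q borel U \<Otimes>\<^sub>M distr Q borel V) = sets (borel \<Otimes>\<^sub>M borel)" by (intro sets_pair_measure_cong) simp_all
  fix A :: "'b set" and B :: "'c set" assume A[measurable]: "A \<in> sets borel" and B[measurable]: "B \<in> sets borel"
  have 1: "(\<integral>x. indicator A (U x) * g (V x) \<partial>Q) = (\<integral>x. indicator A (U x) \<partial>Q) * (\<integral>x. g (V x) \<partial>Q)"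
    if g: "continuous_on UNIV g" "\<And>y. 0 \<le> g y \<and> g y \<le> 1" for g :: "'c \<Rightarrow> real"
  proof -
    have [measurable]: "g \<in> borel_measurable borel" by (rule borel_measurable_continuous_onI[OF g(1)])
    show ?thesis by (rule weighted_distr_eq[OF Q _ _ _ eq]) (use g in auto)
  qed
  have "(\<integral>x. indicator B (V x) * indicator A (U x) \<partial>Q) = (\<integral>x. indicator B (V x) \<partial>Q) * (\<integral>x. indicator A (U x) \<partial>Q :: real)"
  proof (rule weighted_distr_eq[OF Q])
    fix f :: "'c \<Rightarrow> real" assume "continuous_on UNIV f" "\<And>y. 0 \<le> f y \<and> f y \<le> 1"
    from 1[OF this] show "(\<integral>x. f (V x) * indicator A (U x) \<partial>Q) = (\<integral>x. f (V x) \<partial>Q) * (\<integral>x. indicator A (U x) \<partial>Q)"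
      by (simp add: mult.commute)
  qed (auto simp: indicator_def)
  moreover have "(\<integral>x. indicator B (V x) * indicator A (U x) \<partial>Q) = prob {x\<in>space Q. U x \<in> A \<and> V x \<in> B}"
  proof -
    have "(\<integral>x. indicator B (V x) * indicator A (U x) \<partial>Q) = (\<integral>x. indicator {x\<in>space Q. U x \<in> A \<and> V x \<in> B} x \<partial>Q :: real)"
      by (intro Bochner_Integration.integral_cong) (auto simp: indicator_def)
    then show ?thesis by simp
  qed
  moreover have "(\<integral>x. indicator B (V x) \<partial>Q) = prob (V -` B \<inter> space Q)"
  proof -
    have "(\<integral>x. indicator B (V x) \<partial>Q) = (\<integral>x. indicator (V -` B \<inter> space Q) x \<partial>Q :: real)"
      by (intro Bochner_Integration.integral_cong) (auto simp: indicator_def)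
    then show ?thesis by simp
  qed
  moreover have "(\<integral>x. indicator A (U x) \<partial>Q) = prob (U -` A \<inter> space Q)"
  proof -
    have "(\<integral>x. indicator A (U x) \<partial>Q) = (\<integral>x. indicator (U -` A \<inter> space Q) x \<partial>Q :: real)"
      by (intro Bochner_Integration.integral_cong) (auto simp: indicator_def)
    then show ?thesis by simp
  qed
  ultimately have "prob {x\<in>space Q. U x \<in> A \<and> V x \<in> B} = prob (U -` A \<inter> space Q) * prob (V -` B \<inter> space Q)" by simp
  moreover have "emeasure (distr Q (borel \<Otimes>\<^sub>M borel) (\<lambda>x. (U x, V x))) (A \<times> B) = prob {x\<in>space Q. U x \<in> A \<and> V x \<in> B}"
    by (subst emeasure_distr) (auto simp: emeasure_eq_measure intro!: arg_cong[where f=prob])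
  moreover have "emeasure (distr Q borel U \<Otimes>\<^sub>M distr Q borel V) (A \<times> B) = prob (U -` A \<inter> space Q) * prob (V -` B \<inter> space Q)"
  proof -
    interpret V: prob_space "distr Q borel V" by (rule prob_space_distr) simp
    show ?thesis by (subst V.emeasure_pair_measure_Times) (auto simp: emeasure_distr emeasure_eq_measure ennreal_mult)
  qed
  ultimately show "emeasure (distr Q (borel \<Otimes>\<^sub>M borel) (\<lambda>x. (U x, V x))) (A \<times> B) = emeasure (distr Q borel U \<Otimes>\<^sub>M distr Q borel V) (A \<times> B)"
    by simp
qed simp

section \<open>Exponential times on a grid\<close>

abbreviation exp_law :: "real measure" where "exp_law \<equiv> density lborel (exponential_density 1)"

lemma exp_law_prob: "prob_space exp_law"
  by (rule prob_space_exponential_density) simp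

lemma exp_law_interval:
  assumes "0 \<le> a" "a \<le> b" shows "measure exp_law {a..<b} = exp (- a) - exp (- b)"
proof -
  interpret E: prob_space exp_law by (rule exp_law_prob)
  have D: "distributed exp_law lborel (\<lambda>x. x) (exponential_density 1)"
    by (auto simp: distributed_def distr_id2)
  have le: "measure exp_law {..c} = 1 - exp (- c)" if "0 \<le> c" for c
    using E.exponential_distributedD_le[OF D that] by (simp add: atMost_def)
  have "AE x in exp_law. x \<noteq> c" for c
    using AE_lborel_singleton[of c] by (subst AE_density) auto
  then have "AE x in exp_law. x \<noteq> a \<and> x \<noteq> b" by (intro AE_conjI)
  then have "measure exp_law {a..<b} = measure exp_law ({..b} - {..a})"
    by (intro E.finite_measure_eq_AE) auto
  also have "\<dots> = measure exp_law {..b} - measure exp_law {..a}"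
    using assms by (intro E.finite_measure_Diff) auto
  finally show ?thesis using le assms by simp
qed

text \<open>The integer part of \<open>2 ^ n\<close> times a standard exponential variable is
  geometric with ratio \<open>r n\<close>. \<open>grid_size\<close> exceeds it by one, so the
  coefficient \<open>c 0\<close> does not occur.\<close>

lemma exp_law_grid:
  fixes c :: "nat \<Rightarrow> real"
  assumes c: "\<And>M. \<bar>c M\<bar> \<le> B"
  defines "r n \<equiv> exp (- (1 / 2 ^ n))"
  shows "(\<lambda>M. (1 - r n) * r n ^ M * c (Suc M)) sums (\<integral>t. c (grid_size n t) \<partial>exp_law)"
proof -
  interpret E: prob_space exp_law by (rule exp_law_prob)
  define K where "K t = nat \<lfloor>t * 2 ^ n\<rfloor>" for t :: real
  have [measurable]: "K \<in> borel \<rightarrow>\<^sub>M count_space UNIV" unfolding K_def by measurable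
  have [measurable]: "{t. K t = M} \<in> sets borel" for M
    using measurable_sets[of K borel "count_space UNIV" "{M}"] by (simp add: vimage_def)
  have pM: "measure exp_law {t. K t = M} = (1 - r n) * r n ^ M" for M
  proof -
    have "AE t in exp_law. 0 \<le> t" by (subst AE_density) (auto simp: exponential_density_def)
    then have "measure exp_law {t. K t = M} = measure exp_law {real M / 2 ^ n..<real (Suc M) / 2 ^ n}"
    proof (intro E.finite_measure_eq_AE, eventually_elim)
      case (elim t)
      have "K t = M \<longleftrightarrow> \<lfloor>t * 2 ^ n\<rfloor> = int M" using elim by (auto simp: K_def)
      also have "\<dots> \<longleftrightarrow> real M \<le> t * 2 ^ n \<and> t * 2 ^ n < real M + 1" by (simp add: floor_eq_iff)
      finally show ?case by (auto simp: field_simps)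
    qed auto
    also have "\<dots> = exp (- (real M / 2 ^ n)) - exp (- (real (Suc M) / 2 ^ n))"
      by (rule exp_law_interval) (auto simp: divide_right_mono)
    also have "\<dots> = r n ^ M - r n ^ Suc M"
    proof -
      have "exp (- (real k / 2 ^ n)) = r n ^ k" for k by (simp add: r_def flip: exp_of_nat_mult)
      then show ?thesis by (simp only:)
    qed
    also have "\<dots> = (1 - r n) * r n ^ M" by (simp add: algebra_simps)
    finally show ?thesis .
  qed
  have int: "integrable exp_law (\<lambda>t. c (Suc M) * indicator {t. K t = M} t)" for M
    by (intro integrable_mult_right integrable_real_indicator) (auto simp: less_top[symmetric])
  have "(\<lambda>M. \<integral>t. c (Suc M) * indicator {t. K t = M} t \<partial>exp_law) sums (\<integral>t. (\<Sum>M. c (Suc M) * indicator {t. K t = M} t) \<partial>exp_law)"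
  proof (rule sums_integral[OF int])
    show "AE t in exp_law. summable (\<lambda>M. norm (c (Suc M) * indicator {t. K t = M} t))"
    proof (rule AE_I2)
      fix t
      show "summable (\<lambda>M. norm (c (Suc M) * indicator {t. K t = M} t))"
        by (rule summable_finite[of "{K t}"]) auto
    qed
    have r: "0 \<le> r n" "r n < 1" by (auto simp: r_def)
    have le: "norm (\<integral>t. norm (c (Suc M) * indicator {t. K t = M} t) \<partial>exp_law) \<le> B * (1 - r n) * r n ^ M" for M
      using c[of "Suc M"] r pM[of M] by (simp add: abs_mult mult.assoc mult_right_mono)
    have S: "summable (\<lambda>M. B * (1 - r n) * r n ^ M)"
      using r by (intro summable_mult summable_geometric) simp
    show "summable (\<lambda>M. \<integral>t. norm (c (Suc M) * indicator {t. K t = M} t) \<partial>exp_law)"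
      by (rule summable_comparison_test'[OF S]) (rule le)
  qed
  moreover have "(\<Sum>M. c (Suc M) * indicator {t. K t = M} t) = c (grid_size n t)" for t
  proof -
    have "(\<lambda>M. c (Suc M) * indicator {t. K t = M} t) = (\<lambda>M. if M = K t then c (Suc M) else 0)" by (auto simp: indicator_def)
    then show ?thesis using sums_unique[OF sums_single[where f="\<lambda>M. c (Suc M)" and i="K t"]] by (simp add: grid_size_def K_def)
  qed
  ultimately show ?thesis by (simp add: pM mult.commute)
qed

section \<open>Splitting at the supremum\<close>

context levy begin

text \<open>\<open>max 0\<close> extends the functional to negative times, on which
  \<open>exp_law\<close> puts no mass, so that it is measurable on the whole product space.\<close>

definition sup_part :: "real \<times> 'w \<Rightarrow> real \<times> real" where
  "sup_part x = (let f = (\<lambda>s. X s (snd x)); t = max 0 (fst x) in (sup_time f t, run_sup f t))"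

definition end_part :: "real \<times> 'w \<Rightarrow> real \<times> real" where
  "end_part x = (let f = (\<lambda>s. X s (snd x)); t = max 0 (fst x) in (t - sup_time f t, f t - run_sup f t))"

lemma parts_measurable [measurable]:
  "sup_part \<in> borel_measurable (borel \<Otimes>\<^sub>M P)" "end_part \<in> borel_measurable (borel \<Otimes>\<^sub>M P)"
proof -
  have [measurable]: "(\<lambda>x. sup_time (\<lambda>s. X s (snd x)) (max 0 (fst x))) \<in> borel_measurable (borel \<Otimes>\<^sub>M P)"
    "(\<lambda>x. run_sup (\<lambda>s. X s (snd x)) (max 0 (fst x))) \<in> borel_measurable (borel \<Otimes>\<^sub>M P)"
    "(\<lambda>x. X (max 0 (fst x)) (snd x)) \<in> borel_measurable (borel \<Otimes>\<^sub>M P)"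
    by (intro measurable_sup_time measurable_run_sup measurable_X_at; simp)+
  show "sup_part \<in> borel_measurable (borel \<Otimes>\<^sub>M P)" "end_part \<in> borel_measurable (borel \<Otimes>\<^sub>M P)"
    unfolding sup_part_def[abs_def] end_part_def[abs_def] Let_def by (intro borel_measurable_Pair; measurable)+
qed

text \<open>Test functions are continuous because the discrete positions and heights only converge
  to those of the path. The extension to measurable functions is left to
  \<open>distr_pair_eq_product\<close>.\<close>

lemma split_expectation:
  fixes \<Phi> \<Psi> :: "real \<times> real \<Rightarrow> real"
  assumes \<Phi>: "continuous_on UNIV \<Phi>" "\<And>y. 0 \<le> \<Phi> y \<and> \<Phi> y \<le> 1"
    and \<Psi>: "continuous_on UNIV \<Psi>" "\<And>y. 0 \<le> \<Psi> y \<and> \<Psi> y \<le> 1"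
  defines "Q \<equiv> exp_law \<Otimes>\<^sub>M P"
  shows "(\<integral>x. \<Phi> (sup_part x) * \<Psi> (end_part x) \<partial>Q) = (\<integral>x. \<Phi> (sup_part x) \<partial>Q) * (\<integral>x. \<Psi> (end_part x) \<partial>Q)"
proof -
  interpret E: prob_space exp_law by (rule exp_law_prob)
  interpret EP: pair_prob_space exp_law P ..
  have Q_prob: "prob_space Q" unfolding Q_def by (rule EP.prob_space_axioms)
  interpret Q: prob_space Q by (rule Q_prob)
  have sets_Q: "sets Q = sets (borel \<Otimes>\<^sub>M P)" unfolding Q_def by (intro sets_pair_measure_cong) simp_all
  have space_Q: "space Q = UNIV \<times> space P" by (simp add: Q_def space_pair_measure)
  have cong_Q [measurable_cong]: "sets Q = sets (borel \<Otimes>\<^sub>M P)" by (rule sets_Q)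
  have cts [measurable]: "\<Phi> \<in> borel_measurable borel" "\<Psi> \<in> borel_measurable borel"
    by (rule borel_measurable_continuous_onI, fact)+
  have parts_Q [measurable]: "sup_part \<in> borel_measurable Q" "end_part \<in> borel_measurable Q"
    using parts_measurable unfolding measurable_cong_sets[OF sets_Q refl] by auto
  define e where "e j = 1 / real (Suc j)" for j
  \<comment> \<open>The drift \<open>e j\<close> per unit of time amounts to \<open>e j\<close>
    times the mesh per increment.\<close>
  define \<eta> where "\<eta> j n = incr (1 / 2 ^ n) (e j * (1 / 2 ^ n))" for j n
  define am where "am j n N = iid_sequence.argmax (\<eta> j n) N" for j n N
  define wk where "wk j n = iid_sequence.walk (\<eta> j n)" for j n
  have iid: "iid_sequence P (\<eta> j n)" for j n unfolding \<eta>_def by (rule iid_incr) simp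
  have wk: "wk j n k \<omega> = X (real k / 2 ^ n) \<omega> - e j * (real k / 2 ^ n)" if "\<omega> \<in> space P" for j n k \<omega>
    unfolding wk_def \<eta>_def using walk_incr[OF _ that, of "1 / 2 ^ n" "e j * (1 / 2 ^ n)" k] by (simp add: mult.commute)
  define A where "A j n N \<omega> = (real (am j n N \<omega>) / 2 ^ n, wk j n (am j n N \<omega>) \<omega>)" for j n N \<omega>
  define B where "B j n N \<omega> = (real (N - am j n N \<omega>) / 2 ^ n, wk j n N \<omega> - wk j n (am j n N \<omega>) \<omega>)" for j n N \<omega>
  \<comment> \<open>Rescales step counts to time, so that one test function serves on all
    meshes.\<close>
  define lift where "lift f n m s = f (real m / 2 ^ n, s)" for f :: "real \<times> real \<Rightarrow> real" and n m :: nat and s :: real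
  have lift_bd: "\<bar>lift f n m s\<bar> \<le> 1" if "\<And>y. 0 \<le> f y \<and> f y \<le> 1" for f n m s
    using that by (auto simp: lift_def abs_le_iff intro: order_trans[of _ 0])
  have lift_meas: "lift f n m \<in> borel_measurable borel" if [measurable]: "f \<in> borel_measurable borel" for f n m
    unfolding lift_def[abs_def] by measurable
  have mark_eq: "iid_sequence.mark (\<eta> j n) (lift f n) (lift g n) N \<omega> = f (A j n N \<omega>) * g (B j n N \<omega>)" for f g j n N \<omega>
    by (simp add: iid_sequence.mark_def[OF iid] lift_def A_def B_def am_def wk_def)
  define En where "En f g j n = (\<integral>x. f (A j n (grid_size n (fst x)) (snd x)) * g (B j n (grid_size n (fst x)) (snd x)) \<partial>Q)"
    for f g :: "real \<times> real \<Rightarrow> real" and j n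
  define r where "r n = exp (- (1 / 2 ^ n :: real))" for n :: nat
  have r: "0 \<le> r n" "r n < 1" for n by (auto simp: r_def)
  define a where "a f j n = (\<Sum>m. r n ^ m * iid_sequence.pre_sum P (\<eta> j n) (lift f n) m)" for f j n
  define b where "b g j n = (\<Sum>m. r n ^ m * iid_sequence.post_sum P (\<eta> j n) (lift g n) m)" for g j n
  \<comment> \<open>Besides \<open>\<Phi>\<close> and \<open>\<Psi>\<close> this admits the constant
    1, which enters the cross relation at the end.\<close>
  define class1 where "class1 f \<longleftrightarrow> f \<in> borel_measurable borel \<and> (\<forall>y. 0 \<le> f y \<and> f y \<le> (1::real))" for f :: "real \<times> real \<Rightarrow> real"
  have class1D: "f \<in> borel_measurable borel" "0 \<le> f y \<and> f y \<le> 1" if "class1 f" for f y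
    using that unfolding class1_def by blast+
  have classes: "class1 \<Phi>" "class1 \<Psi>" "class1 (\<lambda>_. 1)" using \<Phi> \<Psi> by (auto simp: class1_def)
  have AB_meas: "(\<lambda>x. f (A j n (grid_size n (fst x)) (snd x)) * g (B j n (grid_size n (fst x)) (snd x))) \<in> borel_measurable Q"
    if fg: "class1 f" "class1 g" for f g j n
  proof -
    interpret iid_sequence P "\<eta> j n" by (rule iid)
    have "(\<lambda>x. mark (lift f n) (lift g n) (grid_size n (fst x)) (snd x)) \<in> borel_measurable Q"
    proof (rule measurable_compose_countable[where g="\<lambda>x. grid_size n (fst x)" and f="\<lambda>N x. mark (lift f n) (lift g n) N (snd x)"])
      show "(\<lambda>x. grid_size n (fst x)) \<in> Q \<rightarrow>\<^sub>M count_space UNIV" unfolding grid_size_def by measurable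
      fix N
      have "mark (lift f n) (lift g n) N \<in> borel_measurable P"
        by (intro mark_meas lift_meas class1D fg)
      then show "(\<lambda>x. mark (lift f n) (lift g n) N (snd x)) \<in> borel_measurable Q" by measurable
    qed
    then show ?thesis by (simp add: mark_eq)
  qed
  have fg_bd: "0 \<le> f y * g z \<and> f y * g z \<le> 1" if "class1 f" "class1 g" for f g y z
    using class1D(2)[OF that(1), of y] class1D(2)[OF that(2), of z] by (auto intro!: mult_nonneg_nonneg mult_le_one)
  \<comment> \<open>The geometric series runs over all \<open>N \<ge> 0\<close>, whereas the grid
    time is at least 1. Separating the term \<open>N = 0\<close> costs at most a multiple of
    \<open>1 - r n\<close>, which vanishes with the mesh.\<close>
  have prod_close: "\<bar>(1 - r n) * (a f j n * b g j n) - En f g j n\<bar> \<le> 2 * (1 - r n)" if fg: "class1 f" "class1 g" for f g j n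
  proof -
    interpret iid_sequence P "\<eta> j n" by (rule iid)
    have fm: "\<And>m. lift f n m \<in> borel_measurable borel" "\<And>m. lift g n m \<in> borel_measurable borel"
      and fb: "\<And>m x. \<bar>lift f n m x\<bar> \<le> 1" "\<And>m x. \<bar>lift g n m x\<bar> \<le> 1"
      by (intro lift_meas lift_bd class1D fg)+
    define c where "c N = (\<integral>\<omega>. mark (lift f n) (lift g n) N \<omega> \<partial>P)" for N
    have mb: "0 \<le> mark (lift f n) (lift g n) N \<omega> \<and> mark (lift f n) (lift g n) N \<omega> \<le> 1" for N \<omega>
      unfolding mark_eq by (rule fg_bd[OF fg])
    have int: "integrable P (mark (lift f n) (lift g n) N)" for N
      using mark_meas[OF fm] mark_bound[OF fb] by (intro integrable_const_bound[of _ 1]) auto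
    have c01: "0 \<le> c N" "c N \<le> 1" for N
    proof -
      show "0 \<le> c N" unfolding c_def using mb by (simp add: integral_nonneg)
      show "c N \<le> 1" unfolding c_def using mb by (intro integral_le_const[OF int]) auto
    qed
    have s1: "(\<lambda>N. r n ^ N * c N) sums (a f j n * b g j n)"
      unfolding c_def a_def b_def by (rule geometric_factorisation[OF fm fb r])
    have s2: "(\<lambda>M. (1 - r n) * r n ^ M * c (Suc M)) sums En f g j n"
    proof -
      have "En f g j n = (\<integral>x. mark (lift f n) (lift g n) (grid_size n (fst x)) (snd x) \<partial>Q)"
        by (simp add: En_def mark_eq)
      also have "\<dots> = (\<integral>t. (\<integral>\<omega>. mark (lift f n) (lift g n) (grid_size n t) \<omega> \<partial>P) \<partial>exp_law)"
      proof -
        have "integrable (exp_law \<Otimes>\<^sub>M P) (\<lambda>x. mark (lift f n) (lift g n) (grid_size n (fst x)) (snd x))"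
          using AB_meas[OF fg, of j n] mb unfolding mark_eq[symmetric] Q_def[symmetric]
          by (intro Q.integrable_const_bound[of _ 1]) (auto simp: abs_le_iff intro: order_trans[of _ 0])
        from EP.integral_fst'[OF this] show ?thesis unfolding Q_def by simp
      qed
      also have "\<dots> = (\<integral>t. c (grid_size n t) \<partial>exp_law)" by (simp add: c_def)
      finally have "En f g j n = (\<integral>t. c (grid_size n t) \<partial>exp_law)" .
      moreover have "\<bar>c M\<bar> \<le> 1" for M using c01[of M] by simp
      ultimately show ?thesis using exp_law_grid[of c 1 n] by (simp add: r_def)
    qed
    have "(\<lambda>M. r n ^ Suc M * c (Suc M)) sums (a f j n * b g j n - c 0)"
      using sums_Suc_iff[of "\<lambda>N. r n ^ N * c N"] s1 by simp
    then have "(\<lambda>M. (1 - r n) * (r n ^ Suc M * c (Suc M))) sums ((1 - r n) * (a f j n * b g j n - c 0))" by (rule sums_mult)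
    moreover have "(\<lambda>M. r n * ((1 - r n) * r n ^ M * c (Suc M))) sums (r n * En f g j n)" by (rule sums_mult[OF s2])
    moreover have "(\<lambda>M. (1 - r n) * (r n ^ Suc M * c (Suc M))) = (\<lambda>M. r n * ((1 - r n) * r n ^ M * c (Suc M)))"
      by (simp add: mult_ac)
    ultimately have "(1 - r n) * (a f j n * b g j n - c 0) = r n * En f g j n" by (metis sums_unique2)
    then have eq: "(1 - r n) * (a f j n * b g j n) - En f g j n = (1 - r n) * (c 0 - En f g j n)" by (simp add: algebra_simps)
    have "0 \<le> En f g j n" "En f g j n \<le> 1"
    proof -
      show "0 \<le> En f g j n" unfolding En_def using fg_bd[OF fg] by (simp add: integral_nonneg)
      have "integrable Q (\<lambda>x. f (A j n (grid_size n (fst x)) (snd x)) * g (B j n (grid_size n (fst x)) (snd x)))"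
        using AB_meas[OF fg] fg_bd[OF fg] by (intro Q.integrable_const_bound[of _ 1]) (auto simp: abs_le_iff intro: order_trans[of _ 0])
      then show "En f g j n \<le> 1" unfolding En_def using fg_bd[OF fg] by (intro Q.integral_le_const) auto
    qed
    then have "\<bar>c 0 - En f g j n\<bar> \<le> 2" using c01[of 0] by linarith
    from mult_left_mono[OF this, of "1 - r n"] show ?thesis unfolding eq abs_mult using r[of n] by simp
  qed
  define x y z where "x = (\<integral>x. \<Phi> (sup_part x) * \<Psi> (end_part x) \<partial>Q)" and "y = (\<integral>x. \<Phi> (sup_part x) \<partial>Q)"
    and "z = (\<integral>x. \<Psi> (end_part x) \<partial>Q)"
  define AA where "AA j n x = A j n (grid_size n (max 0 (fst x))) (snd x)" for j n x
  define BB where "BB j n x = B j n (grid_size n (max 0 (fst x))) (snd x)" for j n x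
  have gs: "grid_size n (max 0 t) = grid_size n t" for n t
  proof (cases "0 \<le> t")
    case False
    then have "t * 2 ^ n \<le> 0" by (simp add: mult_nonpos_nonneg)
    then have "nat \<lfloor>t * 2 ^ n\<rfloor> = 0" by linarith
    then show ?thesis using False by (simp add: grid_size_def max_def)
  qed (simp add: max_def)
  have En_eq: "En f g j n = (\<integral>x. f (AA j n x) * g (BB j n x) \<partial>Q)" for f g j n
    by (simp add: En_def AA_def BB_def gs)
  have AAm: "(\<lambda>x. f (AA j n x) * g (BB j n x)) \<in> borel_measurable Q" if "class1 f" "class1 g" for f g j n
    using AB_meas[OF that] by (simp add: AA_def BB_def gs)
  \<comment> \<open>One distance dominates the errors of all three expectations, so that a single
    choice of drift and mesh serves them simultaneously.\<close>
  define dd where "dd p q = \<bar>\<Phi> (fst p) * \<Psi> (snd p) - \<Phi> (fst q) * \<Psi> (snd q)\<bar> + \<bar>\<Phi> (fst p) - \<Phi> (fst q)\<bar> + \<bar>\<Psi> (snd p) - \<Psi> (snd q)\<bar>" for p q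
  define d where "d j n x = dd (AA j n x, BB j n x) (sup_part x, end_part x)" for j n x
  have d_meas: "d j n \<in> borel_measurable Q" for j n
  proof -
    have [measurable]: "(\<lambda>x. \<Phi> (AA j n x) * \<Psi> (BB j n x)) \<in> borel_measurable Q" "(\<lambda>x. \<Phi> (AA j n x)) \<in> borel_measurable Q"
      "(\<lambda>x. \<Psi> (BB j n x)) \<in> borel_measurable Q"
      using AAm[OF classes(1,2), of j n] AAm[OF classes(1,3), of j n] AAm[OF classes(3,2), of j n] by simp_all
    show ?thesis unfolding d_def dd_def fst_conv snd_conv by measurable
  qed
  have \<Phi>b: "\<bar>\<Phi> p - \<Phi> q\<bar> \<le> 1" and \<Psi>b: "\<bar>\<Psi> p - \<Psi> q\<bar> \<le> 1" for p q
    using \<Phi>(2)[of p] \<Phi>(2)[of q] \<Psi>(2)[of p] \<Psi>(2)[of q] by auto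
  have \<Phi>\<Psi>b: "\<bar>\<Phi> p * \<Psi> p' - \<Phi> q * \<Psi> q'\<bar> \<le> 1" for p q p' q'
    using fg_bd[OF classes(1,2), of p p'] fg_bd[OF classes(1,2), of q q'] by auto
  have d_bd: "0 \<le> d j n x \<and> d j n x \<le> 3" for j n x
    using \<Phi>b \<Psi>b \<Phi>\<Psi>b unfolding d_def dd_def by (smt (verit, best) fst_conv snd_conv)
  have d_lim: "\<forall>\<^sub>F j in sequentially. \<forall>\<^sub>F n in sequentially. d j n x \<le> \<kappa>" if x: "x \<in> space Q" and \<kappa>: "0 < \<kappa>" for x \<kappa>
  proof -
    let ?q = "(sup_part x, end_part x)" and ?t = "max 0 (fst x)" and ?\<omega> = "snd x"
    have \<omega>: "?\<omega> \<in> space P" using x by (auto simp: space_Q)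
    interpret cadlag0 "\<lambda>s. X s ?\<omega>" by (rule X_path[OF \<omega>])
    have "continuous_on UNIV (\<lambda>p. dd p ?q)"
      unfolding dd_def by (intro continuous_intros continuous_on_compose2[OF \<Phi>(1)] continuous_on_compose2[OF \<Psi>(1)]) auto
    then have "isCont (\<lambda>p. dd p ?q) ?q"
      unfolding continuous_on_eq_continuous_at[OF open_UNIV] by blast
    moreover have "dd ?q ?q = 0" by (simp add: dd_def)
    ultimately have "((\<lambda>p. dd p ?q) \<longlongrightarrow> 0) (at ?q)" by (simp add: isCont_def)
    then obtain \<delta> where \<delta>: "0 < \<delta>" "\<And>p. p \<noteq> ?q \<Longrightarrow> dist p ?q < \<delta> \<Longrightarrow> dist (dd p ?q) 0 < \<kappa>"
      using \<kappa> unfolding LIM_def by blast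
    have \<delta>': "dd p ?q \<le> \<kappa>" if "dist p ?q < \<delta>" for p
      using \<delta>(2)[OF _ that] \<open>dd ?q ?q = 0\<close> \<kappa> by (cases "p = ?q") auto
    \<comment> \<open>The two pairs will differ by at most \<open>2 * h\<close> and
      \<open>4 * h\<close>; the 7 turns the total \<open>6 * h\<close> into a strict bound.\<close>
    define h where "h = \<delta> / 7"
    have h: "0 < h" using \<delta> by (simp add: h_def)
    from tilted_argmax_limit[OF max.cobounded1 h, of "fst x"]
    obtain e0 where e0: "0 < e0" and lim: "\<And>e. 0 < e \<Longrightarrow> e < e0 \<Longrightarrow> \<forall>\<^sub>F n in sequentially.
        \<forall>m\<le>grid_size n ?t. (\<forall>l\<le>grid_size n ?t. X (real l / 2 ^ n) ?\<omega> - e * (real l / 2 ^ n) \<le> X (real m / 2 ^ n) ?\<omega> - e * (real m / 2 ^ n)) \<longrightarrow>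
      \<bar>real m / 2 ^ n - sup_time (\<lambda>s. X s ?\<omega>) ?t\<bar> \<le> h \<and> \<bar>X (real m / 2 ^ n) ?\<omega> - e * (real m / 2 ^ n) - run_sup (\<lambda>s. X s ?\<omega>) ?t\<bar> \<le> h \<and>
      \<bar>real (grid_size n ?t) / 2 ^ n - ?t\<bar> \<le> h \<and>
      \<bar>X (real (grid_size n ?t) / 2 ^ n) ?\<omega> - e * (real (grid_size n ?t) / 2 ^ n) - X ?t ?\<omega>\<bar> \<le> h" by blast
    have "(\<lambda>j. e j) \<longlonglongrightarrow> 0" unfolding e_def by (intro LIMSEQ_Suc lim_const_over_n)
    then have "\<forall>\<^sub>F j in sequentially. e j < e0" using e0 by (rule order_tendstoD)
    then show ?thesis
    proof eventually_elim
      case (elim j)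
      have ej: "0 < e j" by (simp add: e_def)
      from lim[OF ej elim] show ?case
      proof eventually_elim
        case (elim n)
        interpret iid_sequence P "\<eta> j n" by (rule iid)
        let ?N = "grid_size n ?t" let ?m = "am j n ?N ?\<omega>"
        have m: "?m \<le> ?N" "\<And>l. l \<le> ?N \<Longrightarrow> wk j n l ?\<omega> \<le> wk j n ?m ?\<omega>"
          unfolding am_def wk_def by (rule argmax_props)+
        then have *: "\<bar>real ?m / 2 ^ n - sup_time (\<lambda>s. X s ?\<omega>) ?t\<bar> \<le> h" "\<bar>wk j n ?m ?\<omega> - run_sup (\<lambda>s. X s ?\<omega>) ?t\<bar> \<le> h"
          "\<bar>real ?N / 2 ^ n - ?t\<bar> \<le> h" "\<bar>wk j n ?N ?\<omega> - X ?t ?\<omega>\<bar> \<le> h"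
          using elim[rule_format, OF m(1)] unfolding wk[OF \<omega>] by auto
        have B1: "real (?N - ?m) / 2 ^ n = real ?N / 2 ^ n - real ?m / 2 ^ n"
          using m(1) by (simp add: of_nat_diff diff_divide_distrib)
        have "dist (AA j n x, BB j n x) ?q \<le> dist (AA j n x) (sup_part x) + dist (BB j n x) (end_part x)"
          unfolding dist_Pair_Pair by (rule sqrt_sum_squares_le_sum) (rule zero_le_dist)+
        also have "dist (AA j n x) (sup_part x) \<le> dist (real ?m / 2 ^ n) (sup_time (\<lambda>s. X s ?\<omega>) ?t) + dist (wk j n ?m ?\<omega>) (run_sup (\<lambda>s. X s ?\<omega>) ?t)"
          unfolding AA_def A_def sup_part_def Let_def dist_Pair_Pair by (rule sqrt_sum_squares_le_sum) auto
        also have "\<dots> \<le> 2 * h" using * by (simp add: dist_real_def)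
        also have "dist (BB j n x) (end_part x) \<le> dist (real (?N - ?m) / 2 ^ n) (?t - sup_time (\<lambda>s. X s ?\<omega>) ?t) +
            dist (wk j n ?N ?\<omega> - wk j n ?m ?\<omega>) (X ?t ?\<omega> - run_sup (\<lambda>s. X s ?\<omega>) ?t)"
          unfolding BB_def B_def end_part_def Let_def dist_Pair_Pair by (rule sqrt_sum_squares_le_sum) auto
        also have "\<dots> \<le> 4 * h"
        proof -
          have abs4: "\<bar>a - b - (c - d)\<bar> \<le> 2 * h" if "\<bar>b - d\<bar> \<le> h" "\<bar>a - c\<bar> \<le> h" for a b c d :: real
            using that by linarith
          show ?thesis
            unfolding B1 dist_real_def using add_mono[OF abs4[OF *(1,3)] abs4[OF *(2,4)]] by simp
        qed
        finally have "dist (AA j n x, BB j n x) ?q \<le> 6 * h" by simp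
        then have "dist (AA j n x, BB j n x) ?q < \<delta>" using h by (simp add: h_def)
        then show ?case unfolding d_def by (rule \<delta>')
      qed
    qed
  qed
  have exist: "\<exists>j n. (\<integral>x. d j n x \<partial>Q) < \<kappa> \<and> 1 - r n < \<kappa>" if \<kappa>: "0 < \<kappa>" for \<kappa>
  proof -
    have "\<forall>\<^sub>F j in sequentially. \<forall>\<^sub>F n in sequentially. (\<integral>x. d j n x \<partial>Q) < \<kappa>"
      by (rule iterated_dominated_convergence[OF Q.finite_measure_axioms d_meas d_bd d_lim \<kappa>])
    then obtain j where j: "\<forall>\<^sub>F n in sequentially. (\<integral>x. d j n x \<partial>Q) < \<kappa>"
      using eventually_happens'[OF sequentially_bot] by blast
    have "(\<lambda>n. 1 - r n) \<longlonglongrightarrow> 1 - exp (- 0)"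
      unfolding r_def by (intro tendsto_diff tendsto_const tendsto_exp tendsto_minus LIMSEQ_inverse_power2)
    then have "\<forall>\<^sub>F n in sequentially. 1 - r n < \<kappa>" using \<kappa> by (intro order_tendstoD(2)) auto
    from eventually_happens'[OF sequentially_bot eventually_conj[OF j this]] show ?thesis by blast
  qed
  then have "\<forall>i. \<exists>j n. (\<integral>x. d j n x \<partial>Q) < 1 / real (Suc i) \<and> 1 - r n < 1 / real (Suc i)" by simp
  then obtain jj nn where jn: "\<And>i. (\<integral>x. d (jj i) (nn i) x \<partial>Q) < 1 / real (Suc i)" "\<And>i. 1 - r (nn i) < 1 / real (Suc i)"
    by metis
  have close: "\<bar>En \<Phi> \<Psi> j n - x\<bar> \<le> (\<integral>x. d j n x \<partial>Q)" "\<bar>En \<Phi> (\<lambda>_. 1) j n - y\<bar> \<le> (\<integral>x. d j n x \<partial>Q)"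
    "\<bar>En (\<lambda>_. 1) \<Psi> j n - z\<bar> \<le> (\<integral>x. d j n x \<partial>Q)" for j n
  proof -
    have int_d: "integrable Q (d j n)" using d_meas d_bd by (intro Q.integrable_const_bound[of _ 3]) (auto simp: abs_le_iff intro: order_trans[of _ 0])
    have gen: "\<bar>(\<integral>x. u x \<partial>Q) - (\<integral>x. v x \<partial>Q)\<bar> \<le> (\<integral>x. d j n x \<partial>Q)"
      if m: "u \<in> borel_measurable Q" "v \<in> borel_measurable Q" and b: "\<And>x. 0 \<le> u x \<and> u x \<le> 1" "\<And>x. 0 \<le> v x \<and> v x \<le> 1"
        and le: "\<And>x. \<bar>u x - v x\<bar> \<le> d j n x" for u v
    proof -
      have int: "integrable Q u" "integrable Q v"
        using m b by (auto intro!: Q.integrable_const_bound[of _ 1] simp: abs_le_iff intro: order_trans[of _ 0])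
      have "\<bar>(\<integral>x. u x \<partial>Q) - (\<integral>x. v x \<partial>Q)\<bar> = \<bar>\<integral>x. u x - v x \<partial>Q\<bar>" using int by simp
      also have "\<dots> \<le> (\<integral>x. \<bar>u x - v x\<bar> \<partial>Q)" by (rule integral_abs_bound)
      also have "\<dots> \<le> (\<integral>x. d j n x \<partial>Q)" using int int_d le by (intro integral_mono) auto
      finally show ?thesis .
    qed
    show "\<bar>En \<Phi> \<Psi> j n - x\<bar> \<le> (\<integral>x. d j n x \<partial>Q)" unfolding En_eq x_def
      by (rule gen[OF AAm[OF classes(1,2)]]) (use fg_bd[OF classes(1,2)] in \<open>auto simp: d_def dd_def\<close>)
    show "\<bar>En \<Phi> (\<lambda>_. 1) j n - y\<bar> \<le> (\<integral>x. d j n x \<partial>Q)" unfolding En_eq y_def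
      by (rule gen[OF AAm[OF classes(1,3)]]) (use \<Phi>(2) in \<open>auto simp: d_def dd_def\<close>)
    show "\<bar>En (\<lambda>_. 1) \<Psi> j n - z\<bar> \<le> (\<integral>x. d j n x \<partial>Q)" unfolding En_eq z_def
      by (rule gen[OF AAm[OF classes(3,2)]]) (use \<Psi>(2) in \<open>auto simp: d_def dd_def\<close>)
  qed
  define L where "L f g i = (1 - r (nn i)) * (a f (jj i) (nn i) * b g (jj i) (nn i))" for f g i
  have L: "L f g \<longlonglongrightarrow> v" if fg: "class1 f" "class1 g" and v: "\<And>j n. \<bar>En f g j n - v\<bar> \<le> (\<integral>x. d j n x \<partial>Q)" for f g v
  proof (rule Lim_null[THEN iffD2], rule tendsto_rabs_zero_cancel,
      rule tendsto_sandwich[where f="\<lambda>_. 0" and h="\<lambda>i. 3 / real (Suc i)"])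
    show "(\<lambda>i. 3 / real (Suc i)) \<longlonglongrightarrow> 0" by (rule LIMSEQ_Suc[OF lim_const_over_n])
    show "\<forall>\<^sub>F i in sequentially. \<bar>L f g i - v\<bar> \<le> 3 / real (Suc i)"
    proof (intro always_eventually allI)
      fix i
      have comb: "\<bar>u - v\<bar> \<le> 3 * s" if "\<bar>u - w\<bar> \<le> 2 * c" "\<bar>w - v\<bar> < s" "c < s" for u w c s :: real
        using that by linarith
      have "\<bar>L f g i - En f g (jj i) (nn i)\<bar> \<le> 2 * (1 - r (nn i))" unfolding L_def by (rule prod_close[OF fg])
      from comb[OF this le_less_trans[OF v jn(1)] jn(2)]
      show "\<bar>L f g i - v\<bar> \<le> 3 / real (Suc i)" by simp
    qed
  qed auto
  have one: "\<bar>En (\<lambda>_. 1) (\<lambda>_. 1) j n - 1\<bar> \<le> (\<integral>x. d j n x \<partial>Q)" for j n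
    using d_bd by (simp add: En_eq Q.prob_space integral_nonneg)
  \<comment> \<open>For every \<open>i\<close> this product and the next consist of the same
    factors, one \<open>a\<close> and one \<open>b\<close> for each of the two slots and for the
    constant 1, and twice \<open>1 - r\<close>. Their limits are \<open>x * 1\<close> and
    \<open>y * z\<close>.\<close>
  have "(\<lambda>i. L \<Phi> \<Psi> i * L (\<lambda>_. 1) (\<lambda>_. 1) i) \<longlonglongrightarrow> x * 1"
    by (intro tendsto_mult L classes close one)
  moreover have "(\<lambda>i. L \<Phi> (\<lambda>_. 1) i * L (\<lambda>_. 1) \<Psi> i) \<longlonglongrightarrow> y * z"
    by (intro tendsto_mult L classes close)
  moreover have "(\<lambda>i. L \<Phi> \<Psi> i * L (\<lambda>_. 1) (\<lambda>_. 1) i) = (\<lambda>i. L \<Phi> (\<lambda>_. 1) i * L (\<lambda>_. 1) \<Psi> i)"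
    by (simp add: L_def mult_ac)
  ultimately have "x * 1 = y * z" using LIMSEQ_unique by metis
  then show ?thesis by (simp add: x_def y_def z_def)
qed

section \<open>The factorisation with respect to Lebesgue measure\<close>

definition split_integral :: "(real \<times> real \<Rightarrow> ennreal) \<Rightarrow> (real \<times> real \<Rightarrow> ennreal) \<Rightarrow> ennreal" where
  "split_integral F G = (\<integral>\<^sup>+t. indicator {0<..} t * (\<integral>\<^sup>+\<omega>. F (sup_time (\<lambda>s. X s \<omega>) t, run_sup (\<lambda>s. X s \<omega>) t) *
     G (t - sup_time (\<lambda>s. X s \<omega>) t, X t \<omega> - run_sup (\<lambda>s. X s \<omega>) t) \<partial>P) \<partial>lborel)"

text \<open>The functionals are existentially quantified because only their products matter:
  reciprocal constants could be exchanged between them. Values in \<open>ennreal\<close> accommodate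
  the unbounded weight that compensates the exponential density.\<close>

theorem split_integral_product:
  "\<exists>a b. \<forall>F\<in>borel_measurable borel. \<forall>G\<in>borel_measurable borel. split_integral F G = a F * b G"
proof -
  interpret E: prob_space exp_law by (rule exp_law_prob)
  interpret EP: pair_prob_space exp_law P ..
  let ?Q = "exp_law \<Otimes>\<^sub>M P"
  have sets_Q: "sets ?Q = sets (borel \<Otimes>\<^sub>M P)" by (intro sets_pair_measure_cong) simp_all
  have parts_Q [measurable]: "sup_part \<in> borel_measurable ?Q" "end_part \<in> borel_measurable ?Q"
    using parts_measurable unfolding measurable_cong_sets[OF sets_Q refl] by auto
  interpret V: prob_space "distr ?Q borel end_part" by (rule EP.prob_space_distr) simp
  have ind: "distr ?Q (borel \<Otimes>\<^sub>M borel) (\<lambda>x. (sup_part x, end_part x)) = distr ?Q borel sup_part \<Otimes>\<^sub>M distr ?Q borel end_part"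
    by (rule distr_pair_eq_product[OF EP.prob_space_axioms]) (auto intro!: split_expectation)
  define w where "w F p = ennreal (exp (fst p)) * F p" for F :: "real \<times> real \<Rightarrow> ennreal" and p
  have "split_integral F G = (\<integral>\<^sup>+p. w F p \<partial>distr ?Q borel sup_part) * (\<integral>\<^sup>+p. w G p \<partial>distr ?Q borel end_part)"
    if F[measurable]: "F \<in> borel_measurable borel" and G[measurable]: "G \<in> borel_measurable borel" for F G
  proof -
    have [measurable]: "w F \<in> borel_measurable borel" if [measurable]: "F \<in> borel_measurable borel" for F
    proof -
      have "(\<lambda>p :: real \<times> real. fst p) \<in> borel_measurable borel" by (intro borel_measurable_continuous_onI continuous_intros)
      then show ?thesis unfolding w_def by measurable
    qed
    have m1: "(\<lambda>x. w F (sup_part x) * w G (end_part x)) \<in> borel_measurable ?Q" by measurable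
    have "(\<integral>\<^sup>+p. w F p \<partial>distr ?Q borel sup_part) * (\<integral>\<^sup>+p. w G p \<partial>distr ?Q borel end_part) =
        (\<integral>\<^sup>+p. (\<integral>\<^sup>+q. w F p * w G q \<partial>distr ?Q borel end_part) \<partial>distr ?Q borel sup_part)"
      by (simp add: nn_integral_cmult nn_integral_multc)
    also have "\<dots> = (\<integral>\<^sup>+z. w F (fst z) * w G (snd z) \<partial>(distr ?Q borel sup_part \<Otimes>\<^sub>M distr ?Q borel end_part))"
      by (subst V.nn_integral_fst[symmetric]) auto
    also have "\<dots> = (\<integral>\<^sup>+x. w F (sup_part x) * w G (end_part x) \<partial>?Q)"
      unfolding ind[symmetric] by (subst nn_integral_distr) auto
    also have "\<dots> = (\<integral>\<^sup>+t. (\<integral>\<^sup>+\<omega>. w F (sup_part (t, \<omega>)) * w G (end_part (t, \<omega>)) \<partial>P) \<partial>exp_law)"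
      by (rule nn_integral_fst[symmetric, OF m1])
    also have "\<dots> = (\<integral>\<^sup>+t. ennreal (exponential_density 1 t) * (\<integral>\<^sup>+\<omega>. w F (sup_part (t, \<omega>)) * w G (end_part (t, \<omega>)) \<partial>P) \<partial>lborel)"
    proof (rule nn_integral_density)
      show "(\<lambda>t. \<integral>\<^sup>+\<omega>. w F (sup_part (t, \<omega>)) * w G (end_part (t, \<omega>)) \<partial>P) \<in> borel_measurable lborel"
        using borel_measurable_nn_integral_fst[OF m1] by simp
    qed simp
    also have "\<dots> = split_integral F G"
      unfolding split_integral_def
    proof (rule nn_integral_cong_AE)
      show "AE t in lborel. ennreal (exponential_density 1 t) * (\<integral>\<^sup>+\<omega>. w F (sup_part (t, \<omega>)) * w G (end_part (t, \<omega>)) \<partial>P) =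
        indicator {0<..} t * (\<integral>\<^sup>+\<omega>. F (sup_time (\<lambda>s. X s \<omega>) t, run_sup (\<lambda>s. X s \<omega>) t) *
          G (t - sup_time (\<lambda>s. X s \<omega>) t, X t \<omega> - run_sup (\<lambda>s. X s \<omega>) t) \<partial>P)"
        using AE_lborel_singleton[of 0]
      proof eventually_elim
        case (elim t)
        show ?case
        proof (cases "0 < t")
          case True
          let ?I = "\<lambda>\<omega>. F (sup_time (\<lambda>s. X s \<omega>) t, run_sup (\<lambda>s. X s \<omega>) t) *
              G (t - sup_time (\<lambda>s. X s \<omega>) t, X t \<omega> - run_sup (\<lambda>s. X s \<omega>) t)"
          have I_eq: "?I \<omega> = F (sup_part (t, \<omega>)) * G (end_part (t, \<omega>))" for \<omega>
            using True by (simp add: sup_part_def end_part_def Let_def)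
          have Im: "?I \<in> borel_measurable P" unfolding I_eq by measurable
          have "w F (sup_part (t, \<omega>)) * w G (end_part (t, \<omega>)) = ennreal (exp t) * ?I \<omega>" for \<omega>
          proof -
            have "w F (sup_part (t, \<omega>)) * w G (end_part (t, \<omega>)) =
                (ennreal (exp (sup_time (\<lambda>s. X s \<omega>) t)) * ennreal (exp (t - sup_time (\<lambda>s. X s \<omega>) t))) * ?I \<omega>"
              using True by (simp add: w_def sup_part_def end_part_def Let_def mult_ac)
            also have "ennreal (exp (sup_time (\<lambda>s. X s \<omega>) t)) * ennreal (exp (t - sup_time (\<lambda>s. X s \<omega>) t)) = ennreal (exp t)"
              by (simp flip: ennreal_mult exp_add)
            finally show ?thesis .
          qed
          then have "(\<integral>\<^sup>+\<omega>. w F (sup_part (t, \<omega>)) * w G (end_part (t, \<omega>)) \<partial>P) = ennreal (exp t) * (\<integral>\<^sup>+\<omega>. ?I \<omega> \<partial>P)"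
            using nn_integral_cmult[OF Im] by simp
          moreover have "ennreal (exponential_density 1 t) * ennreal (exp t) = 1"
            using True by (simp add: exponential_density_def flip: ennreal_mult exp_add)
          ultimately show ?thesis using True by (simp flip: mult.assoc)
        qed (use elim in \<open>simp add: exponential_density_def\<close>)
      qed
    qed
    finally show ?thesis by simp
  qed
  note product = this
  show ?thesis
    by (rule exI[of _ "\<lambda>F. \<integral>\<^sup>+p. w F p \<partial>distr ?Q borel sup_part"],
        rule exI[of _ "\<lambda>G. \<integral>\<^sup>+p. w G p \<partial>distr ?Q borel end_part"], intro ballI, rule product)
qed

end

section \<open>Irreducibility and time reversal of the phase process\<close>

text \<open>Combines the derivatives of the entries into the derivative of the kernel acting on a
  vector, in the form that \<open>semigroup_supermedian\<close> asks for.\<close>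

lemma finite_sum_option_matrix:
  fixes v :: "'n::finite \<Rightarrow> real" and c :: "'n \<Rightarrow> real \<Rightarrow> real"
  assumes "\<And>y. ((\<lambda>h. (c y h - (if y = x then 1 else 0)) / h) \<longlongrightarrow> d y) (at_right 0)"
  shows "((\<lambda>h. ((\<Sum>y\<in>UNIV. c y h * v y) - v x) / h) \<longlongrightarrow> (\<Sum>y\<in>UNIV. d y * v y)) (at_right 0)"
proof -
  have "((\<lambda>h. \<Sum>y\<in>UNIV. (c y h - (if y = x then 1 else 0)) / h * v y) \<longlongrightarrow> (\<Sum>y\<in>UNIV. d y * v y)) (at_right 0)"
    by (intro tendsto_sum tendsto_mult tendsto_const assms)
  moreover have "(\<Sum>y\<in>UNIV. (c y h - (if y = x then 1 else 0)) / h * v y) = ((\<Sum>y\<in>UNIV. c y h * v y) - v x) / h" for h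
  proof -
    have "(\<Sum>y\<in>UNIV. (c y h - (if y = x then 1 else 0)) / h * v y) =
        (\<Sum>y\<in>UNIV. (c y h - (if y = x then 1 else 0)) * v y) / h" by (simp add: sum_divide_distrib)
    also have "(\<Sum>y\<in>UNIV. (c y h - (if y = x then 1 else 0)) * v y) = (\<Sum>y\<in>UNIV. c y h * v y) - v x"
    proof -
      have "(c y h - (if y = x then 1 else 0)) * v y = c y h * v y - (if y = x then v x else 0)" for y
        by (auto simp: left_diff_distrib)
      then show ?thesis by (simp add: sum_subtractf)
    qed
    finally show ?thesis .
  qed
  ultimately show ?thesis by simp
qed

context phase_semigroup begin

lemma pp_deriv: "((\<lambda>h. (pp h x y - (if x = y then 1 else 0)) / h) \<longlongrightarrow> T $ x $ y) (at_right 0)"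
  using p_deriv[of "Some x" "Some y"] by (simp add: p_0)

lemma pp_ge: "0 \<le> s \<Longrightarrow> 0 \<le> t \<Longrightarrow> pp s i k * pp t k j \<le> pp (s + t) i j"
  unfolding pp_add by (rule member_le_sum) (auto intro!: mult_nonneg_nonneg p_nonneg)

text \<open>Positive for small times by continuity at 0; a longer time is cut into short pieces,
  each of which ends at \<open>i\<close> again with positive probability.\<close>

lemma pp_refl_pos: assumes t: "0 \<le> t" shows "0 < pp t i i"
proof -
  have "\<forall>\<^sub>F h in at_right 0. 0 < pp h i i"
    using p_tendsto_0[of "Some i" "Some i"] by (intro order_tendstoD(1)) (auto simp: p_0)
  then obtain \<epsilon> where \<epsilon>: "0 < \<epsilon>" "\<And>h. 0 < h \<Longrightarrow> h < \<epsilon> \<Longrightarrow> 0 < pp h i i" by (auto simp: eventually_at_right_field)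
  have n: "0 < pp (real n * h) i i" if h: "0 < h" "h < \<epsilon>" for n h
  proof (induction n)
    case (Suc n)
    have "0 < pp (real n * h) i i * pp h i i" using Suc \<epsilon>(2)[OF h] by simp
    also have "\<dots> \<le> pp (real n * h + h) i i" using h by (intro pp_ge) auto
    finally show ?case by (simp add: algebra_simps)
  qed (simp add: p_0)
  obtain m where m: "t / \<epsilon> < real (Suc m)" using reals_Archimedean2[of "t / \<epsilon>"] less_trans by (metis lessI of_nat_less_iff)
  show ?thesis
  proof (cases "t = 0")
    case False
    have "0 < pp (real (Suc m) * (t / real (Suc m))) i i"
      using m \<epsilon>(1) t False by (intro n) (auto simp: field_simps)
    then show ?thesis by (simp del: of_nat_Suc)
  qed (simp add: p_0)
qed

definition leads :: "('n \<times> 'n) set" where "leads = {(a, b). T $ a $ b \<noteq> 0}\<^sup>*"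

text \<open>Along a chain of nonzero rates, positivity for all small times is propagated by giving
  half of the time to the chain so far and half to the new edge; diagonal entries add no edge. For a
  prescribed \<open>t\<close>, the surplus time is put in front, as a return to
  \<open>i\<close>.\<close>

lemma leads_pos:
  assumes T: "sub_generator T" and ij: "(i, j) \<in> leads" and t: "0 < t"
  shows "0 < pp t i j"
proof -
  have "\<exists>\<epsilon>>0. \<forall>h. 0 < h \<and> h < \<epsilon> \<longrightarrow> 0 < pp h i j"
    using ij unfolding leads_def
  proof (induction rule: rtrancl_induct)
    case base
    then show ?case using pp_refl_pos[of _ i] by (intro exI[of _ 1]) auto
  next
    case (step y z)
    then obtain \<epsilon> where \<epsilon>: "0 < \<epsilon>" "\<And>h. 0 < h \<Longrightarrow> h < \<epsilon> \<Longrightarrow> 0 < pp h i y" by auto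
    show ?case
    proof (cases "y = z")
      case False
      then have "0 < T $ y $ z" using step(2) T unfolding sub_generator_def by (metis (mono_tags, lifting) case_prodD less_eq_real_def mem_Collect_eq)
      moreover have "((\<lambda>h. pp h y z / h) \<longlongrightarrow> T $ y $ z) (at_right 0)" using pp_deriv[of y z] False by simp
      ultimately have "\<forall>\<^sub>F h in at_right 0. 0 < pp h y z / h" by (intro order_tendstoD(1)) auto
      then obtain \<delta> where \<delta>: "0 < \<delta>" "\<And>h. 0 < h \<Longrightarrow> h < \<delta> \<Longrightarrow> 0 < pp h y z / h" by (auto simp: eventually_at_right_field)
      show ?thesis
      proof (intro exI[of _ "min \<epsilon> \<delta>"] conjI allI impI)
        fix h assume h: "0 < h \<and> h < min \<epsilon> \<delta>"
        then have "0 < pp (h / 2) i y" "0 < pp (h / 2) y z" using \<epsilon>(2)[of "h / 2"] \<delta>(2)[of "h / 2"] by (auto simp: zero_less_divide_iff)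
        then have "0 < pp (h / 2) i y * pp (h / 2) y z" by simp
        also have "\<dots> \<le> pp (h / 2 + h / 2) i z" using h by (intro pp_ge) auto
        finally show "0 < pp h i z" by simp
      qed (use \<epsilon> \<delta> in auto)
    qed (use \<epsilon> in auto)
  qed
  then obtain \<epsilon> where \<epsilon>: "0 < \<epsilon>" "\<And>h. 0 < h \<Longrightarrow> h < \<epsilon> \<Longrightarrow> 0 < pp h i j" by auto
  define s where "s = min (t / 2) (\<epsilon> / 2)"
  have s: "0 < s" "s < \<epsilon>" "s \<le> t" using t \<epsilon>(1) by (auto simp: s_def)
  have "0 < pp (t - s) i i * pp s i j" using pp_refl_pos[of "t - s" i] \<epsilon>(2)[OF s(1,2)] s by simp
  also have "\<dots> \<le> pp (t - s + s) i j" using s by (intro pp_ge) auto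
  finally show ?thesis by simp
qed

text \<open>A step of the irreducible matrix that is not a step of \<open>T\<close> is a restart in
  a phase charged by \<open>\<alpha>\<close>. On a chain into \<open>k\<close> the last restart
  provides the initial phase.\<close>

lemma reached_from_initial:
  assumes irr: "irreducible_matrix (T + (\<chi> a b. exit_rates T $ a * \<alpha> $ b))" and \<alpha>: "prob_vector \<alpha>"
  shows "\<exists>i. 0 < \<alpha> $ i \<and> (i, k) \<in> leads"
proof -
  obtain i0 where i0: "0 < \<alpha> $ i0"
    using \<alpha> unfolding prob_vector_def by (metis less_eq_real_def sum.neutral zero_neq_one)
  have "(i0, k) \<in> {(a, b). (T + (\<chi> a b. exit_rates T $ a * \<alpha> $ b)) $ a $ b \<noteq> 0}\<^sup>*"
    using irr by (auto simp: irreducible_matrix_def)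
  then show ?thesis
  proof (induction rule: rtrancl_induct)
    case base
    then show ?case using i0 by (auto simp: leads_def)
  next
    case (step y z)
    then obtain i where i: "0 < \<alpha> $ i" "(i, y) \<in> leads" by auto
    show ?case
    proof (cases "T $ y $ z = 0")
      case False
      then have "(i, z) \<in> leads" using i(2) False rtrancl_into_rtrancl[of i y "{(a, b). T $ a $ b \<noteq> 0}" z]
        by (simp add: leads_def)
      then show ?thesis using i by auto
    next
      case True
      then have "\<alpha> $ z \<noteq> 0" using step(2) by auto
      then have "0 < \<alpha> $ z" using \<alpha> by (auto simp: prob_vector_def less_le)
      then show ?thesis by (auto simp: leads_def)
    qed
  qed
qed

text \<open>Dually, the first restart on a chain out of \<open>k\<close> starts from a phase with
  positive exit rate; if there is none, the end \<open>j0\<close> of the chain is such a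
  phase.\<close>

lemma leads_to_exit:
  assumes irr: "irreducible_matrix (T + (\<chi> a b. exit_rates T $ a * \<alpha> $ b))" and j0: "exit_rates T $ j0 \<noteq> 0"
  shows "\<exists>j. 0 < exit_rates T $ j \<and> (k, j) \<in> leads"
proof -
  have pos: "0 < exit_rates T $ j" if "exit_rates T $ j \<noteq> 0" for j using exit_nonneg[of j] that by simp
  have "(k, j0) \<in> {(a, b). (T + (\<chi> a b. exit_rates T $ a * \<alpha> $ b)) $ a $ b \<noteq> 0}\<^sup>*"
    using irr by (auto simp: irreducible_matrix_def)
  then show ?thesis
  proof (induction rule: converse_rtrancl_induct)
    case base
    then show ?case using pos[OF j0] by (auto simp: leads_def)
  next
    case (step y z)
    then obtain j where j: "0 < exit_rates T $ j" "(z, j) \<in> leads" by auto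
    show ?case
    proof (cases "T $ y $ z = 0")
      case False
      then have "(y, j) \<in> leads" using j(2) False converse_rtrancl_into_rtrancl[of y z "{(a, b). T $ a $ b \<noteq> 0}" j]
        by (simp add: leads_def)
      then show ?thesis using j by auto
    next
      case True
      then have "exit_rates T $ y \<noteq> 0" using step(1) by auto
      from pos[OF this] show ?thesis by (intro exI[of _ y]) (simp add: leads_def)
    qed
  qed
qed

end

lemma diag_matrix_mult_left: "(diag_matrix u ** A) $ i $ j = u $ i * A $ i $ j"
proof -
  have "(diag_matrix u ** A) $ i $ j = (\<Sum>k\<in>UNIV. (if i = k then u $ i else 0) * A $ k $ j)"
    by (simp add: matrix_matrix_mult_def diag_matrix_def)
  also have "\<dots> = (\<Sum>k\<in>UNIV. if k = i then u $ i * A $ i $ j else 0)" by (rule sum.cong) auto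
  finally show ?thesis by simp
qed

lemma diag_matrix_mult_right: "(A ** diag_matrix u) $ i $ j = A $ i $ j * u $ j"
proof -
  have "(A ** diag_matrix u) $ i $ j = (\<Sum>k\<in>UNIV. A $ i $ k * (if k = j then u $ k else 0))"
    by (simp add: matrix_matrix_mult_def diag_matrix_def)
  also have "\<dots> = (\<Sum>k\<in>UNIV. if k = j then A $ i $ j * u $ j else 0)" by (rule sum.cong) auto
  finally show ?thesis by simp
qed

text \<open>\<open>vanish\<close> is termination in analytic form, from every starting phase; it
  excludes conservative \<open>T\<close>, which irreducibility alone admits.\<close>

locale reversible_phases = phase_semigroup p T
  for p :: "real \<Rightarrow> 'n::finite option \<Rightarrow> 'n option \<Rightarrow> real" and T :: "real^'n^'n" +
  fixes \<alpha> :: "real^'n"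
  assumes \<alpha>: "prob_vector \<alpha>" and T: "sub_generator T"
    and irr: "irreducible_matrix (T + (\<chi> a b. exit_rates T $ a * \<alpha> $ b))"
    and vanish: "\<And>i j. (\<lambda>n. pp (real n) i j) \<longlonglongrightarrow> 0"
begin

abbreviation \<nu> :: "real^'n" where "\<nu> \<equiv> reversal_weights \<alpha> T"

text \<open>For a vector in the kernel of \<open>T\<close>, the vector and its negative are both
  supermedian. Since the semigroup vanishes along integer times, this forces both to be
  nonpositive.\<close>

lemma T_invertible: "invertible T"
proof -
  have "v = 0" if Tv: "T *v v = 0" for v
  proof -
    have le: "u $ x \<le> 0" if "T *v u = 0" for u x
    proof -
      have lim: "((\<lambda>h. ((\<Sum>y\<in>UNIV. pp h z y * (- u $ y)) - (- u $ z)) / h) \<longlongrightarrow> 0) (at_right 0)" for z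
      proof -
        have "((\<lambda>h. ((\<Sum>y\<in>UNIV. pp h z y * (- u $ y)) - (- u $ z)) / h) \<longlongrightarrow> (\<Sum>y\<in>UNIV. T $ z $ y * (- u $ y))) (at_right 0)"
          by (rule finite_sum_option_matrix) (use pp_deriv[of z] in \<open>simp add: eq_commute\<close>)
        moreover have "(\<Sum>y\<in>UNIV. T $ z $ y * (- u $ y)) = - (T *v u) $ z"
          by (simp add: matrix_vector_mult_def sum_negf)
        ultimately show ?thesis using that by simp
      qed
      have "(\<Sum>y\<in>UNIV. pp t x y * (- u $ y)) \<le> - u $ x" if "0 \<le> t" for t
        by (rule semigroup_supermedian[where p=pp and w="\<lambda>_. 0"])
          (use lim that in \<open>auto simp: p_0 pp_add p_nonneg p_le_1\<close>)
      then have "\<And>n. (\<Sum>y\<in>UNIV. pp (real n) x y * (- u $ y)) \<le> - u $ x" by simp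
      moreover have "(\<lambda>n. \<Sum>y\<in>UNIV. pp (real n) x y * (- u $ y)) \<longlonglongrightarrow> (\<Sum>y\<in>(UNIV :: 'n set). 0 * (- u $ y))"
        by (intro tendsto_sum tendsto_mult tendsto_const vanish)
      ultimately have "(\<Sum>y\<in>(UNIV :: 'n set). 0 * (- u $ y)) \<le> - u $ x" by (intro LIMSEQ_le_const2) auto
      then show ?thesis by simp
    qed
    have "T *v (- v) = 0" using Tv by (simp add: matrix_vector_mult_def vec_eq_iff sum_negf)
    then have "v $ x = 0" for x using le[OF Tv, of x] le[of "- v" x] by simp
    then show ?thesis by (simp add: vec_eq_iff)
  qed
  then show ?thesis unfolding invertible_left_inverse matrix_left_invertible_ker by blast
qed

lemma matrix_inv_props: "invertible A \<Longrightarrow> A ** matrix_inv A = mat 1 \<and> matrix_inv A ** A = mat 1" for A :: "real^'n^'n"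
  unfolding invertible_def matrix_inv_def by (rule someI_ex)

lemma weights_T: "(\<Sum>i\<in>UNIV. \<nu> $ i * T $ i $ j) = - \<alpha> $ j"
proof -
  have "(\<alpha> v* matrix_inv T) v* T = \<alpha>"
    using matrix_inv_props[OF T_invertible] by (simp add: vector_matrix_mul_assoc)
  then have "(\<Sum>i\<in>UNIV. T $ i $ j * (\<alpha> v* matrix_inv T) $ i) = \<alpha> $ j"
    by (simp add: vector_matrix_mult_def vec_eq_iff mult.commute)
  then show ?thesis by (simp add: reversal_weights_def sum_negf mult.commute)
qed

text \<open>The transposed kernels form a semigroup as well, and its generator sends the weights to
  \<open>- \<alpha>\<close>, which is nonpositive.\<close>

lemma weights_supermedian: "0 \<le> t \<Longrightarrow> (\<Sum>y\<in>UNIV. pp t y x * \<nu> $ y) \<le> \<nu> $ x"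
proof (rule semigroup_supermedian[where p="\<lambda>t x y. pp t y x" and w="\<lambda>x. - \<alpha> $ x"])
  fix x
  have "((\<lambda>h. ((\<Sum>y\<in>UNIV. pp h y x * \<nu> $ y) - \<nu> $ x) / h) \<longlongrightarrow> (\<Sum>y\<in>UNIV. T $ y $ x * \<nu> $ y)) (at_right 0)"
    by (rule finite_sum_option_matrix) (rule pp_deriv)
  then show "((\<lambda>h. ((\<Sum>y\<in>UNIV. pp h y x * \<nu> $ y) - \<nu> $ x) / h) \<longlongrightarrow> - \<alpha> $ x) (at_right 0)"
    using weights_T[of x] by (simp add: mult.commute)
  show "- \<alpha> $ x \<le> 0" using \<alpha> by (simp add: prob_vector_def)
  show "pp (s + t) z x = (\<Sum>y\<in>UNIV. pp s y x * pp t z y)" if "0 \<le> s" "0 \<le> t" for s t x z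
    using pp_add[OF that(2,1), of z x] by (simp add: add.commute mult.commute)
qed (auto simp: p_0 p_nonneg p_le_1)

text \<open>Nonnegativity results from \<open>weights_supermedian\<close> for large times. If the
  weight vanished at \<open>x\<close>, it would vanish at an initial phase \<open>i\<close> leading
  to \<open>x\<close>; the column sum in \<open>weights_T\<close> at \<open>i\<close> would then be
  nonnegative, although it equals \<open>- \<alpha> $ i\<close>.\<close>

lemma weights_pos: "0 < \<nu> $ x"
proof -
  have nonneg: "0 \<le> \<nu> $ x" for x
  proof -
    have "(\<lambda>n. \<Sum>y\<in>UNIV. pp (real n) y x * \<nu> $ y) \<longlonglongrightarrow> (\<Sum>y\<in>(UNIV :: 'n set). 0 * \<nu> $ y)"
      by (intro tendsto_sum tendsto_mult tendsto_const vanish)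
    then have "(\<Sum>y\<in>(UNIV :: 'n set). 0 * \<nu> $ y) \<le> \<nu> $ x"
      by (rule LIMSEQ_le_const2) (use weights_supermedian[of "real _" x] in auto)
    then show ?thesis by simp
  qed
  have "\<nu> $ x \<noteq> 0"
  proof
    assume 0: "\<nu> $ x = 0"
    obtain i where i: "0 < \<alpha> $ i" "(i, x) \<in> leads" using reached_from_initial[OF irr \<alpha>] by blast
    have pos: "0 < pp 1 i x" by (rule leads_pos[OF T i(2)]) simp
    have "pp 1 i x * \<nu> $ i \<le> (\<Sum>y\<in>UNIV. pp 1 y x * \<nu> $ y)"
      by (rule member_le_sum) (auto intro!: mult_nonneg_nonneg p_nonneg nonneg)
    also have "\<dots> \<le> 0" using weights_supermedian[of 1 x] 0 by simp
    finally have "\<nu> $ i \<le> 0" using pos by (simp add: mult_le_0_iff)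
    then have "\<nu> $ i = 0" using nonneg[of i] by simp
    \<comment> \<open>Off the diagonal the entries of \<open>T\<close> are nonnegative; on it the
      weight \<open>\<nu> $ i\<close> is 0.\<close>
    then have "0 \<le> \<nu> $ l * T $ l $ i" for l
      using nonneg[of l] T unfolding sub_generator_def by (cases "l = i") auto
    then have "0 \<le> (\<Sum>l\<in>UNIV. \<nu> $ l * T $ l $ i)" by (intro sum_nonneg) auto
    then show False using weights_T[of i] i(1) by simp
  qed
  then show ?thesis using nonneg[of x] by simp
qed

lemma rev_initial_eq: "rev_initial \<alpha> T $ j = exit_rates T $ j * \<nu> $ j"
  by (simp add: rev_initial_def vector_matrix_mult_def diag_matrix_def if_distrib if_distribR mult.commute cong: if_cong)

lemma rev_generator_eq: "rev_generator \<alpha> T $ i $ j = T $ j $ i * \<nu> $ j / \<nu> $ i"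
proof -
  define D where "D = diag_matrix \<nu>"
  define E where "E = diag_matrix (\<chi> i. 1 / \<nu> $ i)"
  have nz: "\<nu> $ i \<noteq> 0" for i using weights_pos[of i] by simp
  have DE: "D ** E = mat 1" "E ** D = mat 1"
    using nz unfolding D_def E_def vec_eq_iff diag_matrix_mult_left by (simp_all add: diag_matrix_def mat_def)
  then have "invertible D" unfolding invertible_def by blast
  then have "matrix_inv D = matrix_inv D ** (D ** E)" using DE by simp
  also have "\<dots> = E" using matrix_inv_props[OF \<open>invertible D\<close>] by (simp add: matrix_mul_assoc)
  finally have inv: "matrix_inv D = E" .
  show ?thesis unfolding rev_generator_def D_def[symmetric] inv
    by (simp add: D_def E_def diag_matrix_mult_left diag_matrix_mult_right transpose_def)
qed

lemma rev_exit_eq: "exit_rates (rev_generator \<alpha> T) $ i = \<alpha> $ i / \<nu> $ i"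
proof -
  have "(\<Sum>j\<in>UNIV. T $ j $ i * \<nu> $ j / \<nu> $ i) = (\<Sum>j\<in>UNIV. \<nu> $ j * T $ j $ i) / \<nu> $ i"
    by (simp add: sum_divide_distrib mult.commute)
  then show ?thesis
    by (simp add: exit_rates_def matrix_vector_mult_def rev_generator_eq weights_T)
qed

text \<open>Conjugating the transposed semigroup by the weights gives a semigroup whose derivative
  at 0 is \<open>rev_generator\<close>, so uniqueness applies; \<open>C\<close> is a crude common
  bound for the ratios of weights.\<close>

lemma rev_semigroup:
  assumes "phase_semigroup q (rev_generator \<alpha> T)" and t: "0 \<le> t"
  shows "q t (Some i) (Some j) = pp t j i * \<nu> $ j / \<nu> $ i"
proof -
  interpret q: phase_semigroup q "rev_generator \<alpha> T" by fact
  have nz: "\<nu> $ i \<noteq> 0" for i using weights_pos[of i] by simp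
  define C where "C = (\<Sum>i\<in>UNIV. \<Sum>j\<in>UNIV. \<nu> $ j / \<nu> $ i)"
  have C: "\<nu> $ j / \<nu> $ i \<le> C" for i j
  proof -
    have pos: "0 \<le> \<nu> $ j / \<nu> $ i" for i j using weights_pos[of i] weights_pos[of j] by simp
    have "\<nu> $ j / \<nu> $ i \<le> (\<Sum>j\<in>UNIV. \<nu> $ j / \<nu> $ i)" by (rule member_le_sum) (simp_all only: pos finite UNIV_I)
    also have "\<dots> \<le> C" unfolding C_def
      by (rule member_le_sum[where f="\<lambda>i. \<Sum>j\<in>UNIV. \<nu> $ j / \<nu> $ i"]) (simp_all only: sum_nonneg pos finite UNIV_I)
    finally show ?thesis .
  qed
  show ?thesis
  proof (rule semigroup_unique[where p="\<lambda>t i j. q t (Some i) (Some j)" and q="\<lambda>t i j. pp t j i * \<nu> $ j / \<nu> $ i" and C=1 and C'=C])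
    show "\<bar>pp t y x * \<nu> $ y / \<nu> $ x\<bar> \<le> C" if "0 \<le> t" for t x y
    proof -
      have "pp t y x * (\<nu> $ y / \<nu> $ x) \<le> \<nu> $ y / \<nu> $ x"
        using p_le_1[OF that, of "Some y" "Some x"] p_nonneg[OF that, of "Some y" "Some x"] weights_pos[of x] weights_pos[of y]
        by (intro mult_left_le_one_le) auto
      moreover have "0 \<le> pp t y x * (\<nu> $ y / \<nu> $ x)"
        using p_nonneg[OF that, of "Some y" "Some x"] weights_pos[of x] weights_pos[of y] by simp
      ultimately show ?thesis using C[of y x] by simp
    qed
    show "((\<lambda>h. (q h (Some x) (Some y) - pp h y x * \<nu> $ y / \<nu> $ x) / h) \<longlongrightarrow> 0) (at_right 0)" for x y
    proof -
      have "((\<lambda>h. (q h (Some x) (Some y) - (if x = y then 1 else 0)) / h - (pp h y x - (if y = x then 1 else 0)) / h * (\<nu> $ y / \<nu> $ x))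
          \<longlongrightarrow> rev_generator \<alpha> T $ x $ y - T $ y $ x * (\<nu> $ y / \<nu> $ x)) (at_right 0)"
        by (intro tendsto_diff tendsto_mult tendsto_const q.pp_deriv pp_deriv)
      moreover have "(q h (Some x) (Some y) - (if x = y then 1 else 0)) / h - (pp h y x - (if y = x then 1 else 0)) / h * (\<nu> $ y / \<nu> $ x)
          = (q h (Some x) (Some y) - pp h y x * \<nu> $ y / \<nu> $ x) / h" for h
        using nz[of x] by (auto simp: diff_divide_distrib left_diff_distrib)
      ultimately show ?thesis by (simp add: rev_generator_eq)
    qed
    show "pp (s + t) z x * \<nu> $ z / \<nu> $ x = (\<Sum>y\<in>UNIV. (pp s y x * \<nu> $ y / \<nu> $ x) * (pp t z y * \<nu> $ z / \<nu> $ y))"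
      if "0 \<le> s" "0 \<le> t" for s t x z
      using pp_add[OF that(2,1), of z x] nz by (simp add: add.commute sum_distrib_right sum_distrib_left sum_divide_distrib mult_ac)
    show "\<bar>q t (Some x) (Some y)\<bar> \<le> 1" if "0 \<le> t" for t x y
      using q.p_nonneg[OF that, of "Some x" "Some y"] q.p_le_1[OF that, of "Some x" "Some y"] by simp
    show "q (s + t) (Some x) (Some z) = (\<Sum>y\<in>UNIV. q s (Some x) (Some y) * q t (Some y) (Some z))"
      if "0 \<le> s" "0 \<le> t" for s t x z
      by (rule q.pp_add[OF that])
  qed (simp_all add: t nz q.p_0 p_0)
qed

end

text \<open>With all exit rates 0, \<open>phase_integral_at_end\<close> would make every last phase
  a null event, against almost sure termination.\<close>

lemma (in phase_process) exit_exists: "\<exists>j. exit_rates T $ j \<noteq> 0"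
proof (rule ccontr)
  assume "\<not> ?thesis"
  then have z: "exit_rates T $ j = 0" for j by simp
  have "AE \<omega> in M. last_phase J \<omega> \<noteq> Some j" for j
  proof -
    have "(\<integral>\<^sup>+\<omega>. indicator {\<omega>. last_phase J \<omega> = Some j} \<omega> \<partial>M) = 0"
      using phase_integral_at_end[of "\<lambda>_. 1" j] by (simp add: z)
    moreover have m: "{\<omega>\<in>space M. last_phase J \<omega> = Some j} \<in> sets M" by measurable
    ultimately have "emeasure M {\<omega>\<in>space M. last_phase J \<omega> = Some j} = 0"
      by (subst (asm) nn_integral_cong[where v="indicator {\<omega>\<in>space M. last_phase J \<omega> = Some j}"]) (auto simp: indicator_def)
    then show ?thesis using m by (intro AE_I[of _ _ "{\<omega>\<in>space M. last_phase J \<omega> = Some j}"]) auto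
  qed
  then have "AE \<omega> in M. \<forall>j\<in>UNIV. last_phase J \<omega> \<noteq> Some j" by (subst AE_ball_countable) (auto simp: countable_finite)
  with AE_good AE_space have "AE \<omega> in M. False"
  proof eventually_elim
    case (elim \<omega>)
    from good_facts(3)[OF elim(2,1)] elim(3) show False by blast
  qed
  then show False by simp
qed

text \<open>Almost surely the lifetime is finite and exceeded by all large \<open>n\<close>. This is
  how termination reaches the matrix arguments.\<close>

lemma (in phase_process) pi_vanish: "(\<lambda>n. pi (real n) j) \<longlonglongrightarrow> 0"
proof -
  have [measurable]: "{\<omega>\<in>space M. J (real n) \<omega> = Some j} \<in> sets M" for n by (rule J_meas_set) simp
  have "(\<lambda>n. \<integral>\<omega>. indicator {\<omega>\<in>space M. J (real n) \<omega> = Some j} \<omega> \<partial>M) \<longlonglongrightarrow> (\<integral>\<omega>. 0 \<partial>M :: real)"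
  proof (rule integral_dominated_convergence[where w="\<lambda>_. 1"])
    show "AE \<omega> in M. (\<lambda>n. indicator {\<omega>\<in>space M. J (real n) \<omega> = Some j} \<omega> :: real) \<longlonglongrightarrow> 0"
      using AE_good AE_space
    proof eventually_elim
      case (elim \<omega>)
      obtain N where N: "lifetime J \<omega> \<le> real N" using real_arch_simple by blast
      have "J (real n) \<omega> = None" if "n \<ge> N" for n
        using good_facts(2)[OF elim(2,1), of "real n"] N that by (simp add: order_trans)
      then have "\<forall>\<^sub>F n in sequentially. indicator {\<omega>\<in>space M. J (real n) \<omega> = Some j} \<omega> = (0 :: real)"
        by (auto simp: eventually_sequentially indicator_def intro!: exI[of _ N])
      then show ?case by (rule tendsto_eventually)
    qed
  qed (auto simp: indicator_def)
  then show ?thesis by (simp add: pi_prob)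
qed

section \<open>Paths of one sign\<close>

context levy begin

text \<open>Increments have the law of the process at the elapsed time, so a sign valid at all times
  is inherited by increments between dyadic times, and right continuity extends the order to all
  pairs. The factor \<open>c\<close> covers both directions.\<close>

lemma mono_of_nonneg:
  assumes c: "AE \<omega> in P. \<forall>s\<ge>0. 0 \<le> c * X s \<omega>"
  shows "AE \<omega> in P. mono_on {0..} (\<lambda>t. c * X t \<omega>)"
proof -
  have pair: "AE \<omega> in P. 0 \<le> c * (X r \<omega> - X q \<omega>)" if qr: "0 \<le> q" "q \<le> r" for q r
  proof -
    have "distr P borel (\<lambda>\<omega>. X r \<omega> - X q \<omega>) = distr P borel (X (r - q))"
      using levy qr unfolding levy_process_def by blast
    moreover have "AE \<omega> in P. 0 \<le> c * X (r - q) \<omega>" using c by eventually_elim (use qr in auto)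
    then have "AE x in distr P borel (X (r - q)). 0 \<le> c * x"
      using X_meas[of "r - q"] qr by (subst AE_distr_iff) auto
    ultimately have "AE x in distr P borel (\<lambda>\<omega>. X r \<omega> - X q \<omega>). 0 \<le> c * x" by (simp only:)
    then show ?thesis using X_meas[of r] X_meas[of q] qr by (subst (asm) AE_distr_iff) auto
  qed
  \<comment> \<open>The dyadic numbers: countable, and containing every value of
    \<open>dyadic_above\<close>.\<close>
  define G where "G = {real a / 2 ^ n | a n. True}"
  have "G = (\<lambda>(a, n). real a / 2 ^ n) ` UNIV" by (auto simp: G_def)
  then have "countable G" by simp
  have "AE \<omega> in P. \<forall>q\<in>G. \<forall>r\<in>G. q \<le> r \<longrightarrow> 0 \<le> c * (X r \<omega> - X q \<omega>)"
  proof (subst AE_ball_countable[OF \<open>countable G\<close>], intro ballI, subst AE_ball_countable[OF \<open>countable G\<close>], intro ballI)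
    fix q r assume "q \<in> G" "r \<in> G"
    then have "0 \<le> q" by (auto simp: G_def)
    then show "AE \<omega> in P. q \<le> r \<longrightarrow> 0 \<le> c * (X r \<omega> - X q \<omega>)" using pair[of q r] by (cases "q \<le> r") auto
  qed
  with AE_space show ?thesis
  proof eventually_elim
    case (elim \<omega>)
    show ?case
    proof (rule mono_onI)
      fix s t :: real assume st: "s \<in> {0..}" "t \<in> {0..}" "s \<le> t"
      have lim: "(\<lambda>n. c * X (dyadic_above n u) \<omega>) \<longlonglongrightarrow> c * X u \<omega>" if "0 \<le> u" for u
        by (intro tendsto_mult tendsto_const filterlim_compose[OF cadlag_right[OF X_cadlag[OF elim(1)] that] filterlim_dyadic_above[OF that]])
      have "c * X (dyadic_above n s) \<omega> \<le> c * X (dyadic_above n t) \<omega>" for n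
      proof -
        have "dyadic_above n u \<in> G" for u unfolding G_def dyadic_above_def by blast
        moreover have "dyadic_above n s \<le> dyadic_above n t"
          unfolding dyadic_above_grid_size using grid_size_mono[OF st(3), of n] by (simp add: divide_right_mono)
        ultimately show ?thesis using elim(2) by (fastforce simp: right_diff_distrib)
      qed
      then show "c * X s \<omega> \<le> c * X t \<omega>"
        using lim[of s] lim[of t] st by (intro LIMSEQ_le[of "\<lambda>n. c * X (dyadic_above n s) \<omega>" _ "\<lambda>n. c * X (dyadic_above n t) \<omega>"]) auto
    qed
  qed
qed

text \<open>The factorisation yields statements for almost every \<open>t\<close> only. Arbitrarily
  large such \<open>t\<close> exist, and a property that passes down to earlier times then holds for
  all times off one null set.\<close>

lemma AE_all_times:
  fixes A B :: "real \<Rightarrow> 'w \<Rightarrow> bool"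
  assumes ae: "AE t in lborel. 0 < t \<longrightarrow> (AE \<omega> in P. A t \<omega>)"
    and down: "\<And>s t \<omega>. \<omega> \<in> space P \<Longrightarrow> 0 < t \<Longrightarrow> A t \<omega> \<Longrightarrow> 0 \<le> s \<Longrightarrow> s \<le> t \<Longrightarrow> B s \<omega>"
  shows "AE \<omega> in P. \<forall>s\<ge>0. B s \<omega>"
proof -
  have ex: "\<exists>t>real n. AE \<omega> in P. A t \<omega>" for n
  proof (rule ccontr)
    assume "\<not> ?thesis"
    then have no: "\<not> (AE \<omega> in P. A t \<omega>)" if "real n < t" for t using that by blast
    from ae have "AE t in lborel. \<not> real n < t"
    proof eventually_elim
      case (elim t)
      show ?case
      proof
        assume nt: "real n < t"
        then have "0 < t" using of_nat_0_le_iff[of n, where 'a=real] by linarith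
        then show False using elim no[OF nt] by blast
      qed
    qed
    then have "emeasure lborel {t\<in>space lborel. real n < t} = 0" by (rule emeasure_eq_0_AE)
    moreover have "emeasure lborel {real n<..<real n + 1} \<le> emeasure lborel {t\<in>space lborel. real n < t}"
      by (intro emeasure_mono) auto
    ultimately show False by simp
  qed
  then obtain t where t: "\<And>n. real n < t n" "\<And>n. AE \<omega> in P. A (t n) \<omega>" by metis
  have "AE \<omega> in P. \<forall>n. A (t n) \<omega>" using t(2) by (simp add: AE_all_countable)
  with AE_space show ?thesis
  proof eventually_elim
    case (elim \<omega>)
    show ?case
    proof (intro allI impI)
      fix s :: real assume s: "0 \<le> s"
      obtain n where n: "s \<le> real n" using real_arch_simple by blast
      have tn: "0 < t n" using t(1)[of n] by (meson of_nat_0_le_iff order.strict_trans1)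
      have "s \<le> t n" using n t(1)[of n] by linarith
      then show "B s \<omega>" using down[OF elim(1) tn] elim(2) s by blast
    qed
  qed
qed

end

section \<open>The killed process\<close>

context phase_process begin

lemma phase_marginal:
  assumes g: "g \<in> borel_measurable borel" "\<And>t. 0 \<le> t \<Longrightarrow> 0 \<le> g t \<and> g t \<le> t"
    and H: "H \<in> borel_measurable borel" "\<And>t. H t \<le> 1"
  shows "(\<integral>\<^sup>+\<omega>. H (lifetime J \<omega>) * indicator {\<omega>. phase_at J (g (lifetime J \<omega>)) \<omega> = Some k} \<omega> \<partial>M) =
    (\<integral>\<^sup>+t. H t * (indicator {0<..} t * ennreal (\<Sum>j\<in>UNIV. dens k j (g t) t)) \<partial>lborel)"
proof -
  note [measurable] = H(1) g(1)
  have [measurable]: "(\<lambda>\<omega>. phase_at J (g (lifetime J \<omega>)) \<omega>) \<in> M \<rightarrow>\<^sub>M count_space UNIV"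
    using g(2) lifetime_nonneg by (intro phase_at_measurable) auto
  have ind: "(\<lambda>\<omega>. indicator {\<omega>. phase_at J (g (lifetime J \<omega>)) \<omega> = Some k \<and> last_phase J \<omega> = Some j} \<omega> :: ennreal) \<in> borel_measurable M" for j
  proof -
    have "{\<omega>\<in>space M. phase_at J (g (lifetime J \<omega>)) \<omega> = Some k \<and> last_phase J \<omega> = Some j} \<in> sets M" by measurable
    then show ?thesis by (intro borel_measurable_indicator') auto
  qed
  have dm: "(\<lambda>t. indicator {0<..} t * ennreal (dens k j (g t) t)) \<in> borel_measurable borel" for j
  proof -
    have [measurable]: "(\<lambda>t. dens k j (min (max 0 (g t)) (max 0 t)) (max 0 t)) \<in> borel_measurable borel"
      by (rule borel_measurable_dens) auto
    have "(\<lambda>t. indicator {0<..} t * ennreal (dens k j (g t) t)) =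
        (\<lambda>t. indicator {0<..} t * ennreal (dens k j (min (max 0 (g t)) (max 0 t)) (max 0 t)))"
      using g(2) by (intro ext) (auto simp: indicator_def max_def min_def)
    then show ?thesis by simp
  qed
  have "(\<integral>\<^sup>+\<omega>. H (lifetime J \<omega>) * indicator {\<omega>. phase_at J (g (lifetime J \<omega>)) \<omega> = Some k} \<omega> \<partial>M) =
    (\<integral>\<^sup>+\<omega>. (\<Sum>j\<in>UNIV. H (lifetime J \<omega>) * indicator {\<omega>. phase_at J (g (lifetime J \<omega>)) \<omega> = Some k \<and> last_phase J \<omega> = Some j} \<omega>) \<partial>M)"
  proof (rule nn_integral_cong_AE)
    show "AE \<omega> in M. H (lifetime J \<omega>) * indicator {\<omega>. phase_at J (g (lifetime J \<omega>)) \<omega> = Some k} \<omega> =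
      (\<Sum>j\<in>UNIV. H (lifetime J \<omega>) * indicator {\<omega>. phase_at J (g (lifetime J \<omega>)) \<omega> = Some k \<and> last_phase J \<omega> = Some j} \<omega>)"
      using AE_good AE_space
    proof eventually_elim
      case (elim \<omega>)
      obtain i where i: "last_phase J \<omega> = Some i" using good_facts(3)[OF elim(2,1)] by blast
      have "(\<Sum>j\<in>UNIV. H (lifetime J \<omega>) * indicator {\<omega>. phase_at J (g (lifetime J \<omega>)) \<omega> = Some k \<and> last_phase J \<omega> = Some j} \<omega>) =
        (\<Sum>j\<in>UNIV. if j = i then H (lifetime J \<omega>) * indicator {\<omega>. phase_at J (g (lifetime J \<omega>)) \<omega> = Some k} \<omega> else 0)"
        using i by (intro sum.cong) (auto simp: indicator_def)
      then show ?case by simp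
    qed
  qed
  also have "\<dots> = (\<Sum>j\<in>UNIV. \<integral>\<^sup>+\<omega>. H (lifetime J \<omega>) * indicator {\<omega>. phase_at J (g (lifetime J \<omega>)) \<omega> = Some k \<and> last_phase J \<omega> = Some j} \<omega> \<partial>M)"
    using ind by (intro nn_integral_sum) measurable
  also have "\<dots> = (\<Sum>j\<in>UNIV. \<integral>\<^sup>+t. H t * (indicator {0<..} t * ennreal (dens k j (g t) t)) \<partial>lborel)"
    by (intro sum.cong refl phase_integral g H)
  also have "\<dots> = (\<integral>\<^sup>+t. (\<Sum>j\<in>UNIV. H t * (indicator {0<..} t * ennreal (dens k j (g t) t))) \<partial>lborel)"
  proof (rule nn_integral_sum[symmetric])
    show "(\<lambda>t. H t * (indicator {0<..} t * ennreal (dens k j (g t) t))) \<in> borel_measurable lborel" for j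
      using borel_measurable_times_ennreal[OF H(1) dm[of j]] by simp
  qed
  also have "\<dots> = (\<integral>\<^sup>+t. H t * (indicator {0<..} t * ennreal (\<Sum>j\<in>UNIV. dens k j (g t) t)) \<partial>lborel)"
  proof (rule nn_integral_cong)
    fix t :: real
    show "(\<Sum>j\<in>UNIV. H t * (indicator {0<..} t * ennreal (dens k j (g t) t))) = H t * (indicator {0<..} t * ennreal (\<Sum>j\<in>UNIV. dens k j (g t) t))"
    proof (cases "0 < t")
      case True
      then have "(\<Sum>j\<in>UNIV. ennreal (dens k j (g t) t)) = ennreal (\<Sum>j\<in>UNIV. dens k j (g t) t)"
        using g(2)[of t] by (intro sum_ennreal dens_bounds) auto
      then show ?thesis using True by (simp add: sum_distrib_left[symmetric])
    qed simp
  qed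
  finally show ?thesis .
qed

end

lemma phase_process_exists:
  assumes "killed_levy_law P X J a T M"
  shows "\<exists>p. phase_process p T M J a"
proof -
  have "terminating_phase_process M J a T" using assms by (simp add: killed_levy_law_def)
  then have m: "markov_jump_process M J (full_initial a) (full_generator T)" and t: "AE \<omega> in M. \<exists>t\<ge>0. J t \<omega> = None"
    by (auto simp: terminating_phase_process_def)
  from m obtain p where p: "transition_semigroup p (full_generator T)"
    "\<And>ts xs m. ts 0 = 0 \<Longrightarrow> incseq ts \<Longrightarrow>
           measure M {\<omega>\<in>space M. \<forall>l\<le>m. J (ts l) \<omega> = xs l} =
           full_initial a (xs 0) * (\<Prod>l<m. p (ts (Suc l) - ts l) (xs l) (xs (Suc l)))"
    unfolding markov_jump_process_def by blast
  have "phase_process p T M J a"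
    using m p t by (intro phase_process.intro phase_semigroup.intro jump_process.intro phase_process_axioms.intro)
      (auto simp: markov_jump_process_def)
  then show ?thesis by (rule exI[of _ p])
qed

text \<open>Each process comes with a semigroup of its own, existentially quantified. Uniqueness
  lets the laws started in single phases share that of the mixed law.\<close>

lemma phase_process_change_semigroup:
  assumes pp: "phase_process p T M J a" and q: "phase_semigroup q T"
  shows "phase_process q T M J a"
proof -
  interpret p: phase_process p T M J a by fact
  have eq: "p t x y = q t x y" if "0 \<le> t" for t x y
    using transition_semigroup_unique[OF p.sg _ that] q by (auto simp: phase_semigroup_def)
  show ?thesis
  proof (intro phase_process.intro q phase_process_axioms.intro)
    fix ts :: "nat \<Rightarrow> real" and xs and m :: nat assume ts: "ts 0 = 0" "incseq ts"
    have "p (ts (Suc l) - ts l) (xs l) (xs (Suc l)) = q (ts (Suc l) - ts l) (xs l) (xs (Suc l))" for l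
      using ts(2) by (intro eq) (simp add: incseq_Suc_iff)
    then show "measure M {\<omega>\<in>space M. \<forall>l\<le>m. J (ts l) \<omega> = xs l} =
           full_initial a (xs 0) * (\<Prod>l<m. q (ts (Suc l) - ts l) (xs l) (xs (Suc l)))"
      using p.fdd[OF ts, of m xs] by simp
  qed (use p.terminating in \<open>auto intro: p.prob_space_axioms p.jump_process_axioms\<close>)
qed

locale killed_levy = L: levy P X + Ph: phase_process p T M J a
  for P :: "'w measure" and X :: "real \<Rightarrow> 'w \<Rightarrow> real"
    and p :: "real \<Rightarrow> 'n::finite option \<Rightarrow> 'n option \<Rightarrow> real" and T :: "real^'n^'n"
    and M :: "'w measure" and J :: "real \<Rightarrow> 'w \<Rightarrow> 'n option" and a :: "real^'n" +
  assumes law: "killed_levy_law P X J a T M"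
begin

lemma sets_M: "sets M = sets P" and space_M: "space M = space P"
  using law sets_eq_imp_space_eq by (auto simp: killed_levy_law_def)

text \<open>The independence assumption concerns the \<sigma>-algebras generated by the two path
  maps. Viewed in these coarser \<sigma>-algebras, the identity on the sample space gives two
  independent random elements, and Fubini becomes applicable.\<close>

definition FX :: "'w measure" where "FX = vimage_algebra (space P) (path_of X) (path_space borel)"
definition FJ :: "'w measure" where "FJ = vimage_algebra (space P) (path_of J) (path_space (count_space UNIV))"

lemma space_F [simp]: "space FX = space P" "space FJ = space P"
  by (simp_all add: FX_def FJ_def)

lemma path_X_meas: "path_of X \<in> P \<rightarrow>\<^sub>M path_space borel" "path_of X \<in> M \<rightarrow>\<^sub>M path_space borel"
proof -
  show 1: "path_of X \<in> P \<rightarrow>\<^sub>M path_space borel"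
    unfolding path_of_def[abs_def] path_space_def by (intro measurable_restrict L.X_meas) auto
  then show "path_of X \<in> M \<rightarrow>\<^sub>M path_space borel" using measurable_cong_sets[OF sets_M refl] by blast
qed

lemma path_J_meas: "path_of J \<in> M \<rightarrow>\<^sub>M path_space (count_space UNIV)"
  unfolding path_of_def[abs_def] path_space_def by (intro measurable_restrict Ph.J_meas) auto

lemma id_FX: "(\<lambda>\<omega>. \<omega>) \<in> M \<rightarrow>\<^sub>M FX" "(\<lambda>\<omega>. \<omega>) \<in> P \<rightarrow>\<^sub>M FX"
  unfolding FX_def using path_X_meas space_M by (auto intro!: measurable_vimage_algebra2)

lemma id_FJ: "(\<lambda>\<omega>. \<omega>) \<in> M \<rightarrow>\<^sub>M FJ"
  unfolding FJ_def using path_J_meas space_M by (auto intro!: measurable_vimage_algebra2)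

lemma X_FX: assumes "0 \<le> t" shows "X t \<in> borel_measurable FX"
proof -
  have "path_of X \<in> FX \<rightarrow>\<^sub>M path_space borel"
    unfolding FX_def using measurable_space[OF path_X_meas(1)] by (intro measurable_vimage_algebra1) auto
  moreover have "(\<lambda>x. x t) \<in> path_space borel \<rightarrow>\<^sub>M (borel :: real measure)"
    unfolding path_space_def using assms by (intro measurable_component_singleton) auto
  ultimately have "(\<lambda>\<omega>. path_of X \<omega> t) \<in> borel_measurable FX" by (rule measurable_compose)
  then show ?thesis using assms by (simp add: path_of_def)
qed

lemma J_FJ: assumes "0 \<le> t" shows "J t \<in> FJ \<rightarrow>\<^sub>M count_space UNIV"
proof -
  have "path_of J \<in> FJ \<rightarrow>\<^sub>M path_space (count_space UNIV)"
    unfolding FJ_def using measurable_space[OF path_J_meas] space_M by (intro measurable_vimage_algebra1) auto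
  moreover have "(\<lambda>x. x t) \<in> path_space (count_space UNIV) \<rightarrow>\<^sub>M (count_space UNIV :: 'n option measure)"
    unfolding path_space_def using assms by (intro measurable_component_singleton) auto
  ultimately have "(\<lambda>\<omega>. path_of J \<omega> t) \<in> FJ \<rightarrow>\<^sub>M count_space UNIV" by (rule measurable_compose)
  then show ?thesis using assms by (simp add: path_of_def)
qed

sublocale XF: cadlag_process FX X
proof (rule cadlag_process.intro)
  show "X t \<in> borel_measurable FX" if "0 \<le> t" for t using that by (rule X_FX)
  show "cadlag0 (\<lambda>t. X t \<omega>)" if "\<omega> \<in> space FX" for \<omega>
    by (rule L.X_path) (use that in simp)
qed

sublocale XM: cadlag_process M X
proof (rule cadlag_process.intro)
  show "X t \<in> borel_measurable M" if "0 \<le> t" for t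
    using L.X_meas[OF that] unfolding measurable_cong_sets[OF sets_M refl] .
  show "cadlag0 (\<lambda>t. X t \<omega>)" if "\<omega> \<in> space M" for \<omega>
    by (rule L.X_path) (use that space_M in simp)
qed

sublocale JF: jump_process FJ J
proof (rule jump_process.intro)
  show "J t \<in> FJ \<rightarrow>\<^sub>M count_space UNIV" if "0 \<le> t" for t using that by (rule J_FJ)
  show "jump_path (\<lambda>t. J t \<omega>)" if "\<omega> \<in> space FJ" for \<omega>
    by (rule Ph.J_path) (use that space_M in simp)
qed

lemma distr_FX: "distr M FX (\<lambda>\<omega>. \<omega>) = distr P FX (\<lambda>\<omega>. \<omega>)"
proof (rule measure_eqI)
  fix A assume "A \<in> sets (distr M FX (\<lambda>\<omega>. \<omega>))"
  then have A: "A \<in> sets FX" by simp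
  then obtain B where B: "B \<in> sets (path_space borel)" "A = path_of X -` B \<inter> space P"
    unfolding FX_def using measurable_space[OF path_X_meas(1)] by (auto simp: sets_vimage_algebra2)
  have "emeasure (distr M (path_space borel) (path_of X)) B = emeasure (distr P (path_space borel) (path_of X)) B"
    using law by (simp add: killed_levy_law_def)
  then have "emeasure M A = emeasure P A"
    using B by (simp add: emeasure_distr[OF path_X_meas(1)] emeasure_distr[OF path_X_meas(2)] space_M)
  moreover have "A \<subseteq> space P" using B by auto
  ultimately show "emeasure (distr M FX (\<lambda>\<omega>. \<omega>)) A = emeasure (distr P FX (\<lambda>\<omega>. \<omega>)) A"
    using A by (simp add: emeasure_distr id_FX space_M Int_absorb2)
qed simp

lemma distr_pair: "distr M (FX \<Otimes>\<^sub>M FJ) (\<lambda>\<omega>. (\<omega>, \<omega>)) = distr M FX (\<lambda>\<omega>. \<omega>) \<Otimes>\<^sub>M distr M FJ (\<lambda>\<omega>. \<omega>)"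
proof -
  have sX: "sets FX = {path_of X -` A \<inter> space M |A. A \<in> sets (path_space borel)}"
    unfolding FX_def using measurable_space[OF path_X_meas(1)] space_M by (subst sets_vimage_algebra2) auto
  have sJ: "sets FJ = {path_of J -` A \<inter> space M |A. A \<in> sets (path_space (count_space UNIV))}"
    unfolding FJ_def using measurable_space[OF path_J_meas] space_M by (subst sets_vimage_algebra2) auto
  have id: "sigma_sets (space M) {(\<lambda>\<omega>. \<omega>) -` A \<inter> space M |A. A \<in> sets F} = sets F" if "space F = space P" for F :: "'w measure"
  proof -
    have "{(\<lambda>\<omega>. \<omega>) -` A \<inter> space M |A. A \<in> sets F} = sets F"
      using sets.sets_into_space[of _ F] that space_M by (auto simp: Int_absorb2)
    then show ?thesis using sets.sigma_sets_eq[of F] that space_M by simp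
  qed
  have "Ph.indep_set (sets FX) (sets FJ)" unfolding sX sJ using law by (simp add: killed_levy_law_def)
  then have "Ph.indep_var FX (\<lambda>\<omega>. \<omega>) FJ (\<lambda>\<omega>. \<omega>)"
    unfolding Ph.indep_var_eq using id[of FX] id[of FJ] id_FX id_FJ by simp
  then show ?thesis unfolding Ph.indep_var_distribution_eq by simp
qed

text \<open>Fubini on the product of the two generated \<sigma>-algebras: with the path of
  \<open>X\<close> frozen, \<open>g\<close> and \<open>H\<close> are deterministic functions of the
  lifetime and the formula for the phase process applies. Leaving the event \<open>R\<close> and the
  density \<open>D\<close> open covers the joint law and the marginals at once.\<close>

lemma killed_integral:
  fixes g :: "real \<times> 'w \<Rightarrow> real" and H :: "real \<times> 'w \<Rightarrow> ennreal"
  assumes g: "g \<in> borel_measurable (borel \<Otimes>\<^sub>M FX)" "\<And>t \<omega>. \<omega> \<in> space P \<Longrightarrow> 0 \<le> t \<Longrightarrow> 0 \<le> g (t, \<omega>) \<and> g (t, \<omega>) \<le> t"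
    and H: "H \<in> borel_measurable (borel \<Otimes>\<^sub>M FX)" "\<And>x. H x \<le> 1"
    and D: "\<And>g H. g \<in> borel_measurable borel \<Longrightarrow> (\<And>t. 0 \<le> t \<Longrightarrow> 0 \<le> g t \<and> g t \<le> t) \<Longrightarrow>
        H \<in> borel_measurable borel \<Longrightarrow> (\<And>t. H t \<le> 1) \<Longrightarrow>
        (\<integral>\<^sup>+\<omega>. H (lifetime J \<omega>) * indicator {\<omega>. R (phase_at J (g (lifetime J \<omega>)) \<omega>) (last_phase J \<omega>)} \<omega> \<partial>M) =
        (\<integral>\<^sup>+t. H t * (indicator {0<..} t * ennreal (D (g t) t)) \<partial>lborel)"
    and D_meas: "\<And>(g :: real \<times> 'w \<Rightarrow> real) f. g \<in> borel_measurable (borel \<Otimes>\<^sub>M FX) \<Longrightarrow> f \<in> borel_measurable (borel \<Otimes>\<^sub>M FX) \<Longrightarrow>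
        (\<And>x. x \<in> space (borel \<Otimes>\<^sub>M FX) \<Longrightarrow> 0 \<le> g x \<and> g x \<le> f x) \<Longrightarrow> (\<lambda>x. D (g x) (f x)) \<in> borel_measurable (borel \<Otimes>\<^sub>M FX)"
  shows "(\<integral>\<^sup>+\<omega>. H (lifetime J \<omega>, \<omega>) * indicator {\<omega>. R (phase_at J (g (lifetime J \<omega>, \<omega>)) \<omega>) (last_phase J \<omega>)} \<omega> \<partial>M) =
    (\<integral>\<^sup>+t. indicator {0<..} t * (\<integral>\<^sup>+\<omega>. H (t, \<omega>) * ennreal (D (g (t, \<omega>)) t) \<partial>P) \<partial>lborel)"
proof -
  define f where "f z = H (lifetime J (snd z), fst z) *
      (if R (phase_at J (g (lifetime J (snd z), fst z)) (snd z)) (last_phase J (snd z)) then 1 else 0 :: ennreal)" for z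
  have pair_meas: "(\<lambda>z. (lifetime J (snd z), fst z)) \<in> FX \<Otimes>\<^sub>M FJ \<rightarrow>\<^sub>M borel \<Otimes>\<^sub>M FX"
    by (intro measurable_Pair measurable_compose[OF measurable_snd JF.lifetime_measurable] measurable_fst)
  have ph_meas: "(\<lambda>z. phase_at J (g (lifetime J (snd z), fst z)) (snd z)) \<in> FX \<Otimes>\<^sub>M FJ \<rightarrow>\<^sub>M count_space UNIV"
    using g(2) JF.lifetime_nonneg
    by (intro JF.phase_at_measurable measurable_snd measurable_compose[OF pair_meas g(1)]) (auto simp: space_pair_measure)
  have last_meas: "(\<lambda>z. last_phase J (snd z)) \<in> FX \<Otimes>\<^sub>M FJ \<rightarrow>\<^sub>M count_space UNIV"
    by (rule measurable_compose[OF measurable_snd JF.last_phase_measurable])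
  have f_meas: "f \<in> borel_measurable (FX \<Otimes>\<^sub>M FJ)"
  proof -
    have [measurable]: "Measurable.pred (FX \<Otimes>\<^sub>M FJ) (\<lambda>z. R (phase_at J (g (lifetime J (snd z), fst z)) (snd z)) (last_phase J (snd z)))"
    proof (rule measurable_compose_countable[where f="\<lambda>x z. R x (last_phase J (snd z))", OF _ ph_meas])
      show "Measurable.pred (FX \<Otimes>\<^sub>M FJ) (\<lambda>z. R x (last_phase J (snd z)))" for x
        by (rule measurable_compose[OF last_meas, of "R x" "count_space UNIV"]) simp
    qed
    note [measurable] = measurable_compose[OF pair_meas H(1)]
    show ?thesis unfolding f_def by measurable
  qed
  interpret MJ: prob_space "distr M FJ (\<lambda>\<omega>. \<omega>)" by (rule Ph.prob_space_distr[OF id_FJ])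
  interpret PX: prob_space "distr P FX (\<lambda>\<omega>. \<omega>)" by (rule L.prob_space_distr[OF id_FX(2)])
  have sets_pair: "sets (distr P FX (\<lambda>\<omega>. \<omega>) \<Otimes>\<^sub>M distr M FJ (\<lambda>\<omega>. \<omega>)) = sets (FX \<Otimes>\<^sub>M FJ)"
    by (intro sets_pair_measure_cong) simp_all
  have f_meas': "f \<in> borel_measurable (distr P FX (\<lambda>\<omega>. \<omega>) \<Otimes>\<^sub>M distr M FJ (\<lambda>\<omega>. \<omega>))"
    using f_meas measurable_cong_sets[OF sets_pair refl] by blast
  have "(\<integral>\<^sup>+\<omega>. H (lifetime J \<omega>, \<omega>) * indicator {\<omega>. R (phase_at J (g (lifetime J \<omega>, \<omega>)) \<omega>) (last_phase J \<omega>)} \<omega> \<partial>M) =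
      (\<integral>\<^sup>+\<omega>. f (\<omega>, \<omega>) \<partial>M)"
    by (intro nn_integral_cong) (auto simp: f_def indicator_def)
  also have "\<dots> = (\<integral>\<^sup>+z. f z \<partial>distr M (FX \<Otimes>\<^sub>M FJ) (\<lambda>\<omega>. (\<omega>, \<omega>)))"
    using f_meas by (intro nn_integral_distr[symmetric] measurable_Pair id_FX id_FJ) simp
  also have "\<dots> = (\<integral>\<^sup>+z. f z \<partial>(distr P FX (\<lambda>\<omega>. \<omega>) \<Otimes>\<^sub>M distr M FJ (\<lambda>\<omega>. \<omega>)))"
    unfolding distr_pair distr_FX ..
  also have "\<dots> = (\<integral>\<^sup>+\<omega>. (\<integral>\<^sup>+\<omega>'. f (\<omega>, \<omega>') \<partial>distr M FJ (\<lambda>\<omega>. \<omega>)) \<partial>distr P FX (\<lambda>\<omega>. \<omega>))"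
    by (rule MJ.nn_integral_fst[symmetric, OF f_meas'])
  also have "\<dots> = (\<integral>\<^sup>+\<omega>. (\<integral>\<^sup>+t. H (t, \<omega>) * (indicator {0<..} t * ennreal (D (g (t, \<omega>)) t)) \<partial>lborel) \<partial>distr P FX (\<lambda>\<omega>. \<omega>))"
  proof (rule nn_integral_cong)
    fix \<omega> assume "\<omega> \<in> space (distr P FX (\<lambda>\<omega>. \<omega>))"
    then have \<omega>: "\<omega> \<in> space P" by simp
    have sl: "(\<lambda>t. (t, \<omega>)) \<in> borel \<rightarrow>\<^sub>M borel \<Otimes>\<^sub>M FX" using \<omega> by (intro measurable_Pair) auto
    have "(\<lambda>\<omega>'. f (\<omega>, \<omega>')) \<in> borel_measurable FJ"
      using \<omega> by (intro measurable_compose[OF _ f_meas] measurable_Pair) auto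
    then have "(\<integral>\<^sup>+\<omega>'. f (\<omega>, \<omega>') \<partial>distr M FJ (\<lambda>\<omega>. \<omega>)) = (\<integral>\<^sup>+\<omega>'. f (\<omega>, \<omega>') \<partial>M)"
      by (intro nn_integral_distr id_FJ) simp
    also have "\<dots> = (\<integral>\<^sup>+\<omega>'. H (lifetime J \<omega>', \<omega>) * indicator {\<omega>'. R (phase_at J (g (lifetime J \<omega>', \<omega>)) \<omega>') (last_phase J \<omega>')} \<omega>' \<partial>M)"
      by (intro nn_integral_cong) (auto simp: f_def indicator_def)
    also have "\<dots> = (\<integral>\<^sup>+t. H (t, \<omega>) * (indicator {0<..} t * ennreal (D (g (t, \<omega>)) t)) \<partial>lborel)"
      by (rule D[of "\<lambda>t. g (t, \<omega>)" "\<lambda>t. H (t, \<omega>)", OF measurable_compose[OF sl g(1)] _ measurable_compose[OF sl H(1)]])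
         (use g(2)[OF \<omega>] H(2) in auto)
    finally show "(\<integral>\<^sup>+\<omega>'. f (\<omega>, \<omega>') \<partial>distr M FJ (\<lambda>\<omega>. \<omega>)) = (\<integral>\<^sup>+t. H (t, \<omega>) * (indicator {0<..} t * ennreal (D (g (t, \<omega>)) t)) \<partial>lborel)" .
  qed
  also have "\<dots> = (\<integral>\<^sup>+t. (\<integral>\<^sup>+\<omega>. H (t, \<omega>) * (indicator {0<..} t * ennreal (D (g (t, \<omega>)) t)) \<partial>distr P FX (\<lambda>\<omega>. \<omega>)) \<partial>lborel)"
  proof -
    interpret LP: pair_sigma_finite lborel "distr P FX (\<lambda>\<omega>. \<omega>)" ..
    have sets_L: "sets (lborel \<Otimes>\<^sub>M distr P FX (\<lambda>\<omega>. \<omega>)) = sets (borel \<Otimes>\<^sub>M FX)"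
      by (intro sets_pair_measure_cong) simp_all
    \<comment> \<open>Clipped version of the integrand, jointly measurable and equal to it on the
      sample space.\<close>
    define k where "k x = H x * (indicator {0<..} (fst x) * ennreal (D (min (max 0 (g x)) (max 0 (fst x))) (max 0 (fst x))))" for x
    have k_eq: "k (t, \<omega>) = H (t, \<omega>) * (indicator {0<..} t * ennreal (D (g (t, \<omega>)) t))" if "\<omega> \<in> space P" for t \<omega>
      using g(2)[OF that, of t] by (cases "0 < t") (simp_all add: k_def max_def min_def)
    have "k \<in> borel_measurable (borel \<Otimes>\<^sub>M FX)"
    proof -
      note [measurable] = g(1) H(1)
      have [measurable]: "(\<lambda>x. D (min (max 0 (g x)) (max 0 (fst x))) (max 0 (fst x))) \<in> borel_measurable (borel \<Otimes>\<^sub>M FX)"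
        by (rule D_meas) (auto intro!: borel_measurable_min borel_measurable_max)
      show ?thesis unfolding k_def by measurable
    qed
    then have "k \<in> borel_measurable (lborel \<Otimes>\<^sub>M distr P FX (\<lambda>\<omega>. \<omega>))"
      using measurable_cong_sets[OF sets_L refl] by blast
    from LP.Fubini[OF this]
    have "(\<integral>\<^sup>+\<omega>. (\<integral>\<^sup>+t. k (t, \<omega>) \<partial>lborel) \<partial>distr P FX (\<lambda>\<omega>. \<omega>)) = (\<integral>\<^sup>+t. (\<integral>\<^sup>+\<omega>. k (t, \<omega>) \<partial>distr P FX (\<lambda>\<omega>. \<omega>)) \<partial>lborel)" .
    moreover have "(\<integral>\<^sup>+\<omega>. (\<integral>\<^sup>+t. k (t, \<omega>) \<partial>lborel) \<partial>distr P FX (\<lambda>\<omega>. \<omega>)) =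
        (\<integral>\<^sup>+\<omega>. (\<integral>\<^sup>+t. H (t, \<omega>) * (indicator {0<..} t * ennreal (D (g (t, \<omega>)) t)) \<partial>lborel) \<partial>distr P FX (\<lambda>\<omega>. \<omega>))"
      by (intro nn_integral_cong k_eq) simp
    moreover have "(\<integral>\<^sup>+t. (\<integral>\<^sup>+\<omega>. k (t, \<omega>) \<partial>distr P FX (\<lambda>\<omega>. \<omega>)) \<partial>lborel) =
        (\<integral>\<^sup>+t. (\<integral>\<^sup>+\<omega>. H (t, \<omega>) * (indicator {0<..} t * ennreal (D (g (t, \<omega>)) t)) \<partial>distr P FX (\<lambda>\<omega>. \<omega>)) \<partial>lborel)"
      by (intro nn_integral_cong k_eq) simp
    ultimately show ?thesis by argo
  qed
  also have "\<dots> = (\<integral>\<^sup>+t. indicator {0<..} t * (\<integral>\<^sup>+\<omega>. H (t, \<omega>) * ennreal (D (g (t, \<omega>)) t) \<partial>P) \<partial>lborel)"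
  proof (rule nn_integral_cong)
    fix t :: real
    show "(\<integral>\<^sup>+\<omega>. H (t, \<omega>) * (indicator {0<..} t * ennreal (D (g (t, \<omega>)) t)) \<partial>distr P FX (\<lambda>\<omega>. \<omega>)) =
      indicator {0<..} t * (\<integral>\<^sup>+\<omega>. H (t, \<omega>) * ennreal (D (g (t, \<omega>)) t) \<partial>P)"
    proof (cases "0 < t")
      case True
      have sl: "(\<lambda>\<omega>. (t, \<omega>)) \<in> FX \<rightarrow>\<^sub>M borel \<Otimes>\<^sub>M FX" by (intro measurable_Pair) auto
      note [measurable] = measurable_compose[OF sl H(1)] measurable_compose[OF sl g(1)]
      have dm: "(\<lambda>x. D (min (max 0 (g x)) (max 0 (fst x))) (max 0 (fst x))) \<in> borel_measurable (borel \<Otimes>\<^sub>M FX)"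
        by (rule D_meas) (auto intro!: borel_measurable_min borel_measurable_max g(1))
      have [measurable]: "(\<lambda>\<omega>. D (min (max 0 (g (t, \<omega>))) (max 0 t)) (max 0 t)) \<in> borel_measurable FX"
        using measurable_compose[OF sl dm] by simp
      have eq: "D (g (t, \<omega>)) t = D (min (max 0 (g (t, \<omega>))) (max 0 t)) (max 0 t)" if "\<omega> \<in> space P" for \<omega>
        using g(2)[OF that, of t] True by (simp add: max_def min_def)
      have m: "(\<lambda>\<omega>. H (t, \<omega>) * ennreal (D (min (max 0 (g (t, \<omega>))) (max 0 t)) (max 0 t))) \<in> borel_measurable FX" by measurable
      have "(\<integral>\<^sup>+\<omega>. H (t, \<omega>) * ennreal (D (g (t, \<omega>)) t) \<partial>distr P FX (\<lambda>\<omega>. \<omega>)) =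
          (\<integral>\<^sup>+\<omega>. H (t, \<omega>) * ennreal (D (min (max 0 (g (t, \<omega>))) (max 0 t)) (max 0 t)) \<partial>distr P FX (\<lambda>\<omega>. \<omega>))"
        by (intro nn_integral_cong) (simp add: eq)
      also have "\<dots> = (\<integral>\<^sup>+\<omega>. H (t, \<omega>) * ennreal (D (min (max 0 (g (t, \<omega>))) (max 0 t)) (max 0 t)) \<partial>P)"
        using m by (intro nn_integral_distr id_FX) simp
      also have "\<dots> = (\<integral>\<^sup>+\<omega>. H (t, \<omega>) * ennreal (D (g (t, \<omega>)) t) \<partial>P)"
        by (intro nn_integral_cong) (simp add: eq)
      finally show ?thesis using True by simp
    qed simp
  qed
  finally show ?thesis .
qed

end

section \<open>Laws of the extrema and phases of the killed process\<close>

lemma emeasure_law_on: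
  assumes E: "E \<inter> space M \<in> sets M" and Y: "Y \<in> M \<rightarrow>\<^sub>M N" and C: "C \<in> sets N"
  shows "emeasure (law_on M E N Y) C = emeasure M {\<omega>\<in>space M. Y \<omega> \<in> C \<and> \<omega> \<in> E}"
proof -
  have "emeasure (law_on M E N Y) C = emeasure (restrict_space M E) (Y -` C \<inter> space (restrict_space M E))"
    unfolding law_on_def by (rule emeasure_distr[OF measurable_restrict_space1[OF Y] C])
  also have "\<dots> = emeasure M (Y -` C \<inter> space (restrict_space M E))"
    using E by (intro emeasure_restrict_space) (auto simp: space_restrict_space Int_commute)
  also have "Y -` C \<inter> space (restrict_space M E) = {\<omega>\<in>space M. Y \<omega> \<in> C \<and> \<omega> \<in> E}"
    by (auto simp: space_restrict_space)
  finally show ?thesis .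
qed

lemma finite_law_on:
  assumes M: "finite_measure M" and E: "E \<inter> space M \<in> sets M" and Y: "Y \<in> M \<rightarrow>\<^sub>M N"
  shows "finite_measure (law_on M E N Y)"
proof
  have "emeasure (law_on M E N Y) (space (law_on M E N Y)) = emeasure M {\<omega>\<in>space M. Y \<omega> \<in> space N \<and> \<omega> \<in> E}"
    using emeasure_law_on[OF E Y sets.top] by (simp add: law_on_def)
  then show "emeasure (law_on M E N Y) (space (law_on M E N Y)) \<noteq> \<infinity>"
    using finite_measure.emeasure_finite[OF M] by simp
qed

lemma emeasure_eq_indicator_integral:
  assumes "{\<omega>\<in>space M. Q \<omega>} \<in> sets M"
  shows "emeasure M {\<omega>\<in>space M. Q \<omega>} = (\<integral>\<^sup>+\<omega>. indicator {\<omega>. Q \<omega>} \<omega> \<partial>M)"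
proof -
  have "emeasure M {\<omega>\<in>space M. Q \<omega>} = (\<integral>\<^sup>+\<omega>. indicator {\<omega>\<in>space M. Q \<omega>} \<omega> \<partial>M)"
    using assms by (rule nn_integral_indicator[symmetric])
  also have "\<dots> = (\<integral>\<^sup>+\<omega>. indicator {\<omega>. Q \<omega>} \<omega> \<partial>M)"
    by (intro nn_integral_cong) (simp add: indicator_def)
  finally show ?thesis .
qed

context killed_levy begin

lemma end_measurable:
  "sup_at_end X J \<in> borel_measurable M" "inf_at_end X J \<in> borel_measurable M"
  "(\<lambda>\<omega>. X (lifetime J \<omega>) \<omega>) \<in> borel_measurable M"
  "phase_at_sup X J \<in> M \<rightarrow>\<^sub>M count_space UNIV" "phase_at_inf X J \<in> M \<rightarrow>\<^sub>M count_space UNIV"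
proof -
  note lt = measurable_ident_sets[OF refl, of M] Ph.lifetime_measurable Ph.lifetime_nonneg
  show "sup_at_end X J \<in> borel_measurable M"
    using XM.measurable_run_sup[OF lt] by (simp add: sup_at_end_def[abs_def])
  show "inf_at_end X J \<in> borel_measurable M"
    using XM.measurable_run_inf[OF lt] by (simp add: inf_at_end_def[abs_def])
  show "(\<lambda>\<omega>. X (lifetime J \<omega>) \<omega>) \<in> borel_measurable M"
    using XM.measurable_X_at[OF lt] by simp
  have g: "0 \<le> sup_time (\<lambda>t. X t \<omega>) (lifetime J \<omega>)" "0 \<le> inf_time (\<lambda>t. X t \<omega>) (lifetime J \<omega>)" if "\<omega> \<in> space M" for \<omega>
    using cadlag0.sup_time_nonneg[OF XM.X_path[OF that] Ph.lifetime_nonneg]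
      cadlag0.inf_time_nonneg[OF XM.X_path[OF that] Ph.lifetime_nonneg] .
  show "phase_at_sup X J \<in> M \<rightarrow>\<^sub>M count_space UNIV"
    using Ph.phase_at_measurable[OF lt(1) _ g(1)] XM.measurable_sup_time[OF lt] by (simp add: phase_at_sup_def[abs_def])
  show "phase_at_inf X J \<in> M \<rightarrow>\<^sub>M count_space UNIV"
    using Ph.phase_at_measurable[OF lt(1) _ g(2)] XM.measurable_inf_time[OF lt] by (simp add: phase_at_inf_def[abs_def])
qed

lemma path_measurable_FX:
  "(\<lambda>x. sup_time (\<lambda>s. X s (snd x)) (max 0 (fst x))) \<in> borel_measurable (borel \<Otimes>\<^sub>M FX)"
  "(\<lambda>x. inf_time (\<lambda>s. X s (snd x)) (max 0 (fst x))) \<in> borel_measurable (borel \<Otimes>\<^sub>M FX)"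
  "(\<lambda>x. run_sup (\<lambda>s. X s (snd x)) (max 0 (fst x))) \<in> borel_measurable (borel \<Otimes>\<^sub>M FX)"
  "(\<lambda>x. run_inf (\<lambda>s. X s (snd x)) (max 0 (fst x))) \<in> borel_measurable (borel \<Otimes>\<^sub>M FX)"
  "(\<lambda>x. X (max 0 (fst x)) (snd x)) \<in> borel_measurable (borel \<Otimes>\<^sub>M FX)"
  by (intro XF.measurable_sup_time XF.measurable_inf_time XF.measurable_run_sup XF.measurable_run_inf XF.measurable_X_at; simp)+

lemma times_bounds:
  assumes "\<omega> \<in> space P" "0 \<le> t"
  shows "0 \<le> sup_time (\<lambda>s. X s \<omega>) t \<and> sup_time (\<lambda>s. X s \<omega>) t \<le> t"
    "0 \<le> inf_time (\<lambda>s. X s \<omega>) t \<and> inf_time (\<lambda>s. X s \<omega>) t \<le> t"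
  using cadlag0.sup_time_nonneg[OF L.X_path[OF assms(1)] assms(2)] cadlag0.sup_time_le_t[OF L.X_path[OF assms(1)] assms(2)]
    cadlag0.inf_time_nonneg[OF L.X_path[OF assms(1)] assms(2)] cadlag0.inf_time_le_t[OF L.X_path[OF assms(1)] assms(2)] by auto

lemma sup_joint_law:
  assumes A[measurable]: "A \<in> sets borel" and B[measurable]: "B \<in> sets borel"
  shows "emeasure M {\<omega>\<in>space M. sup_at_end X J \<omega> \<in> A \<and> X (lifetime J \<omega>) \<omega> - sup_at_end X J \<omega> \<in> B \<and>
      phase_at_sup X J \<omega> = Some k \<and> last_phase J \<omega> = Some j} =
    L.split_integral (\<lambda>x. ennreal (Ph.pi (max 0 (fst x)) k) * indicator A (snd x))
      (\<lambda>x. ennreal (p (max 0 (fst x)) (Some k) (Some j) * exit_rates T $ j) * indicator B (snd x))"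
proof -
  define g where "g x = sup_time (\<lambda>s. X s (snd x)) (max 0 (fst x))" for x :: "real \<times> 'w"
  define H where "H x = indicator A (run_sup (\<lambda>s. X s (snd x)) (max 0 (fst x))) *
      (indicator B (X (max 0 (fst x)) (snd x) - run_sup (\<lambda>s. X s (snd x)) (max 0 (fst x))) :: ennreal)" for x :: "real \<times> 'w"
  note [measurable] = path_measurable_FX end_measurable
  have gm: "g \<in> borel_measurable (borel \<Otimes>\<^sub>M FX)" unfolding g_def by measurable
  have Hm: "H \<in> borel_measurable (borel \<Otimes>\<^sub>M FX)" unfolding H_def by measurable
  have H1: "H x \<le> 1" for x by (auto simp: H_def indicator_def)
  have gb: "0 \<le> g (t, \<omega>) \<and> g (t, \<omega>) \<le> t" if "\<omega> \<in> space P" "0 \<le> t" for t \<omega>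
    using times_bounds(1)[OF that] that(2) by (simp add: g_def max_def)
  have "emeasure M {\<omega>\<in>space M. sup_at_end X J \<omega> \<in> A \<and> X (lifetime J \<omega>) \<omega> - sup_at_end X J \<omega> \<in> B \<and>
      phase_at_sup X J \<omega> = Some k \<and> last_phase J \<omega> = Some j} =
    (\<integral>\<^sup>+\<omega>. indicator {\<omega>. sup_at_end X J \<omega> \<in> A \<and> X (lifetime J \<omega>) \<omega> - sup_at_end X J \<omega> \<in> B \<and>
      phase_at_sup X J \<omega> = Some k \<and> last_phase J \<omega> = Some j} \<omega> \<partial>M)"
    by (rule emeasure_eq_indicator_integral) measurable
  also have "\<dots> = (\<integral>\<^sup>+\<omega>. H (lifetime J \<omega>, \<omega>) *
      indicator {\<omega>. phase_at J (g (lifetime J \<omega>, \<omega>)) \<omega> = Some k \<and> last_phase J \<omega> = Some j} \<omega> \<partial>M)"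
    using Ph.lifetime_nonneg
    by (intro nn_integral_cong) (auto simp: H_def g_def sup_at_end_def phase_at_sup_def indicator_def max_absorb2)
  also have "\<dots> = (\<integral>\<^sup>+t. indicator {0<..} t * (\<integral>\<^sup>+\<omega>. H (t, \<omega>) * ennreal (Ph.dens k j (g (t, \<omega>)) t) \<partial>P) \<partial>lborel)"
    by (rule killed_integral[where R="\<lambda>x y. x = Some k \<and> y = Some j", OF gm gb Hm H1 Ph.phase_integral Ph.borel_measurable_dens])
  also have "\<dots> = L.split_integral (\<lambda>x. ennreal (Ph.pi (max 0 (fst x)) k) * indicator A (snd x))
      (\<lambda>x. ennreal (p (max 0 (fst x)) (Some k) (Some j) * exit_rates T $ j) * indicator B (snd x))"
    unfolding L.split_integral_def
  proof (rule nn_integral_cong)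
    fix t :: real
    show "indicator {0<..} t * (\<integral>\<^sup>+\<omega>. H (t, \<omega>) * ennreal (Ph.dens k j (g (t, \<omega>)) t) \<partial>P) =
      indicator {0<..} t * (\<integral>\<^sup>+\<omega>. ennreal (Ph.pi (max 0 (fst (sup_time (\<lambda>s. X s \<omega>) t, run_sup (\<lambda>s. X s \<omega>) t))) k) *
        indicator A (snd (sup_time (\<lambda>s. X s \<omega>) t, run_sup (\<lambda>s. X s \<omega>) t)) *
        (ennreal (p (max 0 (fst (t - sup_time (\<lambda>s. X s \<omega>) t, X t \<omega> - run_sup (\<lambda>s. X s \<omega>) t))) (Some k) (Some j) * exit_rates T $ j) *
        indicator B (snd (t - sup_time (\<lambda>s. X s \<omega>) t, X t \<omega> - run_sup (\<lambda>s. X s \<omega>) t))) \<partial>P)"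
    proof (cases "0 < t")
      case True
      have "H (t, \<omega>) * ennreal (Ph.dens k j (g (t, \<omega>)) t) = ennreal (Ph.pi (max 0 (sup_time (\<lambda>s. X s \<omega>) t)) k) *
        indicator A (run_sup (\<lambda>s. X s \<omega>) t) *
        (ennreal (p (max 0 (t - sup_time (\<lambda>s. X s \<omega>) t)) (Some k) (Some j) * exit_rates T $ j) *
        indicator B (X t \<omega> - run_sup (\<lambda>s. X s \<omega>) t))" if "\<omega> \<in> space P" for \<omega>
        using times_bounds(1)[OF that, of t] True Ph.pi_bounds(1)[of "sup_time (\<lambda>s. X s \<omega>) t" k]
          Ph.p_nonneg[of "t - sup_time (\<lambda>s. X s \<omega>) t" "Some k" "Some j"] Ph.exit_nonneg[of j]
        by (simp add: H_def g_def Ph.dens_def ennreal_mult max_absorb2 mult_ac)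
      then show ?thesis using True by (auto intro!: nn_integral_cong)
    qed simp
  qed
  finally show ?thesis .
qed

lemma sup_marginal_law:
  assumes A[measurable]: "A \<in> sets borel"
  shows "emeasure M {\<omega>\<in>space M. sup_at_end X J \<omega> \<in> A \<and> phase_at_sup X J \<omega> = Some k} =
    L.split_integral (\<lambda>x. ennreal (Ph.pi (max 0 (fst x)) k) * indicator A (snd x))
      (\<lambda>x. ennreal (\<Sum>j\<in>UNIV. exit_rates T $ j * p (max 0 (fst x)) (Some k) (Some j)))"
proof -
  define g where "g x = sup_time (\<lambda>s. X s (snd x)) (max 0 (fst x))" for x :: "real \<times> 'w"
  define H where "H x = (indicator A (run_sup (\<lambda>s. X s (snd x)) (max 0 (fst x))) :: ennreal)" for x :: "real \<times> 'w"
  note [measurable] = path_measurable_FX end_measurable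
  have gm: "g \<in> borel_measurable (borel \<Otimes>\<^sub>M FX)" unfolding g_def by measurable
  have Hm: "H \<in> borel_measurable (borel \<Otimes>\<^sub>M FX)" unfolding H_def by measurable
  have H1: "H x \<le> 1" for x by (auto simp: H_def indicator_def)
  have gb: "0 \<le> g (t, \<omega>) \<and> g (t, \<omega>) \<le> t" if "\<omega> \<in> space P" "0 \<le> t" for t \<omega>
    using times_bounds(1)[OF that] that(2) by (simp add: g_def max_def)
  have "emeasure M {\<omega>\<in>space M. sup_at_end X J \<omega> \<in> A \<and> phase_at_sup X J \<omega> = Some k} =
    (\<integral>\<^sup>+\<omega>. indicator {\<omega>. sup_at_end X J \<omega> \<in> A \<and> phase_at_sup X J \<omega> = Some k} \<omega> \<partial>M)"
    by (rule emeasure_eq_indicator_integral) measurable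
  also have "\<dots> = (\<integral>\<^sup>+\<omega>. H (lifetime J \<omega>, \<omega>) * indicator {\<omega>. phase_at J (g (lifetime J \<omega>, \<omega>)) \<omega> = Some k} \<omega> \<partial>M)"
    using Ph.lifetime_nonneg
    by (intro nn_integral_cong) (auto simp: H_def g_def sup_at_end_def phase_at_sup_def indicator_def max_absorb2)
  also have "\<dots> = (\<integral>\<^sup>+t. indicator {0<..} t * (\<integral>\<^sup>+\<omega>. H (t, \<omega>) * ennreal (\<Sum>j\<in>UNIV. Ph.dens k j (g (t, \<omega>)) t) \<partial>P) \<partial>lborel)"
    by (rule killed_integral[where R="\<lambda>x y. x = Some k" and D="\<lambda>s t. \<Sum>j\<in>UNIV. Ph.dens k j s t", OF gm gb Hm H1 Ph.phase_marginal borel_measurable_sum[OF Ph.borel_measurable_dens]])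
  also have "\<dots> = L.split_integral (\<lambda>x. ennreal (Ph.pi (max 0 (fst x)) k) * indicator A (snd x))
      (\<lambda>x. ennreal (\<Sum>j\<in>UNIV. exit_rates T $ j * p (max 0 (fst x)) (Some k) (Some j)))"
    unfolding L.split_integral_def
  proof (rule nn_integral_cong)
    fix t :: real
    show "indicator {0<..} t * (\<integral>\<^sup>+\<omega>. H (t, \<omega>) * ennreal (\<Sum>j\<in>UNIV. Ph.dens k j (g (t, \<omega>)) t) \<partial>P) =
      indicator {0<..} t * (\<integral>\<^sup>+\<omega>. ennreal (Ph.pi (max 0 (fst (sup_time (\<lambda>s. X s \<omega>) t, run_sup (\<lambda>s. X s \<omega>) t))) k) *
        indicator A (snd (sup_time (\<lambda>s. X s \<omega>) t, run_sup (\<lambda>s. X s \<omega>) t)) *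
        ennreal (\<Sum>j\<in>UNIV. exit_rates T $ j * p (max 0 (fst (t - sup_time (\<lambda>s. X s \<omega>) t, X t \<omega> - run_sup (\<lambda>s. X s \<omega>) t))) (Some k) (Some j)) \<partial>P)"
    proof (cases "0 < t")
      case True
      have "H (t, \<omega>) * ennreal (\<Sum>j\<in>UNIV. Ph.dens k j (g (t, \<omega>)) t) = ennreal (Ph.pi (max 0 (sup_time (\<lambda>s. X s \<omega>) t)) k) *
        indicator A (run_sup (\<lambda>s. X s \<omega>) t) *
        ennreal (\<Sum>j\<in>UNIV. exit_rates T $ j * p (max 0 (t - sup_time (\<lambda>s. X s \<omega>) t)) (Some k) (Some j))" if "\<omega> \<in> space P" for \<omega>
      proof -
        let ?s = "sup_time (\<lambda>s. X s \<omega>) t"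
        have s: "0 \<le> ?s" "?s \<le> t" using times_bounds(1)[OF that, of t] True by auto
        have "(\<Sum>j\<in>UNIV. Ph.dens k j ?s t) = Ph.pi ?s k * (\<Sum>j\<in>UNIV. exit_rates T $ j * p (t - ?s) (Some k) (Some j))"
          by (simp add: Ph.dens_def sum_distrib_left mult_ac)
        moreover have "0 \<le> (\<Sum>j\<in>UNIV. exit_rates T $ j * p (t - ?s) (Some k) (Some j))"
          using s by (intro sum_nonneg mult_nonneg_nonneg Ph.exit_nonneg Ph.p_nonneg) auto
        ultimately show ?thesis using s True Ph.pi_bounds(1)[of ?s k]
          by (simp add: H_def g_def ennreal_mult max_absorb2 mult_ac)
      qed
      then show ?thesis using True by (auto intro!: nn_integral_cong)
    qed simp
  qed
  finally show ?thesis .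
qed

text \<open>Not yet a \<open>split_integral\<close>: the time and value of the infimum are exchanged
  for those of the piece after the supremum only in \<open>reversed_inf_law\<close>.\<close>

lemma inf_marginal_law:
  assumes B[measurable]: "B \<in> sets borel"
  shows "emeasure M {\<omega>\<in>space M. inf_at_end X J \<omega> \<in> B \<and> phase_at_inf X J \<omega> = Some k} =
    (\<integral>\<^sup>+t. indicator {0<..} t * (\<integral>\<^sup>+\<omega>. indicator B (run_inf (\<lambda>s. X s \<omega>) t) *
      ennreal (\<Sum>j\<in>UNIV. Ph.dens k j (inf_time (\<lambda>s. X s \<omega>) t) t) \<partial>P) \<partial>lborel)"
proof -
  define g where "g x = inf_time (\<lambda>s. X s (snd x)) (max 0 (fst x))" for x :: "real \<times> 'w"
  define H where "H x = (indicator B (run_inf (\<lambda>s. X s (snd x)) (max 0 (fst x))) :: ennreal)" for x :: "real \<times> 'w"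
  note [measurable] = path_measurable_FX end_measurable
  have gm: "g \<in> borel_measurable (borel \<Otimes>\<^sub>M FX)" unfolding g_def by measurable
  have Hm: "H \<in> borel_measurable (borel \<Otimes>\<^sub>M FX)" unfolding H_def by measurable
  have H1: "H x \<le> 1" for x by (auto simp: H_def indicator_def)
  have gb: "0 \<le> g (t, \<omega>) \<and> g (t, \<omega>) \<le> t" if "\<omega> \<in> space P" "0 \<le> t" for t \<omega>
    using times_bounds(2)[OF that] that(2) by (simp add: g_def max_def)
  have "emeasure M {\<omega>\<in>space M. inf_at_end X J \<omega> \<in> B \<and> phase_at_inf X J \<omega> = Some k} =
    (\<integral>\<^sup>+\<omega>. indicator {\<omega>. inf_at_end X J \<omega> \<in> B \<and> phase_at_inf X J \<omega> = Some k} \<omega> \<partial>M)"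
    by (rule emeasure_eq_indicator_integral) measurable
  also have "\<dots> = (\<integral>\<^sup>+\<omega>. H (lifetime J \<omega>, \<omega>) * indicator {\<omega>. phase_at J (g (lifetime J \<omega>, \<omega>)) \<omega> = Some k} \<omega> \<partial>M)"
    using Ph.lifetime_nonneg
    by (intro nn_integral_cong) (auto simp: H_def g_def inf_at_end_def phase_at_inf_def indicator_def max_absorb2)
  also have "\<dots> = (\<integral>\<^sup>+t. indicator {0<..} t * (\<integral>\<^sup>+\<omega>. H (t, \<omega>) * ennreal (\<Sum>j\<in>UNIV. Ph.dens k j (g (t, \<omega>)) t) \<partial>P) \<partial>lborel)"
    by (rule killed_integral[where R="\<lambda>x y. x = Some k" and D="\<lambda>s t. \<Sum>j\<in>UNIV. Ph.dens k j s t", OF gm gb Hm H1 Ph.phase_marginal borel_measurable_sum[OF Ph.borel_measurable_dens]])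
  also have "\<dots> = (\<integral>\<^sup>+t. indicator {0<..} t * (\<integral>\<^sup>+\<omega>. indicator B (run_inf (\<lambda>s. X s \<omega>) t) *
      ennreal (\<Sum>j\<in>UNIV. Ph.dens k j (inf_time (\<lambda>s. X s \<omega>) t) t) \<partial>P) \<partial>lborel)"
  proof (rule nn_integral_cong)
    fix t :: real
    show "indicator {0<..} t * (\<integral>\<^sup>+\<omega>. H (t, \<omega>) * ennreal (\<Sum>j\<in>UNIV. Ph.dens k j (g (t, \<omega>)) t) \<partial>P) =
      indicator {0<..} t * (\<integral>\<^sup>+\<omega>. indicator B (run_inf (\<lambda>s. X s \<omega>) t) * ennreal (\<Sum>j\<in>UNIV. Ph.dens k j (inf_time (\<lambda>s. X s \<omega>) t) t) \<partial>P)"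
      by (cases "0 < t") (simp_all add: H_def g_def max_absorb2)
  qed
  finally show ?thesis .
qed

end

section \<open>The infimum under the reversed law, and positivity\<close>

text \<open>The two stretches exchange roles. Up to the infimum the reversed process runs from
  \<open>\<beta>\<close> to \<open>k\<close>; this gives \<open>W\<close>, the factor for the
  stretch after the supremum. From there it runs to its exit; this gives \<open>V\<close>, the
  factor up to the supremum. Keeping \<open>\<beta>\<close> general covers the reversed initial law
  as well as a single starting phase.\<close>

lemma reversed_inf_law:
  assumes rp: "reversible_phases p T \<alpha>" and kl: "killed_levy P X q (rev_generator \<alpha> T) M J \<beta>" and B[measurable]: "B \<in> sets borel"
  shows "emeasure M {\<omega>\<in>space M. inf_at_end X J \<omega> \<in> B \<and> phase_at_inf X J \<omega> = Some k} =
    levy.split_integral P X (\<lambda>x. ennreal (\<Sum>l\<in>UNIV. \<alpha> $ l * p (max 0 (fst x)) (Some l) (Some k)))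
      (\<lambda>x. ennreal (\<Sum>j\<in>UNIV. \<beta> $ j / reversal_weights \<alpha> T $ j * p (max 0 (fst x)) (Some k) (Some j)) * indicator B (snd x))"
proof -
  interpret R: reversible_phases p T \<alpha> by (rule rp)
  interpret K: killed_levy P X q "rev_generator \<alpha> T" M J \<beta> by (rule kl)
  let ?\<nu> = "reversal_weights \<alpha> T"
  define W where "W s = (\<Sum>j\<in>UNIV. \<beta> $ j / ?\<nu> $ j * p s (Some k) (Some j))" for s
  define V where "V s = (\<Sum>l\<in>UNIV. \<alpha> $ l * p s (Some l) (Some k))" for s
  have W0: "0 \<le> W s" and V0: "0 \<le> V s" if "0 \<le> s" for s
    using that R.weights_pos R.\<alpha> K.Ph.a_nonneg R.p_nonneg unfolding W_def V_def prob_vector_def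
    by (auto intro!: sum_nonneg mult_nonneg_nonneg divide_nonneg_pos)
  \<comment> \<open>The weights cancel: \<open>pi\<close> contributes \<open>\<nu> $ k\<close>, the
    transition from \<open>k\<close> to \<open>l\<close> the ratio
    \<open>\<nu> $ l / \<nu> $ k\<close>, and the reversed exit rate is
    \<open>\<alpha> $ l / \<nu> $ l\<close>.\<close>
  have dens: "(\<Sum>l\<in>UNIV. K.Ph.dens k l s t) = W s * V (t - s)" if st: "0 \<le> s" "s \<le> t" for s t
  proof -
    have nz: "?\<nu> $ i \<noteq> 0" for i using R.weights_pos[of i] by simp
    have q: "q u (Some i) (Some j) = p u (Some j) (Some i) * ?\<nu> $ j / ?\<nu> $ i" if "0 \<le> u" for u i j
      by (rule R.rev_semigroup[OF K.Ph.phase_semigroup_axioms that])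
    have pi: "K.Ph.pi s k = W s * ?\<nu> $ k"
      unfolding K.Ph.pi_def W_def sum_distrib_right using st by (intro sum.cong refl) (simp add: q mult_ac)
    have "K.Ph.dens k l s t = W s * (\<alpha> $ l * p (t - s) (Some l) (Some k))" for l
      unfolding K.Ph.dens_def pi using st nz[of k] nz[of l] by (simp add: q R.rev_exit_eq mult_ac)
    then show ?thesis by (simp add: V_def sum_distrib_left)
  qed
  have p_meas [measurable]: "(\<lambda>u. p (max 0 u) x y) \<in> borel_measurable borel" for x y
    by (rule R.borel_measurable_p_at) auto
  have [measurable]: "(\<lambda>u. W (max 0 u)) \<in> borel_measurable borel" "(\<lambda>u. V (max 0 u)) \<in> borel_measurable borel"
    unfolding W_def V_def by measurable
  have dual: "(\<integral>\<^sup>+\<omega>. indicator B (run_inf (\<lambda>s. X s \<omega>) t) * ennreal (\<Sum>l\<in>UNIV. K.Ph.dens k l (inf_time (\<lambda>s. X s \<omega>) t) t) \<partial>P) =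
    (\<integral>\<^sup>+\<omega>. ennreal (V (max 0 (sup_time (\<lambda>s. X s \<omega>) t))) *
      (ennreal (W (max 0 (t - sup_time (\<lambda>s. X s \<omega>) t))) * indicator B (X t \<omega> - run_sup (\<lambda>s. X s \<omega>) t)) \<partial>P)"
    if t: "0 < t" for t
  proof -
    define h where "h z = indicator B (snd z) * ennreal (W (max 0 (fst z)) * V (max 0 (t - fst z)))" for z :: "real \<times> real"
    have hm: "h \<in> borel_measurable (borel \<Otimes>\<^sub>M borel)"
    proof -
      have "(\<lambda>z :: real \<times> real. V (max 0 (t - fst z))) \<in> borel_measurable (borel \<Otimes>\<^sub>M borel)"
        by (rule measurable_compose[where N=borel and g="\<lambda>u. V (max 0 u)"]) auto
      moreover have "(\<lambda>z :: real \<times> real. W (max 0 (fst z))) \<in> borel_measurable (borel \<Otimes>\<^sub>M borel)"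
        by (rule measurable_compose[where N=borel and g="\<lambda>u. W (max 0 u)"]) auto
      ultimately show ?thesis unfolding h_def by measurable
    qed
    note ltm = measurable_ident_sets[OF refl, of P] borel_measurable_const[of t P]
    have t0: "0 \<le> t" using t by simp
    have m1: "(\<lambda>\<omega>. (inf_time (\<lambda>s. X s \<omega>) t, run_inf (\<lambda>s. X s \<omega>) t)) \<in> P \<rightarrow>\<^sub>M borel \<Otimes>\<^sub>M borel"
      using K.L.measurable_inf_time[OF ltm t0] K.L.measurable_run_inf[OF ltm t0] by (intro measurable_Pair) simp_all
    have m2: "(\<lambda>\<omega>. (t - sup_time (\<lambda>s. X s \<omega>) t, X t \<omega> - run_sup (\<lambda>s. X s \<omega>) t)) \<in> P \<rightarrow>\<^sub>M borel \<Otimes>\<^sub>M borel"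
      using K.L.measurable_sup_time[OF ltm t0] K.L.measurable_run_sup[OF ltm t0] K.L.X_meas[OF t0]
      by (intro measurable_Pair borel_measurable_diff) simp_all
    have "(\<integral>\<^sup>+\<omega>. indicator B (run_inf (\<lambda>s. X s \<omega>) t) * ennreal (\<Sum>l\<in>UNIV. K.Ph.dens k l (inf_time (\<lambda>s. X s \<omega>) t) t) \<partial>P) =
        (\<integral>\<^sup>+\<omega>. h (inf_time (\<lambda>s. X s \<omega>) t, run_inf (\<lambda>s. X s \<omega>) t) \<partial>P)"
      using K.times_bounds(2)[OF _ t0] by (intro nn_integral_cong) (simp add: h_def dens max_absorb2)
    also have "\<dots> = (\<integral>\<^sup>+z. h z \<partial>distr P (borel \<Otimes>\<^sub>M borel) (\<lambda>\<omega>. (inf_time (\<lambda>s. X s \<omega>) t, run_inf (\<lambda>s. X s \<omega>) t)))"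
      using hm by (intro nn_integral_distr[symmetric] m1) simp
    also have "\<dots> = (\<integral>\<^sup>+\<omega>. h (t - sup_time (\<lambda>s. X s \<omega>) t, X t \<omega> - run_sup (\<lambda>s. X s \<omega>) t) \<partial>P)"
      unfolding K.L.inf_sup_duality[OF t] using hm by (intro nn_integral_distr m2) simp
    also have "\<dots> = (\<integral>\<^sup>+\<omega>. ennreal (V (max 0 (sup_time (\<lambda>s. X s \<omega>) t))) *
      (ennreal (W (max 0 (t - sup_time (\<lambda>s. X s \<omega>) t))) * indicator B (X t \<omega> - run_sup (\<lambda>s. X s \<omega>) t)) \<partial>P)"
      by (intro nn_integral_cong) (simp add: h_def ennreal_mult W0 V0 mult_ac)
    finally show ?thesis .
  qed
  have "emeasure M {\<omega>\<in>space M. inf_at_end X J \<omega> \<in> B \<and> phase_at_inf X J \<omega> = Some k} =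
    (\<integral>\<^sup>+t. indicator {0<..} t * (\<integral>\<^sup>+\<omega>. indicator B (run_inf (\<lambda>s. X s \<omega>) t) *
      ennreal (\<Sum>j\<in>UNIV. K.Ph.dens k j (inf_time (\<lambda>s. X s \<omega>) t) t) \<partial>P) \<partial>lborel)"
    by (rule K.inf_marginal_law[OF B])
  also have "\<dots> = K.L.split_integral (\<lambda>x. ennreal (V (max 0 (fst x)))) (\<lambda>x. ennreal (W (max 0 (fst x))) * indicator B (snd x))"
    unfolding K.L.split_integral_def
  proof (rule nn_integral_cong)
    fix t :: real
    show "indicator {0<..} t * (\<integral>\<^sup>+\<omega>. indicator B (run_inf (\<lambda>s. X s \<omega>) t) * ennreal (\<Sum>j\<in>UNIV. K.Ph.dens k j (inf_time (\<lambda>s. X s \<omega>) t) t) \<partial>P) =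
      indicator {0<..} t * (\<integral>\<^sup>+\<omega>. ennreal (V (max 0 (fst (sup_time (\<lambda>s. X s \<omega>) t, run_sup (\<lambda>s. X s \<omega>) t)))) *
        (ennreal (W (max 0 (fst (t - sup_time (\<lambda>s. X s \<omega>) t, X t \<omega> - run_sup (\<lambda>s. X s \<omega>) t)))) *
          indicator B (snd (t - sup_time (\<lambda>s. X s \<omega>) t, X t \<omega> - run_sup (\<lambda>s. X s \<omega>) t))) \<partial>P)"
      using dual[of t] by (cases "0 < t") simp_all
  qed
  finally show ?thesis unfolding W_def V_def .
qed

text \<open>If the product is 0, one factor is, and the other test function may be replaced by 1. A
  vanishing first factor forces the supremum time to be 0, so that paths stay nonpositive and,
  increments being stationary, decrease. A vanishing second factor forces it to be \<open>t\<close>,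
  and paths increase.\<close>

lemma (in levy) split_integral_pos:
  assumes nm: "non_monotone P X" and F[measurable]: "F \<in> borel_measurable borel" and G[measurable]: "G \<in> borel_measurable borel"
    and Fpos: "\<And>x. 0 < fst x \<Longrightarrow> 0 < F x" and Gpos: "\<And>x. 0 < fst x \<Longrightarrow> 0 < G x"
  shows "split_integral F G \<noteq> 0"
proof
  assume z: "split_integral F G = 0"
  obtain a b where ab: "\<And>F G. F \<in> borel_measurable borel \<Longrightarrow> G \<in> borel_measurable borel \<Longrightarrow> split_integral F G = a F * b G"
    using split_integral_product by blast
  have AE_zero: "AE t in lborel. 0 < t \<longrightarrow> (AE \<omega> in P. F' (sup_time (\<lambda>s. X s \<omega>) t, run_sup (\<lambda>s. X s \<omega>) t) *
      G' (t - sup_time (\<lambda>s. X s \<omega>) t, X t \<omega> - run_sup (\<lambda>s. X s \<omega>) t) = 0)"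
    if [measurable]: "F' \<in> borel_measurable borel" "G' \<in> borel_measurable borel" and z: "split_integral F' G' = 0" for F' G'
  proof -
    let ?I = "\<lambda>x. F' (sup_part x) * G' (end_part x)"
    have m: "?I \<in> borel_measurable (borel \<Otimes>\<^sub>M P)" by measurable
    have inner: "(\<lambda>t. \<integral>\<^sup>+\<omega>. ?I (t, \<omega>) \<partial>P) \<in> borel_measurable borel" by (rule borel_measurable_nn_integral_fst[OF m])
    have eq: "indicator {0<..} t * (\<integral>\<^sup>+\<omega>. F' (sup_time (\<lambda>s. X s \<omega>) t, run_sup (\<lambda>s. X s \<omega>) t) *
      G' (t - sup_time (\<lambda>s. X s \<omega>) t, X t \<omega> - run_sup (\<lambda>s. X s \<omega>) t) \<partial>P) = indicator {0<..} t * (\<integral>\<^sup>+\<omega>. ?I (t, \<omega>) \<partial>P)" for t :: real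
      by (cases "0 < t") (simp_all add: sup_part_def end_part_def Let_def max_absorb2)
    have "(\<integral>\<^sup>+t. indicator {0<..} t * (\<integral>\<^sup>+\<omega>. ?I (t, \<omega>) \<partial>P) \<partial>lborel) = 0"
      using z unfolding split_integral_def eq .
    then have "AE t in lborel. indicator {0<..} t * (\<integral>\<^sup>+\<omega>. ?I (t, \<omega>) \<partial>P) = 0"
      using inner by (subst (asm) nn_integral_0_iff_AE) auto
    then show ?thesis
    proof eventually_elim
      case (elim t)
      show ?case
      proof
        assume t: "0 < t"
        then have "(\<integral>\<^sup>+\<omega>. ?I (t, \<omega>) \<partial>P) = 0" using elim by simp
        moreover have "(\<lambda>\<omega>. ?I (t, \<omega>)) \<in> borel_measurable P" by (rule measurable_compose[OF _ m]) simp
        ultimately have "AE \<omega> in P. ?I (t, \<omega>) = 0" by (simp add: nn_integral_0_iff_AE)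
        then show "AE \<omega> in P. F' (sup_time (\<lambda>s. X s \<omega>) t, run_sup (\<lambda>s. X s \<omega>) t) *
          G' (t - sup_time (\<lambda>s. X s \<omega>) t, X t \<omega> - run_sup (\<lambda>s. X s \<omega>) t) = 0"
          using t by (simp add: sup_part_def end_part_def Let_def max_absorb2)
      qed
    qed
  qed
  have one: "(\<lambda>_. 1 :: ennreal) \<in> borel_measurable (borel :: (real \<times> real) measure)" by simp
  from z have "a F * b G = 0" using ab F G by simp
  then consider "a F = 0" | "b G = 0" by auto
  then show False
  proof cases
    case 1
    then have "split_integral F (\<lambda>_. 1) = 0" using ab[OF F one] by simp
    from AE_zero[OF F one this]
    have "AE t in lborel. 0 < t \<longrightarrow> (AE \<omega> in P. F (sup_time (\<lambda>s. X s \<omega>) t, run_sup (\<lambda>s. X s \<omega>) t) = 0)" by simp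
    then have "AE \<omega> in P. \<forall>s\<ge>0. 0 \<le> (-1) * X s \<omega>"
    proof (rule AE_all_times)
      fix s t \<omega> assume \<omega>: "\<omega> \<in> space P" and t: "0 < t" and s: "0 \<le> s" "s \<le> t"
        and F0: "F (sup_time (\<lambda>s. X s \<omega>) t, run_sup (\<lambda>s. X s \<omega>) t) = 0"
      interpret cadlag0 "\<lambda>s. X s \<omega>" by (rule X_path[OF \<omega>])
      have "\<not> 0 < sup_time (\<lambda>s. X s \<omega>) t"
        using Fpos[of "(sup_time (\<lambda>s. X s \<omega>) t, run_sup (\<lambda>s. X s \<omega>) t)"] F0 by auto
      then have "run_sup (\<lambda>s. X s \<omega>) 0 = run_sup (\<lambda>s. X s \<omega>) t" using sup_time_le_iff[of 0 t] t by simp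
      moreover have "run_sup (\<lambda>s. X s \<omega>) 0 = 0" using zero by (simp add: run_sup_def)
      ultimately show "0 \<le> (-1) * X s \<omega>" using run_sup_upper[OF s] by simp
    qed
    then have "AE \<omega> in P. mono_on {0..} (\<lambda>t. (-1) * X t \<omega>)" by (rule mono_of_nonneg)
    then show False using nm by (simp add: non_monotone_def)
  next
    case 2
    then have "split_integral (\<lambda>_. 1) G = 0" using ab[OF one G] by simp
    from AE_zero[OF one G this]
    have G0: "AE t in lborel. 0 < t \<longrightarrow> (AE \<omega> in P. G (t - sup_time (\<lambda>s. X s \<omega>) t, X t \<omega> - run_sup (\<lambda>s. X s \<omega>) t) = 0)" by simp
    \<comment> \<open>A supremum time equal to \<open>t\<close> only compares the path with its end.
      Duality rephrases it as an infimum time 0, which keeps the whole path up to \<open>t\<close>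
      nonnegative.\<close>
    have "AE t in lborel. 0 < t \<longrightarrow> (AE \<omega> in P. inf_time (\<lambda>s. X s \<omega>) t \<le> 0)"
      using G0
    proof eventually_elim
      case (elim t)
      show ?case
      proof
        assume t: "0 < t"
        then have t0: "0 \<le> t" by simp
        note ltm = measurable_ident_sets[OF refl, of P] borel_measurable_const[of t P]
        have m1: "(\<lambda>\<omega>. (inf_time (\<lambda>s. X s \<omega>) t, run_inf (\<lambda>s. X s \<omega>) t)) \<in> P \<rightarrow>\<^sub>M borel \<Otimes>\<^sub>M borel"
          using measurable_inf_time[OF ltm t0] measurable_run_inf[OF ltm t0] by (intro measurable_Pair) simp_all
        have m2: "(\<lambda>\<omega>. (t - sup_time (\<lambda>s. X s \<omega>) t, X t \<omega> - run_sup (\<lambda>s. X s \<omega>) t)) \<in> P \<rightarrow>\<^sub>M borel \<Otimes>\<^sub>M borel"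
          using measurable_sup_time[OF ltm t0] measurable_run_sup[OF ltm t0] X_meas[OF t0]
          by (intro measurable_Pair borel_measurable_diff) simp_all
        have S: "{z \<in> space (borel \<Otimes>\<^sub>M borel). fst z \<le> (0::real)} \<in> sets (borel \<Otimes>\<^sub>M (borel :: real measure))" by measurable
        have "AE \<omega> in P. fst (t - sup_time (\<lambda>s. X s \<omega>) t, X t \<omega> - run_sup (\<lambda>s. X s \<omega>) t) \<le> 0"
          using elim[rule_format, OF t]
        proof eventually_elim
          case (elim \<omega>)
          then show ?case using Gpos[of "(t - sup_time (\<lambda>s. X s \<omega>) t, X t \<omega> - run_sup (\<lambda>s. X s \<omega>) t)"] by (auto simp: not_less[symmetric])
        qed
        then have "AE z in distr P (borel \<Otimes>\<^sub>M borel) (\<lambda>\<omega>. (t - sup_time (\<lambda>s. X s \<omega>) t, X t \<omega> - run_sup (\<lambda>s. X s \<omega>) t)). fst z \<le> 0"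
          using AE_distr_iff[OF m2 S] by simp
        then have "AE z in distr P (borel \<Otimes>\<^sub>M borel) (\<lambda>\<omega>. (inf_time (\<lambda>s. X s \<omega>) t, run_inf (\<lambda>s. X s \<omega>) t)). fst z \<le> 0"
          unfolding inf_sup_duality[OF t] .
        then show "AE \<omega> in P. inf_time (\<lambda>s. X s \<omega>) t \<le> 0"
          using AE_distr_iff[OF m1 S] by simp
      qed
    qed
    then have "AE \<omega> in P. \<forall>s\<ge>0. 0 \<le> 1 * X s \<omega>"
    proof (rule AE_all_times)
      fix s t \<omega> assume \<omega>: "\<omega> \<in> space P" and t: "0 < t" and s: "0 \<le> s" "s \<le> t"
        and i0: "inf_time (\<lambda>s. X s \<omega>) t \<le> 0"
      interpret cadlag0 "\<lambda>s. X s \<omega>" by (rule X_path[OF \<omega>])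
      have "run_inf (\<lambda>s. X s \<omega>) t = 0" by (rule run_inf_eq_0_of_inf_time[OF less_imp_le[OF t] i0])
      then show "0 \<le> 1 * X s \<omega>" using run_inf_lower[OF s] by simp
    qed
    then have "AE \<omega> in P. mono_on {0..} (\<lambda>t. 1 * X t \<omega>)" by (rule mono_of_nonneg)
    then show False using nm by (simp add: non_monotone_def)
  qed
qed

theorem theorem1:
  fixes X :: "real \<Rightarrow> 'w \<Rightarrow> real"
    and J :: "real \<Rightarrow> 'w \<Rightarrow> 'n::finite option"
    and \<alpha> :: "real^'n" and T :: "real^'n^'n"
    and P P_rev :: "'w measure"
    and P_from P_rev_from :: "'n \<Rightarrow> 'w measure"
    and i j k :: 'n
  assumes "levy_process P X" and "non_monotone P X"
    and "prob_vector \<alpha>" and "sub_generator T"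
    and "irreducible_matrix (T + (\<chi> a b. exit_rates T $ a * \<alpha> $ b))"
    and "killed_levy_law P X J \<alpha> T P"
    and "\<And>a. killed_levy_law P X J (axis a 1) T (P_from a)"
    and "killed_levy_law P X J (rev_initial \<alpha> T) (rev_generator \<alpha> T) P_rev"
    and "\<And>a. killed_levy_law P X J (axis a 1) (rev_generator \<alpha> T) (P_rev_from a)"
    and "\<alpha> $ i \<noteq> 0"
  shows "measure P {\<omega>\<in>space P. phase_at_sup X J \<omega> = Some k} =
           measure P_rev {\<omega>\<in>space P_rev. phase_at_inf X J \<omega> = Some k} \<and>
         measure P {\<omega>\<in>space P. phase_at_sup X J \<omega> = Some k} > 0 \<and>
         law_on (P_from i) {\<omega>. phase_at_sup X J \<omega> = Some k \<and> last_phase J \<omega> = Some j}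
           (borel \<Otimes>\<^sub>M borel)
           (\<lambda>\<omega>. (sup_at_end X J \<omega>, X (lifetime J \<omega>) \<omega> - sup_at_end X J \<omega>)) =
         scale_measure
           (ennreal (rev_initial \<alpha> T $ j / measure P {\<omega>\<in>space P. phase_at_sup X J \<omega> = Some k}))
           (law_on (P_from i) {\<omega>. phase_at_sup X J \<omega> = Some k} borel (sup_at_end X J) \<Otimes>\<^sub>M
            law_on (P_rev_from j) {\<omega>. phase_at_inf X J \<omega> = Some k} borel (inf_at_end X J))"
proof -
  have "levy P X" using assms(1) by (simp add: levy_def levy_axioms_def levy_process_def)
  then interpret L: levy P X .
  obtain p where p: "phase_process p T P J \<alpha>" using phase_process_exists[OF assms(6)] by blast
  then interpret PP: phase_process p T P J \<alpha> .
  have p_from: "phase_process p T (P_from b) J (axis b 1)" for b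
    using phase_process_exists[OF assms(7)[of b]] phase_process_change_semigroup PP.phase_semigroup_axioms by blast
  obtain q where q: "phase_process q (rev_generator \<alpha> T) P_rev J (rev_initial \<alpha> T)" using phase_process_exists[OF assms(8)] by blast
  then interpret QP: phase_process q "rev_generator \<alpha> T" P_rev J "rev_initial \<alpha> T" .
  have q_from: "phase_process q (rev_generator \<alpha> T) (P_rev_from b) J (axis b 1)" for b
    using phase_process_exists[OF assms(9)[of b]] phase_process_change_semigroup QP.phase_semigroup_axioms by blast
  have pi_axis: "phase_process.pi p (axis b 1) s l = p s (Some b) (Some l)" for b s l
    unfolding phase_process.pi_def[OF p_from[of b]] by (simp add: axis_def if_distrib if_distribR cong: if_cong)
  \<comment> \<open>That row \<open>b\<close> of \<open>p\<close> vanishes in the limit is read off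
    from the process started in \<open>b\<close>, including phases with
    \<open>\<alpha> $ b = 0\<close>.\<close>
  have rp: "reversible_phases p T \<alpha>"
  proof (intro reversible_phases.intro reversible_phases_axioms.intro PP.phase_semigroup_axioms assms(3-5))
    show "(\<lambda>n. p (real n) (Some b) (Some l)) \<longlonglongrightarrow> 0" for b l
      using phase_process.pi_vanish[OF p_from[of b], of l] by (simp add: pi_axis)
  qed
  interpret R: reversible_phases p T \<alpha> by (rule rp)
  have K: "killed_levy P X p T P J \<alpha>"
    by (intro killed_levy.intro killed_levy_axioms.intro L.levy_axioms p assms(6))
  have K_from: "killed_levy P X p T (P_from i) J (axis i 1)"
    by (intro killed_levy.intro killed_levy_axioms.intro L.levy_axioms p_from assms(7))
  have K_rev: "killed_levy P X q (rev_generator \<alpha> T) P_rev J (rev_initial \<alpha> T)"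
    by (intro killed_levy.intro killed_levy_axioms.intro L.levy_axioms q assms(8))
  have K_rev_from: "killed_levy P X q (rev_generator \<alpha> T) (P_rev_from j) J (axis j 1)"
    by (intro killed_levy.intro killed_levy_axioms.intro L.levy_axioms q_from assms(9))
  interpret Ki: killed_levy P X p T "P_from i" J "axis i 1" by (rule K_from)
  interpret Kj: killed_levy P X q "rev_generator \<alpha> T" "P_rev_from j" J "axis j 1" by (rule K_rev_from)
  interpret KP: killed_levy P X p T P J \<alpha> by (rule K)
  interpret KR: killed_levy P X q "rev_generator \<alpha> T" P_rev J "rev_initial \<alpha> T" by (rule K_rev)
  let ?\<nu> = "reversal_weights \<alpha> T"
  have \<nu>: "0 < ?\<nu> $ b" for b by (rule R.weights_pos)
  \<comment> \<open>\<open>F1\<close> and \<open>F2\<close> weigh the part up to the supremum, for a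
    start in \<open>i\<close> and under \<open>\<alpha>\<close>. The others weigh the part after it:
    \<open>G1\<close> with exit from \<open>j\<close>, \<open>G2\<close> with exit from any phase,
    and \<open>G3\<close> for the reversed process started in \<open>j\<close>.\<close>
  define F1 where "F1 A x = ennreal (p (max 0 (fst x)) (Some i) (Some k)) * indicator A (snd x)" for A :: "real set" and x :: "real \<times> real"
  define F2 where "F2 x = ennreal (\<Sum>l\<in>UNIV. \<alpha> $ l * p (max 0 (fst x)) (Some l) (Some k))" for x :: "real \<times> real"
  define G1 where "G1 B x = ennreal (p (max 0 (fst x)) (Some k) (Some j) * exit_rates T $ j) * indicator B (snd x)" for B :: "real set" and x :: "real \<times> real"
  define G2 where "G2 x = ennreal (\<Sum>l\<in>UNIV. exit_rates T $ l * p (max 0 (fst x)) (Some k) (Some l))" for x :: "real \<times> real"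
  define G3 where "G3 B x = ennreal (1 / ?\<nu> $ j * p (max 0 (fst x)) (Some k) (Some j)) * indicator B (snd x)" for B :: "real set" and x :: "real \<times> real"
  have fs [measurable]: "(\<lambda>x :: real \<times> real. fst x) \<in> borel_measurable borel" "(\<lambda>x :: real \<times> real. snd x) \<in> borel_measurable borel"
    by (intro borel_measurable_continuous_onI continuous_intros)+
  have pm [measurable]: "(\<lambda>x :: real \<times> real. p (max 0 (fst x)) u v) \<in> borel_measurable borel" for u v
    by (rule PP.borel_measurable_p_at) auto
  have meas: "F2 \<in> borel_measurable borel" "G2 \<in> borel_measurable borel"
    unfolding F2_def[abs_def] G2_def[abs_def] by measurable
  have measA: "F1 A \<in> borel_measurable borel" "G1 A \<in> borel_measurable borel" "G3 A \<in> borel_measurable borel"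
    if [measurable]: "A \<in> sets borel" for A
    unfolding F1_def[abs_def] G1_def[abs_def] G3_def[abs_def] by measurable
  obtain a b where ab: "\<And>F G. F \<in> borel_measurable borel \<Longrightarrow> G \<in> borel_measurable borel \<Longrightarrow> L.split_integral F G = a F * b G"
    using L.split_integral_product by blast
  define c where "c = measure P {\<omega>\<in>space P. phase_at_sup X J \<omega> = Some k}"
  have c_eq: "ennreal c = a F2 * b G2"
  proof -
    have "ennreal c = emeasure P {\<omega>\<in>space P. sup_at_end X J \<omega> \<in> UNIV \<and> phase_at_sup X J \<omega> = Some k}"
      by (simp add: c_def L.emeasure_eq_measure)
    also have "\<dots> = L.split_integral F2 G2"
      by (subst KP.sup_marginal_law) (auto simp: PP.pi_def F2_def[abs_def] G2_def[abs_def])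
    finally show ?thesis using ab meas by simp
  qed
  have c_rev: "ennreal (measure P_rev {\<omega>\<in>space P_rev. phase_at_inf X J \<omega> = Some k}) = a F2 * b G2"
  proof -
    have "ennreal (measure P_rev {\<omega>\<in>space P_rev. phase_at_inf X J \<omega> = Some k}) =
        emeasure P_rev {\<omega>\<in>space P_rev. inf_at_end X J \<omega> \<in> UNIV \<and> phase_at_inf X J \<omega> = Some k}"
      by (simp add: QP.emeasure_eq_measure)
    also have "\<dots> = L.split_integral F2 G2"
    proof (subst reversed_inf_law[OF rp K_rev])
      \<comment> \<open>Under the reversed initial law the weights cancel and the exit rates
        reappear, which turns the second factor into \<open>G2\<close>.\<close>
      have "rev_initial \<alpha> T $ l / ?\<nu> $ l = exit_rates T $ l" for l using \<nu>[of l] by (simp add: R.rev_initial_eq)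
      then show "L.split_integral (\<lambda>x. ennreal (\<Sum>l\<in>UNIV. \<alpha> $ l * p (max 0 (fst x)) (Some l) (Some k)))
        (\<lambda>x. ennreal (\<Sum>l\<in>UNIV. rev_initial \<alpha> T $ l / ?\<nu> $ l * p (max 0 (fst x)) (Some k) (Some l)) * indicator UNIV (snd x)) =
        L.split_integral F2 G2" by (simp add: F2_def[abs_def] G2_def[abs_def])
    qed simp
    finally show ?thesis using ab meas by simp
  qed
  have c_pos: "0 < c"
  proof -
    have "0 < F2 x" if "0 < fst x" for x
    proof -
      obtain l where l: "0 < \<alpha> $ l" "(l, k) \<in> PP.leads" using PP.reached_from_initial[OF R.irr R.\<alpha>] by blast
      have "0 < \<alpha> $ l * p (fst x) (Some l) (Some k)" using l PP.leads_pos[OF R.T l(2) that] by simp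
      also have "\<dots> \<le> (\<Sum>l\<in>UNIV. \<alpha> $ l * p (fst x) (Some l) (Some k))"
        using R.\<alpha> PP.p_nonneg that by (intro member_le_sum) (auto simp: prob_vector_def)
      finally show ?thesis using that by (simp add: F2_def max_absorb2)
    qed
    moreover have "0 < G2 x" if "0 < fst x" for x
    proof -
      obtain l where l: "0 < exit_rates T $ l" "(k, l) \<in> PP.leads" using PP.leads_to_exit[OF R.irr] PP.exit_exists by blast
      have "0 < exit_rates T $ l * p (fst x) (Some k) (Some l)" using l PP.leads_pos[OF R.T l(2) that] by simp
      also have "\<dots> \<le> (\<Sum>l\<in>UNIV. exit_rates T $ l * p (fst x) (Some k) (Some l))"
        using PP.exit_nonneg PP.p_nonneg that by (intro member_le_sum) auto
      finally show ?thesis using that by (simp add: G2_def max_absorb2)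
    qed
    ultimately have "a F2 * b G2 \<noteq> 0" using L.split_integral_pos[OF assms(2) meas] ab[OF meas] by simp
    then have "ennreal c \<noteq> 0" unfolding c_eq .
    then show ?thesis by (simp add: c_def zero_less_measure_iff ennreal_eq_0_iff not_le)
  qed
  have joint: "emeasure (P_from i) {\<omega>\<in>space (P_from i). sup_at_end X J \<omega> \<in> A \<and> X (lifetime J \<omega>) \<omega> - sup_at_end X J \<omega> \<in> B \<and>
      phase_at_sup X J \<omega> = Some k \<and> last_phase J \<omega> = Some j} = a (F1 A) * b (G1 B)"
    if AB: "A \<in> sets borel" "B \<in> sets borel" for A B
    using Ki.sup_joint_law[OF AB, of k j] ab[OF measA(1)[OF AB(1)] measA(2)[OF AB(2)]]
    by (simp add: pi_axis F1_def[abs_def] G1_def[abs_def])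
  have sup_i: "emeasure (P_from i) {\<omega>\<in>space (P_from i). sup_at_end X J \<omega> \<in> A \<and> phase_at_sup X J \<omega> = Some k} = a (F1 A) * b G2"
    if A: "A \<in> sets borel" for A
    using Ki.sup_marginal_law[OF A, of k] ab[OF measA(1)[OF A] meas(2)]
    by (simp add: pi_axis F1_def[abs_def] G2_def[abs_def])
  have inf_j: "emeasure (P_rev_from j) {\<omega>\<in>space (P_rev_from j). inf_at_end X J \<omega> \<in> B \<and> phase_at_inf X J \<omega> = Some k} = a F2 * b (G3 B)"
    if B: "B \<in> sets borel" for B
  proof -
    have "(\<Sum>l\<in>UNIV. axis j 1 $ l / ?\<nu> $ l * p s (Some k) (Some l)) = 1 / ?\<nu> $ j * p s (Some k) (Some j)" for s
    proof -
      have "(\<Sum>l\<in>UNIV. axis j 1 $ l / ?\<nu> $ l * p s (Some k) (Some l)) = (\<Sum>l\<in>UNIV. if l = j then 1 / ?\<nu> $ j * p s (Some k) (Some j) else 0)"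
        by (intro sum.cong) (auto simp: axis_def)
      then show ?thesis by simp
    qed
    then show ?thesis
      using reversed_inf_law[OF rp K_rev_from B, of k] ab[OF meas(1) measA(3)[OF B]]
      by (simp add: F2_def[abs_def] G3_def[abs_def])
  qed
  define r where "r = rev_initial \<alpha> T $ j"
  have r: "r = exit_rates T $ j * ?\<nu> $ j" "0 \<le> r"
    using R.rev_initial_eq[of j] PP.exit_nonneg[of j] \<nu>[of j] by (simp_all add: r_def)
  \<comment> \<open>\<open>G1\<close> is \<open>G3\<close> times the exit rate and the weight of
    \<open>j\<close>, that is, times the reversed initial mass of \<open>j\<close>. As
    \<open>b\<close> is known only through \<open>split_integral\<close>, the constant is pulled out
    there.\<close>
  have G13: "a F * b (G1 B) = ennreal r * (a F * b (G3 B))" if F: "F \<in> borel_measurable borel" and B: "B \<in> sets borel" for F B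
  proof -
    have g: "G1 B x = ennreal r * G3 B x" for x
      using \<nu>[of j] PP.exit_nonneg[of j] PP.p_nonneg[of "max 0 (fst x)" "Some k" "Some j"] r
      by (simp add: G1_def G3_def mult.assoc[symmetric] ennreal_mult[symmetric]) (simp add: mult_ac)
    have "L.split_integral F (G1 B) = ennreal r * L.split_integral F (G3 B)"
    proof -
      note [measurable] = F measA(3)[OF B]
      have m: "(\<lambda>x. F (L.sup_part x) * G3 B (L.end_part x)) \<in> borel_measurable (borel \<Otimes>\<^sub>M P)" by measurable
      define S where "S t = (\<integral>\<^sup>+\<omega>. F (L.sup_part (t, \<omega>)) * G3 B (L.end_part (t, \<omega>)) \<partial>P)" for t
      have S_meas: "S \<in> borel_measurable borel" unfolding S_def by (rule L.borel_measurable_nn_integral_fst[OF m])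
      have S3: "L.split_integral F (G3 B) = (\<integral>\<^sup>+t. indicator {0<..} t * S t \<partial>lborel)"
        unfolding L.split_integral_def
      proof (rule nn_integral_cong)
        fix t :: real
        show "indicator {0<..} t * (\<integral>\<^sup>+\<omega>. F (sup_time (\<lambda>s. X s \<omega>) t, run_sup (\<lambda>s. X s \<omega>) t) *
          G3 B (t - sup_time (\<lambda>s. X s \<omega>) t, X t \<omega> - run_sup (\<lambda>s. X s \<omega>) t) \<partial>P) = indicator {0<..} t * S t"
          by (cases "0 < t") (simp_all add: S_def L.sup_part_def L.end_part_def Let_def max_absorb2)
      qed
      have S1: "L.split_integral F (G1 B) = (\<integral>\<^sup>+t. ennreal r * (indicator {0<..} t * S t) \<partial>lborel)"
        unfolding L.split_integral_def
      proof (rule nn_integral_cong)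
        fix t :: real
        have "(\<lambda>\<omega>. F (L.sup_part (t, \<omega>)) * G3 B (L.end_part (t, \<omega>))) \<in> borel_measurable P"
          by (rule measurable_compose[OF _ m]) simp
        then have "(\<integral>\<^sup>+\<omega>. ennreal r * (F (L.sup_part (t, \<omega>)) * G3 B (L.end_part (t, \<omega>))) \<partial>P) = ennreal r * S t"
          unfolding S_def by (rule nn_integral_cmult)
        then show "indicator {0<..} t * (\<integral>\<^sup>+\<omega>. F (sup_time (\<lambda>s. X s \<omega>) t, run_sup (\<lambda>s. X s \<omega>) t) *
          G1 B (t - sup_time (\<lambda>s. X s \<omega>) t, X t \<omega> - run_sup (\<lambda>s. X s \<omega>) t) \<partial>P) = ennreal r * (indicator {0<..} t * S t)"
          by (cases "0 < t") (simp_all add: g L.sup_part_def L.end_part_def Let_def max_absorb2 mult.left_commute)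
      qed
      show ?thesis unfolding S1 S3 using S_meas by (intro nn_integral_cmult) simp
    qed
    then show ?thesis using ab F measA(2)[OF B] measA(3)[OF B] by simp
  qed
  let ?LHS = "law_on (P_from i) {\<omega>. phase_at_sup X J \<omega> = Some k \<and> last_phase J \<omega> = Some j} (borel \<Otimes>\<^sub>M borel)
      (\<lambda>\<omega>. (sup_at_end X J \<omega>, X (lifetime J \<omega>) \<omega> - sup_at_end X J \<omega>))"
  let ?M1 = "law_on (P_from i) {\<omega>. phase_at_sup X J \<omega> = Some k} borel (sup_at_end X J)"
  let ?M2 = "law_on (P_rev_from j) {\<omega>. phase_at_inf X J \<omega> = Some k} borel (inf_at_end X J)"
  note [measurable] = Ki.end_measurable Kj.end_measurable Ki.Ph.last_phase_measurable
  have E0: "{\<omega>\<in>space (P_from i). phase_at_sup X J \<omega> = Some k \<and> last_phase J \<omega> = Some j} \<in> sets (P_from i)"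
    "{\<omega>\<in>space (P_from i). phase_at_sup X J \<omega> = Some k} \<in> sets (P_from i)"
    "{\<omega>\<in>space (P_rev_from j). phase_at_inf X J \<omega> = Some k} \<in> sets (P_rev_from j)" by measurable
  have E: "{\<omega>. phase_at_sup X J \<omega> = Some k \<and> last_phase J \<omega> = Some j} \<inter> space (P_from i) \<in> sets (P_from i)"
    "{\<omega>. phase_at_sup X J \<omega> = Some k} \<inter> space (P_from i) \<in> sets (P_from i)"
    "{\<omega>. phase_at_inf X J \<omega> = Some k} \<inter> space (P_rev_from j) \<in> sets (P_rev_from j)"
    using E0 by (simp_all add: Int_def conj_commute)
  have Y: "(\<lambda>\<omega>. (sup_at_end X J \<omega>, X (lifetime J \<omega>) \<omega> - sup_at_end X J \<omega>)) \<in> P_from i \<rightarrow>\<^sub>M borel \<Otimes>\<^sub>M borel" by measurable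
  have "?LHS = scale_measure (ennreal (r / c)) (?M1 \<Otimes>\<^sub>M ?M2)"
  proof (rule measure_eqI_rectangles)
    show "finite_measure ?LHS" by (rule finite_law_on[OF Ki.Ph.finite_measure_axioms E(1) Y])
    show "sets ?LHS = sets (borel \<Otimes>\<^sub>M borel)" by (simp add: law_on_def)
    have "sets (?M1 \<Otimes>\<^sub>M ?M2) = sets (borel \<Otimes>\<^sub>M borel)" by (intro sets_pair_measure_cong) (simp_all add: law_on_def)
    then show "sets (scale_measure (ennreal (r / c)) (?M1 \<Otimes>\<^sub>M ?M2)) = sets (borel \<Otimes>\<^sub>M borel)" by simp
    interpret M2: finite_measure ?M2 by (rule finite_law_on[OF Kj.Ph.finite_measure_axioms E(3) Kj.end_measurable(2)])
    fix A B :: "real set" assume AB: "A \<in> sets borel" "B \<in> sets borel"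
    have "emeasure ?LHS (A \<times> B) = emeasure (P_from i) {\<omega>\<in>space (P_from i). sup_at_end X J \<omega> \<in> A \<and> X (lifetime J \<omega>) \<omega> - sup_at_end X J \<omega> \<in> B \<and>
      phase_at_sup X J \<omega> = Some k \<and> last_phase J \<omega> = Some j}"
      using AB by (subst emeasure_law_on[OF E(1) Y]) (auto intro!: arg_cong[where f="emeasure _"])
    also have "\<dots> = ennreal r * (a (F1 A) * b (G3 B))" using joint[OF AB] G13[OF measA(1)[OF AB(1)] AB(2)] by simp
    \<comment> \<open>Cross multiplication: \<open>c\<close>, which is \<open>a F2 * b G2\<close>,
      is inserted and divided out, and regrouping pairs \<open>F1\<close> with \<open>G2\<close> and
      \<open>F2\<close> with \<open>G3\<close>.\<close>
    also have "\<dots> = ennreal (r / c) * ((a (F1 A) * b G2) * (a F2 * b (G3 B)))"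
    proof -
      have "ennreal (r / c) * ((a (F1 A) * b G2) * (a F2 * b (G3 B))) = (ennreal (r / c) * (a F2 * b G2)) * (a (F1 A) * b (G3 B))"
        by (simp add: mult_ac)
      also have "ennreal (r / c) * (a F2 * b G2) = ennreal r"
        unfolding c_eq[symmetric] using c_pos r(2) by (simp flip: ennreal_mult)
      finally show ?thesis by simp
    qed
    also have "a (F1 A) * b G2 = emeasure ?M1 A"
      using sup_i[OF AB(1)] emeasure_law_on[OF E(2) Ki.end_measurable(1) AB(1)] by simp
    also have "a F2 * b (G3 B) = emeasure ?M2 B"
      using inf_j[OF AB(2)] emeasure_law_on[OF E(3) Kj.end_measurable(2) AB(2)] by simp
    also have "emeasure ?M1 A * emeasure ?M2 B = emeasure (?M1 \<Otimes>\<^sub>M ?M2) (A \<times> B)"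
      using AB by (intro M2.emeasure_pair_measure_Times[symmetric]) (simp_all add: law_on_def)
    finally show "emeasure ?LHS (A \<times> B) = emeasure (scale_measure (ennreal (r / c)) (?M1 \<Otimes>\<^sub>M ?M2)) (A \<times> B)" by simp
  qed
  moreover have "c = measure P_rev {\<omega>\<in>space P_rev. phase_at_inf X J \<omega> = Some k}"
    using c_eq c_rev c_pos by (metis ennreal_inj measure_nonneg less_imp_le)
  ultimately show ?thesis using c_pos unfolding c_def r_def by blast
qed

end
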